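(* Let $m$ be a non-degenerate Gaussian measure on $\mathbb{R}^2$, i.e. a Gaussian probability measure with invertible covariance matrix. Then for every integer $k\ge1$, every $f\in L^2(m)$ and every $0\le c\le1$, each of the following optimization problems has a solution which is a quasi-open set: $$\min\Big\{\lambda_k(\Omega)\ :\ \Omega\subset\mathbb{R}^2,\ m(\Omega)\le c\Big\},$$ $$\min\Big\{E_f(\Omega)\ :\ \Omega\subset\mathbb{R}^2,\ m(\Omega)\le c\Big\}.$$
   Context: The admissible sets $\Omega$ are Borel subsets of $\mathbb{R}^2$. Let $H=W^{1,2}(\mathbb{R}^2,m)=\{u\in L^2(m):\ |\nabla u|\in L^2(m)\}$, where $\nabla u$ is the distributional gradient, with norm $\|u\|_H=(\|u\|_{L^2(m)}^2+\|\nabla u\|_{L^2(m)}^2)^{1/2}$. Capacity: for $E\subset\mathbb{R}^2$, $\operatorname{cap}(E)=\inf\{\|u\|_H^2:\ u\in H,\ u\ge0,\ u\ge1\text{ in a neighbourhood of }E\}$. Functions in $H$ are identified with their quasi-continuous representatives (defined up to sets of zero capacity). A set is quasi-open if it is of the form $\{u>0\}$ (up to a set of zero capacity) for some $u\in H$. For $\Omega\subset\mathbb{R}^2$, $W^{1,2}_0(\Omega,m)=\{u\in H:\ \operatorname{cap}(\{u\ne0\}\setminus\Omega)=0\}$. Eigenvalues: $\lambda_k(\Omega)=\inf_{K}\sup\{\int_\Omega|\nabla u|^2\,dm:\ u\in K,\ \int_\Omega u^2\,dm=1\}$, the infimum being over all $k$-dimensional linear subspaces $K$ of $W^{1,2}_0(\Omega,m)$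 (infimum over the empty family is $+\infty$). For the standard Gaussian these are the eigenvalues of the Ornstein-Uhlenbeck operator $-\Delta+x\cdot\nabla$ on $\Omega$ with Dirichlet condition. Energy: $E_f(\Omega)=\inf\{\frac12\int_\Omega|\nabla u|^2\,dm-\int_\Omega fu\,dm:\ u\in W^{1,2}_0(\Omega,m)\}\in[-\infty,0]$. The values $\lambda_k(\Omega)$ and $E_f(\Omega)$ are understood as extended real numbers, and a solution is an admissible set attaining the infimum in the extended reals. *)

theory Defs
  imports "HOL-Probability.Probability"
begin

subsection \<open>Gaussian measures on the plane\<close>

definition std_gaussian :: "(real^2) measure" where
  "std_gaussian = density lborel (\<lambda>x. ennreal (\<Prod>i\<in>UNIV. std_normal_density (x $ i)))"

(* Degenerate Gaussian measures (A not invertible) are included. *)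
definition gaussian_measure :: "(real^2) measure \<Rightarrow> bool" where
  "gaussian_measure m \<longleftrightarrow>
    (\<exists>(a :: real^2) (A :: real^2^2). m = distr std_gaussian borel (\<lambda>z. a + A *v z))"

definition mean_vector :: "(real^2) measure \<Rightarrow> real^2" where
  "mean_vector m = (LINT x|m. x)"

definition covariance_matrix :: "(real^2) measure \<Rightarrow> real^2^2" where
  "covariance_matrix m =
    (\<chi> i j. LINT x|m. (x $ i - mean_vector m $ i) * (x $ j - mean_vector m $ j))"

subsection \<open>Distributional gradients\<close>

definition partial_deriv :: "2 \<Rightarrow> (real^2 \<Rightarrow> real) \<Rightarrow> real^2 \<Rightarrow> real" where
  "partial_deriv i f x = frechet_derivative f (at x) (axis i 1)"

fun Ck :: "nat \<Rightarrow> (real^2 \<Rightarrow> real) \<Rightarrow> bool" where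
  "Ck 0 f \<longleftrightarrow> continuous_on UNIV f"
| "Ck (Suc k) f \<longleftrightarrow> (\<forall>x. f differentiable at x) \<and> (\<forall>i. Ck k (partial_deriv i f))"

definition test_function :: "(real^2 \<Rightarrow> real) \<Rightarrow> bool" where
  "test_function \<phi> \<longleftrightarrow> (\<forall>k. Ck k \<phi>) \<and> compact (closure {x. \<phi> x \<noteq> 0})"

definition locally_integrable :: "(real^2 \<Rightarrow> 'b::{banach, second_countable_topology}) \<Rightarrow> bool" where
  "locally_integrable f \<longleftrightarrow> (\<forall>S. compact S \<longrightarrow> set_integrable lborel S f)"

definition has_weak_gradient :: "(real^2 \<Rightarrow> real) \<Rightarrow> (real^2 \<Rightarrow> real^2) \<Rightarrow> bool" where
  "has_weak_gradient u g \<longleftrightarrow> locally_integrable u \<and> locally_integrable g \<and>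
    (\<forall>\<phi> i. test_function \<phi> \<longrightarrow>
      (LINT x|lborel. u x * partial_deriv i \<phi> x) = - (LINT x|lborel. g x $ i * \<phi> x))"

(* Weak gradients are unique up to Lebesgue null sets. *)
definition weak_gradient :: "(real^2 \<Rightarrow> real) \<Rightarrow> real^2 \<Rightarrow> real^2" where
  "weak_gradient u = (SOME g. has_weak_gradient u g)"

subsection \<open>Sobolev space, capacity, quasi-continuity\<close>

definition L2 :: "(real^2) measure \<Rightarrow> (real^2 \<Rightarrow> real) set" where
  "L2 m = {u \<in> borel_measurable m. integrable m (\<lambda>x. (u x)\<^sup>2)}"

(* All representatives, not only the quasi-continuous ones. *)
definition W12 :: "(real^2) measure \<Rightarrow> (real^2 \<Rightarrow> real) set" where
  "W12 m = {u \<in> L2 m. (\<exists>g. has_weak_gradient u g) \<and>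
                      (\<lambda>x. norm (weak_gradient u x)) \<in> L2 m}"

definition W12_norm :: "(real^2) measure \<Rightarrow> (real^2 \<Rightarrow> real) \<Rightarrow> real" where
  "W12_norm m u =
    sqrt ((LINT x|m. (u x)\<^sup>2) + (LINT x|m. (norm (weak_gradient u x))\<^sup>2))"

definition capacity :: "(real^2) measure \<Rightarrow> (real^2) set \<Rightarrow> ereal" where
  "capacity m E =
    (INF u \<in> {u \<in> W12 m. (AE x in m. 0 \<le> u x) \<and>
                (\<exists>U. open U \<and> E \<subseteq> U \<and> (AE x in m. x \<in> U \<longrightarrow> 1 \<le> u x))}.
      ereal ((W12_norm m u)\<^sup>2))"

definition quasi_continuous :: "(real^2) measure \<Rightarrow> (real^2 \<Rightarrow> real) \<Rightarrow> bool" where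
  "quasi_continuous m u \<longleftrightarrow>
    (\<forall>\<epsilon>>0. \<exists>A. open A \<and> capacity m A < ereal \<epsilon> \<and> continuous_on (- A) u)"

(* Quasi-continuous representatives of elements of the Sobolev space; two such
   representatives of the same class differ on a set of zero capacity. *)
definition W12_qc :: "(real^2) measure \<Rightarrow> (real^2 \<Rightarrow> real) set" where
  "W12_qc m = {u \<in> W12 m. quasi_continuous m u}"

definition quasi_open :: "(real^2) measure \<Rightarrow> (real^2) set \<Rightarrow> bool" where
  "quasi_open m \<Omega> \<longleftrightarrow>
    (\<exists>u \<in> W12_qc m. capacity m ((\<Omega> - {x. u x > 0}) \<union> ({x. u x > 0} - \<Omega>)) = 0)"

definition W12_0 :: "(real^2) measure \<Rightarrow> (real^2) set \<Rightarrow> (real^2 \<Rightarrow> real) set" where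
  "W12_0 m \<Omega> = {u \<in> W12_qc m. capacity m ({x. u x \<noteq> 0} - \<Omega>) = 0}"

subsection \<open>Eigenvalues and energy\<close>

(* Functions that agree m-a.e. are identified, so linear independence is understood m-a.e.
   and K contains every representative in V of each of its classes. *)
definition subspace_of_dim ::
    "(real^2) measure \<Rightarrow> nat \<Rightarrow> (real^2 \<Rightarrow> real) set \<Rightarrow> (real^2 \<Rightarrow> real) set \<Rightarrow> bool" where
  "subspace_of_dim m k V K \<longleftrightarrow>
    (\<exists>b :: nat \<Rightarrow> real^2 \<Rightarrow> real. (\<forall>i<k. b i \<in> V) \<and>
      (\<forall>a :: nat \<Rightarrow> real. (AE x in m. (\<Sum>i<k. a i * b i x) = 0) \<longrightarrow> (\<forall>i<k. a i = 0)) \<and>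
      K = {u \<in> V. \<exists>a :: nat \<Rightarrow> real. AE x in m. u x = (\<Sum>i<k. a i * b i x)})"

definition eigenvalue :: "(real^2) measure \<Rightarrow> nat \<Rightarrow> (real^2) set \<Rightarrow> ereal" where
  "eigenvalue m k \<Omega> =
    (INF K \<in> {K. subspace_of_dim m k (W12_0 m \<Omega>) K}.
      SUP u \<in> {u \<in> K. (LINT x:\<Omega>|m. (u x)\<^sup>2) = 1}.
        ereal (LINT x:\<Omega>|m. (norm (weak_gradient u x))\<^sup>2))"

definition energy :: "(real^2) measure \<Rightarrow> (real^2 \<Rightarrow> real) \<Rightarrow> (real^2) set \<Rightarrow> ereal" where
  "energy m f \<Omega> =
    (INF u \<in> W12_0 m \<Omega>.
      ereal (1/2 * (LINT x:\<Omega>|m. (norm (weak_gradient u x))\<^sup>2) - (LINT x:\<Omega>|m. f x * u x)))"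

definition admissible :: "(real^2) measure \<Rightarrow> real \<Rightarrow> (real^2) set set" where
  "admissible m c = {\<Omega> \<in> sets borel. measure m \<Omega> \<le> c}"

definition is_solution ::
    "(real^2) measure \<Rightarrow> real \<Rightarrow> ((real^2) set \<Rightarrow> ereal) \<Rightarrow> (real^2) set \<Rightarrow> bool" where
  "is_solution m c F \<Omega> \<longleftrightarrow> \<Omega> \<in> admissible m c \<and> (\<forall>\<Omega>' \<in> admissible m c. F \<Omega> \<le> F \<Omega>')"

end

theory Submission
  imports Defs "HOL-Computational_Algebra.Polynomial" "HOL-Library.Diagonal_Subsequence"
begin

text \<open>
  The direct method. A sequence (of \<open>k\<close>-tuples) bounded in the Sobolev space has a subsequence that
  converges in \<open>L\<^sup>2(m)\<close> and almost everywhere: the Poincare inequality on the cells of a fine grid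
  gives compactness on bounded sets, and the drift of the Gaussian density bounds the second
  moments \<open>\<integral> |x|\<^sup>2 u\<^sup>2 dm\<close> by the Sobolev norm, so no mass escapes to infinity. Iterated midpoints of the
  sequence converge strongly in the Sobolev space, so the limit has a quasi-continuous
  representative and the Dirichlet form is lower semicontinuous.

  For a minimising sequence of sets, orthonormal bases of almost optimal \<open>k\<close>-dimensional spaces (or
  almost optimal functions for the energy) converge in this way to \<open>B\<^sub>0, ..., B\<^sub>k\<^sub>-\<^sub>1\<close>. The set
  \<open>{\<Sum> |B\<^sub>i| > 0}\<close> is quasi-open, has measure at most \<open>c\<close> by almost everywhere convergence and
  Fatou's lemma, and is optimal. For the energy with \<open>c < 1\<close> coercivity comes from a Poincare inequality
  on sets of measure at most \<open>c\<close>; for \<open>c = 1\<close> the whole plane is optimal by monotonicity, even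
  where the energy is \<open>-\<infinity>\<close>.
\<close>

text \<open>Compactness is sought for functions, never for sets: the optimal set is read off from
  limit functions, and the measure constraint survives because it is an inequality. Gradients of a
  minimising sequence converge only weakly; midpoints trade this for strong convergence, which
  quasi-continuity needs, since capacity is controlled by the full Sobolev norm. The Sobolev
  calculus rests on one identity, the increment of \<open>u\<close> by \<open>v\<close> as the
  integral of the gradient along the segment: it yields the Poincare inequality on cells, the chain
  rule and the constancy of functions with zero gradient. The Gaussian enters only through a
  probability density that is positive, C^1 and satisfies
  \<open>(x - a) . grad \<rho> \<le> - lam |x - a|^2 \<rho>\<close>. Orthonormal bases are used
  because orthonormality survives \<open>L\<^sup>2\<close> limits, whereas a general basis may
  degenerate and lose dimension. For \<open>c = 1\<close> constants are competitors and defeat the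
  Poincare inequality; for \<open>c = 0\<close> all eigenvalues are infinite. Both extremes force a
  case distinction.\<close>

lemma partial_deriv_eq:
  "(f has_derivative f') (at x) \<Longrightarrow> partial_deriv i f x = f' (axis i 1)"
  unfolding partial_deriv_def by (metis frechet_derivative_at)

lemma Ck_Suc_imp_Ck: "Ck (Suc k) f \<Longrightarrow> Ck k f"
proof (induction k arbitrary: f)
  case 0
  then show ?case
    by (simp add: continuous_at_imp_continuous_on differentiable_imp_continuous_within)
next
  case (Suc k)
  then show ?case by simp
qed

lemma Ck_add: "Ck k f \<Longrightarrow> Ck k g \<Longrightarrow> Ck k (\<lambda>x. f x + g x)"
proof (induction k arbitrary: f g)
  case 0
  then show ?case by (auto intro: continuous_intros)
next
  case (Suc k)
  have "partial_deriv i (\<lambda>x. f x + g x) = (\<lambda>x. partial_deriv i f x + partial_deriv i g x)" for i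
  proof
    fix x
    have "(f has_derivative frechet_derivative f (at x)) (at x)"
         "(g has_derivative frechet_derivative g (at x)) (at x)"
      using Suc.prems by (simp_all add: frechet_derivative_works[symmetric])
    then show "partial_deriv i (\<lambda>x. f x + g x) x = partial_deriv i f x + partial_deriv i g x"
      by (subst partial_deriv_eq[OF has_derivative_add]) (auto simp: partial_deriv_def)
  qed
  with Suc show ?case by simp
qed

lemma Ck_mult: "Ck k f \<Longrightarrow> Ck k g \<Longrightarrow> Ck k (\<lambda>x. f x * g x)"
proof (induction k arbitrary: f g)
  case 0
  then show ?case by (auto intro: continuous_intros)
next
  case (Suc k)
  have "partial_deriv i (\<lambda>x. f x * g x) = (\<lambda>x. f x * partial_deriv i g x + partial_deriv i f x * g x)" for i
  proof
    fix x
    have "(f has_derivative frechet_derivative f (at x)) (at x)"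
         "(g has_derivative frechet_derivative g (at x)) (at x)"
      using Suc.prems by (simp_all add: frechet_derivative_works[symmetric])
    then show "partial_deriv i (\<lambda>x. f x * g x) x = f x * partial_deriv i g x + partial_deriv i f x * g x"
      by (subst partial_deriv_eq[OF has_derivative_mult]) (auto simp: partial_deriv_def)
  qed
  moreover have "Ck k f" "Ck k g" using Suc.prems Ck_Suc_imp_Ck by blast+
  ultimately show ?case using Suc by (simp add: Ck_add)
qed

lemma Ck_const: "Ck k (\<lambda>x. c)"
proof (induction k arbitrary: c)
  case (Suc k)
  have "partial_deriv i (\<lambda>x. c) = (\<lambda>x. 0)" for i
    by (rule ext, subst partial_deriv_eq[OF has_derivative_const]) auto
  with Suc show ?case by simp
qed simp

lemma Ck_prod:
  assumes "finite I" "\<And>i. i \<in> I \<Longrightarrow> Ck k (f i)"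
  shows "Ck k (\<lambda>x. \<Prod>i\<in>I. f i x)"
  using assms by (induction I rule: finite_induct) (auto intro: Ck_const Ck_mult)

lemma partial_deriv_translate:
  assumes "\<And>x. f differentiable at x"
  shows "partial_deriv i (\<lambda>x. f (x + v)) x = partial_deriv i f (x + v)"
proof -
  have "(f has_derivative frechet_derivative f (at (x + v))) (at (x + v))"
    using assms by (simp add: frechet_derivative_works[symmetric])
  from has_derivative_compose[of "\<lambda>x. x + v" "\<lambda>h. h" x UNIV f, OF _ this]
  have "((\<lambda>x. f (x + v)) has_derivative frechet_derivative f (at (x + v))) (at x)"
    using has_derivative_add[OF has_derivative_ident has_derivative_const] by auto
  from partial_deriv_eq[OF this] show ?thesis by (simp add: partial_deriv_def)
qed

lemma Ck_translate: "Ck k f \<Longrightarrow> Ck k (\<lambda>x. f (x + v))"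
proof (induction k arbitrary: f)
  case 0
  then show ?case by (auto intro!: continuous_intros continuous_on_compose2[of UNIV f])
next
  case (Suc k)
  have *: "partial_deriv i (\<lambda>x. f (x + v)) = (\<lambda>x. partial_deriv i f (x + v))" for i
    by (rule ext, rule partial_deriv_translate) (use Suc.prems in auto)
  have "(\<lambda>x. f (x + v)) differentiable at x" for x
  proof -
    have "f differentiable at (x + v)" using Suc.prems by simp
    then have "(f \<circ> (\<lambda>x. x + v)) differentiable at x"
      by (intro differentiable_chain_at) (auto intro!: derivative_intros)
    then show ?thesis by (simp add: o_def)
  qed
  with Suc * show ?case by simp
qed

subsection \<open>Smooth bump functions\<close>

text \<open>The polynomial factor closes the family under differentiation, so smoothness of all
  members is one induction; \<open>flat_exp 1\<close> is the classical flat function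
  \<open>exp (- 1 / t)\<close>.\<close>

definition flat_exp :: "real poly \<Rightarrow> real \<Rightarrow> real" where
  "flat_exp p t = (if t > 0 then poly p (1 / t) * exp (- (1 / t)) else 0)"

lemma poly_exp_neg_tendsto_0: "((\<lambda>y::real. poly q y * exp (- y)) \<longlongrightarrow> 0) at_top"
proof -
  have "((\<lambda>y::real. \<Sum>i\<le>degree q. coeff q i * (y ^ i / exp y)) \<longlongrightarrow> (\<Sum>i\<le>degree q. coeff q i * 0)) at_top"
    by (intro tendsto_intros tendsto_power_div_exp_0)
  then show ?thesis by (simp add: poly_altdef exp_minus divide_inverse sum_distrib_right mult.assoc)
qed

text \<open>With \<open>s = 1 / t\<close> one has \<open>d/dt = - s^2 d/ds\<close>, which turns
  \<open>p(s) exp(-s)\<close> into \<open>s^2 (p - p')(s) exp(-s)\<close>; the polynomial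
  \<open>[:0,0,1:]\<close> is the factor \<open>s^2\<close>.\<close>

lemma flat_exp_has_derivative:
  "(flat_exp p has_real_derivative flat_exp ([:0,0,1:] * (p - pderiv p)) t) (at t)"
proof -
  consider "t > 0" | "t < 0" | "t = 0" by linarith
  then show ?thesis
  proof cases
    case 1
    have "((\<lambda>t. poly p (1 / t) * exp (- (1 / t))) has_real_derivative
       flat_exp ([:0,0,1:] * (p - pderiv p)) t) (at t)"
      using 1 by (auto intro!: derivative_eq_intros DERIV_chain'[OF _ poly_DERIV]
          simp: flat_exp_def field_simps power2_eq_square)
    then show ?thesis
      by (rule has_field_derivative_transform_within_open[where S="{0<..}"]) (use 1 in \<open>auto simp: flat_exp_def\<close>)
  next
    case 2
    have "((\<lambda>t. 0) has_real_derivative flat_exp ([:0,0,1:] * (p - pderiv p)) t) (at t)"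
      using 2 by (simp add: flat_exp_def)
    then show ?thesis
      by (rule has_field_derivative_transform_within_open[where S="{..<0}"]) (use 2 in \<open>auto simp: flat_exp_def\<close>)
  next
    case 3
    have *: "((\<lambda>h. flat_exp p h / h) \<longlongrightarrow> 0) (at_right 0)"
    proof -
      \<comment> \<open>The difference quotient at 0 costs one more factor \<open>1 / h\<close>,
        which the exponential absorbs.\<close>
      have "((\<lambda>h. poly ([:0,1:] * p) (1 / h) * exp (- (1 / h))) \<longlongrightarrow> 0) (at_right (0::real))"
        by (rule filterlim_compose[OF poly_exp_neg_tendsto_0[of "[:0,1:] * p"]])
           (simp add: divide_inverse filterlim_inverse_at_top_right)
      then show ?thesis
        by (rule Lim_transform_eventually)
           (auto simp: eventually_at_filter flat_exp_def field_simps intro!: always_eventually)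
    qed
    have "((\<lambda>h. flat_exp p h / h) \<longlongrightarrow> 0) (at_left 0)"
      by (rule Lim_transform_eventually[OF tendsto_const])
         (auto simp: eventually_at_filter flat_exp_def)
    with * have "((\<lambda>h. flat_exp p h / h) \<longlongrightarrow> 0) (at 0)"
      by (simp add: filterlim_split_at)
    with 3 show ?thesis by (simp add: has_field_derivative_iff flat_exp_def)
  qed
qed

text \<open>The scalar and the polynomial are generalised because the chain rule turns
  \<open>c\<close> into \<open>c * \<beta>\<close> (or into 0 in the other coordinate) and replaces
  \<open>p\<close>; the affine argument never changes.\<close>

lemma Ck_flat_exp: "Ck k (\<lambda>x. c * flat_exp p (\<alpha> + \<beta> * x $ i))"
proof (induction k arbitrary: c p)
  have der: "((\<lambda>x::real^2. c * flat_exp p (\<alpha> + \<beta> * x $ i)) has_derivative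
      (\<lambda>h. c * (flat_exp ([:0,0,1:] * (p - pderiv p)) (\<alpha> + \<beta> * x $ i) * (\<beta> * h $ i)))) (at x)" for x c p
  proof -
    have "((\<lambda>x::real^2. \<alpha> + \<beta> * x $ i) has_derivative (\<lambda>h. \<beta> * h $ i)) (at x)"
      by (auto intro!: derivative_eq_intros bounded_linear.has_derivative[OF bounded_linear_vec_nth])
    from has_derivative_compose[OF this flat_exp_has_derivative[THEN has_field_derivative_imp_has_derivative]]
    show ?thesis by (intro has_derivative_mult_right)
  qed
  {
    case 0
    from der[where c=c and p=p] show ?case
      by (auto intro!: continuous_at_imp_continuous_on has_derivative_continuous)
  next
    case (Suc k)
    have "partial_deriv j (\<lambda>x. c * flat_exp p (\<alpha> + \<beta> * x $ i)) =
      (\<lambda>x. (c * \<beta> * (if i = j then 1 else 0)) * flat_exp ([:0,0,1:] * (p - pderiv p)) (\<alpha> + \<beta> * x $ i))" for j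
      by (rule ext, subst partial_deriv_eq[OF der]) (auto simp: axis_def)
    moreover have "(\<lambda>x. c * flat_exp p (\<alpha> + \<beta> * x $ i)) differentiable at x" for x
      using der by (rule differentiableI)
    ultimately show ?case using Suc by (simp only: Ck.simps) blast
  }
qed

text \<open>At a point of the box every argument grows with \<open>n\<close> and every factor tends
  to 1; elsewhere some factor is 0. So these bumps approximate the indicator of the open box
  pointwise, bounded by 1.\<close>

definition box_bump :: "nat \<Rightarrow> real^2 \<Rightarrow> real^2 \<Rightarrow> real^2 \<Rightarrow> real" where
  "box_bump n a b x = (\<Prod>i\<in>UNIV. flat_exp 1 (real n * (x $ i - a $ i)) * flat_exp 1 (real n * (b $ i - x $ i)))"

lemma flat_exp_1_bounds: "0 \<le> flat_exp 1 t" "flat_exp 1 t \<le> 1"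
  by (auto simp: flat_exp_def)

lemma box_bump_bounds: "0 \<le> box_bump n a b x" "box_bump n a b x \<le> 1"
  unfolding box_bump_def
  by (auto intro!: prod_nonneg prod_le_1 mult_le_one simp: flat_exp_1_bounds)

lemma box_bump_outside: "x \<notin> box a b \<Longrightarrow> box_bump n a b x = 0"
proof -
  assume "x \<notin> box a b"
  then obtain i where "x $ i \<le> a $ i \<or> b $ i \<le> x $ i" by (auto simp: mem_box_cart not_less)
  then have "flat_exp 1 (real n * (x $ i - a $ i)) * flat_exp 1 (real n * (b $ i - x $ i)) = 0"
    by (auto simp: flat_exp_def zero_less_mult_iff)
  then show ?thesis unfolding box_bump_def by (intro prod_zero) auto
qed

lemma box_bump_tendsto: "(\<lambda>n. box_bump n a b x) \<longlonglongrightarrow> indicator (box a b) x"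
proof (cases "x \<in> box a b")
  case True
  have 1: "(\<lambda>n. flat_exp 1 (real n * s)) \<longlonglongrightarrow> 1" if "s > 0" for s
  proof -
    have "(\<lambda>n. exp (- (inverse s * (1 / real n)))) \<longlonglongrightarrow> exp (- (inverse s * 0))"
      by (intro tendsto_intros lim_1_over_n)
    then have "(\<lambda>n. exp (- (inverse s * (1 / real n)))) \<longlonglongrightarrow> 1" by simp
    moreover have "eventually (\<lambda>n. exp (- (inverse s * (1 / real n))) = flat_exp 1 (real n * s)) sequentially"
      using eventually_gt_at_top[of 0] by eventually_elim (use that in \<open>simp add: flat_exp_def field_simps\<close>)
    ultimately show ?thesis by (rule Lim_transform_eventually)
  qed
  have "(\<lambda>n. box_bump n a b x) \<longlonglongrightarrow> (\<Prod>i\<in>(UNIV::2 set). 1 * 1)"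
    unfolding box_bump_def by (intro tendsto_prod tendsto_mult 1) (use True in \<open>auto simp: mem_box_cart\<close>)
  with True show ?thesis by simp
qed (simp add: box_bump_outside)

lemma test_function_box_bump: "test_function (box_bump n a b)"
  unfolding test_function_def
proof
  have "Ck k (\<lambda>x. \<Prod>i\<in>UNIV. (1 * flat_exp 1 (- (real n * a $ i) + real n * x $ i)) *
       (1 * flat_exp 1 (real n * b $ i + (- real n) * x $ i)))" for k
    by (intro Ck_prod Ck_mult[OF Ck_flat_exp Ck_flat_exp]) auto
  moreover have "box_bump n a b = (\<lambda>x. \<Prod>i\<in>UNIV. (1 * flat_exp 1 (- (real n * a $ i) + real n * x $ i)) *
       (1 * flat_exp 1 (real n * b $ i + (- real n) * x $ i)))"
    by (rule ext) (simp add: box_bump_def algebra_simps)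
  ultimately show "\<forall>k. Ck k (box_bump n a b)" by simp
  have "closure {x. box_bump n a b x \<noteq> 0} \<subseteq> cbox a b"
    using box_bump_outside[of _ a b n] box_subset_cbox[of a b] by (intro closure_minimal) auto
  then show "compact (closure {x. box_bump n a b x \<noteq> 0})"
    by (metis bounded_cbox bounded_subset compact_eq_bounded_closed closed_closure)
qed

lemma test_function_translate:
  assumes "test_function \<phi>" shows "test_function (\<lambda>x. \<phi> (x + v))"
proof -
  have "closure {x. \<phi> (x + v) \<noteq> 0} = (\<lambda>x. - v + x) ` closure {x. \<phi> x \<noteq> 0}"
  proof -
    have "{x. \<phi> (x + v) \<noteq> 0} = (\<lambda>x. - v + x) ` {x. \<phi> x \<noteq> 0}"
    proof (intro set_eqI iffI)
      fix x assume "x \<in> {x. \<phi> (x + v) \<noteq> 0}"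
      then show "x \<in> (\<lambda>x. - v + x) ` {x. \<phi> x \<noteq> 0}"
        by (intro image_eqI[of _ _ "x + v"]) auto
    qed auto
    then show ?thesis using closure_translation[of "-v"] by simp
  qed
  with assms show ?thesis unfolding test_function_def
    by (metis (no_types, lifting) Ck_translate compact_translation)
qed

subsection \<open>Local integrability and translations\<close>

lemma locally_integrable_measurable:
  fixes f :: "real^2 \<Rightarrow> 'b::{banach, second_countable_topology}"
  assumes "locally_integrable f" shows "f \<in> borel_measurable borel"
proof -
  have "(\<lambda>x. indicator (cball 0 (real n)) x *\<^sub>R f x) \<in> borel_measurable borel" for n
    using assms by (auto simp: locally_integrable_def set_integrable_def dest!: spec[of _ "cball 0 (real n)"]
        dest: borel_measurable_integrable)
  moreover have "(\<lambda>n. indicator (cball 0 (real n)) x *\<^sub>R f x) \<longlonglongrightarrow> f x" for x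
  proof -
    obtain N where "norm x \<le> real N" using real_arch_simple by blast
    then have "eventually (\<lambda>n. f x = indicator (cball 0 (real n)) x *\<^sub>R f x) sequentially"
      by (intro eventually_sequentiallyI[of N]) (auto simp: indicator_def)
    with tendsto_const show ?thesis by (rule Lim_transform_eventually)
  qed
  ultimately show ?thesis by (rule borel_measurable_LIMSEQ_metric)
qed

lemma locally_integrable_add:
  fixes f g :: "real^2 \<Rightarrow> 'b::{banach, second_countable_topology}"
  assumes "locally_integrable f" "locally_integrable g"
  shows "locally_integrable (\<lambda>x. f x + g x)"
  using assms by (auto simp: locally_integrable_def set_integral_add)

lemma locally_integrable_scaleR:
  fixes f :: "real^2 \<Rightarrow> 'b::{banach, second_countable_topology}"
  assumes "locally_integrable f" shows "locally_integrable (\<lambda>x. c *\<^sub>R f x)"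
  unfolding locally_integrable_def set_integrable_def
proof (intro allI impI)
  fix S :: "(real^2) set" assume "compact S"
  then have "integrable lborel (\<lambda>x. c *\<^sub>R (indicator S x *\<^sub>R f x))"
    using assms unfolding locally_integrable_def set_integrable_def by (intro integrable_scaleR_right) blast
  then show "integrable lborel (\<lambda>x. indicator S x *\<^sub>R c *\<^sub>R f x)"
    by (simp add: mult.commute)
qed

lemma locally_integrable_inner:
  fixes f :: "real^2 \<Rightarrow> 'b::euclidean_space"
  assumes "locally_integrable f" shows "locally_integrable (\<lambda>x. f x \<bullet> v)"
proof -
  have "integrable lborel (\<lambda>x. (indicator S x *\<^sub>R f x) \<bullet> v)" if "compact S" for S
    using assms that by (auto simp: locally_integrable_def set_integrable_def simp del: inner_scaleR_left)
  then show ?thesis by (simp add: locally_integrable_def set_integrable_def)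
qed

text \<open>The pairing behind every integral against a test function, its derivatives or its
  translates.\<close>

lemma integrable_locally_integrable_mult:
  fixes f w :: "real^2 \<Rightarrow> real"
  assumes f: "locally_integrable f" and w: "w \<in> borel_measurable borel"
    and b: "\<And>x. \<bar>w x\<bar> \<le> M" and K: "\<And>x. x \<notin> cball 0 R \<Longrightarrow> w x = 0"
  shows "integrable lborel (\<lambda>x. f x * w x)"
proof -
  have fm: "f \<in> borel_measurable borel" using f by (rule locally_integrable_measurable)
  have "integrable lborel (\<lambda>x. M * (indicator (cball 0 R) x *\<^sub>R f x))"
    using f by (auto simp: locally_integrable_def set_integrable_def)
  then show ?thesis
  proof (rule Bochner_Integration.integrable_bound)
    show "(\<lambda>x. f x * w x) \<in> borel_measurable lborel" using fm w by simp
    show "AE x in lborel. norm (f x * w x) \<le> norm (M * (indicator (cball 0 R) x *\<^sub>R f x))"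
    proof (rule AE_I2)
      fix x show "norm (f x * w x) \<le> norm (M * (indicator (cball 0 R) x *\<^sub>R f x))"
        using K[of x] b[of x] by (cases "x \<in> cball 0 R")
          (auto simp: abs_mult mult.commute[of "\<bar>f x\<bar>"] intro!: mult_right_mono)
    qed
  qed
qed

lemma distr_lborel_translate: "distr lborel borel (\<lambda>x::'a::euclidean_space. x + v) = lborel"
  using lborel_distr_plus[of v] by (simp add: add.commute[of _ v])

lemma nn_integral_lborel_translate:
  fixes f :: "'a::euclidean_space \<Rightarrow> ennreal"
  assumes "f \<in> borel_measurable borel"
  shows "(\<integral>\<^sup>+x. f (x + v) \<partial>lborel) = (\<integral>\<^sup>+x. f x \<partial>lborel)"
  using assms by (subst (2) distr_lborel_translate[of v, symmetric]) (simp add: nn_integral_distr)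

lemma integral_lborel_translate:
  fixes f :: "'a::euclidean_space \<Rightarrow> real"
  assumes "f \<in> borel_measurable borel"
  shows "(LINT x|lborel. f (x + v)) = (LINT x|lborel. f x)"
  using assms by (subst (2) distr_lborel_translate[of v, symmetric]) (simp add: integral_distr)

lemma integrable_lborel_translate:
  fixes f :: "'a::euclidean_space \<Rightarrow> real"
  assumes "integrable lborel f"
  shows "integrable lborel (\<lambda>x. f (x + v))"
proof -
  have "integrable (distr lborel borel (\<lambda>x. x + v)) f"
    using assms by (simp only: distr_lborel_translate)
  then show ?thesis
    using borel_measurable_integrable[OF assms] by (subst (asm) integrable_distr_eq) auto
qed

lemma AE_lborel_translate:
  fixes v :: "'a::euclidean_space"
  assumes "AE x in lborel. P x" shows "AE x in lborel. P (x + v)"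
  using assms by (subst (asm) distr_lborel_translate[of v, symmetric]) (auto dest: AE_distrD[rotated])

lemma locally_integrable_translate:
  fixes f :: "real^2 \<Rightarrow> real"
  assumes f: "locally_integrable f" shows "locally_integrable (\<lambda>x. f (x + v))"
  unfolding locally_integrable_def set_integrable_def
proof (intro allI impI)
  fix S :: "(real^2) set" assume "compact S"
  then have "compact ((\<lambda>x. v + x) ` S)" by (rule compact_translation)
  then have "integrable lborel (\<lambda>x. indicator ((\<lambda>x. v + x) ` S) x *\<^sub>R f x)"
    using f by (auto simp: locally_integrable_def set_integrable_def)
  from integrable_lborel_translate[OF this, of v]
  show "integrable lborel (\<lambda>x. indicator S x *\<^sub>R f (x + v))"
    by (simp add: indicator_def image_iff add.commute)
qed

subsection \<open>The fundamental lemma of the calculus of variations\<close>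

text \<open>Bumps approximating boxes give zero integral over every open box. Boxes are stable under
  intersection and generate the Borel sets, so a Dynkin argument gives zero integral over every
  Borel set.\<close>

lemma locally_integrable_zero_AE:
  fixes f :: "real^2 \<Rightarrow> real"
  assumes f: "locally_integrable f"
    and 0: "\<And>\<phi>. test_function \<phi> \<Longrightarrow> (LINT x|lborel. f x * \<phi> x) = 0"
  shows "AE x in lborel. f x = 0"
proof -
  have fm[measurable]: "f \<in> borel_measurable borel" using f by (rule locally_integrable_measurable)
  have int_cbox: "integrable lborel (\<lambda>x. indicator (cbox a b) x *\<^sub>R f x)" for a b
    using f by (auto simp: locally_integrable_def set_integrable_def)
  have int_box: "integrable lborel (\<lambda>x. indicator (box a b) x * f x)" for a b
    by (rule Bochner_Integration.integrable_bound[OF int_cbox[of a b]])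
       (use box_subset_cbox[of a b] in \<open>auto simp: indicator_def\<close>)
  have box0: "(LINT x|lborel. indicator (box a b) x * f x) = 0" for a b
  proof -
    have "(\<lambda>n. LINT x|lborel. f x * box_bump n a b x) \<longlonglongrightarrow> (LINT x|lborel. indicator (box a b) x * f x)"
    proof (rule integral_dominated_convergence[where w="\<lambda>x. \<bar>indicator (box a b) x * f x\<bar>"])
      show "(\<lambda>x. f x * box_bump n a b x) \<in> borel_measurable lborel" for n
      proof -
        have "box_bump n a b \<in> borel_measurable borel"
          using test_function_box_bump[of n a b]
          by (auto simp: test_function_def dest!: spec[of _ 0] intro!: borel_measurable_continuous_onI)
        then show ?thesis by simp
      qed
      show "integrable lborel (\<lambda>x. \<bar>indicator (box a b) x * f x\<bar>)" using int_box by (rule integrable_abs)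
      show "AE x in lborel. (\<lambda>n. f x * box_bump n a b x) \<longlonglongrightarrow> indicator (box a b) x * f x"
        using box_bump_tendsto by (auto intro!: AE_I2 tendsto_mult simp: mult.commute[of _ "f _"])
      show "AE x in lborel. norm (f x * box_bump n a b x) \<le> \<bar>indicator (box a b) x * f x\<bar>" for n
        using box_bump_bounds[of n a b] box_bump_outside[of _ a b n]
        by (intro AE_I2) (auto simp: indicator_def abs_mult mult_left_le)
    qed (use fm in auto)
    with 0[OF test_function_box_bump] show ?thesis by (simp add: LIMSEQ_const_iff)
  qed
  \<comment> \<open>One box is fixed so that \<open>f\<close> becomes integrable on the whole plane,
    as the passage from zero integrals to zero almost everywhere requires.\<close>
  have AE_box: "AE x in lborel. indicator (box a b) x * f x = 0" for a b
  proof (rule sigma_finite_measure.density_zero[OF sigma_finite_lborel int_box])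
    let ?h = "\<lambda>x. indicator (box a b) x * f x"
    have si: "set_integrable lborel B ?h" if "B \<in> sets borel" for B
      unfolding set_integrable_def using that by (intro integrable_mult_indicator int_box) simp
    fix A :: "(real^2) set" assume "A \<in> sets lborel"
    then have A: "A \<in> sigma_sets UNIV (range (\<lambda>(a, b). box a b))" by (simp add: borel_eq_box)
    have "Int_stable (range (\<lambda>(a, b). box a b :: (real^2) set))"
      unfolding Int_stable_def by (auto simp: box_Int_box intro!: range_eqI[of _ _ "(_, _)"])
    moreover have "range (\<lambda>(a, b). box a b :: (real^2) set) \<subseteq> Pow UNIV" by simp
    moreover note A
    ultimately show "set_lebesgue_integral lborel A ?h = 0"
    proof (induction rule: sigma_sets_induct_disjoint)
      case (basic A)
      then obtain c d where A: "A = box c d" by auto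
      obtain l r where lr: "box c d \<inter> box a b = box l r" by (simp only: box_Int_box)
      have "indicator (box c d) x * indicator (box a b) x = (indicator (box l r) x::real)" for x
        unfolding lr[symmetric] by (rule indicator_inter_arith[symmetric])
      with box0[of l r] show ?case by (simp add: A set_lebesgue_integral_def flip: mult.assoc)
    next
      case (compl A)
      then have [measurable]: "A \<in> sets borel" by (simp add: borel_eq_box)
      have "(LINT x|lborel. ?h x) = set_lebesgue_integral lborel (A \<union> (UNIV - A)) ?h"
        by (simp add: set_lebesgue_integral_def)
      also have "\<dots> = set_lebesgue_integral lborel A ?h + set_lebesgue_integral lborel (UNIV - A) ?h"
        by (rule set_integral_Un) (auto intro!: si)
      finally show ?case using compl box0 by simp
    next
      case (union F)
      then have F: "F i \<in> sets borel" for i by (auto simp: borel_eq_box)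
      have "set_lebesgue_integral lborel (\<Union>i. F i) ?h = (\<Sum>i. set_lebesgue_integral lborel (F i) ?h)"
        using union F by (intro lebesgue_integral_countable_add si) (auto simp: disjoint_family_on_def)
      with union show ?case by simp
    qed (auto simp: set_lebesgue_integral_def)
  qed
  have "AE x in lborel. \<forall>n::nat. indicator (box (\<chi> i. - real n) (\<chi> i. real n)) x * f x = 0"
    unfolding AE_all_countable using AE_box by blast
  then show ?thesis
  proof eventually_elim
    case (elim x)
    obtain n where "norm x < real n" using reals_Archimedean2 by blast
    then have "x \<in> box (\<chi> i. - real n) (\<chi> i. real n)"
      using component_le_norm_cart[of x] unfolding mem_box_cart by (simp add: abs_le_iff) (smt (verit))
    with elim[THEN spec[of _ n]] show ?case by simp
  qed
qed

section \<open>Weak gradients along segments\<close>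

lemma test_function_differentiable: "test_function \<phi> \<Longrightarrow> \<phi> differentiable at x"
  by (auto simp: test_function_def dest: spec[of _ "Suc 0"])

lemma test_function_continuous: "test_function \<phi> \<Longrightarrow> continuous_on UNIV \<phi>"
  by (auto simp: test_function_def dest: spec[of _ 0])

lemma test_function_continuous_partial: "test_function \<phi> \<Longrightarrow> continuous_on UNIV (partial_deriv i \<phi>)"
  by (auto simp: test_function_def dest: spec[of _ "Suc 0"])

lemma has_derivative_partials:
  assumes "\<phi> differentiable at x"
  shows "(\<phi> has_derivative (\<lambda>h. \<Sum>i\<in>UNIV. h $ i * partial_deriv i \<phi> x)) (at x)"
proof -
  have d: "(\<phi> has_derivative frechet_derivative \<phi> (at x)) (at x)"
    using assms by (simp add: frechet_derivative_works[symmetric])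
  then interpret linear "frechet_derivative \<phi> (at x)" by (rule has_derivative_linear)
  have "frechet_derivative \<phi> (at x) h = (\<Sum>i\<in>UNIV. h $ i * partial_deriv i \<phi> x)" for h
  proof -
    have "frechet_derivative \<phi> (at x) h = frechet_derivative \<phi> (at x) (\<Sum>i\<in>UNIV. h $ i *\<^sub>R axis i 1)"
      using basis_expansion[of h] by (simp add: scalar_mult_eq_scaleR)
    then show ?thesis by (simp add: sum scaleR partial_deriv_def)
  qed
  then have "frechet_derivative \<phi> (at x) = (\<lambda>h. \<Sum>i\<in>UNIV. h $ i * partial_deriv i \<phi> x)" by (rule ext)
  with d show ?thesis by simp
qed

lemma partial_deriv_outside_support:
  assumes "\<And>x. x \<notin> cball 0 R \<Longrightarrow> \<phi> x = 0" "x \<notin> cball 0 R"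
  shows "partial_deriv i \<phi> x = 0"
proof -
  have "((\<lambda>x. 0) has_derivative (\<lambda>x. 0)) (at x)" by simp
  then have "(\<phi> has_derivative (\<lambda>x. 0)) (at x)"
    by (rule has_derivative_transform_within_open[where s="- cball 0 R"]) (use assms in auto)
  from partial_deriv_eq[OF this] show ?thesis by simp
qed

lemma continuous_compact_support_bounded:
  fixes \<phi> :: "real^2 \<Rightarrow> real"
  assumes "continuous_on UNIV \<phi>" "\<And>x. x \<notin> cball 0 R \<Longrightarrow> \<phi> x = 0"
  obtains M where "M \<ge> 0" "\<And>x. \<bar>\<phi> x\<bar> \<le> M"
proof -
  have "bounded (\<phi> ` cball 0 R)"
    using assms(1) by (intro compact_imp_bounded compact_continuous_image) (auto intro: continuous_on_subset)
  then obtain M where M: "\<And>x. x \<in> cball 0 R \<Longrightarrow> \<bar>\<phi> x\<bar> \<le> M" by (force simp: bounded_iff)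
  show thesis
  proof (rule that[of "max M 0"])
    show "\<bar>\<phi> x\<bar> \<le> max M 0" for x using M[of x] assms(2)[of x] by (cases "x \<in> cball 0 R") auto
  qed simp
qed

lemma test_function_support:
  assumes "test_function \<phi>" obtains R where "R > 0" "\<And>x. x \<notin> cball 0 R \<Longrightarrow> \<phi> x = 0"
proof -
  from assms have "bounded (closure {x. \<phi> x \<noteq> 0})" by (auto simp: test_function_def compact_imp_bounded)
  then obtain R where R: "R > 0" "\<And>x. x \<in> closure {x. \<phi> x \<noteq> 0} \<Longrightarrow> norm x \<le> R"
    by (auto simp: bounded_pos)
  then show thesis using that[of R] closure_subset[of "{x. \<phi> x \<noteq> 0}"] by fastforce
qed

text \<open>The parameter interval has length 1, so by Tonelli a bound uniform in \<open>s\<close>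
  is itself a bound on the product. This licenses exchanging a segment integral with an integral
  over the plane.\<close>

lemma integrable_strip:
  fixes F :: "real \<times> (real^2) \<Rightarrow> real"
  assumes [measurable]: "F \<in> borel_measurable (borel \<Otimes>\<^sub>M borel)"
    and b: "\<And>s. s \<in> {0..1} \<Longrightarrow> (\<integral>\<^sup>+x. ennreal \<bar>F (s, x)\<bar> \<partial>lborel) \<le> ennreal C"
  shows "integrable (lborel \<Otimes>\<^sub>M lborel) (\<lambda>z. indicator {0..1} (fst z) * F z)"
proof (rule integrableI_bounded)
  show "(\<lambda>z. indicator {0..1} (fst z) * F z) \<in> borel_measurable (lborel \<Otimes>\<^sub>M lborel)"
    by measurable
  have "(\<integral>\<^sup>+z. ennreal (norm (indicator {0..1} (fst z) * F z)) \<partial>(lborel \<Otimes>\<^sub>M lborel))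
     = (\<integral>\<^sup>+s. (\<integral>\<^sup>+x. ennreal (norm (indicator {0..1} (fst (s, x)) * F (s, x))) \<partial>lborel) \<partial>lborel)"
    by (rule lborel.nn_integral_fst[symmetric]) measurable
  also have "\<dots> \<le> (\<integral>\<^sup>+s. ennreal C * indicator {0..1::real} s \<partial>lborel)"
    using b by (intro nn_integral_mono) (auto simp: indicator_def)
  also have "\<dots> = ennreal C" by (simp add: nn_integral_cmult_indicator)
  also have "\<dots> < \<infinity>" by simp
  finally show "(\<integral>\<^sup>+z. ennreal (norm (indicator {0..1} (fst z) * F z)) \<partial>(lborel \<Otimes>\<^sub>M lborel)) < \<infinity>" .
qed

text \<open>One constant serves every weight with the same bound and support radius, in particular
  all translates of one weight by vectors of bounded length, once the radius is enlarged by that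
  length.\<close>

lemma locally_integrable_nn_integral_bound:
  fixes h :: "real^2 \<Rightarrow> real"
  assumes h: "locally_integrable h"
  obtains C where "\<And>w. (\<And>y. \<bar>w y\<bar> \<le> M) \<Longrightarrow> (\<And>y. y \<notin> cball 0 R \<Longrightarrow> w y = 0)
     \<Longrightarrow> (\<integral>\<^sup>+y. ennreal \<bar>h y * w y\<bar> \<partial>lborel) \<le> ennreal C"
proof -
  have i: "integrable lborel (\<lambda>x. M * (indicator (cball 0 R) x *\<^sub>R \<bar>h x\<bar>))"
  proof -
    have "integrable lborel (\<lambda>x. \<bar>indicator (cball 0 R) x *\<^sub>R h x\<bar>)"
      using h by (intro integrable_abs) (auto simp: locally_integrable_def set_integrable_def)
    then show ?thesis by (simp add: abs_mult)
  qed
  show thesis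
  proof (rule that[of "LINT x|lborel. norm (M * (indicator (cball 0 R) x *\<^sub>R \<bar>h x\<bar>))"])
    fix w :: "real^2 \<Rightarrow> real" assume w: "\<And>y. \<bar>w y\<bar> \<le> M" "\<And>y. y \<notin> cball 0 R \<Longrightarrow> w y = 0"
    have "(\<integral>\<^sup>+y. ennreal \<bar>h y * w y\<bar> \<partial>lborel) \<le> (\<integral>\<^sup>+y. ennreal (norm (M * (indicator (cball 0 R) y *\<^sub>R \<bar>h y\<bar>))) \<partial>lborel)"
    proof (intro nn_integral_mono ennreal_leI)
      fix y show "\<bar>h y * w y\<bar> \<le> norm (M * (indicator (cball 0 R) y *\<^sub>R \<bar>h y\<bar>))"
        using w[of y] by (cases "y \<in> cball 0 R") (auto simp: abs_mult mult.commute[of "\<bar>h y\<bar>"] intro!: mult_right_mono)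
    qed
    also have "\<dots> = ennreal (LINT x|lborel. norm (M * (indicator (cball 0 R) x *\<^sub>R \<bar>h x\<bar>)))"
      by (rule nn_integral_eq_integral[OF integrable_norm[OF i]]) simp
    finally show "(\<integral>\<^sup>+y. ennreal \<bar>h y * w y\<bar> \<partial>lborel) \<le> ennreal (LINT x|lborel. norm (M * (indicator (cball 0 R) x *\<^sub>R \<bar>h x\<bar>)))" .
  qed
qed

text \<open>The shift is moved from the merely locally integrable \<open>h\<close> to the bounded
  weight, whose translates stay inside the ball of radius \<open>R + norm v\<close>; there
  \<open>h\<close> has a finite integral.\<close>

lemma integrable_strip_translate:
  fixes h w :: "real^2 \<Rightarrow> real"
  assumes h: "locally_integrable h" and [measurable]: "w \<in> borel_measurable borel"
    and b: "\<And>x. \<bar>w x\<bar> \<le> M" and K: "\<And>x. x \<notin> cball 0 R \<Longrightarrow> w x = 0"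
  shows "integrable (lborel \<Otimes>\<^sub>M lborel) (\<lambda>z. indicator {0..1} (fst z) * (h (snd z + fst z *\<^sub>R v) * w (snd z)))"
proof -
  have [measurable]: "h \<in> borel_measurable borel" using h by (rule locally_integrable_measurable)
  obtain C where C: "\<And>w. (\<And>y. \<bar>w y\<bar> \<le> M) \<Longrightarrow> (\<And>y. y \<notin> cball 0 (R + norm v) \<Longrightarrow> w y = 0)
     \<Longrightarrow> (\<integral>\<^sup>+y. ennreal \<bar>h y * w y\<bar> \<partial>lborel) \<le> ennreal C"
    using locally_integrable_nn_integral_bound[OF h] by blast
  show ?thesis
  proof (rule integrable_strip)
    fix s :: real assume s: "s \<in> {0..1}"
    have "(\<integral>\<^sup>+x. ennreal \<bar>h (x + s *\<^sub>R v) * w x\<bar> \<partial>lborel) = (\<integral>\<^sup>+x. ennreal \<bar>h (x + s *\<^sub>R v) * w (x + s *\<^sub>R v - s *\<^sub>R v)\<bar> \<partial>lborel)"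
      by simp
    also have "\<dots> = (\<integral>\<^sup>+y. ennreal \<bar>h y * w (y - s *\<^sub>R v)\<bar> \<partial>lborel)"
      by (rule nn_integral_lborel_translate[where f="\<lambda>y. ennreal \<bar>h y * w (y - s *\<^sub>R v)\<bar>"]) measurable
    also have "\<dots> \<le> ennreal C"
    proof (rule C)
      fix y :: "real^2" assume "y \<notin> cball 0 (R + norm v)"
      moreover have "norm y \<le> norm (y - s *\<^sub>R v) + norm (s *\<^sub>R v)" using norm_triangle_ineq[of "y - s *\<^sub>R v" "s *\<^sub>R v"] by simp
      moreover have "norm (s *\<^sub>R v) \<le> norm v" using s by (auto intro: mult_left_le_one_le)
      ultimately show "w (y - s *\<^sub>R v) = 0" by (intro K) auto
    qed (rule b)
    finally show "(\<integral>\<^sup>+x. ennreal \<bar>h (snd (s, x) + fst (s, x) *\<^sub>R v) * w (snd (s, x))\<bar> \<partial>lborel) \<le> ennreal C" by simp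
  qed measurable
qed

lemma weak_gradient_direction:
  assumes wg: "has_weak_gradient u g" and \<phi>: "test_function \<phi>"
  shows "(LINT x|lborel. u x * (\<Sum>i\<in>UNIV. v $ i * partial_deriv i \<phi> x)) = - (LINT x|lborel. (g x \<bullet> v) * \<phi> x)"
proof -
  have u: "locally_integrable u" and g: "locally_integrable g"
    using wg by (auto simp: has_weak_gradient_def)
  obtain R where R: "\<And>x. x \<notin> cball 0 R \<Longrightarrow> \<phi> x = 0" using test_function_support[OF \<phi>] by metis
  obtain M where M: "\<And>x. \<bar>\<phi> x\<bar> \<le> M"
    using continuous_compact_support_bounded[OF test_function_continuous[OF \<phi>] R] by metis
  have P0: "x \<notin> cball 0 R \<Longrightarrow> partial_deriv i \<phi> x = 0" for x i
    by (rule partial_deriv_outside_support[where R=R]) (use R in auto)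
  have iu: "integrable lborel (\<lambda>x. u x * partial_deriv i \<phi> x)" for i
  proof -
    obtain M' where "\<And>x. \<bar>partial_deriv i \<phi> x\<bar> \<le> M'"
      using continuous_compact_support_bounded[OF test_function_continuous_partial[OF \<phi>, of i] P0] by metis
    then show ?thesis
      by (intro integrable_locally_integrable_mult[OF u]) (auto intro!: borel_measurable_continuous_onI test_function_continuous_partial \<phi> P0)
  qed
  have ig: "integrable lborel (\<lambda>x. g x $ i * \<phi> x)" for i
    using locally_integrable_inner[OF g, of "axis i 1"] M
    by (intro integrable_locally_integrable_mult) (auto simp: inner_axis intro!: borel_measurable_continuous_onI test_function_continuous \<phi> R)
  have "(LINT x|lborel. u x * (\<Sum>i\<in>UNIV. v $ i * partial_deriv i \<phi> x)) = (\<Sum>i\<in>UNIV. v $ i * (LINT x|lborel. u x * partial_deriv i \<phi> x))"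
    using iu by (simp add: sum_distrib_left mult.left_commute[of "u _"] Bochner_Integration.integral_sum)
  also have "\<dots> = - (\<Sum>i\<in>UNIV. v $ i * (LINT x|lborel. g x $ i * \<phi> x))"
    using wg \<phi> by (simp add: has_weak_gradient_def sum_negf)
  also have "(\<Sum>i\<in>UNIV. v $ i * (LINT x|lborel. g x $ i * \<phi> x)) = (LINT x|lborel. (\<Sum>i\<in>UNIV. v $ i * (g x $ i * \<phi> x)))"
    using ig by (simp add: Bochner_Integration.integral_sum)
  also have "(\<lambda>x. \<Sum>i\<in>UNIV. v $ i * (g x $ i * \<phi> x)) = (\<lambda>x. (g x \<bullet> v) * \<phi> x)"
    by (simp add: inner_vec_def sum_distrib_right sum_distrib_left mult_ac)
  finally show ?thesis by simp
qed

text \<open>Fundamental theorem of calculus for the function sending \<open>s\<close> to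
  \<open>- \<phi> (y - s *\<^sub>R v)\<close>.\<close>

lemma integral_segment_derivative:
  assumes d: "\<And>x. \<phi> differentiable at x" and c: "\<And>i. continuous_on UNIV (partial_deriv i \<phi>)"
  shows "(LINT s|lborel. indicator {0..1} s * (\<Sum>i\<in>UNIV. v $ i * partial_deriv i \<phi> (y - s *\<^sub>R v))) = \<phi> y - \<phi> (y - v)"
proof -
  have "(LINT s|lborel. (\<Sum>i\<in>UNIV. v $ i * partial_deriv i \<phi> (y - s *\<^sub>R v)) * indicator {0..1} s)
     = - \<phi> (y - 1 *\<^sub>R v) - - \<phi> (y - 0 *\<^sub>R v)"
  proof (rule integral_FTC_Icc_real)
    fix s :: real
    have "((\<lambda>s. y - s *\<^sub>R v) has_derivative (\<lambda>h. - (h *\<^sub>R v))) (at s)"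
      by (auto intro!: derivative_eq_intros)
    from has_derivative_compose[OF this has_derivative_partials[OF d]]
    have "((\<lambda>s. \<phi> (y - s *\<^sub>R v)) has_derivative (\<lambda>h. \<Sum>i\<in>UNIV. (- (h *\<^sub>R v)) $ i * partial_deriv i \<phi> (y - s *\<^sub>R v))) (at s)" .
    from has_derivative_minus[OF this]
    show "((\<lambda>s. - \<phi> (y - s *\<^sub>R v)) has_real_derivative (\<Sum>i\<in>UNIV. v $ i * partial_deriv i \<phi> (y - s *\<^sub>R v))) (at s)"
      by (rule has_derivative_imp_has_field_derivative) (simp add: sum_distrib_left sum_negf mult_ac)
    show "isCont (\<lambda>s. \<Sum>i\<in>UNIV. v $ i * partial_deriv i \<phi> (y - s *\<^sub>R v)) s"
    proof (intro continuous_intros)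
      fix i
      have "isCont (\<lambda>s. y - s *\<^sub>R v) s" by (intro continuous_intros)
      moreover have "isCont (partial_deriv i \<phi>) (y - s *\<^sub>R v)"
        using c[of i] by (simp add: continuous_on_eq_continuous_at)
      ultimately show "isCont (\<lambda>s. partial_deriv i \<phi> (y - s *\<^sub>R v)) s" by (rule isCont_o2)
    qed
  qed simp
  then show ?thesis by (simp add: mult.commute)
qed

text \<open>Both sides are tested against a smooth function; Fubini moves the translation onto it.\<close>

theorem weak_gradient_segment:
  assumes wg: "has_weak_gradient u g"
  shows "AE x in lborel. u (x + v) - u x = (LINT s|lborel. indicator {0..1} s * (g (x + s *\<^sub>R v) \<bullet> v))"
proof -
  define G where "G x = (LINT s|lborel. indicator {0..1} s * (g (x + s *\<^sub>R v) \<bullet> v))" for x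
  have u: "locally_integrable u" and g: "locally_integrable g"
    using wg by (auto simp: has_weak_gradient_def)
  have gv: "locally_integrable (\<lambda>x. g x \<bullet> v)" using g by (rule locally_integrable_inner)
  have [measurable]: "u \<in> borel_measurable borel" "g \<in> borel_measurable borel"
    using u g by (auto intro: locally_integrable_measurable)
  have uv: "locally_integrable (\<lambda>x. u (x + v))" using u by (rule locally_integrable_translate)
  have F1: "integrable (lborel \<Otimes>\<^sub>M lborel) (\<lambda>z. indicator {0..1} (fst z) * ((g (snd z + fst z *\<^sub>R v) \<bullet> v) * w (snd z)))"
    if "w \<in> borel_measurable borel" "\<And>x. \<bar>w x\<bar> \<le> M" "\<And>x. x \<notin> cball 0 R \<Longrightarrow> w x = 0" for w M R
    using integrable_strip_translate[OF gv that, where v=v] .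
  have G: "locally_integrable G"
    unfolding locally_integrable_def set_integrable_def
  proof (intro allI impI)
    fix S :: "(real^2) set" assume S: "compact S"
    then obtain R where R: "S \<subseteq> cball 0 R" using compact_imp_bounded bounded_subset_ballD ball_subset_cball by (metis order_trans)
    from S have [measurable]: "S \<in> sets borel" by (simp add: borel_compact)
    have "integrable (lborel \<Otimes>\<^sub>M lborel) (\<lambda>z. indicator {0..1} (fst z) * ((g (snd z + fst z *\<^sub>R v) \<bullet> v) * indicator S (snd z)))"
      by (rule F1[of _ 1 R]) (use R in \<open>auto simp: indicator_def\<close>)
    from lborel_pair.integrable_snd[of "\<lambda>s x. indicator {0..1} s * ((g (x + s *\<^sub>R v) \<bullet> v) * indicator S x)"] this
    have "integrable lborel (\<lambda>x. LINT s|lborel. indicator {0..1} s * ((g (x + s *\<^sub>R v) \<bullet> v) * indicator S x))"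
      by (simp add: split_beta')
    then show "integrable lborel (\<lambda>x. indicator S x *\<^sub>R G x)"
      unfolding G_def by (simp flip: mult.assoc) (simp add: mult.commute)
  qed
  have "AE x in lborel. (u (x + v) + (-1) *\<^sub>R u x) + (-1) *\<^sub>R G x = 0"
  proof (rule locally_integrable_zero_AE)
    show "locally_integrable (\<lambda>x. (u (x + v) + (-1) *\<^sub>R u x) + (-1) *\<^sub>R G x)"
      by (intro locally_integrable_add locally_integrable_scaleR uv u G)
    fix \<phi> assume \<phi>: "test_function \<phi>"
    have [measurable]: "\<phi> \<in> borel_measurable borel" by (intro borel_measurable_continuous_onI test_function_continuous \<phi>)
    have [measurable]: "partial_deriv i \<phi> \<in> borel_measurable borel" for i
      by (intro borel_measurable_continuous_onI test_function_continuous_partial \<phi>)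
    obtain R where R: "\<And>x. x \<notin> cball 0 R \<Longrightarrow> \<phi> x = 0" using test_function_support[OF \<phi>] by metis
    obtain M where M: "\<And>x. \<bar>\<phi> x\<bar> \<le> M"
      using continuous_compact_support_bounded[OF test_function_continuous[OF \<phi>] R] by metis
    define D where "D x = (\<Sum>i\<in>UNIV. v $ i * partial_deriv i \<phi> x)" for x
    have [measurable]: "D \<in> borel_measurable borel" unfolding D_def by measurable
    have D0: "x \<notin> cball 0 R \<Longrightarrow> D x = 0" for x
      unfolding D_def by (rule sum.neutral) (auto intro!: partial_deriv_outside_support[where R=R] R)
    have cD: "continuous_on UNIV D" unfolding D_def by (intro continuous_intros test_function_continuous_partial \<phi>)
    obtain M' where M': "\<And>x. \<bar>D x\<bar> \<le> M'"
      using continuous_compact_support_bounded[OF cD D0] by blast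
    have iu: "integrable lborel (\<lambda>x. u x * \<phi> x)" "integrable lborel (\<lambda>x. u (x + v) * \<phi> x)" "integrable lborel (\<lambda>x. G x * \<phi> x)"
      by (intro integrable_locally_integrable_mult[OF _ _ M R] u uv G; measurable)+
    have iu': "integrable lborel (\<lambda>x. u x * \<phi> (x - v))"
      using integrable_lborel_translate[OF iu(2), of "-v"] by simp
    have "(LINT x|lborel. G x * \<phi> x) = (LINT x|lborel. LINT s|lborel. indicator {0..1} s * ((g (x + s *\<^sub>R v) \<bullet> v) * \<phi> x))"
      unfolding G_def by (simp flip: mult.assoc)
    also have "\<dots> = (LINT s|lborel. LINT x|lborel. indicator {0..1} s * ((g (x + s *\<^sub>R v) \<bullet> v) * \<phi> x))"
      using F1[of \<phi> M R] M R by (intro lborel_pair.Fubini_integral) (simp add: split_beta')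
    \<comment> \<open>For fixed \<open>s\<close> the substitution
      \<open>y = x + s *\<^sub>R v\<close> shifts the test function instead of \<open>g\<close>, and
      the definition of the weak gradient applies to the shifted test function.\<close>
    also have "\<dots> = (LINT s|lborel. LINT y|lborel. - indicator {0..1} s * (u y * D (y - s *\<^sub>R v)))"
    proof (rule Bochner_Integration.integral_cong[OF refl])
      fix s :: real
      have "(LINT x|lborel. (g (x + s *\<^sub>R v) \<bullet> v) * \<phi> x) = (LINT x|lborel. (g (x + s *\<^sub>R v) \<bullet> v) * \<phi> (x + s *\<^sub>R v - s *\<^sub>R v))" by simp
      also have "\<dots> = (LINT y|lborel. (g y \<bullet> v) * \<phi> (y - s *\<^sub>R v))"
        by (rule integral_lborel_translate[where f="\<lambda>y. (g y \<bullet> v) * \<phi> (y - s *\<^sub>R v)"]) measurable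
      also have "\<dots> = - (LINT y|lborel. u y * D (y - s *\<^sub>R v))"
        using weak_gradient_direction[OF wg test_function_translate[OF \<phi>, where v="- (s *\<^sub>R v)"], where v=v]
        by (simp add: D_def partial_deriv_translate[OF test_function_differentiable[OF \<phi>], where v="- (s *\<^sub>R v)", simplified])
      finally show "(LINT x|lborel. indicator {0..1} s * ((g (x + s *\<^sub>R v) \<bullet> v) * \<phi> x)) = (LINT y|lborel. - indicator {0..1} s * (u y * D (y - s *\<^sub>R v)))"
        by simp
    qed
    \<comment> \<open>Exchanging back leaves an inner integral of a continuous directional
      derivative, to which the classical fundamental theorem applies.\<close>
    also have "\<dots> = (LINT y|lborel. LINT s|lborel. - indicator {0..1} s * (u y * D (y - s *\<^sub>R v)))"
    proof (rule lborel_pair.Fubini_integral[symmetric])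
      obtain C where C: "\<And>w. (\<And>y. \<bar>w y\<bar> \<le> M') \<Longrightarrow> (\<And>y. y \<notin> cball 0 (R + norm v) \<Longrightarrow> w y = 0)
         \<Longrightarrow> (\<integral>\<^sup>+y. ennreal \<bar>u y * w y\<bar> \<partial>lborel) \<le> ennreal C"
        using locally_integrable_nn_integral_bound[OF u] by blast
      have "integrable (lborel \<Otimes>\<^sub>M lborel) (\<lambda>z. indicator {0..1} (fst z) * (- (u (snd z) * D (snd z - fst z *\<^sub>R v))))"
      proof (rule integrable_strip)
        fix s :: real assume s: "s \<in> {0..1}"
        have "(\<integral>\<^sup>+y. ennreal \<bar>u y * D (y - s *\<^sub>R v)\<bar> \<partial>lborel) \<le> ennreal C"
        proof (rule C)
          fix y :: "real^2" assume "y \<notin> cball 0 (R + norm v)"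
          moreover have "norm y \<le> norm (y - s *\<^sub>R v) + norm (s *\<^sub>R v)" using norm_triangle_ineq[of "y - s *\<^sub>R v" "s *\<^sub>R v"] by simp
          moreover have "norm (s *\<^sub>R v) \<le> norm v" using s by (auto intro: mult_left_le_one_le)
          ultimately show "D (y - s *\<^sub>R v) = 0" by (intro D0) auto
        qed (rule M')
        then show "(\<integral>\<^sup>+x. ennreal \<bar>- (u (snd (s, x)) * D (snd (s, x) - fst (s, x) *\<^sub>R v))\<bar> \<partial>lborel) \<le> ennreal C" by simp
      qed measurable
      then show "integrable (lborel \<Otimes>\<^sub>M lborel) (\<lambda>(s, y). - indicator {0..1} s * (u y * D (y - s *\<^sub>R v)))"
        by (simp add: split_beta')
    qed
    also have "\<dots> = (LINT y|lborel. u y * (\<phi> (y - v) - \<phi> y))"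
    proof (rule Bochner_Integration.integral_cong[OF refl])
      fix y
      have "(LINT s|lborel. - indicator {0..1} s * (u y * D (y - s *\<^sub>R v))) = (LINT s|lborel. - u y * (indicator {0..1} s * D (y - s *\<^sub>R v)))"
        by (simp add: mult_ac)
      also have "\<dots> = - u y * (\<phi> y - \<phi> (y - v))"
        unfolding D_def by (subst integral_mult_right_zero, subst integral_segment_derivative)
          (auto intro: test_function_differentiable test_function_continuous_partial \<phi>)
      finally show "(LINT s|lborel. - indicator {0..1} s * (u y * D (y - s *\<^sub>R v))) = u y * (\<phi> (y - v) - \<phi> y)"
        by (simp add: algebra_simps)
    qed
    also have "\<dots> = (LINT y|lborel. u y * \<phi> (y - v)) - (LINT y|lborel. u y * \<phi> y)"
      using iu iu' by (simp add: right_diff_distrib)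
    also have "(LINT y|lborel. u y * \<phi> (y - v)) = (LINT y|lborel. u (y + v) * \<phi> y)"
      using integral_lborel_translate[where f="\<lambda>y. u y * \<phi> (y - v)" and v=v] by simp
    finally have "(LINT x|lborel. G x * \<phi> x) = (LINT y|lborel. u (y + v) * \<phi> y) - (LINT y|lborel. u y * \<phi> y)" .
    with iu show "(LINT x|lborel. ((u (x + v) + (-1) *\<^sub>R u x) + (-1) *\<^sub>R G x) * \<phi> x) = 0"
      by (simp add: left_diff_distrib)
  qed
  then show ?thesis by (simp add: G_def)
qed

text \<open>Cauchy-Schwarz on the segment from \<open>x\<close> to \<open>x + v\<close> bounds the
  squared increment by \<open>(norm v)^2\<close> times the average of the squared gradient.
  Convexity keeps the segment in \<open>C\<close>, and integrating over \<open>x\<close> first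
  removes the shift.\<close>

lemma weak_gradient_shift_convex:
  assumes wg: "has_weak_gradient u g" and C: "convex C" and [measurable]: "C \<in> sets borel"
  shows "(\<integral>\<^sup>+x. indicator C x * indicator C (x + v) * ennreal ((u (x + v) - u x)\<^sup>2) \<partial>lborel)
     \<le> ennreal ((norm v)\<^sup>2) * (\<integral>\<^sup>+x. indicator C x * ennreal ((norm (g x))\<^sup>2) \<partial>lborel)"
proof -
  have [measurable]: "u \<in> borel_measurable borel" "g \<in> borel_measurable borel"
    using wg by (auto simp: has_weak_gradient_def intro: locally_integrable_measurable)
  let ?k = "\<lambda>x s. indicator {0..1} s * (g (x + s *\<^sub>R v) \<bullet> v)"
  have jensen: "ennreal ((LINT s|lborel. ?k x s)\<^sup>2) \<le> (\<integral>\<^sup>+s. indicator {0..1} s * (ennreal ((norm v)\<^sup>2) * ennreal ((norm (g (x + s *\<^sub>R v)))\<^sup>2)) \<partial>lborel)" for x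
  proof (cases "integrable lborel (?k x)")
    case True
    have "ennreal ((LINT s|lborel. ?k x s)\<^sup>2) = (ennreal (norm (LINT s|lborel. ?k x s)))\<^sup>2"
      by (simp add: ennreal_power)
    also have "\<dots> \<le> (\<integral>\<^sup>+s. ennreal (norm (?k x s)) \<partial>lborel)\<^sup>2"
      using integral_norm_bound_ennreal[OF True] by (rule power_mono) simp
    also have "(\<integral>\<^sup>+s. ennreal (norm (?k x s)) \<partial>lborel) = (\<integral>\<^sup>+s. ennreal (norm (?k x s)) * indicator {0..1} s \<partial>lborel)"
      by (intro nn_integral_cong) (auto simp: indicator_def)
    also have "\<dots>\<^sup>2 \<le> (\<integral>\<^sup>+s. (ennreal (norm (?k x s)))\<^sup>2 \<partial>lborel) * (\<integral>\<^sup>+s. (indicator {0..1::real} s)\<^sup>2 \<partial>lborel)"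
      by (rule Cauchy_Schwarz_nn_integral) measurable
    also have "(\<integral>\<^sup>+s. (indicator {0..1::real} s)\<^sup>2 \<partial>lborel) = (\<integral>\<^sup>+s. indicator {0..1::real} s \<partial>lborel)"
      by (intro nn_integral_cong) (auto simp: indicator_def)
    also have "\<dots> = 1" by simp
    also have "(\<integral>\<^sup>+s. (ennreal (norm (?k x s)))\<^sup>2 \<partial>lborel) * 1 \<le> (\<integral>\<^sup>+s. indicator {0..1} s * (ennreal ((norm v)\<^sup>2) * ennreal ((norm (g (x + s *\<^sub>R v)))\<^sup>2)) \<partial>lborel)"
      unfolding mult_1_right
    proof (rule nn_integral_mono)
      fix s
      have "\<bar>g (x + s *\<^sub>R v) \<bullet> v\<bar>\<^sup>2 \<le> (norm (g (x + s *\<^sub>R v)) * norm v)\<^sup>2"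
        by (rule power_mono[OF Cauchy_Schwarz_ineq2]) simp
      then show "(ennreal (norm (?k x s)))\<^sup>2 \<le> indicator {0..1} s * (ennreal ((norm v)\<^sup>2) * ennreal ((norm (g (x + s *\<^sub>R v)))\<^sup>2))"
        by (auto simp: indicator_def ennreal_power power_mult_distrib mult.commute simp flip: ennreal_mult' intro!: ennreal_leI)
    qed
    finally show ?thesis .
  next
    \<comment> \<open>The Bochner integral of a non-integrable function is 0 by convention, so the
      left side vanishes.\<close>
    case False
    then show ?thesis by (simp add: not_integrable_integral_eq)
  qed
  have "(\<integral>\<^sup>+x. indicator C x * indicator C (x + v) * ennreal ((u (x + v) - u x)\<^sup>2) \<partial>lborel)
     \<le> (\<integral>\<^sup>+x. (\<integral>\<^sup>+s. indicator {0..1} s * (ennreal ((norm v)\<^sup>2) * (indicator C (x + s *\<^sub>R v) * ennreal ((norm (g (x + s *\<^sub>R v)))\<^sup>2))) \<partial>lborel) \<partial>lborel)"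
  proof (rule nn_integral_mono_AE)
    show "AE x in lborel. indicator C x * indicator C (x + v) * ennreal ((u (x + v) - u x)\<^sup>2)
       \<le> (\<integral>\<^sup>+s. indicator {0..1} s * (ennreal ((norm v)\<^sup>2) * (indicator C (x + s *\<^sub>R v) * ennreal ((norm (g (x + s *\<^sub>R v)))\<^sup>2))) \<partial>lborel)"
      using weak_gradient_segment[OF wg, of v]
    proof eventually_elim
      case (elim x)
      show ?case
      proof (cases "x \<in> C \<and> x + v \<in> C")
        case True
        have "x + s *\<^sub>R v \<in> C" if "s \<in> {0..1}" for s
        proof -
          have "(1 - s) *\<^sub>R x + s *\<^sub>R (x + v) \<in> C" using C True that by (auto simp: convex_alt)
          then show ?thesis by (simp add: algebra_simps)
        qed
        then have "(\<integral>\<^sup>+s. indicator {0..1} s * (ennreal ((norm v)\<^sup>2) * (indicator C (x + s *\<^sub>R v) * ennreal ((norm (g (x + s *\<^sub>R v)))\<^sup>2))) \<partial>lborel)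
          = (\<integral>\<^sup>+s. indicator {0..1} s * (ennreal ((norm v)\<^sup>2) * ennreal ((norm (g (x + s *\<^sub>R v)))\<^sup>2)) \<partial>lborel)"
          by (intro nn_integral_cong) (auto simp: indicator_def)
        with jensen[of x] elim True show ?thesis by simp
      qed (auto simp: indicator_def)
    qed
  qed
  also have "\<dots> = (\<integral>\<^sup>+s. (\<integral>\<^sup>+x. indicator {0..1} s * (ennreal ((norm v)\<^sup>2) * (indicator C (x + s *\<^sub>R v) * ennreal ((norm (g (x + s *\<^sub>R v)))\<^sup>2))) \<partial>lborel) \<partial>lborel)"
    by (rule lborel_pair.Fubini') measurable
  also have "\<dots> = (\<integral>\<^sup>+s. indicator {0..1::real} s * (ennreal ((norm v)\<^sup>2) * (\<integral>\<^sup>+x. indicator C x * ennreal ((norm (g x))\<^sup>2) \<partial>lborel)) \<partial>lborel)"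
  proof (rule nn_integral_cong)
    fix s :: real
    show "(\<integral>\<^sup>+x. indicator {0..1} s * (ennreal ((norm v)\<^sup>2) * (indicator C (x + s *\<^sub>R v) * ennreal ((norm (g (x + s *\<^sub>R v)))\<^sup>2))) \<partial>lborel)
      = indicator {0..1} s * (ennreal ((norm v)\<^sup>2) * (\<integral>\<^sup>+x. indicator C x * ennreal ((norm (g x))\<^sup>2) \<partial>lborel))"
      using nn_integral_lborel_translate[of "\<lambda>x. indicator C x * ennreal ((norm (g x))\<^sup>2)" "s *\<^sub>R v"]
      by (simp add: nn_integral_cmult)
  qed
  also have "\<dots> = ennreal ((norm v)\<^sup>2) * (\<integral>\<^sup>+x. indicator C x * ennreal ((norm (g x))\<^sup>2) \<partial>lborel)"
    by (subst nn_integral_multc) auto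
  finally show ?thesis .
qed

subsection \<open>A chain rule for weak gradients\<close>

lemma C1_compact_support_lipschitz:
  assumes d: "\<And>x. \<psi> differentiable at x" and c: "\<And>i. continuous_on UNIV (partial_deriv i \<psi>)"
    and R: "\<And>x. x \<notin> cball 0 R \<Longrightarrow> \<psi> x = 0"
  obtains M where "M \<ge> 0" "\<And>x y. \<bar>\<psi> x - \<psi> y\<bar> \<le> M * norm (x - y)" "\<And>i x. \<bar>partial_deriv i \<psi> x\<bar> \<le> M"
proof -
  have "\<exists>M\<ge>0. \<forall>x. \<bar>partial_deriv i \<psi> x\<bar> \<le> M" for i
    by (rule continuous_compact_support_bounded[OF c[of i], of R])
       (use partial_deriv_outside_support[of R \<psi>] R in blast)+
  then obtain m where m: "\<And>i. m i \<ge> 0" "\<And>i x. \<bar>partial_deriv i \<psi> x\<bar> \<le> m i" by metis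
  let ?M = "\<Sum>i\<in>UNIV. m i"
  have M: "?M \<ge> 0" using m(1) by (simp add: sum_nonneg)
  have mM: "m i \<le> ?M" for i using m(1) by (intro member_le_sum) auto
  have "norm (\<psi> x - \<psi> y) \<le> ?M * norm (x - y)" for x y
  proof (rule differentiable_bound[of UNIV \<psi> "\<lambda>x h. \<Sum>i\<in>UNIV. h $ i * partial_deriv i \<psi> x"])
    fix x :: "real^2"
    show "(\<psi> has_derivative (\<lambda>h. \<Sum>i\<in>UNIV. h $ i * partial_deriv i \<psi> x)) (at x within UNIV)"
      using has_derivative_partials[OF d] by simp
    show "onorm (\<lambda>h. \<Sum>i\<in>UNIV. h $ i * partial_deriv i \<psi> x) \<le> ?M"
    proof (rule onorm_bound[OF M])
      fix h :: "real^2"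
      have "norm (\<Sum>i\<in>UNIV. h $ i * partial_deriv i \<psi> x) \<le> (\<Sum>i\<in>UNIV. norm h * m i)"
        by (rule sum_norm_le) (auto simp: abs_mult intro!: mult_mono m component_le_norm_cart)
      then show "norm (\<Sum>i\<in>UNIV. h $ i * partial_deriv i \<psi> x) \<le> ?M * norm h"
        by (simp add: sum_distrib_left mult.commute)
    qed
  qed auto
  with M mM m(2) show thesis by (intro that[of ?M]) (auto intro: order_trans)
qed

text \<open>The mean value theorem at an intermediate point replaces Taylor's formula, at the price
  of the constant \<open>L\<close> in place of \<open>L / 2\<close>.\<close>

lemma lipschitz_derivative_remainder:
  fixes F F' :: "real \<Rightarrow> real"
  assumes F: "\<And>t. (F has_real_derivative F' t) (at t)" and L: "\<And>s t. \<bar>F' s - F' t\<bar> \<le> L * \<bar>s - t\<bar>"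
  shows "\<bar>F b - F a - F' a * (b - a)\<bar> \<le> L * (b - a)\<^sup>2"
proof (cases "a = b")
  case False
  have L0: "L \<ge> 0" using L[of 0 1] by (auto intro: order_trans[OF abs_ge_zero])
  have "\<exists>z. \<bar>z - a\<bar> \<le> \<bar>b - a\<bar> \<and> F b - F a = (b - a) * F' z"
  proof (cases "a < b")
    case True
    from MVT2[OF this F] show ?thesis by force
  next
    case False
    with \<open>a \<noteq> b\<close> have "b < a" by simp
    from MVT2[OF this F] obtain z where "b < z" "z < a" "F a - F b = (a - b) * F' z" by blast
    then show ?thesis by (intro exI[of _ z]) (auto simp: algebra_simps)
  qed
  then obtain z where z: "\<bar>z - a\<bar> \<le> \<bar>b - a\<bar>" "F b - F a = (b - a) * F' z" by blast
  then have "F b - F a - F' a * (b - a) = (b - a) * (F' z - F' a)" by (simp add: algebra_simps)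
  then have "\<bar>F b - F a - F' a * (b - a)\<bar> = \<bar>b - a\<bar> * \<bar>F' z - F' a\<bar>" by (simp add: abs_mult)
  also have "\<dots> \<le> \<bar>b - a\<bar> * (L * \<bar>b - a\<bar>)"
    using L[of z a] z(1) L0 by (intro mult_left_mono) (auto intro: order_trans mult_left_mono)
  finally show ?thesis by (simp add: power2_eq_square mult.left_commute)
qed simp

context
  fixes u :: "real^2 \<Rightarrow> real" and g :: "real^2 \<Rightarrow> real^2" and F F' :: "real \<Rightarrow> real"
    and \<psi> :: "real^2 \<Rightarrow> real" and L R M P :: real and B :: "(real^2) set"
  assumes wg: "has_weak_gradient u g"
    and u2: "integrable lborel (\<lambda>x. indicator B x * (u x)\<^sup>2)"
    and g2: "integrable lborel (\<lambda>x. indicator B x * (norm (g x))\<^sup>2)"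
    and F: "\<And>t. (F has_real_derivative F' t) (at t)"
    and L: "\<And>s t. \<bar>F' s - F' t\<bar> \<le> L * \<bar>s - t\<bar>"
    and d: "\<And>x. \<psi> differentiable at x" and c: "\<And>i. continuous_on UNIV (partial_deriv i \<psi>)"
    and R: "\<And>x. x \<notin> cball 0 R \<Longrightarrow> \<psi> x = 0"
    and B_def: "B = cball 0 (R + 1)"
    and M: "M \<ge> 0" "\<And>x y. \<bar>\<psi> x - \<psi> y\<bar> \<le> M * norm (x - y)" "\<And>i x. \<bar>partial_deriv i \<psi> x\<bar> \<le> M"
    and P: "P \<ge> 0" "\<And>x. \<bar>\<psi> x\<bar> \<le> P"
begin

lemma chain_measurable [measurable]:
  "u \<in> borel_measurable borel" "g \<in> borel_measurable borel" "F \<in> borel_measurable borel"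
  "F' \<in> borel_measurable borel" "\<psi> \<in> borel_measurable borel" "partial_deriv i \<psi> \<in> borel_measurable borel"
  "B \<in> sets borel"
proof -
  show "u \<in> borel_measurable borel" "g \<in> borel_measurable borel"
    using wg by (auto simp: has_weak_gradient_def intro: locally_integrable_measurable)
  show "F \<in> borel_measurable borel"
    using F by (intro borel_measurable_continuous_onI) (auto intro!: continuous_at_imp_continuous_on DERIV_isCont)
  have "L-lipschitz_on UNIV F'"
    using L L[of 0 1] by (intro lipschitz_onI) (auto simp: dist_real_def intro: order_trans[OF abs_ge_zero])
  then show "F' \<in> borel_measurable borel"
    by (intro borel_measurable_continuous_onI lipschitz_on_continuous_on)
  show "\<psi> \<in> borel_measurable borel"
    using d by (intro borel_measurable_continuous_onI) (auto intro!: continuous_at_imp_continuous_on differentiable_imp_continuous_within)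
  show "partial_deriv i \<psi> \<in> borel_measurable borel"
    using c by (intro borel_measurable_continuous_onI)
  show "B \<in> sets borel" by (simp add: B_def)
qed

lemma chain_measurable_nth [measurable]: "(\<lambda>x. g x $ i) \<in> borel_measurable borel"
  by (rule measurable_compose[OF chain_measurable(2)]) simp

lemma chain_L_nonneg: "L \<ge> 0" using L[of 0 1] by (auto intro: order_trans[OF abs_ge_zero])

text \<open>The reason for the radius \<open>R + 1\<close> of \<open>B\<close>: shifts of length at
  most 1 cannot carry the support of \<open>\<psi>\<close> out of \<open>B\<close>.\<close>

lemma chain_support:
  assumes "norm v \<le> 1" "x \<notin> B \<or> x + v \<notin> B" shows "\<psi> x = 0"
proof (rule R)
  show "x \<notin> cball 0 R" using assms norm_triangle_ineq[of x v] by (auto simp: B_def)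
qed

lemma chain_integrable_B: "integrable lborel (indicator B :: real^2 \<Rightarrow> real)"
  using emeasure_bounded_finite[OF bounded_cball, of "0 :: real^2" "R + 1"]
  by (intro integrable_real_indicator) (auto simp: B_def)

lemma chain_integrable_u_shift:
  assumes "norm v \<le> 1"
  shows "integrable lborel (\<lambda>x. indicator B x * indicator B (x + v) * (u (x + v) - u x)\<^sup>2)" (is "integrable _ ?f")
    and "(LINT x|lborel. indicator B x * indicator B (x + v) * (u (x + v) - u x)\<^sup>2) \<le> (norm v)\<^sup>2 * (LINT x|lborel. indicator B x * (norm (g x))\<^sup>2)"
proof -
  let ?G = "LINT x|lborel. indicator B x * (norm (g x))\<^sup>2"
  have G: "(\<integral>\<^sup>+x. indicator B x * ennreal ((norm (g x))\<^sup>2) \<partial>lborel) = ennreal ?G"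
    by (subst nn_integral_eq_integral[OF g2, symmetric]) (auto intro!: nn_integral_cong simp: indicator_def)
  have nn: "(\<integral>\<^sup>+x. ennreal (?f x) \<partial>lborel) \<le> ennreal ((norm v)\<^sup>2 * ?G)"
  proof -
    have "(\<integral>\<^sup>+x. ennreal (?f x) \<partial>lborel) = (\<integral>\<^sup>+x. indicator B x * indicator B (x + v) * ennreal ((u (x + v) - u x)\<^sup>2) \<partial>lborel)"
      by (intro nn_integral_cong) (auto simp: indicator_def)
    also have "\<dots> \<le> ennreal ((norm v)\<^sup>2) * ennreal ?G"
      unfolding G[symmetric] by (rule weak_gradient_shift_convex[OF wg]) (simp_all add: B_def)
    finally show ?thesis by (simp add: ennreal_mult')
  qed
  have G0: "?G \<ge> 0" by (intro integral_nonneg_AE) auto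
  show i: "integrable lborel ?f"
    by (rule integrableI_nonneg) (use nn in \<open>auto intro: order.strict_trans1\<close>)
  have "ennreal (LINT x|lborel. ?f x) \<le> ennreal ((norm v)\<^sup>2 * ?G)"
    using nn by (subst nn_integral_eq_integral[OF i, symmetric]) auto
  then show "(LINT x|lborel. ?f x) \<le> (norm v)\<^sup>2 * ?G"
    using G0 by (subst (asm) ennreal_le_iff) auto
qed

text \<open>A Lipschitz \<open>F'\<close> grows at most linearly, so its composition with
  \<open>u\<close> inherits local square integrability.\<close>

lemma chain_F'_sq: "integrable lborel (\<lambda>x. indicator B x * (F' (u x))\<^sup>2)"
proof (rule Bochner_Integration.integrable_bound)
  show "integrable lborel (\<lambda>x. 2 * (F' 0)\<^sup>2 * indicator B x + 2 * L\<^sup>2 * (indicator B x * (u x)\<^sup>2))"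
    using chain_integrable_B u2 by auto
  have "(F' t)\<^sup>2 \<le> 2 * (F' 0)\<^sup>2 + 2 * L\<^sup>2 * t\<^sup>2" for t
  proof -
    have "(F' t - F' 0)\<^sup>2 \<le> (L * \<bar>t\<bar>)\<^sup>2" using power_mono[OF L[of t 0], of 2] by simp
    moreover have "(F' t)\<^sup>2 \<le> 2 * (F' 0)\<^sup>2 + 2 * (F' t - F' 0)\<^sup>2"
      using zero_le_power2[of "F' t - 2 * F' 0"] by (simp add: power2_eq_square algebra_simps)
    ultimately show ?thesis by (simp add: power_mult_distrib)
  qed
  then show "AE x in lborel. norm (indicator B x * (F' (u x))\<^sup>2) \<le> norm (2 * (F' 0)\<^sup>2 * indicator B x + 2 * L\<^sup>2 * (indicator B x * (u x)\<^sup>2))"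
    by (intro AE_I2) (auto simp: indicator_def intro!: order_trans[OF _ abs_ge_self])
qed measurable

text \<open>Quadratic growth of \<open>F\<close> matches square integrability of \<open>u\<close>
  exactly.\<close>

lemma chain_F_abs: "integrable lborel (\<lambda>x. indicator B x * F (u x))"
proof (rule Bochner_Integration.integrable_bound)
  show "integrable lborel (\<lambda>x. (\<bar>F 0\<bar> + (F' 0)\<^sup>2) * indicator B x + (L + 1) * (indicator B x * (u x)\<^sup>2))"
    using chain_integrable_B u2 by auto
  have "\<bar>F t\<bar> \<le> \<bar>F 0\<bar> + (F' 0)\<^sup>2 + (L + 1) * t\<^sup>2" for t
  proof -
    have "\<bar>F t - F 0 - F' 0 * t\<bar> \<le> L * t\<^sup>2"
      using lipschitz_derivative_remainder[OF F L, of t 0] by simp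
    moreover have "\<bar>F' 0 * t\<bar> \<le> (F' 0)\<^sup>2 + t\<^sup>2"
    proof -
      have "2 * \<bar>F' 0\<bar> * \<bar>t\<bar> \<le> (F' 0)\<^sup>2 + t\<^sup>2" using sum_squares_bound[of "\<bar>F' 0\<bar>" "\<bar>t\<bar>"] by simp
      then show ?thesis using abs_ge_zero[of "F' 0 * t"] unfolding abs_mult by linarith
    qed
    ultimately show ?thesis by (simp add: algebra_simps)
  qed
  then show "AE x in lborel. norm (indicator B x * F (u x)) \<le> norm ((\<bar>F 0\<bar> + (F' 0)\<^sup>2) * indicator B x + (L + 1) * (indicator B x * (u x)\<^sup>2))"
    by (intro AE_I2) (auto simp: indicator_def intro!: order_trans[OF _ abs_ge_self])
qed measurable

text \<open>A product rule for differences: the increment of \<open>F' (u x)\<close> costs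
  \<open>L\<close> times the increment of \<open>u\<close>, that of \<open>\<psi>\<close> costs
  \<open>M * norm v\<close>. Both are of order \<open>norm v\<close> in square mean, which replaces
  differentiability of the product.\<close>

lemma chain_w_shift:
  assumes v: "norm v \<le> 1"
  shows "integrable lborel (\<lambda>x. (F' (u (x + v)) * \<psi> (x + v) - F' (u x) * \<psi> x)\<^sup>2)" (is "integrable _ ?f")
    and "(LINT x|lborel. (F' (u (x + v)) * \<psi> (x + v) - F' (u x) * \<psi> x)\<^sup>2)
      \<le> (norm v)\<^sup>2 * (2 * L\<^sup>2 * P\<^sup>2 * (LINT x|lborel. indicator B x * (norm (g x))\<^sup>2) + 2 * M\<^sup>2 * (LINT x|lborel. indicator B x * (F' (u x))\<^sup>2))"
proof -
  let ?k = "\<lambda>x. 2 * L\<^sup>2 * P\<^sup>2 * (indicator B x * indicator B (x + v) * (u (x + v) - u x)\<^sup>2) + 2 * M\<^sup>2 * (norm v)\<^sup>2 * (indicator B x * (F' (u x))\<^sup>2)"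
  have le: "?f x \<le> ?k x" for x
  proof (cases "x \<in> B \<and> x + v \<in> B")
    case True
    let ?a = "(F' (u (x + v)) - F' (u x)) * \<psi> (x + v)" and ?b = "F' (u x) * (\<psi> (x + v) - \<psi> x)"
    have "?f x = (?a + ?b)\<^sup>2" by (simp add: algebra_simps)
    also have "\<dots> \<le> 2 * ?a\<^sup>2 + 2 * ?b\<^sup>2"
      using sum_squares_bound[of ?a ?b] by (simp add: power2_sum)
    also have "?a\<^sup>2 \<le> ((L * \<bar>u (x + v) - u x\<bar>) * P)\<^sup>2"
      using L[of "u (x+v)" "u x"] P by (subst power2_abs[symmetric], intro power_mono) (auto simp: abs_mult intro!: mult_mono order_trans[OF abs_ge_zero])
    also have "?b\<^sup>2 \<le> (\<bar>F' (u x)\<bar> * (M * norm v))\<^sup>2"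
      using M(2)[of "x + v" x] by (subst power2_abs[symmetric], intro power_mono) (auto simp: abs_mult intro!: mult_mono)
    finally show ?thesis using True by (simp add: power_mult_distrib mult_ac)
  next
    case False
    have "\<psi> x = 0" using chain_support[OF v] False by blast
    moreover have "\<psi> (x + v) = 0" using chain_support[of "-v" "x + v"] v False by auto
    ultimately show ?thesis by simp
  qed
  have ik: "integrable lborel ?k" using chain_integrable_u_shift(1)[OF v] chain_F'_sq by auto
  show i: "integrable lborel ?f"
    by (rule Bochner_Integration.integrable_bound[OF ik]) (use le in \<open>auto intro!: AE_I2 intro: order_trans[OF _ abs_ge_self]\<close>)
  have "integral\<^sup>L lborel ?f \<le> integral\<^sup>L lborel ?k" by (rule integral_mono[OF i ik le])
  also have "\<dots> = 2 * L\<^sup>2 * P\<^sup>2 * (LINT x|lborel. indicator B x * indicator B (x + v) * (u (x + v) - u x)\<^sup>2) + 2 * M\<^sup>2 * (norm v)\<^sup>2 * (LINT x|lborel. indicator B x * (F' (u x))\<^sup>2)"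
    using chain_integrable_u_shift(1)[OF v] chain_F'_sq by (subst Bochner_Integration.integral_add) auto
  also have "\<dots> \<le> 2 * L\<^sup>2 * P\<^sup>2 * ((norm v)\<^sup>2 * (LINT x|lborel. indicator B x * (norm (g x))\<^sup>2)) + 2 * M\<^sup>2 * (norm v)\<^sup>2 * (LINT x|lborel. indicator B x * (F' (u x))\<^sup>2)"
    using chain_integrable_u_shift(2)[OF v] by (intro add_right_mono mult_left_mono) auto
  finally show "integral\<^sup>L lborel ?f \<le> (norm v)\<^sup>2 * (2 * L\<^sup>2 * P\<^sup>2 * (LINT x|lborel. indicator B x * (norm (g x))\<^sup>2) + 2 * M\<^sup>2 * (LINT x|lborel. indicator B x * (F' (u x))\<^sup>2))"
    by (simp add: algebra_simps)
qed

lemma chain_w_sq: "integrable lborel (\<lambda>x. (F' (u x) * \<psi> x)\<^sup>2)"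
proof (rule Bochner_Integration.integrable_bound)
  show "integrable lborel (\<lambda>x. P\<^sup>2 * (indicator B x * (F' (u x))\<^sup>2))" using chain_F'_sq by auto
  have "(\<psi> x)\<^sup>2 \<le> P\<^sup>2" for x using power_mono[OF P(2)[of x], of 2] by simp
  then show "AE x in lborel. norm ((F' (u x) * \<psi> x)\<^sup>2) \<le> norm (P\<^sup>2 * (indicator B x * (F' (u x))\<^sup>2))"
    using chain_support[of 0] by (intro AE_I2) (auto simp: indicator_def power_mult_distrib mult.commute intro!: mult_right_mono)
qed measurable

lemma chain_support':
  assumes "norm v \<le> 1" "x \<notin> B" shows "\<psi> (x + v) = 0"
  using chain_support[of "-v" "x + v"] assms by auto

lemma chain_pairing:
  assumes v: "norm v \<le> 1"
  shows "integrable lborel (\<lambda>y. g y $ i * (F' (u (y + v)) * \<psi> (y + v)))"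
proof (rule Bochner_Integration.integrable_bound)
  let ?w = "\<lambda>x. F' (u x) * \<psi> x"
  show "integrable lborel (\<lambda>y. indicator B y * (norm (g y))\<^sup>2 + (?w (y + v))\<^sup>2)"
    using g2 integrable_lborel_translate[OF chain_w_sq, of v] by (rule Bochner_Integration.integrable_add)
  show "AE y in lborel. norm (g y $ i * ?w (y + v)) \<le> norm (indicator B y * (norm (g y))\<^sup>2 + (?w (y + v))\<^sup>2)"
  proof (rule AE_I2)
    fix y
    show "norm (g y $ i * ?w (y + v)) \<le> norm (indicator B y * (norm (g y))\<^sup>2 + (?w (y + v))\<^sup>2)"
    proof (cases "y \<in> B")
      case True
      have "\<bar>g y $ i * ?w (y + v)\<bar> \<le> norm (g y) * \<bar>?w (y + v)\<bar>"
        unfolding abs_mult by (intro mult_right_mono component_le_norm_cart) auto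
      also have "2 * (norm (g y) * \<bar>?w (y + v)\<bar>) \<le> (norm (g y))\<^sup>2 + (?w (y + v))\<^sup>2"
        using sum_squares_bound[of "norm (g y)" "\<bar>?w (y + v)\<bar>"] by simp
      then have "norm (g y) * \<bar>?w (y + v)\<bar> \<le> (norm (g y))\<^sup>2 + (?w (y + v))\<^sup>2"
        using mult_nonneg_nonneg[OF norm_ge_zero abs_ge_zero, of "g y" "?w (y + v)"] by linarith
      finally show ?thesis using True by simp
    next
      case False
      then show ?thesis using chain_support'[OF v] by simp
    qed
  qed
qed measurable

lemma chain_pairing_shift:
  assumes v: "norm v \<le> 1"
  shows "\<bar>(LINT y|lborel. g y $ i * (F' (u (y + v)) * \<psi> (y + v))) - (LINT y|lborel. g y $ i * (F' (u y) * \<psi> y))\<bar>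
    \<le> norm v * ((LINT x|lborel. indicator B x * (norm (g x))\<^sup>2) +
        (2 * L\<^sup>2 * P\<^sup>2 * (LINT x|lborel. indicator B x * (norm (g x))\<^sup>2) + 2 * M\<^sup>2 * (LINT x|lborel. indicator B x * (F' (u x))\<^sup>2)))"
    (is "?lhs \<le> norm v * (?G + ?K)")
proof (cases "v = 0")
  case False
  let ?w = "\<lambda>x. F' (u x) * \<psi> x" and ?t = "norm v"
  let ?d = "\<lambda>y. ?w (y + v) - ?w y"
  \<comment> \<open>Young's inequality with weight \<open>norm v\<close>: the gradient receives the
    factor \<open>norm v / 2\<close>, and the squared difference, of order
    \<open>(norm v)^2\<close>, is divided by \<open>2 * norm v\<close>. Both parts are then of first
    order.\<close>
  let ?k = "\<lambda>y. ?t / 2 * (indicator B y * (norm (g y))\<^sup>2) + 1 / (2 * ?t) * (?d y)\<^sup>2"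
  have t: "?t > 0" using False by simp
  have ik: "integrable lborel ?k" using g2 chain_w_shift(1)[OF v] by auto
  have "?lhs = \<bar>LINT y|lborel. g y $ i * ?d y\<bar>"
    using chain_pairing[OF v, of i] chain_pairing[of 0 i] by (simp add: right_diff_distrib)
  also have "\<dots> \<le> (LINT y|lborel. \<bar>g y $ i * ?d y\<bar>)" by (rule integral_abs_bound)
  also have "\<dots> \<le> (LINT y|lborel. ?k y)"
  proof (rule integral_mono[OF _ ik])
    show "integrable lborel (\<lambda>y. \<bar>g y $ i * ?d y\<bar>)"
      using chain_pairing[OF v, of i] chain_pairing[of 0 i] by (intro integrable_abs) (simp add: right_diff_distrib)
    fix y
    show "\<bar>g y $ i * ?d y\<bar> \<le> ?k y"
    proof (cases "y \<in> B")
      case True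
      have "\<bar>g y $ i * ?d y\<bar> \<le> norm (g y) * \<bar>?d y\<bar>"
        unfolding abs_mult by (intro mult_right_mono component_le_norm_cart) auto
      also have "2 * (?t * norm (g y)) * \<bar>?d y\<bar> \<le> (?t * norm (g y))\<^sup>2 + (?d y)\<^sup>2"
        using sum_squares_bound[of "?t * norm (g y)" "\<bar>?d y\<bar>"] by simp
      then have "norm (g y) * \<bar>?d y\<bar> \<le> ?t / 2 * (norm (g y))\<^sup>2 + 1 / (2 * ?t) * (?d y)\<^sup>2"
        using t by (simp add: field_simps power2_eq_square)
      finally show ?thesis using True by simp
    next
      case False
      then show ?thesis using chain_support'[OF v False] chain_support'[of 0 y] t by simp
    qed
  qed
  also have "\<dots> = ?t / 2 * ?G + 1 / (2 * ?t) * (LINT y|lborel. (?d y)\<^sup>2)"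
    using g2 chain_w_shift(1)[OF v] by (subst Bochner_Integration.integral_add) auto
  also have "\<dots> \<le> ?t / 2 * ?G + 1 / (2 * ?t) * (?t\<^sup>2 * ?K)"
    using chain_w_shift(2)[OF v] t by (intro add_left_mono mult_left_mono) auto
  also have "\<dots> = ?t / 2 * (?G + ?K)" using t by (simp add: field_simps power2_eq_square)
  also have "\<dots> \<le> ?t * (?G + ?K)"
  proof -
    have "?G \<ge> 0" "(LINT x|lborel. indicator B x * (F' (u x))\<^sup>2) \<ge> 0" by (intro integral_nonneg_AE; simp)+
    then have "?G + ?K \<ge> 0" by auto
    with t show ?thesis by (intro mult_right_mono) auto
  qed
  finally show ?thesis .
qed simp

text \<open>The difference quotient of \<open>u\<close> is an average of the gradient over a
  segment. With the shift moved to \<open>F' (u x) * \<psi> x\<close> it becomes the average of the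
  pairings \<open>J s\<close>, each within order \<open>h\<close> of \<open>J 0\<close>.\<close>

lemma chain_difference_quotient:
  assumes h: "0 < h" "h \<le> 1"
  shows "\<bar>(LINT x|lborel. F' (u x) * \<psi> x * (u (x + h *\<^sub>R axis i 1) - u x)) / h - (LINT y|lborel. g y $ i * (F' (u y) * \<psi> y))\<bar>
    \<le> h * ((LINT x|lborel. indicator B x * (norm (g x))\<^sup>2) +
        (2 * L\<^sup>2 * P\<^sup>2 * (LINT x|lborel. indicator B x * (norm (g x))\<^sup>2) + 2 * M\<^sup>2 * (LINT x|lborel. indicator B x * (F' (u x))\<^sup>2)))"
    (is "?lhs \<le> h * ?C")
proof -
  let ?w = "\<lambda>x. F' (u x) * \<psi> x"
  define v where "v = h *\<^sub>R (axis i 1 :: real^2)"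
  have nv: "norm v = h" using h by (simp add: v_def)
  define J where "J s = (LINT y|lborel. g y $ i * ?w (y - s *\<^sub>R v))" for s
  have C0: "?C \<ge> 0"
  proof -
    have "(LINT x|lborel. indicator B x * (norm (g x))\<^sup>2) \<ge> 0" "(LINT x|lborel. indicator B x * (F' (u x))\<^sup>2) \<ge> 0"
      by (intro integral_nonneg_AE; simp)+
    then show ?thesis by auto
  qed
  have J: "\<bar>J s - J 0\<bar> \<le> h * ?C" if "s \<in> {0..1}" for s
  proof -
    have "norm (- (s *\<^sub>R v)) \<le> h" using that nv h by (auto intro: mult_left_le_one_le)
    moreover from this have "\<bar>J s - J 0\<bar> \<le> norm (- (s *\<^sub>R v)) * ?C"
      using chain_pairing_shift[of "- (s *\<^sub>R v)" i] h by (simp add: J_def)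
    ultimately show ?thesis using C0 by (meson mult_right_mono order_trans)
  qed
  let ?F = "\<lambda>z. g (snd z + fst z *\<^sub>R v) $ i * ?w (snd z)"
  have inner: "(LINT x|lborel. ?F (s, x)) = J s" for s
    using integral_lborel_translate[where f="\<lambda>y. g y $ i * ?w (y - s *\<^sub>R v)" and v="s *\<^sub>R v"]
    by (simp add: J_def)
  have iF: "integrable (lborel \<Otimes>\<^sub>M lborel) (\<lambda>z. indicator {0..1} (fst z) * ?F z)"
  proof (rule integrable_strip)
    fix s :: real assume s: "s \<in> {0..1}"
    have le1: "norm (s *\<^sub>R v) \<le> 1" using s nv h by (auto intro: order_trans[OF mult_left_le_one_le])
    let ?k = "\<lambda>x. (norm (indicator B (x + s *\<^sub>R v) *\<^sub>R g (x + s *\<^sub>R v)))\<^sup>2 + (?w x)\<^sup>2"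
    have gB: "integrable lborel (\<lambda>x. (norm (indicator B x *\<^sub>R g x))\<^sup>2)"
      by (rule Bochner_Integration.integrable_cong[THEN iffD1, OF refl _ g2]) (auto simp: indicator_def)
    have ik: "integrable lborel ?k"
      by (rule Bochner_Integration.integrable_add[OF integrable_lborel_translate[OF gB] chain_w_sq])
    have "(\<integral>\<^sup>+x. ennreal \<bar>?F (s, x)\<bar> \<partial>lborel) \<le> (\<integral>\<^sup>+x. ennreal (?k x) \<partial>lborel)"
    proof (intro nn_integral_mono ennreal_leI)
      fix x
      show "\<bar>?F (s, x)\<bar> \<le> ?k x"
      proof (cases "x + s *\<^sub>R v \<in> B")
        case True
        have "\<bar>?F (s, x)\<bar> \<le> norm (g (x + s *\<^sub>R v)) * \<bar>?w x\<bar>"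
          unfolding abs_mult fst_conv snd_conv by (intro mult_right_mono component_le_norm_cart) auto
        also have "2 * (norm (g (x + s *\<^sub>R v)) * \<bar>?w x\<bar>) \<le> (norm (g (x + s *\<^sub>R v)))\<^sup>2 + (?w x)\<^sup>2"
          using sum_squares_bound[of "norm (g (x + s *\<^sub>R v))" "\<bar>?w x\<bar>"] by simp
        then have "norm (g (x + s *\<^sub>R v)) * \<bar>?w x\<bar> \<le> (norm (g (x + s *\<^sub>R v)))\<^sup>2 + (?w x)\<^sup>2"
          using mult_nonneg_nonneg[OF norm_ge_zero abs_ge_zero, of "g (x + s *\<^sub>R v)" "?w x"] by linarith
        finally show ?thesis using True by simp
      next
        case False
        then show ?thesis using chain_support[OF le1, of x] by simp
      qed
    qed
    also have "\<dots> = ennreal (integral\<^sup>L lborel ?k)" by (rule nn_integral_eq_integral[OF ik]) simp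
    also have "integral\<^sup>L lborel ?k = (LINT x|lborel. (norm (indicator B x *\<^sub>R g x))\<^sup>2) + (LINT x|lborel. (?w x)\<^sup>2)"
      using integrable_lborel_translate[OF gB, of "s *\<^sub>R v"] chain_w_sq
        integral_lborel_translate[where f="\<lambda>x. (norm (indicator B x *\<^sub>R g x))\<^sup>2" and v="s *\<^sub>R v"]
      by (subst Bochner_Integration.integral_add) simp_all
    finally show "(\<integral>\<^sup>+x. ennreal \<bar>?F (s, x)\<bar> \<partial>lborel) \<le> ennreal ((LINT x|lborel. (norm (indicator B x *\<^sub>R g x))\<^sup>2) + (LINT x|lborel. (?w x)\<^sup>2))" .
  qed measurable
  have "(LINT x|lborel. ?w x * (u (x + v) - u x)) = (LINT x|lborel. h * (LINT s|lborel. indicator {0..1} s * ?F (s, x)))"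
  proof (rule integral_cong_AE)
    show "AE x in lborel. ?w x * (u (x + v) - u x) = h * (LINT s|lborel. indicator {0..1} s * ?F (s, x))"
      using weak_gradient_segment[OF wg, of v]
    proof eventually_elim
      case (elim x)
      have eq: "indicator {0..1} s * (g (x + s *\<^sub>R v) \<bullet> v) = h * (indicator {0..1} s * g (x + s *\<^sub>R v) $ i)" for s :: real
        by (simp add: v_def inner_axis)
      have "u (x + v) - u x = h * (LINT s|lborel. indicator {0..1} s * g (x + s *\<^sub>R v) $ i)"
        using elim unfolding eq by simp
      then show ?case by (simp flip: mult.assoc)
    qed
  qed measurable
  also have "\<dots> = h * (LINT x|lborel. LINT s|lborel. indicator {0..1} s * ?F (s, x))" by simp
  also have "(LINT x|lborel. LINT s|lborel. indicator {0..1} s * ?F (s, x)) = (LINT s|lborel. LINT x|lborel. indicator {0..1} s * ?F (s, x))"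
    using iF by (intro lborel_pair.Fubini_integral) (simp add: split_beta')
  also have "\<dots> = (LINT s|lborel. indicator {0..1} s * J s)" using inner by simp
  finally have "(LINT x|lborel. ?w x * (u (x + v) - u x)) / h = (LINT s|lborel. indicator {0..1} s * J s)"
    using h by simp
  moreover have iJ: "integrable lborel (\<lambda>s. indicator {0..1} s * J s)"
    using lborel_pair.integrable_fst'[OF iF] inner by simp
  moreover have "(LINT y|lborel. g y $ i * ?w y) = (LINT s|lborel. indicator {0..1::real} s * J 0)"
    by (simp add: J_def)
  moreover have iJ0: "integrable lborel (\<lambda>s. indicator {0..1::real} s * J 0)" by simp
  ultimately have "?lhs = \<bar>LINT s|lborel. indicator {0..1} s * (J s - J 0)\<bar>"
    by (simp add: v_def right_diff_distrib)
  also have "\<dots> \<le> (LINT s|lborel. \<bar>indicator {0..1} s * (J s - J 0)\<bar>)" by (rule integral_abs_bound)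
  also have "\<dots> \<le> (LINT s|lborel. indicator {0..1::real} s * (h * ?C))"
  proof (rule integral_mono)
    show "integrable lborel (\<lambda>s. \<bar>indicator {0..1} s * (J s - J 0)\<bar>)"
      using iJ iJ0 by (intro integrable_abs) (simp add: right_diff_distrib)
    show "\<bar>indicator {0..1} s * (J s - J 0)\<bar> \<le> indicator {0..1} s * (h * ?C)" for s :: real
      using J[of s] by (auto simp: indicator_def)
  qed simp
  also have "\<dots> = h * ?C" by simp
  finally show ?thesis .
qed

lemma chain_F_shift_integrable:
  assumes v: "norm v \<le> 1"
  shows "integrable lborel (\<lambda>y. F (u y) * \<psi> (y + v))"
proof (rule Bochner_Integration.integrable_bound)
  show "integrable lborel (\<lambda>x. P * (indicator B x * F (u x)))" using chain_F_abs by auto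
  show "AE x in lborel. norm (F (u x) * \<psi> (x + v)) \<le> norm (P * (indicator B x * F (u x)))"
    using P chain_support'[OF v]
    by (intro AE_I2) (auto simp: indicator_def abs_mult mult.commute[of P] intro!: mult_left_mono)
qed measurable

text \<open>Summation by parts: a change of variables moves the difference from
  \<open>\<psi>\<close> to \<open>F (u x)\<close>. Linearising \<open>F\<close> leaves a remainder
  of size \<open>L\<close> times a squared increment of \<open>u\<close>, of order
  \<open>h^2\<close> in mean, hence of order \<open>h\<close> after division.\<close>

lemma chain_difference_quotient_F:
  assumes h: "0 < h" "h \<le> 1"
  shows "\<bar>(LINT x|lborel. F (u x) * ((\<psi> x - \<psi> (x - h *\<^sub>R axis i 1)) / h)) + (LINT y|lborel. g y $ i * (F' (u y) * \<psi> y))\<bar>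
    \<le> h * (L * P * (LINT x|lborel. indicator B x * (norm (g x))\<^sup>2) + ((LINT x|lborel. indicator B x * (norm (g x))\<^sup>2) +
        (2 * L\<^sup>2 * P\<^sup>2 * (LINT x|lborel. indicator B x * (norm (g x))\<^sup>2) + 2 * M\<^sup>2 * (LINT x|lborel. indicator B x * (F' (u x))\<^sup>2))))"
    (is "\<bar>?A + ?J\<bar> \<le> h * (L * P * ?G + ?C)")
proof -
  let ?w = "\<lambda>x. F' (u x) * \<psi> x"
  define v where "v = h *\<^sub>R (axis i 1 :: real^2)"
  have nv: "norm v = h" "norm v \<le> 1" "norm (-v) \<le> 1" using h by (simp_all add: v_def)
  let ?r = "\<lambda>x. (F (u (x + v)) - F (u x)) * \<psi> x - ?w x * (u (x + v) - u x)"
  let ?s = "\<lambda>x. indicator B x * indicator B (x + v) * (u (x + v) - u x)\<^sup>2"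
  have s: "integrable lborel ?s" "(LINT x|lborel. ?s x) \<le> h\<^sup>2 * ?G"
    using chain_integrable_u_shift[OF nv(2)] nv(1) by simp_all
  have i1: "integrable lborel (\<lambda>x. F (u x) * \<psi> x)" using chain_F_shift_integrable[of 0] by simp
  have i2: "integrable lborel (\<lambda>x. F (u x) * \<psi> (x - v))" using chain_F_shift_integrable[OF nv(3)] by simp
  have i3: "integrable lborel (\<lambda>x. F (u (x + v)) * \<psi> x)" using integrable_lborel_translate[OF i2, of v] by simp
  have i4: "integrable lborel (\<lambda>x. ?w x * (u (x + v) - u x))"
  proof (rule Bochner_Integration.integrable_bound)
    show "integrable lborel (\<lambda>x. (?w x)\<^sup>2 + ?s x)" using chain_w_sq s(1) by (rule Bochner_Integration.integrable_add)
    show "AE x in lborel. norm (?w x * (u (x + v) - u x)) \<le> norm ((?w x)\<^sup>2 + ?s x)"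
    proof (rule AE_I2)
      fix x
      show "norm (?w x * (u (x + v) - u x)) \<le> norm ((?w x)\<^sup>2 + ?s x)"
      proof (cases "x \<in> B \<and> x + v \<in> B")
        case True
        have "2 * (\<bar>?w x\<bar> * \<bar>u (x + v) - u x\<bar>) \<le> (?w x)\<^sup>2 + (u (x + v) - u x)\<^sup>2"
          using sum_squares_bound[of "\<bar>?w x\<bar>" "\<bar>u (x + v) - u x\<bar>"] by simp
        then have "\<bar>?w x\<bar> * \<bar>u (x + v) - u x\<bar> \<le> (?w x)\<^sup>2 + (u (x + v) - u x)\<^sup>2"
          using mult_nonneg_nonneg[OF abs_ge_zero abs_ge_zero, of "?w x" "u (x + v) - u x"] by linarith
        with True show ?thesis by (simp add: abs_mult)
      next
        case False
        then show ?thesis using chain_support[OF nv(2)] by simp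
      qed
    qed
  qed measurable
  have "?A * h = (LINT x|lborel. F (u x) * \<psi> x - F (u x) * \<psi> (x - v))"
  proof -
    have "?A = (LINT x|lborel. (F (u x) * \<psi> x - F (u x) * \<psi> (x - v)) / h)"
      by (simp add: v_def right_diff_distrib)
    also have "\<dots> = (LINT x|lborel. F (u x) * \<psi> x - F (u x) * \<psi> (x - v)) / h" by simp
    finally show ?thesis using h by simp
  qed
  also have "\<dots> = (LINT x|lborel. F (u x) * \<psi> x) - (LINT x|lborel. F (u x) * \<psi> (x - v))"
    using i1 i2 by simp
  also have "(LINT x|lborel. F (u x) * \<psi> (x - v)) = (LINT x|lborel. F (u (x + v)) * \<psi> x)"
    using integral_lborel_translate[where f="\<lambda>x. F (u x) * \<psi> (x - v)" and v=v] by simp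
  also have "(LINT x|lborel. F (u x) * \<psi> x) - \<dots> = - (LINT x|lborel. ?r x) - (LINT x|lborel. ?w x * (u (x + v) - u x))"
    using i1 i3 i4 by (simp add: left_diff_distrib)
  finally have A: "?A * h = - (LINT x|lborel. ?r x) - (LINT x|lborel. ?w x * (u (x + v) - u x))" .
  have ir: "integrable lborel ?r" using i1 i3 i4 by (simp add: left_diff_distrib)
  have "\<bar>LINT x|lborel. ?r x\<bar> \<le> (LINT x|lborel. \<bar>?r x\<bar>)" by (rule integral_abs_bound)
  also have "\<dots> \<le> (LINT x|lborel. L * P * ?s x)"
  proof (rule integral_mono)
    show "integrable lborel (\<lambda>x. \<bar>?r x\<bar>)" using ir by (rule integrable_abs)
    show "integrable lborel (\<lambda>x. L * P * ?s x)" using s(1) by simp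
    fix x
    show "\<bar>?r x\<bar> \<le> L * P * ?s x"
    proof (cases "x \<in> B \<and> x + v \<in> B")
      case True
      have "?r x = (F (u (x + v)) - F (u x) - F' (u x) * (u (x + v) - u x)) * \<psi> x" by (simp add: algebra_simps)
      then have "\<bar>?r x\<bar> \<le> (L * (u (x + v) - u x)\<^sup>2) * P"
        using lipschitz_derivative_remainder[OF F L, of "u (x + v)" "u x"] P chain_L_nonneg
        by (simp add: abs_mult mult_mono)
      with True show ?thesis by (simp add: mult_ac)
    next
      case False
      then have "\<psi> x = 0" using chain_support[OF nv(2)] by blast
      with False show ?thesis by auto
    qed
  qed
  also have "\<dots> = L * P * (LINT x|lborel. ?s x)" by simp
  also have "\<dots> \<le> L * P * (h\<^sup>2 * ?G)" using s(2) chain_L_nonneg P by (intro mult_left_mono) auto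
  finally have r: "\<bar>LINT x|lborel. ?r x\<bar> / h \<le> h * (L * P * ?G)"
    using h by (simp add: field_simps power2_eq_square)
  have "?A + ?J = - ((LINT x|lborel. ?r x) / h) - ((LINT x|lborel. ?w x * (u (x + v) - u x)) / h - ?J)"
    using A h by (simp add: field_simps)
  then have "\<bar>?A + ?J\<bar> \<le> \<bar>LINT x|lborel. ?r x\<bar> / h + \<bar>(LINT x|lborel. ?w x * (u (x + v) - u x)) / h - ?J\<bar>"
    using h abs_triangle_ineq4[of "- ((LINT x|lborel. ?r x) / h)" "(LINT x|lborel. ?w x * (u (x + v) - u x)) / h - ?J"]
    by simp
  also have "\<dots> \<le> h * (L * P * ?G) + h * ?C"
    using r chain_difference_quotient[OF h, of i] by (intro add_mono) (simp_all add: v_def)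
  finally show ?thesis by (simp add: distrib_left)
qed

text \<open>Along \<open>h n = 1 / (n + 1)\<close> the difference quotients of \<open>\<psi>\<close>
  converge boundedly to the partial derivative, while the preceding estimate forces the sum with the
  gradient term to 0.\<close>

lemma chain_rule_aux:
  "(LINT x|lborel. F (u x) * partial_deriv i \<psi> x) = - (LINT x|lborel. F' (u x) * g x $ i * \<psi> x)"
proof -
  define h :: "nat \<Rightarrow> real" where "h n = 1 / real (Suc n)" for n
  have h: "0 < h n" "h n \<le> 1" for n by (simp_all add: h_def)
  have h0: "h \<longlonglongrightarrow> 0" unfolding h_def by (rule LIMSEQ_Suc[OF lim_1_over_n])
  let ?A = "\<lambda>n. LINT x|lborel. F (u x) * ((\<psi> x - \<psi> (x - h n *\<^sub>R axis i 1)) / h n)"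
  let ?J = "LINT y|lborel. g y $ i * (F' (u y) * \<psi> y)"
  have "?A \<longlonglongrightarrow> (LINT x|lborel. F (u x) * partial_deriv i \<psi> x)"
  proof (rule integral_dominated_convergence[where w="\<lambda>x. M * \<bar>indicator B x * F (u x)\<bar>"])
    show "integrable lborel (\<lambda>x. M * \<bar>indicator B x * F (u x)\<bar>)" using integrable_abs[OF chain_F_abs] by simp
    show "AE x in lborel. (\<lambda>n. F (u x) * ((\<psi> x - \<psi> (x - h n *\<^sub>R axis i 1)) / h n)) \<longlonglongrightarrow> F (u x) * partial_deriv i \<psi> x"
    proof (intro AE_I2 tendsto_mult tendsto_const)
      fix x :: "real^2"
      have "((\<lambda>t. x - t *\<^sub>R (axis i 1)) has_derivative (\<lambda>t. - (t *\<^sub>R axis i 1))) (at (0::real))"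
        by (auto intro!: derivative_eq_intros)
      moreover have "(\<psi> has_derivative frechet_derivative \<psi> (at (x - 0 *\<^sub>R axis i 1))) (at (x - 0 *\<^sub>R axis i 1))"
        using d by (simp add: frechet_derivative_works[symmetric])
      ultimately have "((\<lambda>t. \<psi> (x - t *\<^sub>R axis i 1)) has_derivative (\<lambda>t. frechet_derivative \<psi> (at (x - 0 *\<^sub>R axis i 1)) (- (t *\<^sub>R axis i 1)))) (at 0)"
        by (rule has_derivative_compose)
      moreover have "frechet_derivative \<psi> (at x) (- (t *\<^sub>R axis i 1)) = - partial_deriv i \<psi> x * t" for t
      proof -
        have "linear (frechet_derivative \<psi> (at x))" using d by (rule linear_frechet_derivative)
        from linear_cmul[OF this, of "-t" "axis i 1"] show ?thesis by (simp add: partial_deriv_def)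
      qed
      ultimately have "((\<lambda>t. \<psi> (x - t *\<^sub>R axis i 1)) has_real_derivative - partial_deriv i \<psi> x) (at 0)"
        by (auto intro!: has_derivative_imp_has_field_derivative simp: mult.commute)
      then have "((\<lambda>t. (\<psi> (x - t *\<^sub>R axis i 1) - \<psi> x) / t) \<longlongrightarrow> - partial_deriv i \<psi> x) (at 0)"
        by (simp add: has_field_derivative_iff)
      then have "(\<lambda>n. (\<psi> (x - h n *\<^sub>R axis i 1) - \<psi> x) / h n) \<longlonglongrightarrow> - partial_deriv i \<psi> x"
        by (rule filterlim_compose) (use h0 h(1) in \<open>auto simp: filterlim_at intro!: always_eventually less_imp_neq[symmetric]\<close>)
      from tendsto_minus[OF this] show "(\<lambda>n. (\<psi> x - \<psi> (x - h n *\<^sub>R axis i 1)) / h n) \<longlonglongrightarrow> partial_deriv i \<psi> x"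
        by (simp add: minus_divide_left)
    qed
    show "AE x in lborel. norm (F (u x) * ((\<psi> x - \<psi> (x - h n *\<^sub>R axis i 1)) / h n)) \<le> M * \<bar>indicator B x * F (u x)\<bar>" for n
    proof (rule AE_I2)
      fix x
      show "norm (F (u x) * ((\<psi> x - \<psi> (x - h n *\<^sub>R axis i 1)) / h n)) \<le> M * \<bar>indicator B x * F (u x)\<bar>"
      proof (cases "x \<in> B")
        case True
        have "\<bar>\<psi> x - \<psi> (x - h n *\<^sub>R axis i 1)\<bar> / h n \<le> M"
          using M(2)[of x "x - h n *\<^sub>R axis i 1"] h[of n] by (simp add: field_simps)
        then have "\<bar>F (u x)\<bar> * (\<bar>\<psi> x - \<psi> (x - h n *\<^sub>R axis i 1)\<bar> / h n) \<le> \<bar>F (u x)\<bar> * M"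
          by (intro mult_left_mono) auto
        then show ?thesis using True h(1)[of n] by (simp add: abs_mult mult.commute[of M])
      next
        case False
        then show ?thesis using chain_support'[of 0 x] chain_support'[of "- (h n *\<^sub>R axis i 1)" x] h[of n] by simp
      qed
    qed
  qed measurable
  then have "(\<lambda>n. ?A n + ?J) \<longlonglongrightarrow> (LINT x|lborel. F (u x) * partial_deriv i \<psi> x) + ?J"
    by (intro tendsto_intros)
  moreover have "(\<lambda>n. ?A n + ?J) \<longlonglongrightarrow> 0"
    by (rule tendsto_rabs_zero_cancel, rule tendsto_sandwich[OF _ _ tendsto_const tendsto_mult_left_zero[OF h0]])
       (use chain_difference_quotient_F[OF h] in \<open>auto intro!: always_eventually\<close>)
  ultimately have "(LINT x|lborel. F (u x) * partial_deriv i \<psi> x) + ?J = 0" by (rule LIMSEQ_unique)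
  then show ?thesis by (simp add: mult_ac)
qed

end

declare chain_measurable [measurable del] chain_measurable_nth [measurable del]

text \<open>The generality has two uses: an unbounded \<open>F'\<close> admits
  \<open>F t = t^2\<close>, and a merely C^1 cut-off admits test fields built from the density. Both
  meet in the second moment estimate.\<close>

theorem weak_chain_rule:
  assumes wg: "has_weak_gradient u g"
    and u2: "\<And>R. integrable lborel (\<lambda>x. indicator (cball 0 R) x * (u x)\<^sup>2)"
    and g2: "\<And>R. integrable lborel (\<lambda>x. indicator (cball 0 R) x * (norm (g x))\<^sup>2)"
    and F: "\<And>t. (F has_real_derivative F' t) (at t)"
    and L: "\<And>s t. \<bar>F' s - F' t\<bar> \<le> L * \<bar>s - t\<bar>"
    and d: "\<And>x. \<psi> differentiable at x" and c: "\<And>i. continuous_on UNIV (partial_deriv i \<psi>)"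
    and R: "\<And>x. x \<notin> cball 0 R \<Longrightarrow> \<psi> x = 0"
  shows "(LINT x|lborel. F (u x) * partial_deriv i \<psi> x) = - (LINT x|lborel. F' (u x) * g x $ i * \<psi> x)"
proof -
  obtain M where M: "M \<ge> 0" "\<And>x y. \<bar>\<psi> x - \<psi> y\<bar> \<le> M * norm (x - y)" "\<And>i x. \<bar>partial_deriv i \<psi> x\<bar> \<le> M"
    using C1_compact_support_lipschitz[OF d c R] by blast
  have cont: "continuous_on UNIV \<psi>"
    using d by (auto intro!: continuous_at_imp_continuous_on differentiable_imp_continuous_within)
  obtain P where P: "P \<ge> 0" "\<And>x. \<bar>\<psi> x\<bar> \<le> P"
    using continuous_compact_support_bounded[OF cont R] by blast
  show ?thesis
    by (rule chain_rule_aux[OF wg u2 g2 F L d c R refl M P])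
qed

section \<open>Uniqueness, linearity and composition of weak gradients\<close>

lemma borel_measurable_vec_nth [measurable (raw)]:
  fixes g :: "'a \<Rightarrow> real^2"
  assumes "g \<in> borel_measurable M" shows "(\<lambda>x. g x $ i) \<in> borel_measurable M"
  using assms by (rule measurable_compose[where N=borel]) simp

lemma has_weak_gradient_integrable_test:
  assumes "has_weak_gradient u g" "test_function \<phi>"
  shows "integrable lborel (\<lambda>x. u x * partial_deriv i \<phi> x)" "integrable lborel (\<lambda>x. g x $ i * \<phi> x)"
proof -
  have u: "locally_integrable u" and g: "locally_integrable g" using assms by (auto simp: has_weak_gradient_def)
  obtain R where R: "\<And>x. x \<notin> cball 0 R \<Longrightarrow> \<phi> x = 0" using test_function_support[OF assms(2)] by metis
  obtain M where M: "\<And>x y. \<bar>\<phi> x - \<phi> y\<bar> \<le> M * norm (x - y)" "\<And>i x. \<bar>partial_deriv i \<phi> x\<bar> \<le> M"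
    using C1_compact_support_lipschitz[OF test_function_differentiable[OF assms(2)] test_function_continuous_partial[OF assms(2)] R] by metis
  obtain P where P: "\<And>x. \<bar>\<phi> x\<bar> \<le> P"
    using continuous_compact_support_bounded[OF test_function_continuous[OF assms(2)] R] by metis
  show "integrable lborel (\<lambda>x. u x * partial_deriv i \<phi> x)"
    using partial_deriv_outside_support[of R \<phi>] R
    by (intro integrable_locally_integrable_mult[OF u _ M(2)] borel_measurable_continuous_onI test_function_continuous_partial assms) blast
  have "locally_integrable (\<lambda>x. g x $ i)" using locally_integrable_inner[OF g, of "axis i 1"] by (simp add: inner_axis)
  then show "integrable lborel (\<lambda>x. g x $ i * \<phi> x)"
    by (intro integrable_locally_integrable_mult[OF _ _ P R] borel_measurable_continuous_onI test_function_continuous assms)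
qed

lemma has_weak_gradient_unique:
  assumes "has_weak_gradient u g" "has_weak_gradient u h"
  shows "AE x in lborel. g x = h x"
proof -
  have g: "locally_integrable g" and h: "locally_integrable h"
    using assms by (auto simp: has_weak_gradient_def)
  have comp: "AE x in lborel. g x $ i + (-1) *\<^sub>R (h x $ i) = 0" for i
  proof (rule locally_integrable_zero_AE)
    have gi: "locally_integrable (\<lambda>x. g x $ i)" and hi: "locally_integrable (\<lambda>x. h x $ i)"
      using locally_integrable_inner[OF g, of "axis i 1"] locally_integrable_inner[OF h, of "axis i 1"]
      by (simp_all add: inner_axis)
    then show "locally_integrable (\<lambda>x. g x $ i + (-1) *\<^sub>R (h x $ i))"
      by (intro locally_integrable_add locally_integrable_scaleR)
    fix \<phi> assume \<phi>: "test_function \<phi>"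
    have "integrable lborel (\<lambda>x. g x $ i * \<phi> x)" "integrable lborel (\<lambda>x. h x $ i * \<phi> x)"
      using has_weak_gradient_integrable_test(2)[OF _ \<phi>] assms by blast+
    moreover have "(LINT x|lborel. g x $ i * \<phi> x) = (LINT x|lborel. h x $ i * \<phi> x)"
      using assms \<phi> by (auto simp: has_weak_gradient_def)
    ultimately show "(LINT x|lborel. (g x $ i + (-1) *\<^sub>R (h x $ i)) * \<phi> x) = 0"
      by (simp add: left_diff_distrib)
  qed
  have "AE x in lborel. \<forall>i\<in>UNIV. g x $ i + (-1) *\<^sub>R (h x $ i) = 0"
    using comp by (intro AE_finite_allI) auto
  then show ?thesis by eventually_elim (simp add: vec_eq_iff)
qed

lemma has_weak_gradient_add:
  assumes u: "has_weak_gradient u g" and v: "has_weak_gradient v h"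
  shows "has_weak_gradient (\<lambda>x. u x + v x) (\<lambda>x. g x + h x)"
  unfolding has_weak_gradient_def
proof (intro conjI allI impI)
  show "locally_integrable (\<lambda>x. u x + v x)" "locally_integrable (\<lambda>x. g x + h x)"
    using u v by (auto simp: has_weak_gradient_def intro: locally_integrable_add)
  fix \<phi> i assume \<phi>: "test_function \<phi>"
  show "(LINT x|lborel. (u x + v x) * partial_deriv i \<phi> x) = - (LINT x|lborel. (g x + h x) $ i * \<phi> x)"
    using has_weak_gradient_integrable_test[OF u \<phi>, of i] has_weak_gradient_integrable_test[OF v \<phi>, of i] u v \<phi>
    by (simp add: distrib_right has_weak_gradient_def)
qed

lemma has_weak_gradient_scale:
  assumes u: "has_weak_gradient u g"
  shows "has_weak_gradient (\<lambda>x. c * u x) (\<lambda>x. c *\<^sub>R g x)"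
  unfolding has_weak_gradient_def
proof (intro conjI allI impI)
  show "locally_integrable (\<lambda>x. c * u x)" "locally_integrable (\<lambda>x. c *\<^sub>R g x)"
    using u locally_integrable_scaleR[of u c] locally_integrable_scaleR[of g c] by (auto simp: has_weak_gradient_def)
  fix \<phi> i assume \<phi>: "test_function \<phi>"
  show "(LINT x|lborel. c * u x * partial_deriv i \<phi> x) = - (LINT x|lborel. (c *\<^sub>R g x) $ i * \<phi> x)"
    using u \<phi> by (simp add: mult.assoc has_weak_gradient_def)
qed

lemma locally_integrable_cong_AE:
  fixes f f' :: "real^2 \<Rightarrow> 'b::{banach, second_countable_topology}"
  assumes f: "locally_integrable f" and f': "f' \<in> borel_measurable borel" and ae: "AE x in lborel. f x = f' x"
  shows "locally_integrable f'"
  unfolding locally_integrable_def set_integrable_def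
proof (intro allI impI)
  fix S :: "(real^2) set" assume S: "compact S"
  show "integrable lborel (\<lambda>x. indicator S x *\<^sub>R f' x)"
  proof (rule integrable_cong_AE_imp)
    show "integrable lborel (\<lambda>x. indicator S x *\<^sub>R f x)"
      using f S by (simp add: locally_integrable_def set_integrable_def)
    show "(\<lambda>x. indicator S x *\<^sub>R f' x) \<in> borel_measurable lborel"
      using f' S borel_compact[OF S] by (intro borel_measurable_scaleR borel_measurable_indicator) auto
    show "AE x in lborel. indicator S x *\<^sub>R f x = indicator S x *\<^sub>R f' x"
      using ae by eventually_elim simp
  qed
qed

lemma has_weak_gradient_cong_AE:
  assumes u: "has_weak_gradient u g" and m: "u' \<in> borel_measurable borel" "g' \<in> borel_measurable borel"
    and ae: "AE x in lborel. u x = u' x" "AE x in lborel. g x = g' x"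
  shows "has_weak_gradient u' g'"
  unfolding has_weak_gradient_def
proof (intro conjI allI impI)
  show "locally_integrable u'" "locally_integrable g'"
    using u m ae by (auto simp: has_weak_gradient_def intro: locally_integrable_cong_AE)
  fix \<phi> i assume \<phi>: "test_function \<phi>"
  have [measurable]: "u \<in> borel_measurable borel" "g \<in> borel_measurable borel"
    using u by (auto simp: has_weak_gradient_def intro: locally_integrable_measurable)
  note m[measurable]
  have [measurable]: "\<phi> \<in> borel_measurable borel" "partial_deriv i \<phi> \<in> borel_measurable borel"
    by (intro borel_measurable_continuous_onI test_function_continuous test_function_continuous_partial \<phi>)+
  have "(LINT x|lborel. u' x * partial_deriv i \<phi> x) = (LINT x|lborel. u x * partial_deriv i \<phi> x)"
    using ae(1) by (intro integral_cong_AE) auto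
  also have "\<dots> = - (LINT x|lborel. g x $ i * \<phi> x)" using u \<phi> by (simp add: has_weak_gradient_def)
  also have "(LINT x|lborel. g x $ i * \<phi> x) = (LINT x|lborel. g' x $ i * \<phi> x)"
    using ae(2) by (intro integral_cong_AE) auto
  finally show "(LINT x|lborel. u' x * partial_deriv i \<phi> x) = - (LINT x|lborel. g' x $ i * \<phi> x)" .
qed

lemma lipschitz_from_derivative_bound:
  fixes f f' :: "real \<Rightarrow> real"
  assumes "\<And>t. (f has_real_derivative f' t) (at t)" "\<And>t. \<bar>f' t\<bar> \<le> L"
  shows "\<bar>f s - f t\<bar> \<le> L * \<bar>s - t\<bar>"
  using field_differentiable_bound[of UNIV f f' L s t] assms by simp

text \<open>Dominated convergence in the integrated chain rule. The constants \<open>L n\<close> may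
  blow up, so the limit derivative \<open>G'\<close> may be discontinuous; the dominating functions
  come from the uniform bounds on \<open>F n\<close> and \<open>F' n\<close>.\<close>

lemma weak_gradient_composition_limit:
  assumes wg: "has_weak_gradient u g"
    and u2: "\<And>R. integrable lborel (\<lambda>x. indicator (cball 0 R) x * (u x)\<^sup>2)"
    and g2: "\<And>R. integrable lborel (\<lambda>x. indicator (cball 0 R) x * (norm (g x))\<^sup>2)"
    and F: "\<And>n t. (F n has_real_derivative F' n t) (at t)"
    and L: "\<And>n s t. \<bar>F' n s - F' n t\<bar> \<le> L n * \<bar>s - t\<bar>"
    and F1: "\<And>n t. \<bar>F n t\<bar> \<le> \<bar>t\<bar> + 1" and F2: "\<And>n t. \<bar>F' n t\<bar> \<le> 1"
    and G: "\<And>t. (\<lambda>n. F n t) \<longlonglongrightarrow> G t" and G': "\<And>t. (\<lambda>n. F' n t) \<longlonglongrightarrow> G' t"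
  shows "has_weak_gradient (\<lambda>x. G (u x)) (\<lambda>x. G' (u x) *\<^sub>R g x)"
proof -
  have u: "locally_integrable u" and g: "locally_integrable g" using wg by (auto simp: has_weak_gradient_def)
  have [measurable]: "u \<in> borel_measurable borel" "g \<in> borel_measurable borel"
    using u g by (auto intro: locally_integrable_measurable)
  have [measurable]: "F n \<in> borel_measurable borel" for n
    using F by (intro borel_measurable_continuous_onI) (auto intro!: continuous_at_imp_continuous_on DERIV_isCont)
  have [measurable]: "F' n \<in> borel_measurable borel" for n
  proof -
    have "(L n)-lipschitz_on UNIV (F' n)"
      using L[of n] L[of n 0 1] by (intro lipschitz_onI) (auto simp: dist_real_def intro: order_trans[OF abs_ge_zero])
    then show ?thesis by (intro borel_measurable_continuous_onI lipschitz_on_continuous_on)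
  qed
  have [measurable]: "G \<in> borel_measurable borel" "G' \<in> borel_measurable borel"
    by (rule borel_measurable_LIMSEQ_real[OF G], simp) (rule borel_measurable_LIMSEQ_real[OF G'], simp)
  have G1: "\<bar>G t\<bar> \<le> \<bar>t\<bar> + 1" for t
    using tendsto_rabs[OF G[of t]] F1 by (intro LIMSEQ_le_const2) auto
  have G'1: "\<bar>G' t\<bar> \<le> 1" for t
    using tendsto_rabs[OF G'[of t]] F2 by (intro LIMSEQ_le_const2) auto
  have "locally_integrable (\<lambda>x. G (u x))"
    unfolding locally_integrable_def set_integrable_def
  proof (intro allI impI)
    fix S :: "(real^2) set" assume S: "compact S"
    have [measurable]: "S \<in> sets borel" using S by (rule borel_compact)
    have "integrable lborel (\<lambda>x. \<bar>indicator S x *\<^sub>R u x\<bar> + indicator S x)"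
      using u S emeasure_compact_finite[OF S]
      by (intro Bochner_Integration.integrable_add integrable_abs integrable_real_indicator)
         (auto simp: locally_integrable_def set_integrable_def)
    then show "integrable lborel (\<lambda>x. indicator S x *\<^sub>R G (u x))"
      by (rule Bochner_Integration.integrable_bound) (use G1 in \<open>auto intro!: AE_I2 simp: indicator_def\<close>)
  qed
  moreover have "locally_integrable (\<lambda>x. G' (u x) *\<^sub>R g x)"
    unfolding locally_integrable_def set_integrable_def
  proof (intro allI impI)
    fix S :: "(real^2) set" assume S: "compact S"
    have [measurable]: "S \<in> sets borel" using S by (rule borel_compact)
    have "integrable lborel (\<lambda>x. indicator S x *\<^sub>R g x)"
      using g S by (auto simp: locally_integrable_def set_integrable_def)
    then show "integrable lborel (\<lambda>x. indicator S x *\<^sub>R G' (u x) *\<^sub>R g x)"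
      by (rule Bochner_Integration.integrable_bound)
         (use G'1 in \<open>auto intro!: AE_I2 mult_left_le_one_le simp: indicator_def\<close>)
  qed
  moreover have "(LINT x|lborel. G (u x) * partial_deriv i \<phi> x) = - (LINT x|lborel. (G' (u x) *\<^sub>R g x) $ i * \<phi> x)"
    if \<phi>: "test_function \<phi>" for \<phi> i
  proof -
    have [measurable]: "\<phi> \<in> borel_measurable borel" "partial_deriv i \<phi> \<in> borel_measurable borel"
      by (intro borel_measurable_continuous_onI test_function_continuous test_function_continuous_partial \<phi>)+
    obtain R where R: "\<And>x. x \<notin> cball 0 R \<Longrightarrow> \<phi> x = 0" using test_function_support[OF \<phi>] by metis
    have Fn: "(LINT x|lborel. F n (u x) * partial_deriv i \<phi> x) = - (LINT x|lborel. F' n (u x) * g x $ i * \<phi> x)" for n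
      by (rule weak_chain_rule[OF wg u2 g2 F L test_function_differentiable[OF \<phi>] test_function_continuous_partial[OF \<phi>] R])
    have D: "integrable lborel (\<lambda>x. partial_deriv i \<phi> x)"
    proof -
      have "continuous_on UNIV (partial_deriv i \<phi>)" by (rule test_function_continuous_partial[OF \<phi>])
      moreover have "partial_deriv i \<phi> x = 0" if "x \<notin> cball 0 R" for x
        by (rule partial_deriv_outside_support[OF _ that]) (rule R)
      ultimately obtain M where "\<And>x. \<bar>partial_deriv i \<phi> x\<bar> \<le> M" "\<And>x. x \<notin> cball 0 R \<Longrightarrow> partial_deriv i \<phi> x = 0"
        using continuous_compact_support_bounded[of "partial_deriv i \<phi>" R] by metis
      moreover have "locally_integrable (\<lambda>x. 1::real)"
        using emeasure_compact_finite
        by (auto simp: locally_integrable_def set_integrable_def borel_compact intro!: integrable_real_indicator)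
      ultimately have "integrable lborel (\<lambda>x. 1 * partial_deriv i \<phi> x)"
        by (intro integrable_locally_integrable_mult) auto
      then show ?thesis by simp
    qed
    have lim1: "(\<lambda>n. LINT x|lborel. F n (u x) * partial_deriv i \<phi> x) \<longlonglongrightarrow> (LINT x|lborel. G (u x) * partial_deriv i \<phi> x)"
    proof (rule integral_dominated_convergence[where w="\<lambda>x. \<bar>u x * partial_deriv i \<phi> x\<bar> + \<bar>partial_deriv i \<phi> x\<bar>"])
      show "integrable lborel (\<lambda>x. \<bar>u x * partial_deriv i \<phi> x\<bar> + \<bar>partial_deriv i \<phi> x\<bar>)"
        using has_weak_gradient_integrable_test(1)[OF wg \<phi>] D by (intro Bochner_Integration.integrable_add integrable_abs)
      show "AE x in lborel. norm (F n (u x) * partial_deriv i \<phi> x) \<le> \<bar>u x * partial_deriv i \<phi> x\<bar> + \<bar>partial_deriv i \<phi> x\<bar>" for n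
      proof (rule AE_I2)
        fix x
        have "\<bar>F n (u x)\<bar> * \<bar>partial_deriv i \<phi> x\<bar> \<le> (\<bar>u x\<bar> + 1) * \<bar>partial_deriv i \<phi> x\<bar>"
          using F1 by (intro mult_right_mono) auto
        then show "norm (F n (u x) * partial_deriv i \<phi> x) \<le> \<bar>u x * partial_deriv i \<phi> x\<bar> + \<bar>partial_deriv i \<phi> x\<bar>"
          by (simp add: abs_mult distrib_right)
      qed
      show "AE x in lborel. (\<lambda>n. F n (u x) * partial_deriv i \<phi> x) \<longlonglongrightarrow> G (u x) * partial_deriv i \<phi> x"
        by (intro AE_I2 tendsto_intros G)
    qed measurable
    have lim2: "(\<lambda>n. LINT x|lborel. F' n (u x) * g x $ i * \<phi> x) \<longlonglongrightarrow> (LINT x|lborel. G' (u x) * g x $ i * \<phi> x)"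
    proof (rule integral_dominated_convergence[where w="\<lambda>x. \<bar>g x $ i * \<phi> x\<bar>"])
      show "integrable lborel (\<lambda>x. \<bar>g x $ i * \<phi> x\<bar>)"
        using has_weak_gradient_integrable_test(2)[OF wg \<phi>] by (intro integrable_abs)
      show "AE x in lborel. norm (F' n (u x) * g x $ i * \<phi> x) \<le> \<bar>g x $ i * \<phi> x\<bar>" for n
        using F2 by (intro AE_I2) (auto simp: abs_mult mult.assoc intro!: mult_left_le_one_le)
      show "AE x in lborel. (\<lambda>n. F' n (u x) * g x $ i * \<phi> x) \<longlonglongrightarrow> G' (u x) * g x $ i * \<phi> x"
        by (intro AE_I2 tendsto_intros G')
    qed measurable
    from LIMSEQ_unique[OF lim1[unfolded Fn] tendsto_minus[OF lim2]] show ?thesis by simp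
  qed
  ultimately show ?thesis by (auto simp: has_weak_gradient_def)
qed

lemma abs_regularisation_tendsto: "(\<lambda>n. 1 / real (Suc n)) \<longlonglongrightarrow> 0"
  by (rule LIMSEQ_Suc[OF lim_1_over_n])

text \<open>The regularisations \<open>sqrt (t^2 + \<delta>^2)\<close> have derivatives bounded by 1
  that converge to \<open>sgn t\<close>, with value 0 at \<open>t = 0\<close>; their second
  derivatives are at most \<open>1 / \<delta>\<close>.\<close>

theorem has_weak_gradient_abs:
  assumes wg: "has_weak_gradient u g"
    and u2: "\<And>R. integrable lborel (\<lambda>x. indicator (cball 0 R) x * (u x)\<^sup>2)"
    and g2: "\<And>R. integrable lborel (\<lambda>x. indicator (cball 0 R) x * (norm (g x))\<^sup>2)"
  shows "has_weak_gradient (\<lambda>x. \<bar>u x\<bar>) (\<lambda>x. sgn (u x) *\<^sub>R g x)"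
proof -
  define \<delta> :: "nat \<Rightarrow> real" where "\<delta> n = 1 / real (Suc n)" for n
  have \<delta>: "\<delta> n > 0" "\<delta> n \<le> 1" for n by (simp_all add: \<delta>_def)
  have \<delta>0: "\<delta> \<longlonglongrightarrow> 0" unfolding \<delta>_def by (rule abs_regularisation_tendsto)
  define r where "r n t = sqrt (t\<^sup>2 + (\<delta> n)\<^sup>2)" for n t
  have r0: "r n t > 0" for n t unfolding r_def using \<delta>(1)[of n] by (simp add: add_nonneg_pos)
  have rt: "\<bar>t\<bar> \<le> r n t" "\<delta> n \<le> r n t" for n t
    unfolding r_def using \<delta>(1)[of n] by (auto intro!: real_le_rsqrt)
  have r2: "(r n t)\<^sup>2 = t\<^sup>2 + (\<delta> n)\<^sup>2" for n t by (simp add: r_def)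
  have dr: "(r n has_real_derivative t / r n t) (at t)" for n t
    unfolding r_def using r0[of n t]
    by (auto intro!: derivative_eq_intros simp: r_def field_simps)
  have rlim: "(\<lambda>n. r n t) \<longlonglongrightarrow> \<bar>t\<bar>" for t
  proof -
    have "(\<lambda>n. sqrt (t\<^sup>2 + (\<delta> n)\<^sup>2)) \<longlonglongrightarrow> sqrt (t\<^sup>2 + 0\<^sup>2)" by (intro tendsto_intros \<delta>0)
    then show ?thesis by (simp add: r_def)
  qed
  show ?thesis
  proof (rule weak_gradient_composition_limit[OF wg u2 g2, where F=r and F'="\<lambda>n t. t / r n t" and L="\<lambda>n. 1 / \<delta> n"])
    show "(r n has_real_derivative t / r n t) (at t)" for n t by (rule dr)
    show "\<bar>s / r n s - t / r n t\<bar> \<le> 1 / \<delta> n * \<bar>s - t\<bar>" for n s t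
    proof (rule lipschitz_from_derivative_bound[where f="\<lambda>t. t / r n t" and f'="\<lambda>t. (\<delta> n)\<^sup>2 / (r n t) ^ 3"])
      fix t
      have eq: "(1 * r n t - t * (t / r n t)) / (r n t * r n t) = (\<delta> n)\<^sup>2 / (r n t) ^ 3"
        using r0[of n t] r2[of n t] by (simp add: field_simps power2_eq_square power3_eq_cube)
      have "((\<lambda>t. t / r n t) has_real_derivative (1 * r n t - t * (t / r n t)) / (r n t * r n t)) (at t)"
        using r0[of n t] by (intro DERIV_divide DERIV_ident dr) auto
      then show "((\<lambda>t. t / r n t) has_real_derivative (\<delta> n)\<^sup>2 / (r n t) ^ 3) (at t)" unfolding eq .
      have "(\<delta> n) ^ 3 \<le> (r n t) ^ 3" using rt(2)[of n t] \<delta>(1)[of n] by (intro power_mono) auto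
      then show "\<bar>(\<delta> n)\<^sup>2 / (r n t) ^ 3\<bar> \<le> 1 / \<delta> n"
        using r0[of n t] \<delta>(1)[of n] by (simp add: field_simps power2_eq_square power3_eq_cube)
    qed
    show "\<bar>r n t\<bar> \<le> \<bar>t\<bar> + 1" for n t
    proof -
      have "r n t \<le> \<bar>t\<bar> + \<delta> n" unfolding r_def
        using sqrt_sum_squares_le_sum_abs[of t "\<delta> n"] \<delta>(1)[of n] by simp
      with \<delta>(2)[of n] r0[of n t] show ?thesis by simp
    qed
    show "\<bar>t / r n t\<bar> \<le> 1" for n t using rt(1)[of t n] r0[of n t] by simp
    show "(\<lambda>n. r n t) \<longlonglongrightarrow> \<bar>t\<bar>" for t by (rule rlim)
    show "(\<lambda>n. t / r n t) \<longlonglongrightarrow> sgn t" for t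
    proof (cases "t = 0")
      case False
      then have "(\<lambda>n. t / r n t) \<longlonglongrightarrow> t / \<bar>t\<bar>" by (intro tendsto_intros rlim) auto
      with False show ?thesis by (simp add: sgn_if abs_if split: if_splits)
    qed simp
  qed
qed

text \<open>The functions \<open>t - \<delta> * arctan (t / \<delta>)\<close> converge to the
  identity, but their derivatives \<open>t^2 / (t^2 + \<delta>^2)\<close> converge to 0 at
  \<open>t = 0\<close> and to 1 elsewhere. So \<open>u\<close> has two weak gradients,
  \<open>g\<close> and \<open>g\<close> cut off on the zero set, and uniqueness equates
  them.\<close>

theorem weak_gradient_zero_on_level:
  assumes wg: "has_weak_gradient u g"
    and u2: "\<And>R. integrable lborel (\<lambda>x. indicator (cball 0 R) x * (u x)\<^sup>2)"
    and g2: "\<And>R. integrable lborel (\<lambda>x. indicator (cball 0 R) x * (norm (g x))\<^sup>2)"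
  shows "AE x in lborel. u x = 0 \<longrightarrow> g x = 0"
proof -
  define \<delta> :: "nat \<Rightarrow> real" where "\<delta> n = 1 / real (Suc n)" for n
  have \<delta>: "\<delta> n > 0" "\<delta> n \<le> 1" for n by (simp_all add: \<delta>_def)
  have \<delta>0: "\<delta> \<longlonglongrightarrow> 0" unfolding \<delta>_def by (rule abs_regularisation_tendsto)
  have pos: "t\<^sup>2 + (\<delta> n)\<^sup>2 > 0" for n t using \<delta>(1)[of n] by (simp add: add_nonneg_pos)
  have "has_weak_gradient (\<lambda>x. u x) (\<lambda>x. (if u x = 0 then 0 else 1) *\<^sub>R g x)"
  proof (rule weak_gradient_composition_limit[OF wg u2 g2, where F="\<lambda>n t. t - \<delta> n * arctan (t / \<delta> n)"
        and F'="\<lambda>n t. t\<^sup>2 / (t\<^sup>2 + (\<delta> n)\<^sup>2)" and L="\<lambda>n. 1 / \<delta> n" and G="\<lambda>t. t" and G'="\<lambda>t. if t = 0 then 0 else 1"])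
    show "((\<lambda>t. t - \<delta> n * arctan (t / \<delta> n)) has_real_derivative t\<^sup>2 / (t\<^sup>2 + (\<delta> n)\<^sup>2)) (at t)" for n t
    proof -
      have "1 - \<delta> n * (inverse (1 + (t / \<delta> n)\<^sup>2) * (1 / \<delta> n)) = t\<^sup>2 / (t\<^sup>2 + (\<delta> n)\<^sup>2)"
        using \<delta>(1)[of n] pos[of t n] by (simp add: field_simps power2_eq_square)
      then show ?thesis using \<delta>(1)[of n] by (auto intro!: derivative_eq_intros)
    qed
    show "\<bar>s\<^sup>2 / (s\<^sup>2 + (\<delta> n)\<^sup>2) - t\<^sup>2 / (t\<^sup>2 + (\<delta> n)\<^sup>2)\<bar> \<le> 1 / \<delta> n * \<bar>s - t\<bar>" for n s t
    proof (rule lipschitz_from_derivative_bound[where f="\<lambda>t. t\<^sup>2 / (t\<^sup>2 + (\<delta> n)\<^sup>2)" and f'="\<lambda>t. 2 * t * (\<delta> n)\<^sup>2 / (t\<^sup>2 + (\<delta> n)\<^sup>2)\<^sup>2"])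
      fix t
      show "((\<lambda>t. t\<^sup>2 / (t\<^sup>2 + (\<delta> n)\<^sup>2)) has_real_derivative 2 * t * (\<delta> n)\<^sup>2 / (t\<^sup>2 + (\<delta> n)\<^sup>2)\<^sup>2) (at t)"
        using pos[of t n] by (auto intro!: derivative_eq_intros simp: field_simps power2_eq_square)
      have "2 * \<bar>t\<bar> * \<delta> n \<le> t\<^sup>2 + (\<delta> n)\<^sup>2" using sum_squares_bound[of "\<bar>t\<bar>" "\<delta> n"] by simp
      moreover have "(\<delta> n)\<^sup>2 \<le> t\<^sup>2 + (\<delta> n)\<^sup>2" by simp
      ultimately have "(2 * \<bar>t\<bar> * \<delta> n) * (\<delta> n)\<^sup>2 \<le> (t\<^sup>2 + (\<delta> n)\<^sup>2) * (t\<^sup>2 + (\<delta> n)\<^sup>2)"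
        using \<delta>(1)[of n] by (intro mult_mono) auto
      then show "\<bar>2 * t * (\<delta> n)\<^sup>2 / (t\<^sup>2 + (\<delta> n)\<^sup>2)\<^sup>2\<bar> \<le> 1 / \<delta> n"
        using \<delta>(1)[of n] pos[of t n] by (simp add: abs_mult divide_le_eq le_divide_eq) (simp add: field_simps power2_eq_square)
    qed
    show "\<bar>t - \<delta> n * arctan (t / \<delta> n)\<bar> \<le> \<bar>t\<bar> + 1" for n t
    proof -
      have "\<bar>arctan s - arctan 0\<bar> \<le> 1 * \<bar>s - 0\<bar>" for s
        by (rule lipschitz_from_derivative_bound[where f'="\<lambda>t. inverse (1 + t\<^sup>2)"])
           (auto intro!: derivative_eq_intros simp: inverse_le_1_iff abs_of_nonneg)
      then have a: "\<bar>\<delta> n * arctan (t / \<delta> n)\<bar> \<le> \<bar>t\<bar>"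
        using \<delta>(1)[of n] by (simp add: abs_mult field_simps) (metis (no_types, opaque_lifting) abs_divide abs_of_pos pos_le_divide_eq mult.commute)
      have "0 \<le> t \<Longrightarrow> 0 \<le> \<delta> n * arctan (t / \<delta> n)" "t \<le> 0 \<Longrightarrow> \<delta> n * arctan (t / \<delta> n) \<le> 0"
        using \<delta>(1)[of n] by (auto simp: mult_le_0_iff divide_le_0_iff)
      with a show ?thesis by linarith
    qed
    show "\<bar>t\<^sup>2 / (t\<^sup>2 + (\<delta> n)\<^sup>2)\<bar> \<le> 1" for n t using pos[of t n] by simp
    show "(\<lambda>n. t - \<delta> n * arctan (t / \<delta> n)) \<longlonglongrightarrow> t" for t
    proof -
      have "(\<lambda>n. \<delta> n * arctan (t / \<delta> n)) \<longlonglongrightarrow> 0"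
      proof (rule Lim_null_comparison)
        show "\<forall>\<^sub>F n in sequentially. norm (\<delta> n * arctan (t / \<delta> n)) \<le> \<delta> n * (pi / 2)"
        proof (rule always_eventually, rule allI)
          fix n
          have "\<bar>arctan (t / \<delta> n)\<bar> \<le> pi / 2" using arctan_bounded[of "t / \<delta> n"] by auto
          then show "norm (\<delta> n * arctan (t / \<delta> n)) \<le> \<delta> n * (pi / 2)"
            using \<delta>(1)[of n] by (simp add: abs_mult)
        qed
        show "(\<lambda>n. \<delta> n * (pi / 2)) \<longlonglongrightarrow> 0" using tendsto_mult_left_zero[OF \<delta>0] .
      qed
      from tendsto_diff[OF tendsto_const[of t] this] show ?thesis by simp
    qed
    show "(\<lambda>n. t\<^sup>2 / (t\<^sup>2 + (\<delta> n)\<^sup>2)) \<longlonglongrightarrow> (if t = 0 then 0 else 1)" for t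
    proof (cases "t = 0")
      case False
      then have "(\<lambda>n. t\<^sup>2 / (t\<^sup>2 + (\<delta> n)\<^sup>2)) \<longlonglongrightarrow> t\<^sup>2 / (t\<^sup>2 + 0\<^sup>2)" by (intro tendsto_intros \<delta>0) auto
      with False show ?thesis by simp
    qed simp
  qed
  from has_weak_gradient_unique[OF wg this] show ?thesis by eventually_elim auto
qed

subsection \<open>Square-integrable functions\<close>

text \<open>Values in a Euclidean space let functions and gradient fields share one set of lemmas.
  The companion \<open>sq_norm\<close> is the square of the norm, so factors 2 stand in for the
  triangle inequality.\<close>

definition sq_integrable :: "'a measure \<Rightarrow> ('a \<Rightarrow> 'b::euclidean_space) \<Rightarrow> bool" where
  "sq_integrable M f \<longleftrightarrow> f \<in> borel_measurable M \<and> integrable M (\<lambda>x. (norm (f x))\<^sup>2)"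

definition sq_norm :: "'a measure \<Rightarrow> ('a \<Rightarrow> 'b::euclidean_space) \<Rightarrow> real" where
  "sq_norm M f = (LINT x|M. (norm (f x))\<^sup>2)"

lemma sq_norm_nonneg [simp]: "0 \<le> sq_norm M f"
  by (simp add: sq_norm_def)

lemma norm_add_sq_le: "(norm (a + b))\<^sup>2 \<le> 2 * (norm a)\<^sup>2 + 2 * (norm (b::'b::real_normed_vector))\<^sup>2"
proof -
  have "(norm (a + b))\<^sup>2 \<le> (norm a + norm b)\<^sup>2" by (intro power_mono norm_triangle_ineq) simp
  also have "\<dots> \<le> 2 * (norm a)\<^sup>2 + 2 * (norm b)\<^sup>2"
    using sum_squares_bound[of "norm a" "norm b"] by (simp add: power2_sum)
  finally show ?thesis .
qed

lemma sq_integrable_measurable [measurable_dest]: "sq_integrable M f \<Longrightarrow> f \<in> borel_measurable M"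
  by (simp add: sq_integrable_def)

lemma sq_integrableD: "sq_integrable M f \<Longrightarrow> integrable M (\<lambda>x. (norm (f x))\<^sup>2)"
  by (simp add: sq_integrable_def)

lemma sq_integrable_bound:
  assumes "integrable M h" "f \<in> borel_measurable M" "AE x in M. (norm (f x))\<^sup>2 \<le> h x"
  shows "sq_integrable M f"
proof -
  have "integrable M (\<lambda>x. (norm (f x))\<^sup>2)"
    by (rule Bochner_Integration.integrable_bound[OF assms(1)])
       (use assms(2,3) in \<open>auto elim!: eventually_mono intro: order_trans[OF _ abs_ge_self]\<close>)
  with assms show ?thesis by (simp add: sq_integrable_def)
qed

lemma sq_integrable_add:
  assumes "sq_integrable M f" "sq_integrable M g" shows "sq_integrable M (\<lambda>x. f x + g x)"
proof (rule sq_integrable_bound)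
  show "integrable M (\<lambda>x. 2 * (norm (f x))\<^sup>2 + 2 * (norm (g x))\<^sup>2)" using assms[THEN sq_integrableD] by auto
qed (use assms in \<open>auto intro!: AE_I2 norm_add_sq_le dest: sq_integrable_measurable\<close>)

lemma sq_norm_add_le:
  assumes "sq_integrable M f" "sq_integrable M g"
  shows "sq_norm M (\<lambda>x. f x + g x) \<le> 2 * sq_norm M f + 2 * sq_norm M g"
proof -
  have "sq_norm M (\<lambda>x. f x + g x) \<le> (LINT x|M. 2 * (norm (f x))\<^sup>2 + 2 * (norm (g x))\<^sup>2)"
    unfolding sq_norm_def using assms sq_integrable_add[OF assms]
    by (intro integral_mono) (auto dest!: sq_integrableD intro: norm_add_sq_le)
  also have "\<dots> = 2 * sq_norm M f + 2 * sq_norm M g"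
    using assms by (auto dest!: sq_integrableD simp: sq_norm_def)
  finally show ?thesis .
qed

lemma sq_integrable_scaleR: "sq_integrable M f \<Longrightarrow> sq_integrable M (\<lambda>x. c *\<^sub>R f x)"
  by (auto simp: sq_integrable_def power_mult_distrib)

lemma sq_norm_scaleR: "sq_norm M (\<lambda>x. c *\<^sub>R f x) = c\<^sup>2 * sq_norm M f"
  by (simp add: sq_norm_def power_mult_distrib)

lemma sq_integrable_diff:
  assumes "sq_integrable M f" "sq_integrable M g" shows "sq_integrable M (\<lambda>x. f x - g x)"
  using sq_integrable_add[OF assms(1) sq_integrable_scaleR[OF assms(2), of "-1"]] by simp

lemma sq_integrable_sum:
  "(\<And>i. i \<in> I \<Longrightarrow> sq_integrable M (f i)) \<Longrightarrow> sq_integrable M (\<lambda>x. \<Sum>i\<in>I. f i x)"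
  by (induction I rule: infinite_finite_induct)
     (auto intro!: sq_integrable_add, auto simp: sq_integrable_def)

lemma sq_integrable_inner:
  assumes "sq_integrable M f" "sq_integrable M g" shows "integrable M (\<lambda>x. f x \<bullet> g x)"
proof (rule Bochner_Integration.integrable_bound)
  show "integrable M (\<lambda>x. (norm (f x))\<^sup>2 + (norm (g x))\<^sup>2)" using assms[THEN sq_integrableD] by auto
  have "\<bar>f x \<bullet> g x\<bar> \<le> (norm (f x))\<^sup>2 + (norm (g x))\<^sup>2" for x
  proof -
    have "2 * \<bar>f x \<bullet> g x\<bar> \<le> 2 * (norm (f x) * norm (g x))" using Cauchy_Schwarz_ineq2[of "f x" "g x"] by simp
    also have "\<dots> \<le> (norm (f x))\<^sup>2 + (norm (g x))\<^sup>2" using sum_squares_bound[of "norm (f x)" "norm (g x)"] by simp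
    finally show ?thesis using abs_ge_zero[of "f x \<bullet> g x"] by linarith
  qed
  then show "AE x in M. norm (f x \<bullet> g x) \<le> norm ((norm (f x))\<^sup>2 + (norm (g x))\<^sup>2)" by simp
qed (use assms in \<open>auto dest: sq_integrable_measurable\<close>)

lemma sq_norm_cong_AE:
  assumes "AE x in M. f x = g x" "f \<in> borel_measurable M" "g \<in> borel_measurable M"
  shows "sq_norm M f = sq_norm M g"
  unfolding sq_norm_def using assms by (intro integral_cong_AE) auto

lemma sq_norm_nn_integral:
  "sq_integrable M f \<Longrightarrow> (\<integral>\<^sup>+x. ennreal ((norm (f x))\<^sup>2) \<partial>M) = ennreal (sq_norm M f)"
  unfolding sq_norm_def sq_integrable_def by (intro nn_integral_eq_integral) auto

lemma sq_norm_le_nn: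
  assumes "f \<in> borel_measurable M" "(\<integral>\<^sup>+x. ennreal ((norm (f x))\<^sup>2) \<partial>M) \<le> ennreal C" "C \<ge> 0"
  shows "sq_integrable M f" "sq_norm M f \<le> C"
proof -
  show s: "sq_integrable M f"
    unfolding sq_integrable_def using assms by (auto intro!: integrableI_nonneg intro: order.strict_trans1)
  show "sq_norm M f \<le> C" using assms sq_norm_nn_integral[OF s] by simp
qed

lemma sq_norm_tendsto_AE_subseq:
  assumes "\<And>n. sq_integrable M (f n)" "sq_integrable M h" "(\<lambda>n. sq_norm M (\<lambda>x. f n x - h x)) \<longlonglongrightarrow> 0"
  obtains r where "strict_mono (r::nat\<Rightarrow>nat)" "AE x in M. (\<lambda>n. f (r n) x) \<longlonglongrightarrow> h x"
proof -
  have "\<exists>r::nat\<Rightarrow>nat. strict_mono r \<and> (AE x in M. (\<lambda>n. (norm (f (r n) x - h x))\<^sup>2) \<longlonglongrightarrow> 0)"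
  proof (rule tendsto_L1_AE_subseq[where u="\<lambda>n x. (norm (f n x - h x))\<^sup>2"])
    show "integrable M (\<lambda>x. (norm (f n x - h x))\<^sup>2)" for n
      using sq_integrable_diff[OF assms(1,2)] by (rule sq_integrableD)
    show "(\<lambda>n. LINT x|M. norm ((norm (f n x - h x))\<^sup>2)) \<longlonglongrightarrow> 0" using assms(3) by (simp add: sq_norm_def)
  qed
  then obtain r where r: "strict_mono (r::nat\<Rightarrow>nat)" "AE x in M. (\<lambda>n. (norm (f (r n) x - h x))\<^sup>2) \<longlonglongrightarrow> 0" by blast
  from r(2) have "AE x in M. (\<lambda>n. f (r n) x) \<longlonglongrightarrow> h x"
  proof eventually_elim
    case (elim x)
    from tendsto_real_sqrt[OF elim] have "(\<lambda>n. norm (f (r n) x - h x)) \<longlonglongrightarrow> 0" by simp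
    from LIM_zero_cancel[OF tendsto_norm_zero_cancel[OF this]] show ?case .
  qed
  with r(1) show thesis by (rule that)
qed

lemma sq_norm_Fatou:
  assumes f: "\<And>n. sq_integrable M (f n)" and h: "h \<in> borel_measurable M"
    and ae: "AE x in M. (\<lambda>n. f n x) \<longlonglongrightarrow> h x" and C: "\<And>n. n \<ge> N \<Longrightarrow> sq_norm M (f n) \<le> C"
  shows "sq_integrable M h" "sq_norm M h \<le> C"
proof -
  have "C \<ge> 0" using C[of N] sq_norm_nonneg[of M "f N"] by linarith
  have "(\<integral>\<^sup>+x. ennreal ((norm (h x))\<^sup>2) \<partial>M) \<le> (\<integral>\<^sup>+x. liminf (\<lambda>n. ennreal ((norm (f n x))\<^sup>2)) \<partial>M)"
  proof (rule nn_integral_mono_AE)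
    show "AE x in M. ennreal ((norm (h x))\<^sup>2) \<le> liminf (\<lambda>n. ennreal ((norm (f n x))\<^sup>2))"
      using ae
    proof eventually_elim
      case (elim x)
      have "(\<lambda>n. ennreal ((norm (f n x))\<^sup>2)) \<longlonglongrightarrow> ennreal ((norm (h x))\<^sup>2)"
        using elim by (intro tendsto_ennrealI tendsto_intros)
      from lim_imp_Liminf[OF _ this] show ?case by simp
    qed
  qed
  also have "\<dots> \<le> liminf (\<lambda>n. \<integral>\<^sup>+x. ennreal ((norm (f n x))\<^sup>2) \<partial>M)"
    using f by (intro nn_integral_liminf) (auto dest: sq_integrable_measurable)
  also have "\<dots> \<le> ennreal C"
  proof -
    have "\<forall>\<^sub>F n in sequentially. (\<integral>\<^sup>+x. ennreal ((norm (f n x))\<^sup>2) \<partial>M) \<le> ennreal C"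
      by (rule eventually_sequentiallyI[of N]) (use C in \<open>simp add: sq_norm_nn_integral[OF f] ennreal_leI\<close>)
    then have "liminf (\<lambda>n. \<integral>\<^sup>+x. ennreal ((norm (f n x))\<^sup>2) \<partial>M) \<le> liminf (\<lambda>n. ennreal C)"
      by (rule Liminf_mono)
    then show ?thesis by (simp add: Liminf_const)
  qed
  finally show "sq_integrable M h" "sq_norm M h \<le> C" using sq_norm_le_nn[OF h _ \<open>C \<ge> 0\<close>] by blast+
qed

lemma ennreal_le_suminf: "a n \<le> suminf (a :: nat \<Rightarrow> ennreal)"
  using sum_le_suminf[of a "{n}"] by simp

text \<open>Riesz-Fischer: a subsequence with fast decaying increments converges almost everywhere,
  and Fatou's lemma carries the Cauchy estimate of the whole sequence to the limit.\<close>

theorem sq_integrable_complete: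
  fixes f :: "nat \<Rightarrow> 'a \<Rightarrow> 'b::euclidean_space"
  assumes f: "\<And>n. sq_integrable M (f n)"
    and cauchy: "\<And>\<epsilon>. \<epsilon> > 0 \<Longrightarrow> \<exists>N. \<forall>i\<ge>N. \<forall>j\<ge>N. sq_norm M (\<lambda>x. f i x - f j x) < \<epsilon>"
  obtains h where "sq_integrable M h" "(\<lambda>n. sq_norm M (\<lambda>x. f n x - h x)) \<longlonglongrightarrow> 0"
proof -
  have [measurable]: "f n \<in> borel_measurable M" for n using f by (rule sq_integrable_measurable)
  \<comment> \<open>The rate \<open>8^(-n)\<close> leaves room for a weight \<open>4^n\<close>: the
    weighted squares still sum to a geometric series of ratio 1/2, and where the weighted sum is
    finite the increments are at most a multiple of \<open>2^(-n)\<close>.\<close>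
  obtain N where N: "\<And>n i j. i \<ge> N n \<Longrightarrow> j \<ge> N n \<Longrightarrow> sq_norm M (\<lambda>x. f i x - f j x) < (1 / 8) ^ n"
    using cauchy[of "(1 / 8) ^ n" for n] by (metis zero_less_power zero_less_divide_1_iff zero_less_numeral)
  have "\<exists>r. \<forall>n. r n \<ge> N n \<and> r (Suc n) > r n"
  proof (rule dependent_nat_choice)
    show "\<exists>x. x \<ge> N 0" by blast
    show "\<exists>y. y \<ge> N (Suc n) \<and> y > x" for x n by (intro exI[of _ "max (N (Suc n)) (Suc x)"]) auto
  qed
  then obtain r where r: "\<And>n. r n \<ge> N n" "\<And>n. r (Suc n) > r n" by blast
  then have sm: "strict_mono r" by (simp add: strict_mono_Suc_iff)
  define d where "d n x = f (r (Suc n)) x - f (r n) x" for n x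
  have d: "sq_integrable M (d n)" "sq_norm M (d n) \<le> (1 / 8) ^ n" for n
  proof -
    show "sq_integrable M (d n)" unfolding d_def by (intro sq_integrable_diff f)
    have "r (Suc n) \<ge> N n" using r[of n] by simp
    then show "sq_norm M (d n) \<le> (1 / 8) ^ n" unfolding d_def using N[of n "r (Suc n)" "r n"] r(1)[of n] by simp
  qed
  have [measurable]: "d n \<in> borel_measurable M" for n using d(1) by (rule sq_integrable_measurable)
  have "(\<integral>\<^sup>+x. (\<Sum>n. ennreal (4 ^ n * (norm (d n x))\<^sup>2)) \<partial>M) = (\<Sum>n. \<integral>\<^sup>+x. ennreal (4 ^ n * (norm (d n x))\<^sup>2) \<partial>M)"
    by (rule nn_integral_suminf) measurable
  also have "\<dots> \<le> (\<Sum>n. ennreal ((1 / 2) ^ n))"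
  proof (rule suminf_le)
    fix n
    have "(\<integral>\<^sup>+x. ennreal (4 ^ n * (norm (d n x))\<^sup>2) \<partial>M) = ennreal (4 ^ n) * ennreal (sq_norm M (d n))"
      by (simp add: ennreal_mult nn_integral_cmult sq_norm_nn_integral[OF d(1)])
    also have "\<dots> \<le> ennreal (4 ^ n * (1 / 8) ^ n)"
      using d(2)[of n] by (subst ennreal_mult[symmetric]) (auto intro!: ennreal_leI)
    also have "4 ^ n * (1 / 8) ^ n = (1 / 2 :: real) ^ n" by (simp flip: power_mult_distrib)
    finally show "(\<integral>\<^sup>+x. ennreal (4 ^ n * (norm (d n x))\<^sup>2) \<partial>M) \<le> ennreal ((1 / 2) ^ n)" .
  qed auto
  also have "\<dots> = ennreal (\<Sum>n. (1 / 2) ^ n)" by (rule suminf_ennreal2) (auto intro: summable_geometric)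
  also have "\<dots> < \<infinity>" by simp
  finally have "(\<integral>\<^sup>+x. (\<Sum>n. ennreal (4 ^ n * (norm (d n x))\<^sup>2)) \<partial>M) \<noteq> \<infinity>" by simp
  then have "AE x in M. (\<Sum>n. ennreal (4 ^ n * (norm (d n x))\<^sup>2)) \<noteq> \<infinity>"
    by (intro nn_integral_PInf_AE) measurable
  then have conv: "AE x in M. convergent (\<lambda>n. f (r n) x)"
  proof eventually_elim
    case (elim x)
    define C where "C = enn2real (\<Sum>n. ennreal (4 ^ n * (norm (d n x))\<^sup>2))"
    have C: "C \<ge> 0" "(\<Sum>n. ennreal (4 ^ n * (norm (d n x))\<^sup>2)) = ennreal C"
    proof -
      show "C \<ge> 0" by (simp only: C_def enn2real_nonneg)
      have "(\<Sum>n. ennreal (4 ^ n * (norm (d n x))\<^sup>2)) < top"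
        using elim by (simp only: infinity_ennreal_def less_top)
      then show "(\<Sum>n. ennreal (4 ^ n * (norm (d n x))\<^sup>2)) = ennreal C"
        unfolding C_def by (rule ennreal_enn2real[symmetric])
    qed
    have "norm (d n x) \<le> sqrt C * (1 / 2) ^ n" for n
    proof -
      have "ennreal (4 ^ n * (norm (d n x))\<^sup>2) \<le> ennreal C"
        unfolding C(2)[symmetric] by (rule ennreal_le_suminf)
      then have "4 ^ n * (norm (d n x))\<^sup>2 \<le> C" using C(1) by (simp add: ennreal_le_iff)
      moreover have "(2 ^ n * norm (d n x))\<^sup>2 = (2 ^ n * 2 ^ n) * (norm (d n x))\<^sup>2" by (simp add: power2_eq_square)
      moreover have "(2::real) ^ n * 2 ^ n = 4 ^ n" by (simp flip: power_mult_distrib)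
      ultimately have "(2 ^ n * norm (d n x))\<^sup>2 \<le> C" by simp
      then have "2 ^ n * norm (d n x) \<le> sqrt C" by (rule real_le_rsqrt)
      then show ?thesis by (simp add: field_simps)
    qed
    note bound = this
    have "summable (\<lambda>n. d n x)"
    proof (rule summable_comparison_test'[where N=0])
      show "summable (\<lambda>n. sqrt C * (1 / 2) ^ n)" by (intro summable_mult summable_geometric) simp
      show "norm (d n x) \<le> sqrt C * (1 / 2) ^ n" for n by (rule bound)
    qed
    then have "(\<lambda>n. f (r 0) x + (\<Sum>k<n. d k x)) \<longlonglongrightarrow> f (r 0) x + (\<Sum>k. d k x)"
      by (intro tendsto_intros summable_LIMSEQ)
    moreover have "f (r 0) x + (\<Sum>k<n. d k x) = f (r n) x" for n
      unfolding d_def by (subst sum_lessThan_telescope[where f="\<lambda>n. f (r n) x"]) simp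
    ultimately show ?case by (auto simp: convergent_def)
  qed
  define h where "h x = lim (\<lambda>n. f (r n) x)" for x
  have hm: "h \<in> borel_measurable M" unfolding h_def by measurable
  have ae: "AE x in M. (\<lambda>n. f (r n) x) \<longlonglongrightarrow> h x"
    using conv by eventually_elim (simp add: h_def convergent_LIMSEQ_iff)
  have close: "sq_integrable M (\<lambda>x. f i x - h x) \<and> sq_norm M (\<lambda>x. f i x - h x) \<le> (1 / 8) ^ n" if "i \<ge> N n" for i n
  proof -
    have 1: "sq_integrable M (\<lambda>x. f i x - f (r j) x)" for j by (intro sq_integrable_diff f)
    have 2: "(\<lambda>x. f i x - h x) \<in> borel_measurable M" using hm by measurable
    have 3: "AE x in M. (\<lambda>j. f i x - f (r j) x) \<longlonglongrightarrow> f i x - h x"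
      using ae by eventually_elim (intro tendsto_intros)
    have 4: "sq_norm M (\<lambda>x. f i x - f (r j) x) \<le> (1 / 8) ^ n" if "j \<ge> n" for j
    proof -
      have "r j \<ge> N n" using r(1)[of n] strict_mono_less_eq[OF sm, of n j] that by simp
      then show ?thesis using N[OF \<open>i \<ge> N n\<close>, of "r j"] by simp
    qed
    show ?thesis using sq_norm_Fatou[OF 1 2 3 4] by blast
  qed
  show thesis
  proof
    have "sq_integrable M (\<lambda>x. f (N 0) x - (f (N 0) x - h x))"
      by (rule sq_integrable_diff[OF f close[OF order_refl, THEN conjunct1]])
    then show "sq_integrable M h" by simp
    show "(\<lambda>n. sq_norm M (\<lambda>x. f n x - h x)) \<longlonglongrightarrow> 0"
    proof (rule LIMSEQ_I)
      fix \<epsilon> :: real assume "0 < \<epsilon>"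
      then obtain n where n: "(1 / 8 :: real) ^ n < \<epsilon>" using real_arch_pow_inv[of \<epsilon> "1/8"] by auto
      show "\<exists>no. \<forall>i\<ge>no. norm (sq_norm M (\<lambda>x. f i x - h x) - 0) < \<epsilon>"
        using close[of n] n by (intro exI[of _ "N n"]) (auto intro: le_less_trans)
    qed
  qed
qed

subsection \<open>Sobolev functions for a measure with positive continuous density\<close>

text \<open>A positive continuous density gives \<open>m\<close> and Lebesgue measure the same null
  sets and comparable norms on balls. This links weak gradients, defined by Lebesgue integrals, to
  norms taken in \<open>m\<close>.\<close>

locale weighted_plane = prob_space m for m :: "(real^2) measure" +
  fixes \<rho> :: "real^2 \<Rightarrow> real"
  assumes m_eq: "m = density lborel (\<lambda>x. ennreal (\<rho> x))"
    and \<rho>_pos: "\<And>x. 0 < \<rho> x" and \<rho>_cont: "continuous_on UNIV \<rho>"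
begin

lemma sets_m [simp, measurable_cong]: "sets m = sets borel" by (simp add: m_eq)

lemma space_m [simp]: "space m = UNIV" by (simp add: m_eq)

lemma \<rho>_measurable [measurable]: "\<rho> \<in> borel_measurable borel"
  using \<rho>_cont by (rule borel_measurable_continuous_onI)

lemma AE_m_iff: "(AE x in m. P x) \<longleftrightarrow> (AE x in lborel. P x)"
  unfolding m_eq by (subst AE_density) (auto simp: \<rho>_pos)

lemma integral_m: "f \<in> borel_measurable borel \<Longrightarrow> (LINT x|m. f x) = (LINT x|lborel. \<rho> x * (f x :: real))"
  unfolding m_eq by (subst integral_density) (auto simp: \<rho>_pos less_imp_le)

lemma integrable_m: "f \<in> borel_measurable borel \<Longrightarrow> integrable m f \<longleftrightarrow> integrable lborel (\<lambda>x. \<rho> x * (f x :: real))"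
  unfolding m_eq by (subst integrable_density) (auto simp: \<rho>_pos less_imp_le)

lemma density_bounds:
  obtains c C where "0 < c" "\<And>x. x \<in> cball 0 R \<Longrightarrow> c \<le> \<rho> x" "0 < C" "\<And>x. x \<in> cball 0 R \<Longrightarrow> \<rho> x \<le> C"
proof (cases "R \<ge> 0")
  case True
  have ne: "cball (0::real^2) R \<noteq> {}" using True by simp
  have c: "continuous_on (cball 0 R) \<rho>" using \<rho>_cont continuous_on_subset by blast
  obtain a where a: "\<And>y. y \<in> cball 0 R \<Longrightarrow> \<rho> a \<le> \<rho> y"
    using continuous_attains_inf[OF compact_cball ne c] by blast
  obtain b where b: "\<And>y. y \<in> cball 0 R \<Longrightarrow> \<rho> y \<le> \<rho> b"
    using continuous_attains_sup[OF compact_cball ne c] by blast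
  show ?thesis by (rule that[OF \<rho>_pos a \<rho>_pos b])
next
  case False
  then show ?thesis by (intro that[of 1 1]) auto
qed

lemma sq_integrable_local:
  fixes f :: "real^2 \<Rightarrow> 'b::euclidean_space"
  assumes f: "sq_integrable m f" and c: "0 < c" "\<And>x. x \<in> S \<Longrightarrow> c \<le> \<rho> x" and [measurable]: "S \<in> sets borel"
  shows "integrable lborel (\<lambda>x. indicator S x * (norm (f x))\<^sup>2)"
    and "(LINT x|lborel. indicator S x * (norm (f x))\<^sup>2) \<le> sq_norm m f / c"
proof -
  have [measurable]: "f \<in> borel_measurable borel" using f by (auto dest: sq_integrable_measurable)
  have i: "integrable lborel (\<lambda>x. \<rho> x * (norm (f x))\<^sup>2 / c)"
    using sq_integrableD[OF f] by (simp add: integrable_m)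
  have le: "indicator S x * (norm (f x))\<^sup>2 \<le> \<rho> x * (norm (f x))\<^sup>2 / c" for x
  proof (cases "x \<in> S")
    case True
    have "c * (norm (f x))\<^sup>2 \<le> \<rho> x * (norm (f x))\<^sup>2" using c(2)[OF True] by (intro mult_right_mono) auto
    with True c(1) show ?thesis by (simp add: field_simps)
  qed (use c(1) \<rho>_pos[of x] in \<open>simp add: less_imp_le\<close>)
  show j: "integrable lborel (\<lambda>x. indicator S x * (norm (f x))\<^sup>2)"
    by (rule Bochner_Integration.integrable_bound[OF i])
       (use le c(1) \<rho>_pos in \<open>auto intro!: AE_I2 simp: abs_mult abs_of_pos\<close>)
  have "(LINT x|lborel. indicator S x * (norm (f x))\<^sup>2) \<le> (LINT x|lborel. \<rho> x * (norm (f x))\<^sup>2 / c)"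
    by (rule integral_mono[OF j i le])
  also have "\<dots> = sq_norm m f / c" by (simp add: sq_norm_def integral_m)
  finally show "(LINT x|lborel. indicator S x * (norm (f x))\<^sup>2) \<le> sq_norm m f / c" .
qed

lemma sq_integrable_cball:
  fixes f :: "real^2 \<Rightarrow> 'b::euclidean_space"
  assumes "sq_integrable m f" shows "integrable lborel (\<lambda>x. indicator (cball 0 R) x * (norm (f x))\<^sup>2)"
proof -
  obtain c C where "0 < c" "\<And>x. x \<in> cball 0 R \<Longrightarrow> c \<le> \<rho> x" "0 < C" "\<And>x. x \<in> cball 0 R \<Longrightarrow> \<rho> x \<le> C"
    using density_bounds[of R] by metis
  then show ?thesis using assms by (intro sq_integrable_local(1)) auto
qed

lemma sq_integrable_locally_integrable:
  fixes f :: "real^2 \<Rightarrow> 'b::euclidean_space"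
  assumes f: "sq_integrable m f" shows "locally_integrable f"
  unfolding locally_integrable_def set_integrable_def
proof (intro allI impI)
  fix S :: "(real^2) set" assume S: "compact S"
  then have [measurable]: "S \<in> sets borel" by (rule borel_compact)
  have [measurable]: "f \<in> borel_measurable borel" using f by (auto dest: sq_integrable_measurable)
  obtain R where R: "S \<subseteq> cball 0 R"
    using compact_imp_bounded[OF S] bounded_subset_ballD ball_subset_cball by (metis order_trans)
  have "integrable lborel (\<lambda>x. indicator (cball 0 R) x * (norm (f x))\<^sup>2 + indicator S x)"
    using sq_integrable_cball[OF f] emeasure_compact_finite[OF S]
    by (intro Bochner_Integration.integrable_add integrable_real_indicator) auto
  then show "integrable lborel (\<lambda>x. indicator S x *\<^sub>R f x)"
  proof (rule Bochner_Integration.integrable_bound)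
    have "norm (f x) \<le> (norm (f x))\<^sup>2 + 1" for x
    proof -
      have "2 * norm (f x) \<le> (norm (f x))\<^sup>2 + 1"
        using zero_le_power2[of "norm (f x) - 1"] by (simp add: power2_eq_square algebra_simps)
      then show ?thesis using norm_ge_zero[of "f x"] by linarith
    qed
    then show "AE x in lborel. norm (indicator S x *\<^sub>R f x) \<le> norm (indicator (cball 0 R) x * (norm (f x))\<^sup>2 + indicator S x)"
      using R by (intro AE_I2) (auto simp: indicator_def)
  qed measurable
qed

text \<open>Pairs of a Sobolev function and a version of its weak gradient, independent of the choice made
  by \<^const>\<open>weak_gradient\<close>.\<close>

definition sobolev :: "(real^2 \<Rightarrow> real) \<Rightarrow> (real^2 \<Rightarrow> real^2) \<Rightarrow> bool" where
  "sobolev u g \<longleftrightarrow> has_weak_gradient u g \<and> sq_integrable m u \<and> sq_integrable m g"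

lemma sobolevD:
  assumes "sobolev u g"
  shows "has_weak_gradient u g" "sq_integrable m u" "sq_integrable m g"
  using assms by (auto simp: sobolev_def)

lemma sobolev_measurable:
  assumes "sobolev u g" shows "u \<in> borel_measurable borel" "g \<in> borel_measurable borel"
  using assms by (auto simp: sobolev_def dest!: sq_integrable_measurable)

lemma sobolev_local:
  assumes "sobolev u g"
  shows "integrable lborel (\<lambda>x. indicator (cball 0 R) x * (u x)\<^sup>2)"
    "integrable lborel (\<lambda>x. indicator (cball 0 R) x * (norm (g x))\<^sup>2)"
  using sq_integrable_cball[OF sobolevD(2)[OF assms], of R] sq_integrable_cball[OF sobolevD(3)[OF assms], of R]
  by simp_all

lemma sobolev_gradient_AE:
  assumes "sobolev u g" "sobolev u h" shows "AE x in m. g x = h x"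
  using has_weak_gradient_unique[OF sobolevD(1)[OF assms(1)] sobolevD(1)[OF assms(2)]] by (simp add: AE_m_iff)

text \<open>The choice operator in \<open>weak_gradient\<close> fixes a version only up to null
  sets; this allows any convenient version \<open>g\<close> to stand for it in integrals.\<close>

lemma weak_gradient_AE:
  assumes "sobolev u g"
  shows "has_weak_gradient u (weak_gradient u)" "AE x in m. weak_gradient u x = g x"
proof -
  show w: "has_weak_gradient u (weak_gradient u)"
    unfolding weak_gradient_def using sobolevD(1)[OF assms] by (rule someI[of "has_weak_gradient u"])
  show "AE x in m. weak_gradient u x = g x"
    using has_weak_gradient_unique[OF w sobolevD(1)[OF assms]] by (simp add: AE_m_iff)
qed

lemma sobolev_cong_AE:
  assumes u: "sobolev u g" and m: "u' \<in> borel_measurable borel" "g' \<in> borel_measurable borel"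
    and ae: "AE x in m. u x = u' x" "AE x in m. g x = g' x"
  shows "sobolev u' g'"
  unfolding sobolev_def
proof (intro conjI)
  note [measurable] = m sobolev_measurable[OF u]
  show "has_weak_gradient u' g'"
    using has_weak_gradient_cong_AE[OF sobolevD(1)[OF u] m] ae by (simp add: AE_m_iff)
  show "sq_integrable m u'"
    by (rule sq_integrable_bound[OF sq_integrableD[OF sobolevD(2)[OF u]]]) (use ae in \<open>auto elim: eventually_mono\<close>)
  show "sq_integrable m g'"
    by (rule sq_integrable_bound[OF sq_integrableD[OF sobolevD(3)[OF u]]]) (use ae in \<open>auto elim: eventually_mono\<close>)
qed

lemma weak_gradient_measurable:
  assumes "sobolev u g" shows "weak_gradient u \<in> borel_measurable borel"
  using weak_gradient_AE(1)[OF assms] by (auto simp: has_weak_gradient_def intro: locally_integrable_measurable)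

lemma sobolev_weak_gradient:
  assumes "sobolev u g" shows "sobolev u (weak_gradient u)"
  by (rule sobolev_cong_AE[OF assms sobolev_measurable(1)[OF assms] weak_gradient_measurable[OF assms]])
     (use weak_gradient_AE(2)[OF assms] in \<open>auto elim: eventually_mono\<close>)

lemma W12_iff: "u \<in> W12 m \<longleftrightarrow> (\<exists>g. sobolev u g)"
proof
  assume "u \<in> W12 m"
  then have u: "u \<in> L2 m" "\<exists>g. has_weak_gradient u g" "(\<lambda>x. norm (weak_gradient u x)) \<in> L2 m"
    by (auto simp: W12_def)
  have w: "has_weak_gradient u (weak_gradient u)"
    unfolding weak_gradient_def using u(2) by (rule someI_ex)
  have "weak_gradient u \<in> borel_measurable borel"
    using w by (auto simp: has_weak_gradient_def intro: locally_integrable_measurable)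
  with w u show "\<exists>g. sobolev u g"
    by (auto simp: sobolev_def sq_integrable_def L2_def intro!: exI[of _ "weak_gradient u"])
next
  assume "\<exists>g. sobolev u g"
  then obtain g where g: "sobolev u g" by blast
  from sobolev_weak_gradient[OF g] show "u \<in> W12 m"
    by (auto simp: sobolev_def sq_integrable_def L2_def W12_def)
qed

lemma sobolev_sq_norm_gradient:
  assumes "sobolev u g" "sobolev u h" shows "sq_norm m g = sq_norm m h"
  by (rule sq_norm_cong_AE[OF sobolev_gradient_AE[OF assms]])
     (use assms in \<open>auto dest: sobolev_measurable\<close>)

lemma W12_norm_sq:
  assumes "sobolev u g" shows "(W12_norm m u)\<^sup>2 = sq_norm m u + sq_norm m g"
proof -
  have "(W12_norm m u)\<^sup>2 = sq_norm m u + sq_norm m (weak_gradient u)"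
    unfolding W12_norm_def sq_norm_def by (subst real_sqrt_pow2) auto
  also have "sq_norm m (weak_gradient u) = sq_norm m g"
    by (rule sobolev_sq_norm_gradient[OF sobolev_weak_gradient[OF assms] assms])
  finally show ?thesis .
qed

lemma sobolev_add: "sobolev u g \<Longrightarrow> sobolev v h \<Longrightarrow> sobolev (\<lambda>x. u x + v x) (\<lambda>x. g x + h x)"
  by (auto simp: sobolev_def intro: has_weak_gradient_add sq_integrable_add)

lemma sobolev_scale: "sobolev u g \<Longrightarrow> sobolev (\<lambda>x. c * u x) (\<lambda>x. c *\<^sub>R g x)"
  using sq_integrable_scaleR[of m u c] sq_integrable_scaleR[of m g c] has_weak_gradient_scale[of u g c]
  by (auto simp: sobolev_def)

text \<open>That a partial derivative of a test function integrates to 0 is read off the chain rule,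
  applied to the zero function with \<open>F\<close> constant.\<close>

lemma sobolev_const: "sobolev (\<lambda>x. c) (\<lambda>x. 0)"
proof -
  have z: "sq_integrable m (\<lambda>x. 0 :: real)" "sq_integrable m (\<lambda>x. 0 :: real^2)" by (simp_all add: sq_integrable_def)
  have c: "sq_integrable m (\<lambda>x. c)" by (simp add: sq_integrable_def)
  have w0: "has_weak_gradient (\<lambda>x. 0) (\<lambda>x. 0)"
    unfolding has_weak_gradient_def using sq_integrable_locally_integrable[OF z(1)] sq_integrable_locally_integrable[OF z(2)] by auto
  have "(LINT x|lborel. c * partial_deriv i \<phi> x) = 0" if \<phi>: "test_function \<phi>" for \<phi> i
  proof -
    obtain R where R: "\<And>x. x \<notin> cball 0 R \<Longrightarrow> \<phi> x = 0" using test_function_support[OF \<phi>] by metis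
    have "(LINT x|lborel. (\<lambda>t. c) ((\<lambda>x. 0) x) * partial_deriv i \<phi> x) = - (LINT x|lborel. (\<lambda>t. 0) ((\<lambda>x. 0) x) * (0::real^2) $ i * \<phi> x)"
      by (rule weak_chain_rule[OF w0, where F="\<lambda>t. c" and F'="\<lambda>t. 0" and L=0 and R=R])
         (auto simp: R intro: test_function_differentiable test_function_continuous_partial \<phi>)
    then show ?thesis by simp
  qed
  then have "has_weak_gradient (\<lambda>x. c) (\<lambda>x. 0)"
    unfolding has_weak_gradient_def using sq_integrable_locally_integrable[OF z(2)] sq_integrable_locally_integrable[OF c] by auto
  with z c show ?thesis by (simp add: sobolev_def)
qed

lemma sobolev_sum:
  "(\<And>i. i \<in> I \<Longrightarrow> sobolev (u i) (g i)) \<Longrightarrow> sobolev (\<lambda>x. \<Sum>i\<in>I. u i x) (\<lambda>x. \<Sum>i\<in>I. g i x)"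
proof (induction I rule: infinite_finite_induct)
  case (insert i I)
  then show ?case using sobolev_add[of "u i" "g i"] by simp
qed (auto intro: sobolev_const)

lemma sobolev_diff: "sobolev u g \<Longrightarrow> sobolev v h \<Longrightarrow> sobolev (\<lambda>x. u x - v x) (\<lambda>x. g x - h x)"
  using sobolev_add[OF _ sobolev_scale[of v h "-1"]] by fastforce

lemma sobolev_abs:
  assumes "sobolev u g"
  shows "sobolev (\<lambda>x. \<bar>u x\<bar>) (\<lambda>x. sgn (u x) *\<^sub>R g x)" "sq_norm m (\<lambda>x. sgn (u x) *\<^sub>R g x) \<le> sq_norm m g"
proof -
  note [measurable] = sobolev_measurable[OF assms]
  have le: "(norm (sgn (u x) *\<^sub>R g x))\<^sup>2 \<le> (norm (g x))\<^sup>2" for x by (simp add: sgn_if)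
  have 1: "sq_integrable m (\<lambda>x. sgn (u x) *\<^sub>R g x)"
    by (rule sq_integrable_bound[OF sq_integrableD[OF sobolevD(3)[OF assms]]]) (use le in auto)
  moreover have "sq_integrable m (\<lambda>x. \<bar>u x\<bar>)" using sobolevD(2)[OF assms] by (auto simp: sq_integrable_def)
  ultimately show "sobolev (\<lambda>x. \<bar>u x\<bar>) (\<lambda>x. sgn (u x) *\<^sub>R g x)"
    using has_weak_gradient_abs[OF sobolevD(1)[OF assms] sobolev_local[OF assms]] by (simp add: sobolev_def)
  show "sq_norm m (\<lambda>x. sgn (u x) *\<^sub>R g x) \<le> sq_norm m g"
    unfolding sq_norm_def using 1 sobolevD(3)[OF assms] le by (intro integral_mono) (auto simp: sq_integrable_def)
qed

lemma sobolev_gradient_zero: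
  assumes "sobolev u g" shows "AE x in m. u x = 0 \<longrightarrow> g x = 0"
  using weak_gradient_zero_on_level[OF sobolevD(1)[OF assms] sobolev_local[OF assms]] by (simp add: AE_m_iff)

text \<open>On the support of the weight the density is bounded below, so smallness in
  \<open>m\<close> is smallness for Lebesgue measure; Young's inequality then turns square means
  into means.\<close>

lemma sq_norm_tendsto_integral:
  fixes f :: "nat \<Rightarrow> real^2 \<Rightarrow> real"
  assumes f: "\<And>n. sq_integrable m (f n)" and h: "sq_integrable m h"
    and lim: "(\<lambda>n. sq_norm m (\<lambda>x. f n x - h x)) \<longlonglongrightarrow> 0"
    and w: "w \<in> borel_measurable borel" "\<And>x. \<bar>w x\<bar> \<le> M" "\<And>x. x \<notin> cball 0 R \<Longrightarrow> w x = 0"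
  shows "(\<lambda>n. LINT x|lborel. f n x * w x) \<longlonglongrightarrow> (LINT x|lborel. h x * w x)"
proof (rule LIMSEQ_I)
  fix \<epsilon> :: real assume \<epsilon>: "0 < \<epsilon>"
  obtain c C where c: "0 < c" "\<And>x. x \<in> cball 0 R \<Longrightarrow> c \<le> \<rho> x" using density_bounds[of R] by metis
  have M: "M \<ge> 0" using w(2)[of 0] by linarith
  define V where "V = measure lborel (cball (0::real^2) R)"
  have V: "V \<ge> 0" by (simp add: V_def)
  have frac: "y / (y + 1) < 1" if "y \<ge> 0" for y :: real using that by (simp add: divide_less_eq)
  \<comment> \<open>The part \<open>M * \<delta> * V\<close> of Young's bound stays below
    \<open>\<epsilon> / 2\<close>; the threshold for \<open>sq_norm\<close> chosen next does the
    same for the part divided by \<open>\<delta>\<close>. The added 1 covers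
    \<open>M * V = 0\<close>.\<close>
  define \<delta> where "\<delta> = \<epsilon> / (2 * (M * V + 1))"
  have \<delta>: "\<delta> > 0" using \<epsilon> M V by (auto simp: \<delta>_def intro!: divide_pos_pos mult_pos_pos add_nonneg_pos)
  have "\<forall>\<^sub>F n in sequentially. sq_norm m (\<lambda>x. f n x - h x) < c * \<delta> * \<epsilon> / (2 * (M + 1))"
    using lim by (rule order_tendstoD) (use \<epsilon> c M \<delta> in auto)
  then obtain N where N: "\<And>n. n \<ge> N \<Longrightarrow> sq_norm m (\<lambda>x. f n x - h x) < c * \<delta> * \<epsilon> / (2 * (M + 1))"
    by (auto simp: eventually_sequentially)
  have ii: "integrable lborel (\<lambda>x. k x * w x)" if "sq_integrable m k" for k
    by (rule integrable_locally_integrable_mult[OF sq_integrable_locally_integrable[OF that] w])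
  show "\<exists>no. \<forall>n\<ge>no. norm ((LINT x|lborel. f n x * w x) - (LINT x|lborel. h x * w x)) < \<epsilon>"
  proof (intro exI[of _ N] allI impI)
    fix n assume n: "n \<ge> N"
    let ?d = "\<lambda>x. f n x - h x"
    have d: "sq_integrable m ?d" using f h by (rule sq_integrable_diff)
    let ?k = "\<lambda>x. M * (\<delta> * indicator (cball 0 R) x + (1 / \<delta>) * (indicator (cball 0 R) x * (norm (?d x))\<^sup>2))"
    have i1: "integrable lborel (indicator (cball (0::real^2) R) :: _ \<Rightarrow> real)"
      using emeasure_bounded_finite[OF bounded_cball, of "0::real^2" R] by (intro integrable_real_indicator) auto
    have i2: "integrable lborel (\<lambda>x. indicator (cball 0 R) x * (norm (?d x))\<^sup>2)" using d by (rule sq_integrable_cball)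
    have ik: "integrable lborel ?k" using i1 i2 by auto
    have le2: "(LINT x|lborel. indicator (cball 0 R) x * (norm (?d x))\<^sup>2) \<le> sq_norm m ?d / c"
      by (rule sq_integrable_local(2)[OF d c]) auto
    have "norm ((LINT x|lborel. f n x * w x) - (LINT x|lborel. h x * w x)) = \<bar>LINT x|lborel. ?d x * w x\<bar>"
      using ii[OF f] ii[OF h] by (simp add: left_diff_distrib)
    also have "\<dots> \<le> (LINT x|lborel. \<bar>?d x * w x\<bar>)" by (rule integral_abs_bound)
    also have "\<dots> \<le> integral\<^sup>L lborel ?k"
    proof (rule integral_mono[OF _ ik])
      show "integrable lborel (\<lambda>x. \<bar>?d x * w x\<bar>)" using ii[OF d] by (rule integrable_abs)
      fix x
      show "\<bar>?d x * w x\<bar> \<le> ?k x"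
      proof (cases "x \<in> cball 0 R")
        case True
        have "2 * \<bar>?d x\<bar> * \<delta> \<le> (?d x)\<^sup>2 + \<delta>\<^sup>2" using sum_squares_bound[of "\<bar>?d x\<bar>" \<delta>] by simp
        then have "\<bar>?d x\<bar> * \<delta> \<le> (?d x)\<^sup>2 + \<delta>\<^sup>2" using mult_nonneg_nonneg[OF abs_ge_zero less_imp_le[OF \<delta>], of "?d x"] by linarith
        then have "\<bar>?d x\<bar> \<le> \<delta> + (1 / \<delta>) * (?d x)\<^sup>2" using \<delta> by (simp add: field_simps power2_eq_square)
        then have "\<bar>?d x\<bar> * \<bar>w x\<bar> \<le> (\<delta> + (1 / \<delta>) * (?d x)\<^sup>2) * M"
          using w(2)[of x] M \<delta> by (intro mult_mono) auto
        then show ?thesis using True by (simp add: abs_mult mult.commute)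
      qed (simp add: w(3))
    qed
    also have "\<dots> = M * (\<delta> * V + (1 / \<delta>) * (LINT x|lborel. indicator (cball 0 R) x * (norm (?d x))\<^sup>2))"
      using i1 i2 by (simp add: V_def)
    also have "\<dots> \<le> M * (\<delta> * V + (1 / \<delta>) * (sq_norm m ?d / c))"
      using le2 M \<delta> by (intro mult_left_mono add_left_mono) auto
    also have "\<dots> \<le> M * (\<delta> * V + (1 / \<delta>) * ((c * \<delta> * \<epsilon> / (2 * (M + 1))) / c))"
      using N[OF n] M \<delta> c(1) by (intro mult_left_mono add_left_mono divide_right_mono) auto
    also have "\<dots> = \<epsilon> / 2 * (M * V / (M * V + 1)) + \<epsilon> / 2 * (M / (M + 1))"
    proof -
      have "(1 / \<delta>) * ((c * \<delta> * \<epsilon> / (2 * (M + 1))) / c) = \<epsilon> / (2 * (M + 1))" using c(1) \<delta> by simp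
      moreover have "M * (\<delta> * V) = \<epsilon> / 2 * (M * V / (M * V + 1))" by (simp add: \<delta>_def algebra_simps)
      moreover have "M * (\<epsilon> / (2 * (M + 1))) = \<epsilon> / 2 * (M / (M + 1))" by (simp add: algebra_simps)
      ultimately show ?thesis by (simp only: distrib_left)
    qed
    also have "\<dots> < \<epsilon> / 2 * 1 + \<epsilon> / 2 * 1"
      using \<epsilon> frac[OF M] frac[OF mult_nonneg_nonneg[OF M V]] by (intro add_strict_mono mult_strict_left_mono) auto
    finally show "norm ((LINT x|lborel. f n x * w x) - (LINT x|lborel. h x * w x)) < \<epsilon>" by simp
  qed
qed

text \<open>Both sides of the defining identity of the weak gradient are continuous under
  convergence in square mean, because test functions and their derivatives are bounded with compact
  support.\<close>

lemma sobolev_limit: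
  assumes u: "\<And>n. sobolev (u n) (g n)" and v: "sq_integrable m v" and h: "sq_integrable m h"
    and lim: "(\<lambda>n. sq_norm m (\<lambda>x. u n x - v x)) \<longlonglongrightarrow> 0" "(\<lambda>n. sq_norm m (\<lambda>x. g n x - h x)) \<longlonglongrightarrow> 0"
  shows "sobolev v h"
proof -
  have "(LINT x|lborel. v x * partial_deriv i \<phi> x) = - (LINT x|lborel. h x $ i * \<phi> x)" if \<phi>: "test_function \<phi>" for \<phi> i
  proof -
    obtain R where R: "\<And>x. x \<notin> cball 0 R \<Longrightarrow> \<phi> x = 0" using test_function_support[OF \<phi>] by metis
    obtain M where M: "\<And>x y. \<bar>\<phi> x - \<phi> y\<bar> \<le> M * norm (x - y)" "\<And>i x. \<bar>partial_deriv i \<phi> x\<bar> \<le> M"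
      using C1_compact_support_lipschitz[OF test_function_differentiable[OF \<phi>] test_function_continuous_partial[OF \<phi>] R] by metis
    obtain P where P: "\<And>x. \<bar>\<phi> x\<bar> \<le> P"
      using continuous_compact_support_bounded[OF test_function_continuous[OF \<phi>] R] by metis
    have D0: "partial_deriv i \<phi> x = 0" if "x \<notin> cball 0 R" for x
      by (rule partial_deriv_outside_support[OF _ that]) (rule R)
    have comp: "sq_integrable m (\<lambda>x. k x $ i)" "sq_norm m (\<lambda>x. k x $ i) \<le> sq_norm m k" if k: "sq_integrable m k" for k :: "real^2 \<Rightarrow> real^2"
    proof -
      have [measurable]: "k \<in> borel_measurable m" using k by (rule sq_integrable_measurable)
      have le: "(norm (k x $ i))\<^sup>2 \<le> (norm (k x))\<^sup>2" for x by (intro power_mono) (auto simp: component_le_norm_cart)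
      show s: "sq_integrable m (\<lambda>x. k x $ i)"
        by (rule sq_integrable_bound[OF sq_integrableD[OF k]]) (use le in auto)
      show "sq_norm m (\<lambda>x. k x $ i) \<le> sq_norm m k"
        unfolding sq_norm_def using s k le by (intro integral_mono) (auto simp: sq_integrable_def)
    qed
    have l1: "(\<lambda>n. LINT x|lborel. u n x * partial_deriv i \<phi> x) \<longlonglongrightarrow> (LINT x|lborel. v x * partial_deriv i \<phi> x)"
      by (rule sq_norm_tendsto_integral[OF sobolevD(2)[OF u] v lim(1) _ M(2) D0])
         (intro borel_measurable_continuous_onI test_function_continuous_partial \<phi>)
    have l2: "(\<lambda>n. LINT x|lborel. g n x $ i * \<phi> x) \<longlonglongrightarrow> (LINT x|lborel. h x $ i * \<phi> x)"
    proof (rule sq_norm_tendsto_integral[OF comp(1)[OF sobolevD(3)[OF u]] comp(1)[OF h] _ _ P R])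
      show "\<phi> \<in> borel_measurable borel" by (intro borel_measurable_continuous_onI test_function_continuous \<phi>)
      show "(\<lambda>n. sq_norm m (\<lambda>x. g n x $ i - h x $ i)) \<longlonglongrightarrow> 0"
        using comp(2)[OF sq_integrable_diff[OF sobolevD(3)[OF u] h]]
        by (intro tendsto_sandwich[OF _ _ tendsto_const lim(2)]) (auto intro!: always_eventually)
    qed
    have eq: "(LINT x|lborel. u n x * partial_deriv i \<phi> x) = - (LINT x|lborel. g n x $ i * \<phi> x)" for n
      using sobolevD(1)[OF u[of n]] \<phi> by (simp add: has_weak_gradient_def)
    show ?thesis by (rule LIMSEQ_unique[OF l1[unfolded eq] tendsto_minus[OF l2]])
  qed
  then show ?thesis
    unfolding sobolev_def has_weak_gradient_def
    using v h sq_integrable_locally_integrable[OF v] sq_integrable_locally_integrable[OF h] by auto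
qed

end

subsection \<open>Capacity and quasi-continuity\<close>

context weighted_plane
begin

lemma capacity_le:
  assumes "sobolev w g" "AE x in m. 0 \<le> w x" "open U" "E \<subseteq> U" "AE x in m. x \<in> U \<longrightarrow> 1 \<le> w x"
  shows "capacity m E \<le> ereal (sq_norm m w + sq_norm m g)"
  unfolding capacity_def W12_norm_sq[OF assms(1), symmetric]
  by (rule INF_lower) (use assms in \<open>auto simp: W12_iff\<close>)

lemma capacity_lessE:
  assumes "capacity m E < ereal \<epsilon>"
  obtains w g U where "sobolev w g" "AE x in m. 0 \<le> w x" "open U" "E \<subseteq> U" "AE x in m. x \<in> U \<longrightarrow> 1 \<le> w x"
    "sq_norm m w + sq_norm m g < \<epsilon>"
proof -
  from assms obtain w where w: "w \<in> W12 m" "AE x in m. 0 \<le> w x" "ereal ((W12_norm m w)\<^sup>2) < ereal \<epsilon>"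
    and ex: "\<exists>U. open U \<and> E \<subseteq> U \<and> (AE x in m. x \<in> U \<longrightarrow> 1 \<le> w x)"
    unfolding capacity_def INF_less_iff by blast
  from w(1) obtain g where g: "sobolev w g" by (auto simp: W12_iff)
  from ex obtain U where "open U" "E \<subseteq> U" "AE x in m. x \<in> U \<longrightarrow> 1 \<le> w x" by blast
  with w g show thesis by (intro that[of w g U]) (auto simp: W12_norm_sq[OF g])
qed

lemma capacity_nonneg: "0 \<le> capacity m E"
  unfolding capacity_def by (rule INF_greatest) simp

lemma capacity_mono: "E \<subseteq> F \<Longrightarrow> capacity m E \<le> capacity m F"
  unfolding capacity_def by (rule INF_superset_mono) auto

lemma capacity_empty: "capacity m {} = 0"
proof -
  have "capacity m {} \<le> ereal (sq_norm m (\<lambda>x. 0 :: real) + sq_norm m (\<lambda>x. 0 :: real^2))"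
    by (rule capacity_le[OF sobolev_const, where U="{}"]) auto
  then show ?thesis using capacity_nonneg[of "{}"] by (simp add: sq_norm_def zero_ereal_def antisym)
qed

lemma capacity_zeroI: "(\<And>\<epsilon>. \<epsilon> > 0 \<Longrightarrow> capacity m E \<le> ereal \<epsilon>) \<Longrightarrow> capacity m E = 0"
  using ereal_le_epsilon2[of "capacity m E" 0] capacity_nonneg[of E] by (intro antisym) (auto simp: zero_ereal_def)

text \<open>The competitor for the union is the sum of the two competitors; the squared norm of a
  sum costs the factor 2. Only smallness of capacities matters later.\<close>

lemma capacity_Un:
  assumes "capacity m E < ereal \<epsilon>" "capacity m F < ereal \<delta>"
  shows "capacity m (E \<union> F) < ereal (2 * \<epsilon> + 2 * \<delta>)"
proof -
  obtain w g U where w: "sobolev w g" "AE x in m. 0 \<le> w x" "open U" "E \<subseteq> U" "AE x in m. x \<in> U \<longrightarrow> 1 \<le> w x"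
    "sq_norm m w + sq_norm m g < \<epsilon>" by (rule capacity_lessE[OF assms(1)])
  obtain v h V where v: "sobolev v h" "AE x in m. 0 \<le> v x" "open V" "F \<subseteq> V" "AE x in m. x \<in> V \<longrightarrow> 1 \<le> v x"
    "sq_norm m v + sq_norm m h < \<delta>" by (rule capacity_lessE[OF assms(2)])
  have "capacity m (E \<union> F) \<le> ereal (sq_norm m (\<lambda>x. w x + v x) + sq_norm m (\<lambda>x. g x + h x))"
  proof (rule capacity_le[OF sobolev_add[OF w(1) v(1)], where U="U \<union> V"])
    show "AE x in m. 0 \<le> w x + v x" using w(2) v(2) by eventually_elim simp
    show "AE x in m. x \<in> U \<union> V \<longrightarrow> 1 \<le> w x + v x" using w(2,5) v(2,5) by eventually_elim auto
  qed (use w v in auto)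
  also have "\<dots> < ereal (2 * \<epsilon> + 2 * \<delta>)"
    using sq_norm_add_le[OF sobolevD(2)[OF w(1)] sobolevD(2)[OF v(1)]]
      sq_norm_add_le[OF sobolevD(3)[OF w(1)] sobolevD(3)[OF v(1)]] w(6) v(6) by simp
  finally show ?thesis .
qed

lemma capacity_zero_Un:
  assumes "capacity m E = 0" "capacity m F = 0" shows "capacity m (E \<union> F) = 0"
proof (rule capacity_zeroI)
  fix \<epsilon> :: real assume "\<epsilon> > 0"
  then show "capacity m (E \<union> F) \<le> ereal \<epsilon>"
    using capacity_Un[of E "\<epsilon> / 4" F "\<epsilon> / 4"] assms by simp
qed

lemma capacity_zero_mono: "E \<subseteq> F \<Longrightarrow> capacity m F = 0 \<Longrightarrow> capacity m E = 0"
  using capacity_mono[of E F] capacity_nonneg[of E] by auto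

text \<open>Splitting off one summand at a time doubles the cost of all later ones. The weights are
  independent of the number of summands and harmless against decay like
  \<open>4^(-n)\<close>.\<close>

lemma sq_norm_sum_dyadic:
  fixes f :: "nat \<Rightarrow> real^2 \<Rightarrow> 'b::euclidean_space"
  assumes "\<And>n. sq_integrable m (f n)"
  shows "sq_norm m (\<lambda>x. \<Sum>n<k. f n x) \<le> (\<Sum>n<k. 2 ^ Suc n * sq_norm m (f n))"
  using assms
proof (induction k arbitrary: f)
  case 0
  then show ?case by (simp add: sq_norm_def)
next
  case (Suc k)
  have "sq_norm m (\<lambda>x. \<Sum>n<Suc k. f n x) = sq_norm m (\<lambda>x. f 0 x + (\<Sum>n<k. f (Suc n) x))"
    by (simp only: sum.lessThan_Suc_shift)
  also have "\<dots> \<le> 2 * sq_norm m (f 0) + 2 * sq_norm m (\<lambda>x. \<Sum>n<k. f (Suc n) x)"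
    using Suc.prems by (intro sq_norm_add_le sq_integrable_sum)
  also have "\<dots> \<le> 2 * sq_norm m (f 0) + 2 * (\<Sum>n<k. 2 ^ Suc n * sq_norm m (f (Suc n)))"
    using Suc.IH[of "\<lambda>n. f (Suc n)"] Suc.prems by simp
  also have "\<dots> = (\<Sum>n<Suc k. 2 ^ Suc n * sq_norm m (f n))"
    by (simp add: sum.lessThan_Suc_shift sum_distrib_left mult.assoc del: sum.lessThan_Suc)
  finally show ?case .
qed

text \<open>The weight \<open>2^(n + 1)\<close> meets the decay \<open>4^(-(n + 1))\<close>, and the
  remaining powers of 1/2 sum to less than 1.\<close>

lemma sq_norm_geometric_tail:
  fixes f :: "nat \<Rightarrow> real^2 \<Rightarrow> 'b::euclidean_space"
  assumes f: "\<And>n. sq_integrable m (f n)" and b: "\<And>n. sq_norm m (f n) \<le> \<eta> * (1 / 4) ^ Suc n"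
  shows "sq_norm m (\<lambda>x. \<Sum>n<k. f (i + n) x) \<le> \<eta> * (1 / 4) ^ i"
proof -
  have "0 \<le> \<eta> * (1 / 4) ^ Suc 0" using b[of 0] sq_norm_nonneg[of m "f 0"] by (rule order_trans[rotated])
  then have "\<eta> \<ge> 0" by simp
  have "sq_norm m (\<lambda>x. \<Sum>n<k. f (i + n) x) \<le> (\<Sum>n<k. 2 ^ Suc n * sq_norm m (f (i + n)))"
    using f by (rule sq_norm_sum_dyadic)
  also have "\<dots> \<le> (\<Sum>n<k. \<eta> * (1 / 4) ^ i * (1 / 2) ^ Suc n)"
  proof (rule sum_mono)
    fix n
    have "2 ^ Suc n * sq_norm m (f (i + n)) \<le> 2 ^ Suc n * (\<eta> * (1 / 4) ^ Suc (i + n))"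
      using b[of "i + n"] by (intro mult_left_mono) auto
    also have "\<dots> = \<eta> * (1 / 4) ^ i * (2 ^ Suc n * (1 / 4) ^ Suc n)" by (simp add: power_add)
    also have "(2::real) ^ Suc n * (1 / 4) ^ Suc n = (1 / 2) ^ Suc n" by (simp only: power_mult_distrib[symmetric]) simp
    finally show "2 ^ Suc n * sq_norm m (f (i + n)) \<le> \<eta> * (1 / 4) ^ i * (1 / 2) ^ Suc n" .
  qed
  also have "\<dots> = \<eta> * (1 / 4) ^ i * (\<Sum>n<k. (1 / 2) ^ Suc n)" by (simp add: sum_distrib_left)
  also have "(\<Sum>n<k. (1 / 2 :: real) ^ Suc n) = 1 - (1 / 2) ^ k" by (induction k) (auto simp: field_simps)
  also have "\<eta> * (1 / 4) ^ i * (1 - (1 / 2) ^ k) \<le> \<eta> * (1 / 4) ^ i * 1"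
    using \<open>\<eta> \<ge> 0\<close> by (intro mult_left_mono) auto
  finally show ?thesis by simp
qed

lemma sum_split: "(\<Sum>n<i + (k::nat). f n) = (\<Sum>n<i. f n) + (\<Sum>n<k. f (i + n) :: 'b::ab_group_add)"
  by (induction k) (simp_all add: add.assoc)

lemma geometric_series_complete:
  fixes f :: "nat \<Rightarrow> real^2 \<Rightarrow> 'b::euclidean_space"
  assumes f: "\<And>n. sq_integrable m (f n)" and b: "\<And>n. sq_norm m (f n) \<le> \<eta> * (1 / 4) ^ Suc n" and \<eta>: "\<eta> > 0"
  obtains h where "sq_integrable m h" "(\<lambda>k. sq_norm m (\<lambda>x. (\<Sum>n<k. f n x) - h x)) \<longlonglongrightarrow> 0"
proof (rule sq_integrable_complete[of m "\<lambda>k x. \<Sum>n<k. f n x"])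
  show "sq_integrable m (\<lambda>x. \<Sum>n<k. f n x)" for k using f by (intro sq_integrable_sum)
  fix \<epsilon> :: real assume "\<epsilon> > 0"
  then have "\<epsilon> / \<eta> > 0" using \<eta> by simp
  then obtain N where "(1 / 4 :: real) ^ N < \<epsilon> / \<eta>" using real_arch_pow_inv[of "\<epsilon> / \<eta>" "1/4"] by auto
  then have N: "\<eta> * (1 / 4) ^ N < \<epsilon>" using \<eta> by (simp add: field_simps)
  have le: "sq_norm m (\<lambda>x. (\<Sum>n<j. f n x) - (\<Sum>n<i. f n x)) < \<epsilon>" if ij: "N \<le> i" "i \<le> j" for i j
  proof -
    have "(\<Sum>n<j. f n x) - (\<Sum>n<i. f n x) = (\<Sum>n<j - i. f (i + n) x)" for x
    proof -
      have "(\<Sum>n<i + (j - i). f n x) = (\<Sum>n<i. f n x) + (\<Sum>n<j - i. f (i + n) x)"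
        by (rule sum_split)
      then show ?thesis using ij by simp
    qed
    then have "sq_norm m (\<lambda>x. (\<Sum>n<j. f n x) - (\<Sum>n<i. f n x)) \<le> \<eta> * (1 / 4) ^ i"
      using sq_norm_geometric_tail[OF f b, of i "j - i"] by simp
    also have "\<dots> \<le> \<eta> * (1 / 4) ^ N" using ij \<eta> by (intro mult_left_mono power_decreasing) auto
    finally show ?thesis using N by simp
  qed
  have sym: "sq_norm m (\<lambda>x. (\<Sum>n<i. f n x) - (\<Sum>n<j. f n x)) = sq_norm m (\<lambda>x. (\<Sum>n<j. f n x) - (\<Sum>n<i. f n x))" for i j
    by (simp add: sq_norm_def norm_minus_commute)
  show "\<exists>N. \<forall>i\<ge>N. \<forall>j\<ge>N. sq_norm m (\<lambda>x. (\<Sum>n<i. f n x) - (\<Sum>n<j. f n x)) < \<epsilon>"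
  proof (intro exI[of _ N] allI impI)
    fix i j assume "N \<le> i" "N \<le> j"
    then show "sq_norm m (\<lambda>x. (\<Sum>n<i. f n x) - (\<Sum>n<j. f n x)) < \<epsilon>"
      using le[of i j] le[of j i] unfolding sym[of i j] by (cases "i \<le> j") auto
  qed
qed (use that in blast)

text \<open>The sum of the competitors converges in the Sobolev norm and, all terms being
  non-negative, dominates each of them almost everywhere; the union of the neighbourhoods serves the
  union. One \<open>\<eta>\<close> bounds the function, the other its gradient.\<close>

lemma capacity_UN:
  assumes cap: "\<And>n. capacity m (E n) < ereal (\<eta> * (1 / 4) ^ Suc n)" and \<eta>: "\<eta> > 0"
  shows "capacity m (\<Union>n. E n) \<le> ereal (2 * \<eta>)"
proof -
  define Q where "Q n w g U \<longleftrightarrow> sobolev w g \<and> (AE x in m. 0 \<le> w x) \<and> open U \<and> E n \<subseteq> U \<and>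
    (AE x in m. x \<in> U \<longrightarrow> 1 \<le> w x) \<and> sq_norm m w + sq_norm m g < \<eta> * (1 / 4) ^ Suc n" for n w g U
  have "\<exists>w g U. Q n w g U" for n
    by (rule capacity_lessE[OF cap[of n]]) (auto simp: Q_def)
  then obtain w g U where "\<And>n. Q n (w n) (g n) (U n)" by metis
  note W = this[unfolded Q_def]
  have w: "\<And>n. sobolev (w n) (g n)" "\<And>n. AE x in m. 0 \<le> w n x" "\<And>n. open (U n)" "\<And>n. E n \<subseteq> U n"
    "\<And>n. AE x in m. x \<in> U n \<longrightarrow> 1 \<le> w n x" "\<And>n. sq_norm m (w n) + sq_norm m (g n) < \<eta> * (1 / 4) ^ Suc n"
    using W by blast+
  have bw: "sq_norm m (w n) \<le> \<eta> * (1 / 4) ^ Suc n" "sq_norm m (g n) \<le> \<eta> * (1 / 4) ^ Suc n" for n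
    using w(6)[of n] sq_norm_nonneg[of m "w n"] sq_norm_nonneg[of m "g n"] by linarith+
  obtain v where v: "sq_integrable m v" "(\<lambda>k. sq_norm m (\<lambda>x. (\<Sum>n<k. w n x) - v x)) \<longlonglongrightarrow> 0"
    by (rule geometric_series_complete[OF sobolevD(2)[OF w(1)] bw(1) \<eta>])
  obtain h where h: "sq_integrable m h" "(\<lambda>k. sq_norm m (\<lambda>x. (\<Sum>n<k. g n x) - h x)) \<longlonglongrightarrow> 0"
    by (rule geometric_series_complete[OF sobolevD(3)[OF w(1)] bw(2) \<eta>])
  have S: "sobolev (\<lambda>x. \<Sum>n<k. w n x) (\<lambda>x. \<Sum>n<k. g n x)" for k by (intro sobolev_sum w(1))
  have vh: "sobolev v h" by (rule sobolev_limit[OF S v(1) h(1) v(2) h(2)])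
  obtain r where r: "strict_mono (r::nat\<Rightarrow>nat)" "AE x in m. (\<lambda>k. \<Sum>n<r k. w n x) \<longlonglongrightarrow> v x"
    by (rule sq_norm_tendsto_AE_subseq[OF sobolevD(2)[OF S] v])
  obtain r' where r': "strict_mono (r'::nat\<Rightarrow>nat)" "AE x in m. (\<lambda>k. \<Sum>n<r' k. g n x) \<longlonglongrightarrow> h x"
    by (rule sq_norm_tendsto_AE_subseq[OF sobolevD(3)[OF S] h])
  have le: "sq_norm m v \<le> \<eta>" "sq_norm m h \<le> \<eta>"
  proof -
    show "sq_norm m v \<le> \<eta>"
      by (rule sq_norm_Fatou(2)[OF sobolevD(2)[OF S] _ r(2), where N=0])
         (use v sq_norm_geometric_tail[OF sobolevD(2)[OF w(1)] bw(1), of 0] in \<open>auto dest: sq_integrable_measurable\<close>)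
    show "sq_norm m h \<le> \<eta>"
      by (rule sq_norm_Fatou(2)[OF sobolevD(3)[OF S] _ r'(2), where N=0])
         (use h sq_norm_geometric_tail[OF sobolevD(3)[OF w(1)] bw(2), of 0] in \<open>auto dest: sq_integrable_measurable\<close>)
  qed
  have "AE x in m. \<forall>n. 0 \<le> w n x" "AE x in m. \<forall>n. x \<in> U n \<longrightarrow> 1 \<le> w n x"
    using w(2,5) by (simp_all add: AE_all_countable)
  then have ge: "AE x in m. (\<forall>n. w n x \<le> v x) \<and> (\<forall>n. 0 \<le> w n x) \<and> (\<forall>n. x \<in> U n \<longrightarrow> 1 \<le> w n x)"
    using r(2)
  proof eventually_elim
    case (elim x)
    have "w n x \<le> v x" for n
    proof (rule LIMSEQ_le_const[OF elim(3)], intro exI[of _ "Suc n"] allI impI)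
      fix k assume "Suc n \<le> k"
      then have "n < r k" using seq_suble[OF r(1), of k] by simp
      then show "w n x \<le> (\<Sum>n<r k. w n x)" using elim(1) by (intro member_le_sum) auto
    qed
    with elim show ?case by blast
  qed
  have "capacity m (\<Union>n. E n) \<le> ereal (sq_norm m v + sq_norm m h)"
  proof (rule capacity_le[OF vh, where U="\<Union>n. U n"])
    show "AE x in m. 0 \<le> v x" using ge by eventually_elim (meson order_trans)
    show "AE x in m. x \<in> (\<Union>n. U n) \<longrightarrow> 1 \<le> v x" using ge by eventually_elim (auto intro: order_trans)
    show "open (\<Union>n. U n)" using w(3) by auto
    show "(\<Union>n. E n) \<subseteq> (\<Union>n. U n)" using w(4) by blast
  qed
  also have "\<dots> \<le> ereal (2 * \<eta>)" using le by simp
  finally show ?thesis .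
qed

text \<open>A competitor that is at least 1 on the open set \<open>U\<close> gives
  \<open>measure m U\<close> at most its squared norm. Since \<open>E\<close> itself may fail to be
  measurable, it is covered by a null intersection of open sets.\<close>

lemma capacity_zero_AE:
  assumes "capacity m E = 0" shows "AE x in m. x \<notin> E"
proof -
  have "\<exists>U. open U \<and> E \<subseteq> U \<and> measure m U \<le> 1 / real (Suc n)" for n
  proof -
    have "capacity m E < ereal (1 / real (Suc n))" using assms by simp
    then obtain w g U where w: "sobolev w g" "AE x in m. 0 \<le> w x" "open U" "E \<subseteq> U" "AE x in m. x \<in> U \<longrightarrow> 1 \<le> w x"
      "sq_norm m w + sq_norm m g < 1 / real (Suc n)" by (rule capacity_lessE)
    have "measure m U = (LINT x|m. indicator U x)" using w(3) by simp
    also have "\<dots> \<le> sq_norm m w"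
      unfolding sq_norm_def
    proof (rule integral_mono_AE)
      show "AE x in m. indicator U x \<le> (norm (w x))\<^sup>2"
        using w(5) by eventually_elim (auto simp: indicator_def)
    qed (use w(3) sq_integrableD[OF sobolevD(2)[OF w(1)]] in \<open>auto simp: emeasure_eq_measure\<close>)
    also have "\<dots> \<le> 1 / real (Suc n)" using w(6) sq_norm_nonneg[of m g] by linarith
    finally show ?thesis using w(3,4) by blast
  qed
  then obtain U where U: "\<And>n. open (U n)" "\<And>n. E \<subseteq> U n" "\<And>n. measure m (U n) \<le> 1 / real (Suc n)" by metis
  have [measurable]: "U n \<in> sets borel" for n using U(1) by simp
  have "measure m (\<Inter>n. U n) \<le> 1 / real (Suc n)" for n
    using finite_measure_mono[of "\<Inter>n. U n" "U n"] U(3)[of n] by (auto intro: order_trans)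
  then have "measure m (\<Inter>n. U n) \<le> 0"
    by (intro LIMSEQ_le_const[OF abs_regularisation_tendsto]) auto
  then have "(\<Inter>n. U n) \<in> null_sets m"
    by (auto simp: null_sets_def emeasure_eq_measure measure_le_0_iff)
  then show ?thesis by (rule AE_I') (use U(2) in auto)
qed

lemma quasi_continuous_add:
  assumes "quasi_continuous m u" "quasi_continuous m v" shows "quasi_continuous m (\<lambda>x. u x + v x)"
  unfolding quasi_continuous_def
proof (intro allI impI)
  fix \<epsilon> :: real assume "\<epsilon> > 0"
  \<comment> \<open>A quarter for each function, since \<open>capacity_Un\<close> doubles both
    bounds.\<close>
  then have "\<epsilon> / 4 > 0" by simp
  with assms obtain A B where "open A" "capacity m A < ereal (\<epsilon> / 4)" "continuous_on (- A) u"
    "open B" "capacity m B < ereal (\<epsilon> / 4)" "continuous_on (- B) v" unfolding quasi_continuous_def by meson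
  moreover from this have "continuous_on (- (A \<union> B)) (\<lambda>x. u x + v x)"
    by (intro continuous_on_add) (auto intro: continuous_on_subset)
  ultimately show "\<exists>A. open A \<and> capacity m A < ereal \<epsilon> \<and> continuous_on (- A) (\<lambda>x. u x + v x)"
    using capacity_Un[of A "\<epsilon> / 4" B "\<epsilon> / 4"] by (intro exI[of _ "A \<union> B"]) auto
qed

lemma quasi_continuous_compose:
  assumes "quasi_continuous m u" "continuous_on UNIV f" shows "quasi_continuous m (\<lambda>x. f (u x))"
  unfolding quasi_continuous_def
proof (intro allI impI)
  fix \<epsilon> :: real assume "\<epsilon> > 0"
  with assms(1) obtain A where A: "open A" "capacity m A < ereal \<epsilon>" "continuous_on (- A) u"
    unfolding quasi_continuous_def by meson
  have "continuous_on (- A) (\<lambda>x. f (u x))"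
    by (rule continuous_on_compose2[OF assms(2) A(3)]) simp
  with A show "\<exists>A. open A \<and> capacity m A < ereal \<epsilon> \<and> continuous_on (- A) (\<lambda>x. f (u x))" by blast
qed

lemma quasi_continuous_const: "quasi_continuous m (\<lambda>x. c)"
  unfolding quasi_continuous_def using capacity_empty by (intro allI impI exI[of _ "{}"]) auto

lemma quasi_continuous_scale: "quasi_continuous m u \<Longrightarrow> quasi_continuous m (\<lambda>x. c * u x)"
  by (rule quasi_continuous_compose[where f="\<lambda>t. c * t"]) (auto intro: continuous_intros)

lemma quasi_continuous_abs: "quasi_continuous m u \<Longrightarrow> quasi_continuous m (\<lambda>x. \<bar>u x\<bar>)"
  by (rule quasi_continuous_compose[where f=abs]) (auto intro: continuous_intros)

lemma quasi_continuous_diff: "quasi_continuous m u \<Longrightarrow> quasi_continuous m v \<Longrightarrow> quasi_continuous m (\<lambda>x. u x - v x)"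
  using quasi_continuous_add[OF _ quasi_continuous_scale[of v "-1"]] by simp

lemma quasi_continuous_sum:
  "(\<And>i. i \<in> I \<Longrightarrow> quasi_continuous m (u i)) \<Longrightarrow> quasi_continuous m (\<lambda>x. \<Sum>i\<in>I. u i x)"
  by (induction I rule: infinite_finite_induct) (auto intro: quasi_continuous_add quasi_continuous_const)

text \<open>The complement is the part of the closed set \<open>- A\<close> where the continuous
  restriction is at most \<open>t\<close>, hence closed in the plane.\<close>

lemma open_superlevel:
  fixes v :: "real^2 \<Rightarrow> real"
  assumes "open A" "continuous_on (- A) v" shows "open ({x. \<bar>v x\<bar> > t} \<union> A)"
proof -
  have cl: "closed {x \<in> - A. \<bar>v x\<bar> \<le> t}"
    using assms by (intro continuous_on_closed_Collect_le continuous_intros) auto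
  have eq: "- {x \<in> - A. \<bar>v x\<bar> \<le> t} = {x. \<bar>v x\<bar> > t} \<union> A" by auto
  from open_Compl[OF cl] show ?thesis unfolding eq .
qed

text \<open>Chebyshev's inequality for capacity. The competitor \<open>\<bar>v\<bar> / t\<close> is
  at least 1 on the superlevel set, which need not be open; adding a cheap competitor for the
  exceptional set \<open>A\<close> makes it at least 1 on the open union with
  \<open>A\<close>.\<close>

lemma capacity_superlevel:
  assumes v: "quasi_continuous m v" "sobolev v g" and t: "t > 0"
  shows "capacity m {x. \<bar>v x\<bar> > t} \<le> ereal (2 / t\<^sup>2 * (sq_norm m v + sq_norm m g))"
proof (rule ereal_le_epsilon2)
  fix \<epsilon> :: real assume "\<epsilon> > 0"
  then have "\<epsilon> / 2 > 0" by simp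
  with v(1) obtain A where A: "open A" "capacity m A < ereal (\<epsilon> / 2)" "continuous_on (- A) v"
    unfolding quasi_continuous_def by meson
  obtain w h U where w: "sobolev w h" "AE x in m. 0 \<le> w x" "open U" "A \<subseteq> U" "AE x in m. x \<in> U \<longrightarrow> 1 \<le> w x"
    "sq_norm m w + sq_norm m h < \<epsilon> / 2" by (rule capacity_lessE[OF A(2)])
  let ?v = "\<lambda>x. (1 / t) * \<bar>v x\<bar>" and ?g = "\<lambda>x. (1 / t) *\<^sub>R (sgn (v x) *\<^sub>R g x)"
  have va: "sobolev ?v ?g" by (rule sobolev_scale[OF sobolev_abs(1)[OF v(2)]])
  have nv: "sq_norm m ?v = sq_norm m v / t\<^sup>2" "sq_norm m ?g \<le> sq_norm m g / t\<^sup>2"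
  proof -
    show "sq_norm m ?v = sq_norm m v / t\<^sup>2" by (simp add: sq_norm_def power_divide)
    show "sq_norm m ?g \<le> sq_norm m g / t\<^sup>2"
      unfolding sq_norm_scaleR using sobolev_abs(2)[OF v(2)] t by (simp add: power_divide divide_right_mono)
  qed
  have "capacity m {x. \<bar>v x\<bar> > t} \<le> ereal (sq_norm m (\<lambda>x. ?v x + w x) + sq_norm m (\<lambda>x. ?g x + h x))"
  proof (rule capacity_le[OF sobolev_add[OF va w(1)], where U="{x. \<bar>v x\<bar> > t} \<union> A"])
    show "AE x in m. 0 \<le> ?v x + w x" using w(2) by eventually_elim (use t in simp)
    show "AE x in m. x \<in> {x. \<bar>v x\<bar> > t} \<union> A \<longrightarrow> 1 \<le> ?v x + w x"
      using w(2,5)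
    proof eventually_elim
      case (elim x)
      have "0 \<le> ?v x" "\<bar>v x\<bar> > t \<Longrightarrow> 1 \<le> ?v x" using t by (auto simp: field_simps)
      moreover have "x \<in> A \<Longrightarrow> 1 \<le> w x" using elim w(4) by blast
      ultimately show ?case using elim(1) by (auto intro: add_increasing add_increasing2)
    qed
  qed (use open_superlevel[OF A(1,3)] in auto)
  also have "\<dots> \<le> ereal (2 / t\<^sup>2 * (sq_norm m v + sq_norm m g) + \<epsilon>)"
    using sq_norm_add_le[OF sobolevD(2)[OF va] sobolevD(2)[OF w(1)]]
      sq_norm_add_le[OF sobolevD(3)[OF va] sobolevD(3)[OF w(1)]] w(6) nv by (simp add: distrib_left)
  finally show "capacity m {x. \<bar>v x\<bar> > t} \<le> ereal (2 / t\<^sup>2 * (sq_norm m v + sq_norm m g)) + ereal \<epsilon>" by simp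
qed

text \<open>A fast subsequence converges uniformly off sets of small capacity, by Chebyshev's
  inequality for its increments, and a uniform limit of continuous functions is continuous.\<close>

theorem quasi_continuous_limit:
  assumes v: "\<And>n. quasi_continuous m (v n)" "\<And>n. sobolev (v n) (g n)" and u: "sobolev u h"
    and lim: "(\<lambda>n. sq_norm m (\<lambda>x. v n x - u x)) \<longlonglongrightarrow> 0" "(\<lambda>n. sq_norm m (\<lambda>x. g n x - h x)) \<longlonglongrightarrow> 0"
  obtains w where "quasi_continuous m w" "sobolev w h" "AE x in m. w x = u x"
proof -
  obtain s where s: "strict_mono (s::nat\<Rightarrow>nat)" "AE x in m. (\<lambda>n. v (s n) x) \<longlonglongrightarrow> u x"
    by (rule sq_norm_tendsto_AE_subseq[OF sobolevD(2)[OF v(2)] sobolevD(2)[OF u] lim(1)])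
  define N where "N n = sq_norm m (\<lambda>x. v (s n) x - u x) + sq_norm m (\<lambda>x. g (s n) x - h x)" for n
  have N0: "N \<longlonglongrightarrow> 0"
    unfolding N_def using tendsto_add[OF LIMSEQ_subseq_LIMSEQ[OF lim(1) s(1)] LIMSEQ_subseq_LIMSEQ[OF lim(2) s(1)]]
    by (simp add: o_def)
  \<comment> \<open>The rate \<open>32^(-n)\<close> pays for the factor \<open>4^n\<close> that
    Chebyshev's inequality costs at level \<open>2^(-n)\<close>; the remaining \<open>8^(-n)\<close>
    decays faster than the \<open>4^(-n)\<close> that \<open>capacity_UN\<close> requires.\<close>
  have "\<exists>K. \<forall>k\<ge>K. N k < (1 / 32) ^ n" for n
    using order_tendstoD(2)[OF N0, of "(1 / 32) ^ n"] by (simp add: eventually_sequentially)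
  then obtain K where K: "\<And>n k. k \<ge> K n \<Longrightarrow> N k < (1 / 32) ^ n" by metis
  have "\<exists>r. \<forall>n. r n \<ge> K n \<and> r (Suc n) > r n"
  proof (rule dependent_nat_choice)
    show "\<exists>x. x \<ge> K 0" by blast
    show "\<exists>y. y \<ge> K (Suc n) \<and> y > x" for x n by (intro exI[of _ "max (K (Suc n)) (Suc x)"]) auto
  qed
  then obtain r where r: "\<And>n. r n \<ge> K n" "\<And>n. r (Suc n) > r n" by blast
  then have sr: "strict_mono r" by (simp add: strict_mono_Suc_iff)
  define V where "V n = v (s (r n))" for n
  define G where "G n = g (s (r n))" for n
  have V: "quasi_continuous m (V n)" "sobolev (V n) (G n)" for n unfolding V_def G_def by (rule v)+
  have Vae: "AE x in m. (\<lambda>n. V n x) \<longlonglongrightarrow> u x"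
    using s(2) unfolding V_def by eventually_elim (use LIMSEQ_subseq_LIMSEQ[OF _ sr] in \<open>auto simp: o_def\<close>)
  define D where "D n x = V (Suc n) x - V n x" for n x
  define DG where "DG n x = G (Suc n) x - G n x" for n x
  have D: "quasi_continuous m (D n)" "sobolev (D n) (DG n)" for n
    unfolding D_def DG_def by (intro quasi_continuous_diff sobolev_diff V)+
  have Dn: "sq_norm m (D n) + sq_norm m (DG n) \<le> 4 * (1 / 32) ^ n" for n
  proof -
    let ?a = "\<lambda>n x. V n x - u x" and ?b = "\<lambda>n x. G n x - h x"
    have sa: "sq_integrable m (?a n)" "sq_integrable m (?b n)" for n
      by (intro sq_integrable_diff sobolevD(2)[OF V(2)] sobolevD(2)[OF u] sobolevD(3)[OF V(2)] sobolevD(3)[OF u])+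
    have "sq_norm m (D n) = sq_norm m (\<lambda>x. ?a (Suc n) x + (-1) *\<^sub>R ?a n x)" by (simp add: D_def[abs_def])
    also have "\<dots> \<le> 2 * sq_norm m (?a (Suc n)) + 2 * sq_norm m (\<lambda>x. (-1) *\<^sub>R ?a n x)"
      by (intro sq_norm_add_le sa sq_integrable_scaleR)
    finally have 1: "sq_norm m (D n) \<le> 2 * sq_norm m (?a (Suc n)) + 2 * sq_norm m (?a n)"
      by (simp only: sq_norm_scaleR) simp
    have "sq_norm m (DG n) = sq_norm m (\<lambda>x. ?b (Suc n) x + (-1) *\<^sub>R ?b n x)" by (simp add: DG_def[abs_def])
    also have "\<dots> \<le> 2 * sq_norm m (?b (Suc n)) + 2 * sq_norm m (\<lambda>x. (-1) *\<^sub>R ?b n x)"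
      by (intro sq_norm_add_le sa sq_integrable_scaleR)
    finally have 2: "sq_norm m (DG n) \<le> 2 * sq_norm m (?b (Suc n)) + 2 * sq_norm m (?b n)"
      by (simp only: sq_norm_scaleR) simp
    have "K n \<le> r (Suc n)" using r[of n] by simp
    then have "N (r (Suc n)) < (1 / 32) ^ n" "N (r n) < (1 / 32) ^ n" using K r(1) by auto
    then show ?thesis using 1 2 by (simp add: N_def V_def G_def)
  qed
  define E where "E n = {x. \<bar>D n x\<bar> > (1 / 2) ^ n}" for n
  have capE: "capacity m (E n) \<le> ereal (8 * (1 / 8) ^ n)" for n
  proof -
    have "capacity m (E n) \<le> ereal (2 / ((1 / 2) ^ n)\<^sup>2 * (sq_norm m (D n) + sq_norm m (DG n)))"
      unfolding E_def by (rule capacity_superlevel[OF D]) simp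
    also have "\<dots> \<le> ereal (2 / ((1 / 2) ^ n)\<^sup>2 * (4 * (1 / 32) ^ n))"
      using Dn[of n] by (intro ereal_less_eq(3)[THEN iffD2] mult_left_mono) auto
    also have "2 / ((1 / 2) ^ n)\<^sup>2 * (4 * (1 / 32) ^ n) = 8 * ((1 / 32 :: real) ^ n / ((1 / 2) ^ n * (1 / 2) ^ n))"
      by (simp add: power2_eq_square)
    also have "(1 / 32 :: real) ^ n / ((1 / 2) ^ n * (1 / 2) ^ n) = (1 / 8) ^ n"
      by (simp only: power_mult_distrib[symmetric] power_divide[symmetric]) simp
    finally show ?thesis .
  qed
  \<comment> \<open>Where the sequence diverges, \<open>lim\<close> takes an unspecified value; such
    points lie in each of the exceptional sets constructed below.\<close>
  define w where "w x = lim (\<lambda>n. V n x)" for x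
  have [measurable]: "V n \<in> borel_measurable borel" for n using sobolev_measurable[OF V(2)] by simp
  have wm: "w \<in> borel_measurable borel" unfolding w_def by measurable
  have wu: "AE x in m. w x = u x" using Vae by eventually_elim (simp add: w_def limI)
  have "AE x in m. u x = w x" using wu by eventually_elim simp
  then have sw: "sobolev w h" by (rule sobolev_cong_AE[OF u wm sobolev_measurable(2)[OF u]]) simp
  moreover have "quasi_continuous m w"
    unfolding quasi_continuous_def
  proof (intro allI impI)
    fix \<epsilon> :: real assume \<epsilon>: "\<epsilon> > 0"
    \<comment> \<open>The sets \<open>E k\<close> from index \<open>M\<close> on contribute capacity
      at most \<open>128 * 8^(-M) < \<epsilon> / 8\<close>, the exceptional sets of the
      \<open>V n\<close> less than \<open>\<epsilon> / 4\<close>. Doubled by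
      \<open>capacity_Un\<close>, they add up to at most \<open>\<epsilon>\<close>.\<close>
    obtain M where M: "(1 / 8 :: real) ^ M < \<epsilon> / 1024"
      using real_arch_pow_inv[of "\<epsilon> / 1024" "1 / 8"] \<epsilon> by auto
    have c1: "capacity m (\<Union>n. E (M + n)) \<le> ereal (2 * (64 * (1 / 8) ^ M))"
    proof (rule capacity_UN)
      fix n
      have "capacity m (E (M + n)) \<le> ereal (8 * (1 / 8) ^ (M + n))" by (rule capE)
      also have "\<dots> < ereal (64 * (1 / 8) ^ M * (1 / 4) ^ Suc n)"
      proof -
        have "8 * (1 / 8 :: real) ^ n < 64 * (1 / 4) ^ Suc n"
          using power_mono[of "1 / 8 :: real" "1 / 4" n] by (simp add: field_simps) (smt (verit) zero_less_power)
        then have "(1 / 8) ^ M * (8 * (1 / 8 :: real) ^ n) < (1 / 8) ^ M * (64 * (1 / 4) ^ Suc n)"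
          by (intro mult_strict_left_mono) auto
        then show ?thesis by (simp add: power_add mult_ac)
      qed
      finally show "capacity m (E (M + n)) < ereal (64 * (1 / 8) ^ M * (1 / 4) ^ Suc n)" .
    qed simp
    have "\<exists>A. open A \<and> capacity m A < ereal (\<epsilon> / 16 * (1 / 4) ^ Suc n) \<and> continuous_on (- A) (V n)" for n
    proof -
      have "\<epsilon> / 16 * (1 / 4) ^ Suc n > 0" using \<epsilon> by simp
      then show ?thesis using V(1)[of n] unfolding quasi_continuous_def by blast
    qed
    then obtain A where A: "\<And>n. open (A n)" "\<And>n. capacity m (A n) < ereal (\<epsilon> / 16 * (1 / 4) ^ Suc n)"
      "\<And>n. continuous_on (- A n) (V n)" by metis
    have c2: "capacity m (\<Union>n. A n) \<le> ereal (2 * (\<epsilon> / 16))" by (rule capacity_UN[OF A(2)]) (use \<epsilon> in simp)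
    define O' where "O' = (\<Union>n. E (M + n)) \<union> (\<Union>n. A n)"
    have capO: "capacity m O' < ereal \<epsilon>"
    proof -
      have "capacity m (\<Union>n. E (M + n)) < ereal (\<epsilon> / 8)" using M by (intro le_less_trans[OF c1]) simp
      moreover have "capacity m (\<Union>n. A n) < ereal (\<epsilon> / 4)" using \<epsilon> by (intro le_less_trans[OF c2]) simp
      ultimately have "capacity m O' < ereal (2 * (\<epsilon> / 8) + 2 * (\<epsilon> / 4))" unfolding O'_def by (rule capacity_Un)
      also have "\<dots> \<le> ereal \<epsilon>" using \<epsilon> by simp
      finally show ?thesis .
    qed
    \<comment> \<open>A single \<open>E k\<close> need not be open: the increment \<open>D k\<close>
      is continuous only off the exceptional sets of both \<open>V k\<close> and
      \<open>V (Suc k)\<close>, so these are adjoined before the openness of superlevel sets is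
      used.\<close>
    have openO: "open O'"
    proof -
      have "O' = (\<Union>n. E (M + n) \<union> (A (M + n) \<union> A (Suc (M + n)))) \<union> (\<Union>n. A n)" unfolding O'_def by blast
      moreover have "open (E k \<union> (A k \<union> A (Suc k)))" for k
        unfolding E_def
      proof (rule open_superlevel)
        show "continuous_on (- (A k \<union> A (Suc k))) (D k)"
          unfolding D_def using A(3) by (intro continuous_on_diff) (auto intro: continuous_on_subset)
      qed (use A(1) in auto)
      ultimately show ?thesis using A(1) by auto
    qed
    have contV: "continuous_on (- O') (V n)" for n
      by (rule continuous_on_subset[OF A(3)[of n]]) (auto simp: O'_def)
    have small: "norm (D (M + k) x) \<le> (1 / 2) ^ (M + k)" if "x \<in> - O'" for x k
    proof -
      have "x \<notin> E (M + k)" using that unfolding O'_def by blast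
      then show ?thesis by (simp add: E_def)
    qed
    have ul: "uniform_limit (- O') (\<lambda>n x. \<Sum>k<n. D (M + k) x) (\<lambda>x. \<Sum>k. D (M + k) x) sequentially"
    proof (rule Weierstrass_m_test[OF small])
      have "summable (\<lambda>k. (1 / 2 :: real) ^ M * (1 / 2) ^ k)" by (intro summable_mult summable_geometric) simp
      then show "summable (\<lambda>k. (1 / 2 :: real) ^ (M + k))" by (simp add: power_add)
    qed
    have VS: "V (M + n) x = V M x + (\<Sum>k<n. D (M + k) x)" for n x
      by (induction n) (simp_all add: D_def)
    have weq: "w x = V M x + (\<Sum>k. D (M + k) x)" if "x \<in> - O'" for x
    proof -
      have "(\<lambda>n. V M x + (\<Sum>k<n. D (M + k) x)) \<longlonglongrightarrow> V M x + (\<Sum>k. D (M + k) x)"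
        by (intro tendsto_intros tendsto_uniform_limitI[OF ul that])
      then have "(\<lambda>n. V (n + M) x) \<longlonglongrightarrow> V M x + (\<Sum>k. D (M + k) x)" by (simp add: VS add.commute[of _ M])
      then have "(\<lambda>n. V n x) \<longlonglongrightarrow> V M x + (\<Sum>k. D (M + k) x)" by (rule LIMSEQ_offset)
      then show ?thesis by (simp add: w_def limI)
    qed
    have cD: "continuous_on (- O') (\<lambda>x. \<Sum>k. D (M + k) x)"
    proof (rule uniform_limit_theorem[OF _ ul])
      show "\<forall>\<^sub>F n in sequentially. continuous_on (- O') (\<lambda>x. \<Sum>k<n. D (M + k) x)"
        unfolding D_def by (intro always_eventually allI continuous_intros contV)
    qed simp
    have "continuous_on (- O') w \<longleftrightarrow> continuous_on (- O') (\<lambda>x. V M x + (\<Sum>k. D (M + k) x))"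
      by (rule continuous_on_cong[OF refl weq])
    with continuous_on_add[OF contV[of M] cD] have "continuous_on (- O') w" by simp
    with openO capO show "\<exists>A. open A \<and> capacity m A < ereal \<epsilon> \<and> continuous_on (- A) w" by blast
  qed
  ultimately show thesis using wu that by blast
qed

end

subsection \<open>Compactness\<close>

lemma diagonal_convergent_subsequence:
  fixes f :: "nat \<Rightarrow> nat \<Rightarrow> real"
  assumes b: "\<And>k. \<exists>B. \<forall>n. \<bar>f n k\<bar> \<le> B"
  obtains r :: "nat \<Rightarrow> nat" where "strict_mono r" "\<And>k. convergent (\<lambda>n. f (r n) k)"
proof -
  interpret subseqs "\<lambda>k s. convergent (\<lambda>n. f (s n) k)"
  proof
    fix k and s :: "nat \<Rightarrow> nat" assume "strict_mono s"
    obtain B where "\<forall>n. \<bar>f n k\<bar> \<le> B" using b by blast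
    then have "bounded (range (\<lambda>n. f (s n) k))" by (auto simp: bounded_iff)
    from bounded_imp_convergent_subsequence[OF this]
    show "\<exists>r'. strict_mono r' \<and> convergent (\<lambda>n. f ((s \<circ> r') n) k)" by (auto simp: convergent_def o_def)
  qed
  have "convergent (\<lambda>n. f (diagseq n) k)" for k
  proof -
    have "convergent (\<lambda>n. f ((diagseq \<circ> (+) (Suc k)) n) k)"
    proof (rule diagseq_holds)
      fix r s :: "nat \<Rightarrow> nat" and n
      assume "strict_mono r" "convergent (\<lambda>i. f (s i) n)"
      then show "convergent (\<lambda>i. f ((s \<circ> r) i) n)"
        using convergent_subseq_convergent[of "\<lambda>i. f (s i) n" r] by (simp add: o_def)
    qed
    then have "convergent (\<lambda>n. f (diagseq (n + Suc k)) k)" by (simp add: o_def add.commute)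
    then show ?thesis by (simp only: convergent_ignore_initial_segment[of "\<lambda>n. f (diagseq n) k" "Suc k"])
  qed
  with subseq_diagseq show thesis by (rule that)
qed

text \<open>Doubling the variables, the mean oscillation on a convex cell is an average of
  translation differences.\<close>

lemma poincare_cell:
  assumes wg: "has_weak_gradient w g" and C: "convex C" and [measurable]: "C \<in> sets borel"
    and h: "h > 0" and diam: "\<And>x y i. x \<in> C \<Longrightarrow> y \<in> C \<Longrightarrow> \<bar>y $ i - x $ i\<bar> \<le> h"
    and fin: "emeasure lborel C < \<infinity>" and w2: "integrable lborel (\<lambda>x. indicator C x * (w x)\<^sup>2)"
    and g2: "integrable lborel (\<lambda>x. indicator C x * (norm (g x))\<^sup>2)"
  shows "measure lborel C * (LINT x|lborel. indicator C x * (w x)\<^sup>2)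
    \<le> (LINT x|lborel. indicator C x * w x)\<^sup>2 + 4 * h ^ 4 * (LINT x|lborel. indicator C x * (norm (g x))\<^sup>2)"
proof -
  have [measurable]: "w \<in> borel_measurable borel" "g \<in> borel_measurable borel"
    using wg by (auto simp: has_weak_gradient_def intro: locally_integrable_measurable)
  define W :: "(real^2) set" where "W = cbox (\<chi> i. - h) (\<chi> i. h)"
  have [measurable]: "W \<in> sets borel" by (simp add: W_def)
  define \<mu> where "\<mu> = measure lborel C"
  define Q where "Q = (LINT x|lborel. indicator C x * (w x)\<^sup>2)"
  define S where "S = (LINT x|lborel. indicator C x * w x)"
  define G where "G = (LINT x|lborel. indicator C x * (norm (g x))\<^sup>2)"
  have iC: "integrable lborel (indicator C :: real^2 \<Rightarrow> real)" using fin by (intro integrable_real_indicator) auto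
  have w1: "integrable lborel (\<lambda>x. indicator C x * w x)"
  proof (rule Bochner_Integration.integrable_bound)
    show "integrable lborel (\<lambda>x. indicator C x + indicator C x * (w x)\<^sup>2)" using iC w2 by (rule Bochner_Integration.integrable_add)
    have "\<bar>t\<bar> \<le> 1 + t\<^sup>2" for t :: real
    proof -
      have "2 * \<bar>t\<bar> \<le> 1 + t\<^sup>2" using sum_squares_bound[of 1 "\<bar>t\<bar>"] by simp
      then show ?thesis using abs_ge_zero[of t] by linarith
    qed
    then show "AE x in lborel. norm (indicator C x * w x) \<le> norm (indicator C x + indicator C x * (w x)\<^sup>2)"
      by (intro AE_I2) (auto simp: indicator_def)
  qed measurable
  have G0: "G \<ge> 0" unfolding G_def by (intro integral_nonneg_AE) auto
  let ?k = "\<lambda>x y. indicator C x * indicator C y * (w y - w x)\<^sup>2"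
  have inner: "(\<integral>\<^sup>+x. ennreal (?k x y) \<partial>lborel) = ennreal (indicator C y * (\<mu> * (w y)\<^sup>2 - 2 * w y * S + Q))" for y
  proof (cases "y \<in> C")
    case True
    have eq: "?k x y = (w y)\<^sup>2 * indicator C x - 2 * w y * (indicator C x * w x) + indicator C x * (w x)\<^sup>2" for x
      using True by (simp add: power2_diff algebra_simps)
    have i: "integrable lborel (\<lambda>x. ?k x y)"
      unfolding eq by (intro Bochner_Integration.integrable_add Bochner_Integration.integrable_diff integrable_mult_right iC w1 w2)
    have "(LINT x|lborel. ?k x y) = (w y)\<^sup>2 * \<mu> - 2 * w y * S + Q"
      unfolding eq using iC w1 w2 by (simp add: \<mu>_def S_def Q_def)
    then show ?thesis using True by (subst nn_integral_eq_integral[OF i]) (auto simp: mult.commute)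
  qed simp
  \<comment> \<open>Expanding the square of the difference and integrating in both variables gives
    twice the quantity \<open>\<mu> * Q - S^2\<close> to be bounded.\<close>
  have "ennreal (2 * \<mu> * Q - 2 * S\<^sup>2) = (\<integral>\<^sup>+y. \<integral>\<^sup>+x. ennreal (?k x y) \<partial>lborel \<partial>lborel)"
  proof -
    have eq: "indicator C y * (\<mu> * (w y)\<^sup>2 - 2 * w y * S + Q) = \<mu> * (indicator C y * (w y)\<^sup>2) - 2 * S * (indicator C y * w y) + Q * indicator C y" for y
      by (simp add: algebra_simps)
    have i: "integrable lborel (\<lambda>y. indicator C y * (\<mu> * (w y)\<^sup>2 - 2 * w y * S + Q))"
      unfolding eq by (intro Bochner_Integration.integrable_add Bochner_Integration.integrable_diff integrable_mult_right iC w1 w2)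
    have nn: "0 \<le> indicator C y * (\<mu> * (w y)\<^sup>2 - 2 * w y * S + Q)" for y
    proof (cases "y \<in> C")
      case True
      have eq2: "?k x y = (w y)\<^sup>2 * indicator C x - 2 * w y * (indicator C x * w x) + indicator C x * (w x)\<^sup>2" for x
        using True by (simp add: power2_diff algebra_simps)
      have "0 \<le> (LINT x|lborel. ?k x y)" by (intro integral_nonneg_AE) auto
      also have "\<dots> = (w y)\<^sup>2 * \<mu> - 2 * w y * S + Q"
        unfolding eq2 using iC w1 w2 by (simp add: \<mu>_def S_def Q_def)
      finally show ?thesis using True by (simp add: mult.commute)
    qed simp
    have "(LINT y|lborel. indicator C y * (\<mu> * (w y)\<^sup>2 - 2 * w y * S + Q)) = \<mu> * Q - 2 * S * S + Q * \<mu>"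
      unfolding eq using iC w1 w2 by (simp add: \<mu>_def S_def Q_def)
    then have int: "(LINT y|lborel. indicator C y * (\<mu> * (w y)\<^sup>2 - 2 * w y * S + Q)) = 2 * \<mu> * Q - 2 * S\<^sup>2"
      by (simp add: power2_eq_square)
    show ?thesis unfolding inner by (subst nn_integral_eq_integral[OF i nn[THEN AE_I2]]) (simp only: int)
  qed
  also have "\<dots> = (\<integral>\<^sup>+x. \<integral>\<^sup>+y. ennreal (?k x y) \<partial>lborel \<partial>lborel)"
    by (rule lborel_pair.Fubini') measurable
  also have "\<dots> = (\<integral>\<^sup>+x. \<integral>\<^sup>+v. ennreal (?k x (v + x)) \<partial>lborel \<partial>lborel)"
    by (intro nn_integral_cong nn_integral_lborel_translate[symmetric]) measurable
  also have "\<dots> = (\<integral>\<^sup>+v. \<integral>\<^sup>+x. ennreal (?k x (v + x)) \<partial>lborel \<partial>lborel)"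
    by (rule lborel_pair.Fubini') measurable
  \<comment> \<open>Two points of the cell differ by a vector of the square \<open>W\<close>, of
    area \<open>4 * h^2\<close>, on which \<open>(norm v)^2 \<le> 2 * h^2\<close>. The product
    \<open>8 * h^4\<close>, halved at the end, is the constant of the lemma.\<close>
  also have "\<dots> \<le> (\<integral>\<^sup>+v. indicator W v * ennreal (2 * h\<^sup>2 * G) \<partial>lborel)"
  proof (rule nn_integral_mono)
    fix v :: "real^2"
    show "(\<integral>\<^sup>+x. ennreal (?k x (v + x)) \<partial>lborel) \<le> indicator W v * ennreal (2 * h\<^sup>2 * G)"
    proof (cases "v \<in> W")
      case True
      have nv: "(norm v)\<^sup>2 \<le> 2 * h\<^sup>2"
      proof -
        have "(norm v)\<^sup>2 = (\<Sum>i\<in>UNIV. (v $ i)\<^sup>2)" by (simp add: norm_vec_def L2_set_def sum_nonneg)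
        also have "\<dots> \<le> (\<Sum>i\<in>(UNIV::2 set). h\<^sup>2)"
          using True h by (intro sum_mono abs_le_square_iff[THEN iffD1]) (auto simp: W_def mem_box_cart abs_le_iff minus_le_iff)
        finally show ?thesis by simp
      qed
      have "(\<integral>\<^sup>+x. ennreal (?k x (v + x)) \<partial>lborel) = (\<integral>\<^sup>+x. indicator C x * indicator C (x + v) * ennreal ((w (x + v) - w x)\<^sup>2) \<partial>lborel)"
        by (intro nn_integral_cong) (auto simp: indicator_def add.commute)
      also have "\<dots> \<le> ennreal ((norm v)\<^sup>2) * (\<integral>\<^sup>+x. indicator C x * ennreal ((norm (g x))\<^sup>2) \<partial>lborel)"
        by (rule weak_gradient_shift_convex[OF wg C]) measurable
      also have "(\<integral>\<^sup>+x. indicator C x * ennreal ((norm (g x))\<^sup>2) \<partial>lborel) = ennreal G"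
        unfolding G_def by (subst nn_integral_eq_integral[OF g2, symmetric]) (auto intro!: nn_integral_cong simp: indicator_def)
      also have "ennreal ((norm v)\<^sup>2) * ennreal G \<le> ennreal (2 * h\<^sup>2 * G)"
        using nv G0 by (subst ennreal_mult[symmetric]) (auto intro!: ennreal_leI mult_right_mono)
      finally show ?thesis using True by simp
    next
      case False
      have z0: "?k x (v + x) = 0" for x
      proof (rule ccontr)
        assume "?k x (v + x) \<noteq> 0"
        then have "x \<in> C" "v + x \<in> C" by (auto simp: indicator_def split: if_splits)
        then have "\<bar>v $ i\<bar> \<le> h" for i using diam[of x "v + x" i] by simp
        then have "v \<in> W" by (auto simp: W_def mem_box_cart abs_le_iff minus_le_iff)
        with False show False by simp
      qed
      show ?thesis by (simp only: z0) simp
    qed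
  qed
  also have "\<dots> = ennreal (2 * h\<^sup>2 * G) * emeasure lborel W"
    by (simp add: mult.commute[of _ "ennreal _"] nn_integral_cmult_indicator)
  also have "emeasure lborel W = ennreal (4 * h\<^sup>2)"
  proof -
    have "measure lborel W = (\<Prod>i\<in>(UNIV::2 set). h - - h)"
      unfolding W_def using h by (subst content_cbox_cart) (auto simp: interval_ne_empty_cart)
    also have "\<dots> = 4 * h\<^sup>2" by (simp add: power2_eq_square)
    finally show ?thesis
      using emeasure_lborel_cbox_finite[of "\<chi> i. - h" "\<chi> i. h :: real^2"] by (subst emeasure_eq_ennreal_measure) (auto simp: W_def)
  qed
  finally have "ennreal (2 * \<mu> * Q - 2 * S\<^sup>2) \<le> ennreal (2 * h\<^sup>2 * G) * ennreal (4 * h\<^sup>2)" .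
  also have "\<dots> = ennreal (2 * h\<^sup>2 * G * (4 * h\<^sup>2))" using G0 by (intro ennreal_mult[symmetric]) auto
  finally have "ennreal (2 * \<mu> * Q - 2 * S\<^sup>2) \<le> ennreal (2 * h\<^sup>2 * G * (4 * h\<^sup>2))" .
  moreover have "0 \<le> 2 * h\<^sup>2 * G * (4 * h\<^sup>2)" using G0 by (intro mult_nonneg_nonneg) auto
  ultimately have "2 * \<mu> * Q - 2 * S\<^sup>2 \<le> 2 * h\<^sup>2 * G * (4 * h\<^sup>2)" by (simp only: ennreal_le_iff)
  then have "\<mu> * Q \<le> S\<^sup>2 + 4 * h ^ 4 * G" by (simp add: power2_eq_square power4_eq_xxxx algebra_simps)
  then show ?thesis by (simp add: \<mu>_def Q_def S_def G_def)
qed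

section \<open>Grid cells of mesh \<open>1 / N\<close>\<close>

definition grid_cell :: "nat \<Rightarrow> int \<times> int \<Rightarrow> (real^2) set" where
  "grid_cell N j = {x. \<lfloor>real N * x $ 1\<rfloor> = fst j \<and> \<lfloor>real N * x $ 2\<rfloor> = snd j}"

lemma grid_cell_eq:
  "grid_cell N j = {x. axis 1 (real N) \<bullet> x \<ge> fst j} \<inter> {x. axis 1 (real N) \<bullet> x < fst j + 1} \<inter>
     {x. axis 2 (real N) \<bullet> x \<ge> snd j} \<inter> {x. axis 2 (real N) \<bullet> x < snd j + 1}"
  by (auto simp: grid_cell_def inner_axis' floor_eq_iff)

lemma grid_cell_convex: "convex (grid_cell N j)"
  unfolding grid_cell_eq by (intro convex_Int convex_halfspace_ge convex_halfspace_lt)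

lemma grid_cell_borel [measurable]: "grid_cell N j \<in> sets borel"
  unfolding grid_cell_eq by measurable

lemma grid_cell_diam:
  assumes N: "N > 0" and "x \<in> grid_cell N j" "y \<in> grid_cell N j" shows "\<bar>y $ i - x $ i\<bar> \<le> 1 / real N"
proof -
  have "\<bar>real N * y $ i - real N * x $ i\<bar> \<le> 1"
    using assms(2,3) exhaust_2[of i] by (auto simp: grid_cell_def floor_eq_iff abs_le_iff)
  then have "real N * \<bar>y $ i - x $ i\<bar> \<le> 1" by (simp add: abs_mult right_diff_distrib[symmetric])
  then show ?thesis using N by (simp add: field_simps)
qed

lemma grid_cell_bounded:
  assumes N: "N > 0" and x: "x \<in> grid_cell N j" shows "norm x \<le> \<bar>real_of_int (fst j)\<bar> + \<bar>real_of_int (snd j)\<bar> + 2"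
proof -
  have b: "\<bar>t\<bar> \<le> \<bar>real_of_int k\<bar> + 1" if "\<lfloor>real N * t\<rfloor> = k" for t k
  proof -
    have "\<bar>t\<bar> \<le> real N * \<bar>t\<bar>" using N by (simp add: mult_left_le_one_le mult_le_cancel_right1)
    also have "\<dots> = \<bar>real N * t\<bar>" by (simp add: abs_mult)
    also have "\<dots> \<le> \<bar>real_of_int k\<bar> + 1" using that by (simp add: floor_eq_iff) linarith
    finally show ?thesis .
  qed
  have "norm x \<le> (\<Sum>i\<in>UNIV. \<bar>x $ i\<bar>)" by (rule norm_le_l1_cart)
  also have "\<dots> = \<bar>x $ 1\<bar> + \<bar>x $ 2\<bar>" by (simp add: sum_2)
  also have "\<dots> \<le> (\<bar>real_of_int (fst j)\<bar> + 1) + (\<bar>real_of_int (snd j)\<bar> + 1)"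
    using x by (intro add_mono b) (auto simp: grid_cell_def)
  finally show ?thesis by simp
qed

lemma grid_cell_measure:
  assumes N: "N > 0"
  shows "emeasure lborel (grid_cell N j) < \<infinity>" "(1 / real N)\<^sup>2 \<le> measure lborel (grid_cell N j)"
proof -
  have "bounded (grid_cell N j)" using grid_cell_bounded[OF N, of _ j] unfolding bounded_iff by blast
  then show fin: "emeasure lborel (grid_cell N j) < \<infinity>" by (rule emeasure_bounded_finite)
  define l :: "real^2" where "l = (\<chi> i. if i = 1 then real_of_int (fst j) / N else real_of_int (snd j) / N)"
  define r :: "real^2" where "r = (\<chi> i. if i = 1 then (real_of_int (fst j) + 1) / N else (real_of_int (snd j) + 1) / N)"
  have sub: "box l r \<subseteq> grid_cell N j"
  proof
    fix x assume "x \<in> box l r"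
    then have "l $ 1 < x $ 1" "x $ 1 < r $ 1" "l $ 2 < x $ 2" "x $ 2 < r $ 2" by (auto simp: mem_box_cart)
    then show "x \<in> grid_cell N j" using N by (auto simp: l_def r_def grid_cell_def floor_eq_iff field_simps)
  qed
  have le: "l $ i \<le> r $ i" for i using N by (auto simp: l_def r_def field_simps)
  have "measure lborel (box l r) = measure lborel (cbox l r)" by (simp add: measure_lborel_box_eq measure_lborel_cbox_eq)
  also have "\<dots> = (\<Prod>i\<in>UNIV. r $ i - l $ i)"
    using le by (intro content_cbox_cart) (auto simp: interval_ne_empty_cart)
  also have "\<dots> = (1 / real N)\<^sup>2" by (simp add: UNIV_2 l_def r_def power2_eq_square add_divide_distrib)
  finally have "(1 / real N)\<^sup>2 = measure lborel (box l r)" by simp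
  also have "\<dots> \<le> measure lborel (grid_cell N j)"
    using fin sub by (intro measure_mono_fmeasurable) (auto simp: fmeasurable_def)
  finally show "(1 / real N)\<^sup>2 \<le> measure lborel (grid_cell N j)" .
qed

text \<open>Half-open cells partition the plane, so only the cell indexed by the two floors can
  contribute.\<close>

lemma sum_indicator_grid_cell:
  assumes "finite J"
  shows "(\<Sum>j\<in>J. indicator (grid_cell N j) x * (c::real)) = (if (\<lfloor>real N * x $ 1\<rfloor>, \<lfloor>real N * x $ 2\<rfloor>) \<in> J then c else 0)"
proof -
  have "(\<Sum>j\<in>J. indicator (grid_cell N j) x * c) = (\<Sum>j\<in>J. if j = (\<lfloor>real N * x $ 1\<rfloor>, \<lfloor>real N * x $ 2\<rfloor>) then c else 0)"
    by (intro sum.cong) (auto simp: grid_cell_def indicator_def)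
  then show ?thesis using assms by simp
qed

lemma locally_integrable_cballI:
  fixes f :: "real^2 \<Rightarrow> real"
  assumes "f \<in> borel_measurable borel" "\<And>R. integrable lborel (\<lambda>x. indicator (cball 0 R) x * h x)" "\<And>x. \<bar>f x\<bar> \<le> h x"
  shows "locally_integrable f"
  unfolding locally_integrable_def set_integrable_def
proof (intro allI impI)
  fix S :: "(real^2) set" assume S: "compact S"
  note assms(1)[measurable]
  have [measurable]: "S \<in> sets borel" using S by (rule borel_compact)
  obtain R where R: "S \<subseteq> cball 0 R"
    using compact_imp_bounded[OF S] bounded_subset_ballD ball_subset_cball by (metis order_trans)
  show "integrable lborel (\<lambda>x. indicator S x *\<^sub>R f x)"
  proof (rule Bochner_Integration.integrable_bound[OF assms(2)[of R]])
    show "AE x in lborel. norm (indicator S x *\<^sub>R f x) \<le> norm (indicator (cball 0 R) x * h x)"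
      using R assms(3) by (intro AE_I2) (auto simp: indicator_def intro: order_trans[OF _ abs_ge_self])
  qed measurable
qed

section \<open>Second moments from the drift of the density\<close>

lemma has_derivative_C1:
  assumes "\<And>x. (f has_derivative (\<lambda>h. \<Sum>i\<in>UNIV. h $ i * D i x)) (at x)" "\<And>i. continuous_on UNIV (D i)"
  shows "f differentiable at x" "partial_deriv i f = D i" "continuous_on UNIV (partial_deriv i f)"
proof -
  show "f differentiable at x" using assms(1) by (rule differentiableI)
  show "partial_deriv i f = D i"
  proof
    fix x
    show "partial_deriv i f x = D i x"
      by (subst partial_deriv_eq[OF assms(1)]) (simp add: axis_def if_distrib[of "\<lambda>t. t * _"] cong: if_cong)
  qed
  then show "continuous_on UNIV (partial_deriv i f)" using assms(2) by simp
qed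

text \<open>Squaring makes the positive part differentiable at 0; this is why the cut-off of the
  moment estimate enters through its square.\<close>

lemma pos_part_sq_has_derivative: "((\<lambda>t. (max 0 t)\<^sup>2) has_real_derivative 2 * max 0 t) (at (t::real))"
proof -
  consider "t > 0" | "t < 0" | "t = 0" by linarith
  then show ?thesis
  proof cases
    case 1
    have "((\<lambda>t. t\<^sup>2) has_real_derivative 2 * max 0 t) (at t)" using 1 by (auto intro!: derivative_eq_intros)
    then show ?thesis by (rule has_field_derivative_transform_within_open[where S="{0<..}"]) (use 1 in auto)
  next
    case 2
    have "((\<lambda>t. 0) has_real_derivative 2 * max 0 t) (at t)" using 2 by simp
    then show ?thesis by (rule has_field_derivative_transform_within_open[where S="{..<0}"]) (use 2 in auto)
  next
    case 3
    have "((\<lambda>h. (max 0 h)\<^sup>2 / h) \<longlongrightarrow> 0) (at (0::real))"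
    proof (rule Lim_null_comparison)
      show "\<forall>\<^sub>F h in at 0. norm ((max 0 h)\<^sup>2 / h) \<le> \<bar>h\<bar>" for h :: real
        by (intro always_eventually) (auto simp: max_def power2_eq_square)
      show "((\<lambda>h. \<bar>h\<bar>) \<longlongrightarrow> 0) (at (0::real))" by (intro tendsto_rabs_zero tendsto_ident_at)
    qed
    with 3 show ?thesis by (simp add: has_field_derivative_iff)
  qed
qed

text \<open>For a Gaussian density with mean \<open>a\<close> and covariance \<open>S\<close> the
  left side of \<open>drift\<close> equals minus the quadratic form of the inverse of
  \<open>S\<close> at \<open>x - a\<close>, times \<open>\<rho> x\<close>. So \<open>lam\<close> may
  be any positive lower bound of that form on unit vectors.\<close>

locale gaussian_plane = weighted_plane m \<rho> for m \<rho> +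
  fixes a :: "real^2" and lam :: real
  assumes \<rho>_diff: "\<And>x. \<rho> differentiable at x" and \<rho>_C1: "\<And>i. continuous_on UNIV (partial_deriv i \<rho>)"
    and lam: "lam > 0"
    and drift: "\<And>x. (\<Sum>i\<in>UNIV. (x - a) $ i * partial_deriv i \<rho> x) \<le> - lam * (norm (x - a))\<^sup>2 * \<rho> x"
begin

text \<open>Integration by parts against the field \<open>(x - a) \<rho>\<close>, cut off at radius \<open>R\<close>.\<close>

lemma second_moment_cutoff:
  assumes u: "sobolev u g" and R: "R > 0"
  shows "sq_integrable m (\<lambda>x. norm (x - a) * max 0 (1 - (norm (x - a))\<^sup>2 / R\<^sup>2) * u x)"
    "sq_norm m (\<lambda>x. norm (x - a) * max 0 (1 - (norm (x - a))\<^sup>2 / R\<^sup>2) * u x) \<le> 4 / lam * sq_norm m u + 4 / lam\<^sup>2 * sq_norm m g"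
proof -
  note [measurable] = sobolev_measurable[OF u]
  define p where "p x = max 0 (1 - (norm (x - a))\<^sup>2 / R\<^sup>2)" for x
  define c where "c = 1 / R\<^sup>2"
  have c: "c \<ge> 0" by (simp add: c_def)
  \<comment> \<open>The field \<open>(x - a) * \<rho> * p^2\<close>, by components;
    \<open>D i j\<close> are its classical partial derivatives, the last summand stemming from the
    cut-off.\<close>
  define \<psi> where "\<psi> i x = (x - a) $ i * \<rho> x * (p x)\<^sup>2" for i x
  define D where "D i j x = (if j = i then 1 else 0) * \<rho> x * (p x)\<^sup>2 + (x - a) $ i * partial_deriv j \<rho> x * (p x)\<^sup>2
     + (x - a) $ i * \<rho> x * (2 * p x * (- 2 * (x - a) $ j * c))" for i j x
  have pm[measurable]: "p \<in> borel_measurable borel" unfolding p_def by measurable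
  have pc: "continuous_on UNIV p" unfolding p_def by (intro continuous_intros) (use R in auto)
  have p01: "0 \<le> p x" "p x \<le> 1" for x using R by (auto simp: p_def)
  define R' where "R' = norm a + R"
  have p0: "p x = 0" if "x \<notin> cball 0 R'" for x
  proof -
    have "norm (x - a) > R" using that norm_triangle_sub[of x a] by (simp add: R'_def)
    then have "R\<^sup>2 \<le> (norm (x - a))\<^sup>2" using R by (intro power_mono) auto
    then show ?thesis using R by (simp add: p_def field_simps)
  qed
  have der: "(\<psi> i has_derivative (\<lambda>h. \<Sum>j\<in>UNIV. h $ j * D i j x)) (at x)" for i x
  proof -
    have d1: "((\<lambda>x. (x - a) $ i) has_derivative (\<lambda>h. h $ i)) (at x)"
      by (auto intro!: derivative_eq_intros bounded_linear.has_derivative[OF bounded_linear_vec_nth])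
    have d2: "(\<rho> has_derivative (\<lambda>h. \<Sum>j\<in>UNIV. h $ j * partial_deriv j \<rho> x)) (at x)"
      by (rule has_derivative_partials[OF \<rho>_diff])
    have d3: "((\<lambda>x. 1 - (norm (x - a))\<^sup>2 * c) has_derivative (\<lambda>h. - (2 * ((x - a) \<bullet> h) * c))) (at x)"
      unfolding power2_norm_eq_inner by (auto intro!: derivative_eq_intros simp: inner_commute algebra_simps)
    have d4: "((\<lambda>x. (p x)\<^sup>2) has_derivative (\<lambda>h. 2 * p x * (- (2 * ((x - a) \<bullet> h) * c)))) (at x)"
      using has_derivative_compose[OF d3 pos_part_sq_has_derivative[THEN has_field_derivative_imp_has_derivative]]
      by (simp add: p_def c_def)
    show ?thesis
      unfolding \<psi>_def
      by (rule has_derivative_eq_rhs[OF has_derivative_mult[OF has_derivative_mult[OF d1 d2] d4]])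
         (use exhaust_2[of i] in \<open>auto simp: D_def fun_eq_iff inner_vec_def UNIV_2 algebra_simps\<close>)
  qed
  have Dc: "continuous_on UNIV (D i j)" for i j
    unfolding D_def by (intro continuous_intros \<rho>_cont \<rho>_C1 pc)
  note C1 = has_derivative_C1[OF der Dc]
  have D0: "D i j x = 0" if "x \<notin> cball 0 R'" for i j x using p0[OF that] by (simp add: D_def)
  have \<psi>0: "\<psi> i x = 0" if "x \<notin> cball 0 R'" for i x using p0[OF that] by (simp add: \<psi>_def)
  have \<psi>c: "continuous_on UNIV (\<psi> i)" for i unfolding \<psi>_def by (intro continuous_intros \<rho>_cont pc)
  have [measurable]: "D i j \<in> borel_measurable borel" "\<psi> i \<in> borel_measurable borel" for i j
    by (intro borel_measurable_continuous_onI Dc \<psi>c)+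
  \<comment> \<open>The chain rule with \<open>F t = t^2\<close> transfers the divergence of the
    field to the square of \<open>u\<close>.\<close>
  have parts: "(LINT x|lborel. (u x)\<^sup>2 * D i i x) = - (LINT x|lborel. 2 * u x * g x $ i * \<psi> i x)" for i
  proof -
    have "(LINT x|lborel. (\<lambda>t. t\<^sup>2) (u x) * partial_deriv i (\<psi> i) x) = - (LINT x|lborel. (\<lambda>t. 2 * t) (u x) * g x $ i * \<psi> i x)"
    proof (rule weak_chain_rule[OF sobolevD(1)[OF u] sobolev_local[OF u], where L=2 and R=R'])
      show "((\<lambda>t. t\<^sup>2) has_real_derivative 2 * t) (at t)" for t :: real by (auto intro!: derivative_eq_intros)
      show "\<bar>2 * s - 2 * t\<bar> \<le> 2 * \<bar>s - t\<bar>" for s t :: real by (auto simp: abs_if)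
      show "\<psi> i differentiable at x" for x by (rule C1(1))
      show "continuous_on UNIV (partial_deriv j (\<psi> i))" for j by (rule C1(3))
      show "\<psi> i x = 0" if "x \<notin> cball 0 R'" for x using that by (rule \<psi>0)
    qed
    then show ?thesis by (simp add: C1(2))
  qed
  have lu: "locally_integrable (\<lambda>x. (u x)\<^sup>2)"
    by (rule locally_integrable_cballI[OF _ sobolev_local(1)[OF u]]) auto
  have lug: "locally_integrable (\<lambda>x. 2 * u x * g x $ i)" for i
  proof (rule locally_integrable_cballI[where h="\<lambda>x. (u x)\<^sup>2 + (norm (g x))\<^sup>2"])
    show "integrable lborel (\<lambda>x. indicator (cball 0 R) x * ((u x)\<^sup>2 + (norm (g x))\<^sup>2))" for R
      using sobolev_local[OF u, of R] by (simp add: distrib_left)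
    fix x
    have "\<bar>2 * u x * g x $ i\<bar> \<le> 2 * \<bar>u x\<bar> * norm (g x)"
      by (auto simp: abs_mult intro!: mult_left_mono component_le_norm_cart)
    also have "\<dots> \<le> (u x)\<^sup>2 + (norm (g x))\<^sup>2" using sum_squares_bound[of "\<bar>u x\<bar>" "norm (g x)"] by simp
    finally show "\<bar>2 * u x * g x $ i\<bar> \<le> (u x)\<^sup>2 + (norm (g x))\<^sup>2" .
  qed measurable
  have i1: "integrable lborel (\<lambda>x. (u x)\<^sup>2 * D i i x)" for i
  proof -
    obtain B where "\<And>x. \<bar>D i i x\<bar> \<le> B" using continuous_compact_support_bounded[OF Dc D0] by blast
    then show ?thesis by (intro integrable_locally_integrable_mult[OF lu _ _ D0]) auto
  qed
  have i2: "integrable lborel (\<lambda>x. 2 * u x * g x $ i * \<psi> i x)" for i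
  proof -
    obtain B where "\<And>x. \<bar>\<psi> i x\<bar> \<le> B" using continuous_compact_support_bounded[OF \<psi>c \<psi>0] by blast
    then show ?thesis by (intro integrable_locally_integrable_mult[OF lug _ _ \<psi>0]) auto
  qed
  let ?f = "\<lambda>x. norm (x - a) * p x * u x"
  have i3: "integrable lborel (\<lambda>x. (u x)\<^sup>2 * ((norm (x - a))\<^sup>2 * \<rho> x * (p x)\<^sup>2))"
  proof -
    have cc: "continuous_on UNIV (\<lambda>x. (norm (x - a))\<^sup>2 * \<rho> x * (p x)\<^sup>2)" by (intro continuous_intros \<rho>_cont pc)
    have z: "x \<notin> cball 0 R' \<Longrightarrow> (norm (x - a))\<^sup>2 * \<rho> x * (p x)\<^sup>2 = 0" for x using p0 by simp
    obtain B where "\<And>x. \<bar>(norm (x - a))\<^sup>2 * \<rho> x * (p x)\<^sup>2\<bar> \<le> B" using continuous_compact_support_bounded[OF cc z] by blast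
    then show ?thesis by (intro integrable_locally_integrable_mult[OF lu _ _ z]) auto
  qed
  have f2: "\<rho> x * (?f x)\<^sup>2 = (u x)\<^sup>2 * ((norm (x - a))\<^sup>2 * \<rho> x * (p x)\<^sup>2)" for x
    using p01[of x] by (simp add: power_mult_distrib)
  have fs: "sq_integrable m ?f"
    unfolding sq_integrable_def using i3 by (simp add: integrable_m f2)
  have fn: "sq_norm m ?f = (LINT x|lborel. (u x)\<^sup>2 * ((norm (x - a))\<^sup>2 * \<rho> x * (p x)\<^sup>2))"
    unfolding sq_norm_def by (subst integral_m) (simp_all add: f2)
  have iu: "integrable lborel (\<lambda>x. \<rho> x * (u x)\<^sup>2)" "(LINT x|lborel. \<rho> x * (u x)\<^sup>2) = sq_norm m u"
    using sq_integrableD[OF sobolevD(2)[OF u]] by (auto simp: integrable_m sq_norm_def integral_m)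
  have ig: "integrable lborel (\<lambda>x. \<rho> x * (norm (g x))\<^sup>2)" "(LINT x|lborel. \<rho> x * (norm (g x))\<^sup>2) = sq_norm m g"
    using sq_integrableD[OF sobolevD(3)[OF u]] by (auto simp: integrable_m sq_norm_def integral_m)
  have point: "lam / 2 * ((u x)\<^sup>2 * ((norm (x - a))\<^sup>2 * \<rho> x * (p x)\<^sup>2))
     \<le> 2 * (\<rho> x * (u x)\<^sup>2) + 2 / lam * (\<rho> x * (norm (g x))\<^sup>2) - ((\<Sum>i\<in>UNIV. (u x)\<^sup>2 * D i i x) + (\<Sum>i\<in>UNIV. 2 * u x * g x $ i * \<psi> i x))" for x
  proof -
    let ?y = "x - a" and ?q = "\<rho> x * (p x)\<^sup>2"
    have q: "0 \<le> ?q" "?q \<le> \<rho> x" using p01[of x] \<rho>_pos[of x] by (auto intro!: mult_left_le power_le_one)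
    \<comment> \<open>The constant 2 is the dimension. The derivative of the cut-off has a
      favourable sign and is discarded, and the drift produces \<open>- lam\<close> times the second
      moment density.\<close>
    have "(\<Sum>i\<in>UNIV. D i i x) = 2 * ?q + (\<Sum>i\<in>UNIV. ?y $ i * partial_deriv i \<rho> x) * (p x)\<^sup>2
        - 4 * \<rho> x * p x * c * (\<Sum>i\<in>UNIV. (?y $ i)\<^sup>2)"
      by (simp add: D_def UNIV_2 algebra_simps power2_eq_square)
    also have "\<dots> \<le> 2 * ?q - lam * (norm ?y)\<^sup>2 * ?q"
    proof -
      have "(\<Sum>i\<in>UNIV. ?y $ i * partial_deriv i \<rho> x) * (p x)\<^sup>2 \<le> - lam * (norm ?y)\<^sup>2 * \<rho> x * (p x)\<^sup>2"
        by (rule mult_right_mono[OF drift]) simp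
      then have "(\<Sum>i\<in>UNIV. ?y $ i * partial_deriv i \<rho> x) * (p x)\<^sup>2 \<le> - (lam * (norm ?y)\<^sup>2 * ?q)"
        by (simp only: mult.assoc mult_minus_left)
      moreover have "0 \<le> 4 * \<rho> x * p x * c * (\<Sum>i\<in>UNIV. (?y $ i)\<^sup>2)"
        using \<rho>_pos[of x] p01[of x] c by (intro mult_nonneg_nonneg sum_nonneg) auto
      ultimately show ?thesis by linarith
    qed
    finally have "(u x)\<^sup>2 * (\<Sum>i\<in>UNIV. D i i x) \<le> (u x)\<^sup>2 * (2 * ?q - lam * (norm ?y)\<^sup>2 * ?q)" by (rule mult_left_mono) simp
    moreover have "(\<Sum>i\<in>UNIV. (u x)\<^sup>2 * D i i x) = (u x)\<^sup>2 * (\<Sum>i\<in>UNIV. D i i x)" by (simp only: sum_distrib_left)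
    moreover have "(u x)\<^sup>2 * (2 * ?q - lam * (norm ?y)\<^sup>2 * ?q) = 2 * (u x)\<^sup>2 * ?q - lam * (norm ?y)\<^sup>2 * (u x)\<^sup>2 * ?q"
      by (simp add: algebra_simps)
    ultimately have A: "(\<Sum>i\<in>UNIV. (u x)\<^sup>2 * D i i x) \<le> 2 * (u x)\<^sup>2 * ?q - lam * (norm ?y)\<^sup>2 * (u x)\<^sup>2 * ?q"
      by linarith
    \<comment> \<open>Young's inequality spends half of the favourable term: \<open>lam / 2\<close>
      times the moment absorbs the mixed term, and the other half stays on the left.\<close>
    have "2 * u x * (g x \<bullet> ?y) \<le> lam / 2 * (norm ?y)\<^sup>2 * (u x)\<^sup>2 + 2 / lam * (norm (g x))\<^sup>2"
    proof -
      have "2 * u x * (g x \<bullet> ?y) \<le> 2 * (\<bar>u x\<bar> * (norm (g x) * norm ?y))"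
      proof -
        have "u x * (g x \<bullet> ?y) \<le> \<bar>u x\<bar> * \<bar>g x \<bullet> ?y\<bar>" unfolding abs_mult[symmetric] by (rule abs_ge_self)
        also have "\<dots> \<le> \<bar>u x\<bar> * (norm (g x) * norm ?y)" by (intro mult_left_mono Cauchy_Schwarz_ineq2) simp
        finally show ?thesis by simp
      qed
      also have "\<dots> = 2 * (sqrt (lam / 2) * norm ?y * \<bar>u x\<bar>) * (sqrt (2 / lam) * norm (g x))"
      proof -
        have "sqrt (lam / 2) * sqrt (2 / lam) = 1" using lam by (simp flip: real_sqrt_mult)
        then have "2 * (\<bar>u x\<bar> * (norm (g x) * norm ?y)) = 2 * (\<bar>u x\<bar> * (norm (g x) * norm ?y)) * (sqrt (lam / 2) * sqrt (2 / lam))" by simp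
        then show ?thesis by (simp only: mult_ac)
      qed
      also have "\<dots> \<le> (sqrt (lam / 2) * norm ?y * \<bar>u x\<bar>)\<^sup>2 + (sqrt (2 / lam) * norm (g x))\<^sup>2"
        by (rule sum_squares_bound)
      also have "\<dots> = lam / 2 * (norm ?y)\<^sup>2 * (u x)\<^sup>2 + 2 / lam * (norm (g x))\<^sup>2"
        using lam by (simp add: power_mult_distrib)
      finally show ?thesis .
    qed
    then have B: "2 * u x * (g x \<bullet> ?y) * ?q \<le> (lam / 2 * (norm ?y)\<^sup>2 * (u x)\<^sup>2 + 2 / lam * (norm (g x))\<^sup>2) * ?q"
      using q(1) by (rule mult_right_mono)
    have B2: "(\<Sum>i\<in>UNIV. 2 * u x * g x $ i * \<psi> i x) = 2 * u x * (g x \<bullet> ?y) * ?q"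
      by (simp add: \<psi>_def inner_vec_def UNIV_2 algebra_simps)
    have C: "2 * (u x)\<^sup>2 * ?q \<le> 2 * (\<rho> x * (u x)\<^sup>2)" "2 / lam * (norm (g x))\<^sup>2 * ?q \<le> 2 / lam * (\<rho> x * (norm (g x))\<^sup>2)"
      using mult_left_mono[OF q(2), of "2 * (u x)\<^sup>2"] mult_left_mono[OF q(2), of "2 / lam * (norm (g x))\<^sup>2"] lam
      by (simp_all add: algebra_simps)
    have E: "lam / 2 * ((u x)\<^sup>2 * ((norm ?y)\<^sup>2 * \<rho> x * (p x)\<^sup>2)) = lam / 2 * (norm ?y)\<^sup>2 * (u x)\<^sup>2 * ?q"
      "lam * (norm ?y)\<^sup>2 * (u x)\<^sup>2 * ?q = 2 * (lam / 2 * (norm ?y)\<^sup>2 * (u x)\<^sup>2 * ?q)"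
      by (simp_all add: algebra_simps)
    show ?thesis using A B B2 C E unfolding distrib_right by linarith
  qed
  have "lam / 2 * sq_norm m ?f = (LINT x|lborel. lam / 2 * ((u x)\<^sup>2 * ((norm (x - a))\<^sup>2 * \<rho> x * (p x)\<^sup>2)))"
    unfolding fn by simp
  also have "\<dots> \<le> (LINT x|lborel. 2 * (\<rho> x * (u x)\<^sup>2) + 2 / lam * (\<rho> x * (norm (g x))\<^sup>2) - ((\<Sum>i\<in>UNIV. (u x)\<^sup>2 * D i i x) + (\<Sum>i\<in>UNIV. 2 * u x * g x $ i * \<psi> i x)))"
    using i1 i2 i3 iu ig
    by (intro integral_mono point Bochner_Integration.integrable_diff Bochner_Integration.integrable_add Bochner_Integration.integrable_sum integrable_mult_right) auto
  also have "\<dots> = 2 * sq_norm m u + 2 / lam * sq_norm m g - ((\<Sum>i\<in>UNIV. LINT x|lborel. (u x)\<^sup>2 * D i i x) + (\<Sum>i\<in>UNIV. LINT x|lborel. 2 * u x * g x $ i * \<psi> i x))"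
  proof -
    have j1: "integrable lborel (\<lambda>x. \<Sum>i\<in>UNIV. (u x)\<^sup>2 * D i i x)" "integrable lborel (\<lambda>x. \<Sum>i\<in>UNIV. 2 * u x * g x $ i * \<psi> i x)"
      using i1 i2 by (intro Bochner_Integration.integrable_sum; simp)+
    show ?thesis
      using i1 i2 iu ig j1 by (simp add: Bochner_Integration.integral_sum)
  qed
  also have "(\<Sum>i\<in>UNIV. LINT x|lborel. (u x)\<^sup>2 * D i i x) + (\<Sum>i\<in>UNIV. LINT x|lborel. 2 * u x * g x $ i * \<psi> i x) = 0"
    unfolding parts by (simp add: sum_negf)
  finally have "lam / 2 * sq_norm m ?f \<le> 2 * sq_norm m u + 2 / lam * sq_norm m g" by simp
  then have "sq_norm m ?f \<le> 4 / lam * sq_norm m u + 4 / lam\<^sup>2 * sq_norm m g"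
    using lam by (simp add: field_simps power2_eq_square)
  with fs show "sq_integrable m (\<lambda>x. norm (x - a) * max 0 (1 - (norm (x - a))\<^sup>2 / R\<^sup>2) * u x)"
    "sq_norm m (\<lambda>x. norm (x - a) * max 0 (1 - (norm (x - a))\<^sup>2 / R\<^sup>2) * u x) \<le> 4 / lam * sq_norm m u + 4 / lam\<^sup>2 * sq_norm m g"
    by (simp_all add: p_def)
qed

text \<open>The cut-off estimate has the same right side for every radius, so Fatou's lemma removes
  the cut-off.\<close>

lemma second_moment:
  assumes u: "sobolev u g"
  shows "sq_integrable m (\<lambda>x. norm (x - a) * u x)"
    "sq_norm m (\<lambda>x. norm (x - a) * u x) \<le> 4 / lam * sq_norm m u + 4 / lam\<^sup>2 * sq_norm m g"
proof -
  note [measurable] = sobolev_measurable[OF u]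
  let ?f = "\<lambda>n x. norm (x - a) * max 0 (1 - (norm (x - a))\<^sup>2 / (real (Suc n))\<^sup>2) * u x"
  have lim: "AE x in m. (\<lambda>n. ?f n x) \<longlonglongrightarrow> norm (x - a) * u x"
  proof (rule AE_I2)
    fix x
    have "(\<lambda>n. 1 / real (Suc n)) \<longlonglongrightarrow> 0" by (rule LIMSEQ_Suc[OF lim_1_over_n])
    then have "(\<lambda>n. norm (x - a) * max 0 (1 - (norm (x - a))\<^sup>2 * (1 / real (Suc n))\<^sup>2) * u x) \<longlonglongrightarrow> norm (x - a) * max 0 (1 - (norm (x - a))\<^sup>2 * 0\<^sup>2) * u x"
      by (intro tendsto_intros)
    then show "(\<lambda>n. ?f n x) \<longlonglongrightarrow> norm (x - a) * u x" by (simp add: power_divide)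
  qed
  have meas: "(\<lambda>x. norm (x - a) * u x) \<in> borel_measurable m" by measurable
  have R: "real (Suc n) > 0" for n by simp
  show "sq_integrable m (\<lambda>x. norm (x - a) * u x)"
    "sq_norm m (\<lambda>x. norm (x - a) * u x) \<le> 4 / lam * sq_norm m u + 4 / lam\<^sup>2 * sq_norm m g"
    using sq_norm_Fatou[OF second_moment_cutoff(1)[OF u R] meas lim, of 0] second_moment_cutoff(2)[OF u R] by blast+
qed

end

lemma sq_norm_diff_le:
  assumes "sq_integrable M f" "sq_integrable M g"
  shows "sq_norm M (\<lambda>x. f x - g x) \<le> 2 * sq_norm M f + 2 * sq_norm M g"
  using sq_norm_add_le[OF assms(1) sq_integrable_scaleR[OF assms(2), of "-1"]] sq_norm_scaleR[of M "-1" g] by simp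

lemma sq_norm_limit_le:
  assumes f: "\<And>n. sq_integrable M (f n)" "sq_integrable M h" and lim: "(\<lambda>n. sq_norm M (\<lambda>x. f n x - h x)) \<longlonglongrightarrow> 0"
    and C: "\<And>n. n \<ge> N \<Longrightarrow> sq_norm M (f n) \<le> C"
  shows "sq_norm M h \<le> C"
proof -
  obtain r where r: "strict_mono (r::nat\<Rightarrow>nat)" "AE x in M. (\<lambda>n. f (r n) x) \<longlonglongrightarrow> h x"
    by (rule sq_norm_tendsto_AE_subseq[OF f lim])
  show ?thesis
  proof (rule sq_norm_Fatou(2)[OF f(1) sq_integrable_measurable[OF f(2)] r(2)])
    fix n assume "N \<le> n"
    then show "sq_norm M (f (r n)) \<le> C" using seq_suble[OF r(1), of n] by (intro C) simp
  qed
qed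

section \<open>Compact embedding of the Sobolev space\<close>

context gaussian_plane
begin

text \<open>A cell has area at least \<open>1 / N^2\<close>, so its Poincare inequality is
  multiplied by \<open>N^2\<close>. The cells indexed by \<open>J\<close> cover the ball of radius
  \<open>R\<close>; their points have coordinates of size at most \<open>R + 2\<close>, hence lie in
  the ball of radius \<open>2 * (R + 2)\<close>, where the density is at least
  \<open>c\<close>.\<close>

lemma grid_estimate:
  assumes w: "sobolev w h" and N: "N > 0" and R: "R \<ge> 0" and J: "J = {- \<lceil>real N * R\<rceil> .. \<lceil>real N * R\<rceil>}"
    and c: "c > 0" "\<And>x. x \<in> cball 0 (2 * (R + 2)) \<Longrightarrow> c \<le> \<rho> x"
  shows "(LINT x|lborel. indicator (cball 0 R) x * (w x)\<^sup>2)
    \<le> (real N)\<^sup>2 * (\<Sum>j\<in>J \<times> J. (LINT x|lborel. indicator (grid_cell N j) x * w x)\<^sup>2) + 4 / (real N)\<^sup>2 * (sq_norm m h / c)"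
proof -
  note [measurable] = sobolev_measurable[OF w]
  let ?C = "grid_cell N" and ?B = "cball 0 (2 * (R + 2)) :: (real^2) set"
  have fin: "finite (J \<times> J)" by (simp add: J)
  have local: "integrable lborel (\<lambda>x. indicator (?C j) x * (norm (f x))\<^sup>2)" if "sq_integrable m f" for f :: "real^2 \<Rightarrow> 'b::euclidean_space" and j
  proof -
    have [measurable]: "f \<in> borel_measurable borel" using sq_integrable_measurable[OF that] by simp
    obtain R0 where "\<And>x. x \<in> ?C j \<Longrightarrow> norm x \<le> R0" using grid_cell_bounded[OF N] by blast
    then show ?thesis
      by (intro Bochner_Integration.integrable_bound[OF sq_integrable_cball[OF that, of R0]]) (auto simp: indicator_def)
  qed
  have w2: "integrable lborel (\<lambda>x. indicator (?C j) x * (w x)\<^sup>2)" for j using local[OF sobolevD(2)[OF w], of j] by simp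
  have h2: "integrable lborel (\<lambda>x. indicator (?C j) x * (norm (h x))\<^sup>2)" for j using local[OF sobolevD(3)[OF w], of j] .
  have cell: "(LINT x|lborel. indicator (?C j) x * (w x)\<^sup>2) \<le> (real N)\<^sup>2 * (LINT x|lborel. indicator (?C j) x * w x)\<^sup>2 + 4 / (real N)\<^sup>2 * (LINT x|lborel. indicator (?C j) x * (norm (h x))\<^sup>2)"
    (is "?Q \<le> _ * ?S\<^sup>2 + _ * ?G") for j
  proof -
    have "(1 / real N)\<^sup>2 * ?Q \<le> measure lborel (?C j) * ?Q"
      using grid_cell_measure(2)[OF N] by (intro mult_right_mono integral_nonneg_AE) auto
    also have "\<dots> \<le> ?S\<^sup>2 + 4 * (1 / real N) ^ 4 * ?G"
      by (rule poincare_cell[OF sobolevD(1)[OF w] grid_cell_convex])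
         (use N grid_cell_diam[OF N] grid_cell_measure(1)[OF N] w2 h2 in auto)
    finally have "(real N)\<^sup>2 * ((1 / real N)\<^sup>2 * ?Q) \<le> (real N)\<^sup>2 * (?S\<^sup>2 + 4 * (1 / real N) ^ 4 * ?G)"
      by (rule mult_left_mono) simp
    moreover have "(real N)\<^sup>2 * ((1 / real N)\<^sup>2 * ?Q) = ?Q" using N by (simp add: power_divide)
    moreover have "(real N)\<^sup>2 * (?S\<^sup>2 + 4 * (1 / real N) ^ 4 * ?G) = (real N)\<^sup>2 * ?S\<^sup>2 + 4 / (real N)\<^sup>2 * ?G"
      using N by (simp add: field_simps power2_eq_square power4_eq_xxxx)
    ultimately show ?thesis by simp
  qed
  have Gsum: "(\<Sum>j\<in>J\<times>J. LINT x|lborel. indicator (?C j) x * (norm (h x))\<^sup>2) \<le> sq_norm m h / c"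
  proof -
    have "(\<Sum>j\<in>J\<times>J. LINT x|lborel. indicator (?C j) x * (norm (h x))\<^sup>2) = (LINT x|lborel. (\<Sum>j\<in>J\<times>J. indicator (?C j) x * (norm (h x))\<^sup>2))"
      using h2 by (rule Bochner_Integration.integral_sum[symmetric])
    also have "\<dots> \<le> (LINT x|lborel. indicator ?B x * (norm (h x))\<^sup>2)"
    proof (rule integral_mono)
      show "integrable lborel (\<lambda>x. \<Sum>j\<in>J\<times>J. indicator (?C j) x * (norm (h x))\<^sup>2)" using h2 by (rule Bochner_Integration.integrable_sum)
      show "integrable lborel (\<lambda>x. indicator ?B x * (norm (h x))\<^sup>2)" by (rule sobolev_local(2)[OF w])
      fix x :: "real^2"
      have "x \<in> ?B" if "(\<lfloor>real N * x $ 1\<rfloor>, \<lfloor>real N * x $ 2\<rfloor>) \<in> J \<times> J"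
      proof -
        have b: "\<bar>t\<bar> \<le> R + 2" if "\<lfloor>real N * t\<rfloor> \<in> J" for t
        proof -
          have "real_of_int \<lceil>real N * R\<rceil> \<le> real N * R + 1" by linarith
          then have "\<bar>real N * t\<bar> \<le> real N * R + 2"
            using that unfolding J atLeastAtMost_iff floor_le_iff le_floor_iff abs_le_iff by linarith
          also have "\<dots> \<le> real N * (R + 2)" using N by (simp add: distrib_left)
          finally have "real N * \<bar>t\<bar> \<le> real N * (R + 2)" by (simp add: abs_mult)
          then show ?thesis using N by simp
        qed
        have "norm x \<le> (\<Sum>i\<in>UNIV. \<bar>x $ i\<bar>)" by (rule norm_le_l1_cart)
        also have "\<dots> = \<bar>x $ 1\<bar> + \<bar>x $ 2\<bar>" by (simp add: sum_2)
        also have "\<dots> \<le> (R + 2) + (R + 2)" using that by (intro add_mono b) auto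
        finally show ?thesis by simp
      qed
      then show "(\<Sum>j\<in>J\<times>J. indicator (?C j) x * (norm (h x))\<^sup>2) \<le> indicator ?B x * (norm (h x))\<^sup>2"
        unfolding sum_indicator_grid_cell[OF fin] by (auto simp: indicator_def)
    qed
    also have "\<dots> \<le> sq_norm m h / c" by (rule sq_integrable_local(2)[OF sobolevD(3)[OF w] c]) auto
    finally show ?thesis .
  qed
  have "(LINT x|lborel. indicator (cball 0 R) x * (w x)\<^sup>2) \<le> (LINT x|lborel. (\<Sum>j\<in>J\<times>J. indicator (?C j) x * (w x)\<^sup>2))"
  proof (rule integral_mono)
    show "integrable lborel (\<lambda>x. indicator (cball 0 R) x * (w x)\<^sup>2)" by (rule sobolev_local(1)[OF w])
    show "integrable lborel (\<lambda>x. \<Sum>j\<in>J\<times>J. indicator (?C j) x * (w x)\<^sup>2)" using w2 by (rule Bochner_Integration.integrable_sum)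
    fix x :: "real^2"
    have "(\<lfloor>real N * x $ 1\<rfloor>, \<lfloor>real N * x $ 2\<rfloor>) \<in> J \<times> J" if "x \<in> cball 0 R"
    proof -
      have "\<lfloor>real N * x $ i\<rfloor> \<in> J" for i
      proof -
        have "\<bar>x $ i\<bar> \<le> R" using component_le_norm_cart[of x i] that by simp
        then have "\<bar>real N * x $ i\<bar> \<le> real N * R" by (simp add: abs_mult mult_left_mono)
        then have "real N * x $ i \<le> real N * R" "- (real N * R) \<le> real N * x $ i" by (auto simp: abs_le_iff)
        then show ?thesis unfolding J by (auto simp: floor_le_iff le_floor_iff) linarith+
      qed
      then show ?thesis by simp
    qed
    then show "indicator (cball 0 R) x * (w x)\<^sup>2 \<le> (\<Sum>j\<in>J\<times>J. indicator (?C j) x * (w x)\<^sup>2)"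
      unfolding sum_indicator_grid_cell[OF fin] by (auto simp: indicator_def)
  qed
  also have "\<dots> = (\<Sum>j\<in>J\<times>J. LINT x|lborel. indicator (?C j) x * (w x)\<^sup>2)"
    using w2 by (rule Bochner_Integration.integral_sum)
  also have "\<dots> \<le> (\<Sum>j\<in>J\<times>J. (real N)\<^sup>2 * (LINT x|lborel. indicator (?C j) x * w x)\<^sup>2 + 4 / (real N)\<^sup>2 * (LINT x|lborel. indicator (?C j) x * (norm (h x))\<^sup>2))"
    by (intro sum_mono cell)
  also have "\<dots> = (real N)\<^sup>2 * (\<Sum>j\<in>J\<times>J. (LINT x|lborel. indicator (?C j) x * w x)\<^sup>2) + 4 / (real N)\<^sup>2 * (\<Sum>j\<in>J\<times>J. LINT x|lborel. indicator (?C j) x * (norm (h x))\<^sup>2)"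
    by (simp only: sum.distrib sum_distrib_left)
  also have "\<dots> \<le> (real N)\<^sup>2 * (\<Sum>j\<in>J\<times>J. (LINT x|lborel. indicator (?C j) x * w x)\<^sup>2) + 4 / (real N)\<^sup>2 * (sq_norm m h / c)"
    using Gsum by (intro add_left_mono mult_left_mono) auto
  finally show ?thesis .
qed

text \<open>Chebyshev: off the ball \<open>norm (x - a) \<ge> r\<close>, so the second moment
  divided by \<open>r^2\<close> bounds the tail, while on the ball the density is at most
  \<open>C\<close>.\<close>

lemma local_global_estimate:
  assumes w: "sobolev w h" and r: "r > 0" and C: "C > 0" "\<And>x. x \<in> cball 0 (norm a + r) \<Longrightarrow> \<rho> x \<le> C"
  shows "sq_norm m w \<le> (4 / lam * sq_norm m w + 4 / lam\<^sup>2 * sq_norm m h) / r\<^sup>2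
     + C * (LINT x|lborel. indicator (cball 0 (norm a + r)) x * (w x)\<^sup>2)"
proof -
  note [measurable] = sobolev_measurable[OF w]
  let ?B = "cball 0 (norm a + r) :: (real^2) set" and ?f = "\<lambda>x. norm (x - a) * w x"
  have f: "integrable lborel (\<lambda>x. \<rho> x * (?f x)\<^sup>2)" "(LINT x|lborel. \<rho> x * (?f x)\<^sup>2) = sq_norm m ?f"
    using sq_integrableD[OF second_moment(1)[OF w]] by (simp_all add: integrable_m sq_norm_def integral_m)
  have i: "integrable lborel (\<lambda>x. \<rho> x * (w x)\<^sup>2)" "(LINT x|lborel. \<rho> x * (w x)\<^sup>2) = sq_norm m w"
    using sq_integrableD[OF sobolevD(2)[OF w]] by (simp_all add: integrable_m sq_norm_def integral_m)
  have j: "integrable lborel (\<lambda>x. indicator ?B x * (w x)\<^sup>2)" by (rule sobolev_local(1)[OF w])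
  have "(LINT x|lborel. \<rho> x * (w x)\<^sup>2) \<le> (LINT x|lborel. \<rho> x * (?f x)\<^sup>2 / r\<^sup>2 + C * (indicator ?B x * (w x)\<^sup>2))"
  proof (rule integral_mono[OF i(1)])
    show "integrable lborel (\<lambda>x. \<rho> x * (?f x)\<^sup>2 / r\<^sup>2 + C * (indicator ?B x * (w x)\<^sup>2))" using f(1) j by simp
    fix x
    show "\<rho> x * (w x)\<^sup>2 \<le> \<rho> x * (?f x)\<^sup>2 / r\<^sup>2 + C * (indicator ?B x * (w x)\<^sup>2)"
    proof (cases "x \<in> ?B")
      case True
      have "\<rho> x * (w x)\<^sup>2 \<le> C * (w x)\<^sup>2" using C(2)[OF True] by (intro mult_right_mono) auto
      moreover have "0 \<le> \<rho> x * (?f x)\<^sup>2 / r\<^sup>2" using \<rho>_pos[of x] by simp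
      ultimately show ?thesis using True by simp
    next
      case False
      have "r \<le> norm (x - a)" using False norm_triangle_sub[of x a] by simp
      then have "r\<^sup>2 \<le> (norm (x - a))\<^sup>2" using r by (intro power_mono) auto
      then have "1 \<le> (norm (x - a))\<^sup>2 / r\<^sup>2" using r by simp
      then have "\<rho> x * (w x)\<^sup>2 * 1 \<le> \<rho> x * (w x)\<^sup>2 * ((norm (x - a))\<^sup>2 / r\<^sup>2)"
        using \<rho>_pos[of x] by (intro mult_left_mono) auto
      then show ?thesis using False by (simp add: power_mult_distrib mult_ac)
    qed
  qed
  also have "\<dots> = sq_norm m ?f / r\<^sup>2 + C * (LINT x|lborel. indicator ?B x * (w x)\<^sup>2)" using f j by simp
  also have "\<dots> \<le> (4 / lam * sq_norm m w + 4 / lam\<^sup>2 * sq_norm m h) / r\<^sup>2 + C * (LINT x|lborel. indicator ?B x * (w x)\<^sup>2)"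
    using second_moment(2)[OF w] by (intro add_right_mono divide_right_mono) auto
  finally show ?thesis using i(2) by simp
qed

text \<open>The integrals over all cells of all grids are countably many bounded sequences. Along a
  diagonal subsequence they converge, and differences are then small by three estimates fixed in
  this order: the tail by a radius, the oscillation within cells by a mesh, the cell integrals by an
  index.\<close>

theorem rellich:
  assumes u: "\<And>n. sobolev (u n) (g n)" and b: "\<And>n. sq_norm m (u n) \<le> K" "\<And>n. sq_norm m (g n) \<le> K"
  obtains r v where "strict_mono (r::nat\<Rightarrow>nat)" "sq_integrable m v" "(\<lambda>n. sq_norm m (\<lambda>x. u (r n) x - v x)) \<longlonglongrightarrow> 0"
proof -
  have K: "K \<ge> 0" using b(1)[of 0] sq_norm_nonneg[of m "u 0"] by linarith
  define S where "S N j n = (LINT x|lborel. indicator (grid_cell (Suc N) j) x * u n x)" for N j n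
  \<comment> \<open>Enumerates the pairs of a mesh and a cell, so that one diagonal extraction
    handles all grids.\<close>
  define idx :: "nat \<Rightarrow> nat \<times> int \<times> int" where "idx = from_nat"
  have iC: "integrable lborel (\<lambda>x. indicator (grid_cell (Suc N) j) x * u n x)" for N j n
  proof -
    obtain R0 where "\<And>x. x \<in> grid_cell (Suc N) j \<Longrightarrow> norm x \<le> R0" using grid_cell_bounded[of "Suc N"] by blast
    then have "integrable lborel (\<lambda>x. u n x * indicator (grid_cell (Suc N) j) x)"
      by (intro integrable_locally_integrable_mult[OF sq_integrable_locally_integrable[OF sobolevD(2)[OF u]], of _ 1 R0]) (auto simp: indicator_def)
    then show ?thesis by (simp add: mult.commute)
  qed
  have Sb: "\<exists>B. \<forall>n. \<bar>S N j n\<bar> \<le> B" for N j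
  proof -
    let ?C = "grid_cell (Suc N) j"
    obtain R0 where R0: "\<And>x. x \<in> ?C \<Longrightarrow> norm x \<le> R0" using grid_cell_bounded[of "Suc N"] by blast
    obtain c where c: "0 < c" "\<And>x. x \<in> cball 0 R0 \<Longrightarrow> c \<le> \<rho> x" using density_bounds[of R0] by metis
    have i1: "integrable lborel (indicator (cball 0 R0) :: real^2 \<Rightarrow> real)"
      using emeasure_bounded_finite[OF bounded_cball, of "0::real^2" R0] by (intro integrable_real_indicator) auto
    have "\<bar>S N j n\<bar> \<le> measure lborel (cball (0::real^2) R0) + K / c" for n
    proof -
      have "\<bar>S N j n\<bar> \<le> (LINT x|lborel. \<bar>indicator ?C x * u n x\<bar>)" unfolding S_def by (rule integral_abs_bound)
      also have "\<dots> \<le> (LINT x|lborel. indicator (cball 0 R0) x + indicator (cball 0 R0) x * (norm (u n x))\<^sup>2)"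
      proof (rule integral_mono)
        show "integrable lborel (\<lambda>x. \<bar>indicator ?C x * u n x\<bar>)" using iC by (rule integrable_abs)
        show "integrable lborel (\<lambda>x. indicator (cball 0 R0) x + indicator (cball 0 R0) x * (norm (u n x))\<^sup>2)"
          using i1 sq_integrable_cball[OF sobolevD(2)[OF u]] by (rule Bochner_Integration.integrable_add)
        fix x
        have "2 * \<bar>u n x\<bar> \<le> 1 + (u n x)\<^sup>2" using sum_squares_bound[of 1 "\<bar>u n x\<bar>"] by simp
        then have "\<bar>u n x\<bar> \<le> 1 + (u n x)\<^sup>2" using abs_ge_zero[of "u n x"] by linarith
        then show "\<bar>indicator ?C x * u n x\<bar> \<le> indicator (cball 0 R0) x + indicator (cball 0 R0) x * (norm (u n x))\<^sup>2"
          using R0[of x] by (auto simp: indicator_def)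
      qed
      also have "\<dots> = measure lborel (cball (0::real^2) R0) + (LINT x|lborel. indicator (cball 0 R0) x * (norm (u n x))\<^sup>2)"
        using i1 sq_integrable_cball[OF sobolevD(2)[OF u], of R0] by (subst Bochner_Integration.integral_add) auto
      also have "\<dots> \<le> measure lborel (cball (0::real^2) R0) + sq_norm m (u n) / c"
        by (intro add_left_mono sq_integrable_local(2)[OF sobolevD(2)[OF u[of n]] c]) auto
      also have "\<dots> \<le> measure lborel (cball (0::real^2) R0) + K / c" using b(1)[of n] c by (simp add: divide_right_mono)
      finally show ?thesis .
    qed
    then show ?thesis by blast
  qed
  obtain r where r: "strict_mono (r::nat\<Rightarrow>nat)" and conv: "\<And>k. convergent (\<lambda>n. S (fst (idx k)) (snd (idx k)) (r n))"
    by (rule diagonal_convergent_subsequence[of "\<lambda>n k. S (fst (idx k)) (snd (idx k)) n"]) (use Sb in auto)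
  have conv': "Cauchy (\<lambda>n. S N j (r n))" for N j
    using conv[of "to_nat (N, j)"] by (simp add: idx_def Cauchy_convergent_iff)
  have diff: "sobolev (\<lambda>x. u (r i) x - u (r j) x) (\<lambda>x. g (r i) x - g (r j) x)"
    "sq_norm m (\<lambda>x. u (r i) x - u (r j) x) \<le> 4 * K" "sq_norm m (\<lambda>x. g (r i) x - g (r j) x) \<le> 4 * K" for i j
    using sobolev_diff[OF u u] sq_norm_diff_le[OF sobolevD(2)[OF u] sobolevD(2)[OF u], of "r i" "r j"]
      sq_norm_diff_le[OF sobolevD(3)[OF u] sobolevD(3)[OF u], of "r i" "r j"] b(1)[of "r i"] b(1)[of "r j"] b(2)[of "r i"] b(2)[of "r j"]
    by auto
  have "\<exists>n0. \<forall>i\<ge>n0. \<forall>j\<ge>n0. sq_norm m (\<lambda>x. u (r i) x - u (r j) x) < \<epsilon>" if \<epsilon>: "\<epsilon> > 0" for \<epsilon>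
  proof -
    \<comment> \<open>Differences of the sequence have squared norms at most \<open>4 * K\<close>,
      so \<open>T\<close> bounds their second moments; \<open>r0\<close> is then large enough for
      \<open>T / r0^2 < \<epsilon> / 3\<close>.\<close>
    define T where "T = 4 / lam * (4 * K) + 4 / lam\<^sup>2 * (4 * K)"
    have T: "T \<ge> 0" using K lam by (simp add: T_def)
    define r0 where "r0 = 1 + 3 * T / \<epsilon>"
    have r0: "r0 \<ge> 1" "r0 > 0" using T \<epsilon> by (auto simp: r0_def intro: add_pos_nonneg)
    have r0T: "T / r0\<^sup>2 < \<epsilon> / 3"
    proof -
      have "3 * T < \<epsilon> * r0" using \<epsilon> T by (simp add: r0_def field_simps)
      also have "\<epsilon> * r0 \<le> \<epsilon> * r0\<^sup>2" using r0 \<epsilon> by (simp add: power2_eq_square)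
      finally show ?thesis using r0 by (simp add: field_simps)
    qed
    define R where "R = norm a + r0"
    have R: "R \<ge> 0" using r0 by (simp add: R_def)
    obtain C where C: "0 < C" "\<And>x. x \<in> cball 0 R \<Longrightarrow> \<rho> x \<le> C" using density_bounds[of R] by metis
    obtain c where c: "0 < c" "\<And>x. x \<in> cball 0 (2 * (R + 2)) \<Longrightarrow> c \<le> \<rho> x" using density_bounds[of "2 * (R + 2)"] by metis
    \<comment> \<open>The mesh is fixed after the radius, because \<open>C\<close> and
      \<open>c\<close> depend on the ball. It makes the oscillation term smaller than
      \<open>\<epsilon> / 3\<close>.\<close>
    obtain N where N: "real N > 48 * C * K / (c * \<epsilon>)" using reals_Archimedean2 by blast
    let ?N = "real (Suc N)"
    have N2: "C * (4 / ?N\<^sup>2 * (4 * K / c)) < \<epsilon> / 3"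
    proof -
      have "48 * C * K / (c * \<epsilon>) < ?N" using N by simp
      also have "?N \<le> ?N\<^sup>2" by (simp add: power2_eq_square)
      finally have "48 * C * K < ?N\<^sup>2 * (c * \<epsilon>)" using c \<epsilon> by (simp add: divide_less_eq)
      moreover have "C * (4 / ?N\<^sup>2 * (4 * K / c)) = 48 * C * K / (?N\<^sup>2 * c * 3)" by (simp add: field_simps)
      moreover have "?N\<^sup>2 * c * 3 > 0" using c by simp
      ultimately show ?thesis by (simp add: divide_less_eq mult_ac)
    qed
    define J where "J = {- \<lceil>?N * R\<rceil> .. \<lceil>?N * R\<rceil>}"
    \<comment> \<open>The summand 1 keeps \<open>A\<close> positive, and \<open>\<eta>\<close> is
      chosen with \<open>A * \<eta>^2 = \<epsilon> / 3\<close>, which covers all cell integrals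
      together.\<close>
    define A where "A = C * (?N\<^sup>2 * real (card (J \<times> J))) + 1"
    have A: "A > 0" unfolding A_def using C by (intro add_nonneg_pos mult_nonneg_nonneg) auto
    define \<eta> where "\<eta> = sqrt (\<epsilon> / (3 * A))"
    have \<eta>: "\<eta> > 0" "\<eta>\<^sup>2 = \<epsilon> / (3 * A)" using \<epsilon> A by (auto simp: \<eta>_def)
    have "\<exists>n0. \<forall>i\<ge>n0. \<forall>k\<ge>n0. \<bar>S N j (r i) - S N j (r k)\<bar> < \<eta>" for j
      using conv'[of N j] \<eta>(1) unfolding Cauchy_def dist_real_def by blast
    then obtain nn where nn: "\<And>j i k. i \<ge> nn j \<Longrightarrow> k \<ge> nn j \<Longrightarrow> \<bar>S N j (r i) - S N j (r k)\<bar> < \<eta>" by metis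
    define n0 where "n0 = Max (insert 0 (nn ` (J \<times> J)))"
    have finJ: "finite (J \<times> J)" by (simp add: J_def)
    have n0: "nn j \<le> n0" if "j \<in> J \<times> J" for j unfolding n0_def using finJ that by (intro Max_ge) auto
    show ?thesis
    proof (intro exI[of _ n0] allI impI)
      fix i k assume ik: "i \<ge> n0" "k \<ge> n0"
      let ?w = "\<lambda>x. u (r i) x - u (r k) x" and ?h = "\<lambda>x. g (r i) x - g (r k) x"
      have S2: "(LINT x|lborel. indicator (grid_cell (Suc N) j) x * ?w x)\<^sup>2 \<le> \<eta>\<^sup>2" if "j \<in> J \<times> J" for j
      proof -
        have "(LINT x|lborel. indicator (grid_cell (Suc N) j) x * ?w x) = S N j (r i) - S N j (r k)"
          unfolding S_def using iC[of N j "r i"] iC[of N j "r k"] by (simp add: right_diff_distrib)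
        moreover have "\<bar>S N j (r i) - S N j (r k)\<bar> < \<eta>" using nn[of j i k] n0[OF that] ik by simp
        ultimately show ?thesis using \<eta>(1) by (simp add: abs_le_square_iff[symmetric])
      qed
      have "sq_norm m ?w \<le> (4 / lam * sq_norm m ?w + 4 / lam\<^sup>2 * sq_norm m ?h) / r0\<^sup>2
          + C * (LINT x|lborel. indicator (cball 0 R) x * (?w x)\<^sup>2)"
        using local_global_estimate[OF diff(1) r0(2) C[unfolded R_def]] by (simp add: R_def)
      also have "\<dots> \<le> T / r0\<^sup>2 + C * (?N\<^sup>2 * (\<Sum>j\<in>J\<times>J. \<eta>\<^sup>2) + 4 / ?N\<^sup>2 * (4 * K / c))"
      proof (rule add_mono)
        show "(4 / lam * sq_norm m ?w + 4 / lam\<^sup>2 * sq_norm m ?h) / r0\<^sup>2 \<le> T / r0\<^sup>2"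
          unfolding T_def using diff(2,3)[of i k] lam by (intro divide_right_mono add_mono mult_left_mono) auto
        have "(LINT x|lborel. indicator (cball 0 R) x * (?w x)\<^sup>2) \<le> ?N\<^sup>2 * (\<Sum>j\<in>J\<times>J. (LINT x|lborel. indicator (grid_cell (Suc N) j) x * ?w x)\<^sup>2) + 4 / ?N\<^sup>2 * (sq_norm m ?h / c)"
          by (rule grid_estimate[OF diff(1) _ R J_def c]) auto
        also have "\<dots> \<le> ?N\<^sup>2 * (\<Sum>j\<in>J\<times>J. \<eta>\<^sup>2) + 4 / ?N\<^sup>2 * (4 * K / c)"
          using S2 diff(3)[of i k] c(1) by (intro add_mono mult_left_mono sum_mono divide_right_mono) auto
        finally show "C * (LINT x|lborel. indicator (cball 0 R) x * (?w x)\<^sup>2) \<le> C * (?N\<^sup>2 * (\<Sum>j\<in>J\<times>J. \<eta>\<^sup>2) + 4 / ?N\<^sup>2 * (4 * K / c))"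
          using C(1) by (intro mult_left_mono) auto
      qed
      also have "\<dots> = T / r0\<^sup>2 + (A - 1) * \<eta>\<^sup>2 + C * (4 / ?N\<^sup>2 * (4 * K / c))"
        by (simp only: A_def sum_constant) (simp only: distrib_left add_diff_cancel_right' mult.assoc add.assoc)
      finally have "sq_norm m ?w \<le> T / r0\<^sup>2 + (A - 1) * \<eta>\<^sup>2 + C * (4 / ?N\<^sup>2 * (4 * K / c))" .
      moreover have "(A - 1) * \<eta>\<^sup>2 \<le> A * \<eta>\<^sup>2" by (intro mult_right_mono) auto
      moreover have "A * \<eta>\<^sup>2 = \<epsilon> / 3" using A by (simp add: \<eta>(2))
      ultimately show "sq_norm m ?w < \<epsilon>" using r0T N2 by linarith
    qed
  qed
  then obtain v where "sq_integrable m v" "(\<lambda>n. sq_norm m (\<lambda>x. u (r n) x - v x)) \<longlonglongrightarrow> 0"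
    using sq_integrable_complete[of m "\<lambda>n. u (r n)"] sobolevD(2)[OF u] by blast
  with r show thesis by (rule that)
qed

end

text \<open>The infima of \<open>Q\<close> over the decreasing sets increase to a finite limit.
  Elements of late sets chosen nearly minimal have values close to that limit, and so has any value
  at their midpoint from below, which makes the parallelogram defect small. For a squared norm this
  defect is the squared distance.\<close>

lemma midpoint_cauchy_sequence:
  fixes C :: "nat \<Rightarrow> 'x set" and Q :: "'x \<Rightarrow> real" and mid :: "'x \<Rightarrow> 'x \<Rightarrow> 'x"
  assumes dec: "\<And>i j. i \<le> j \<Longrightarrow> C j \<subseteq> C i" and mid: "\<And>n x y. x \<in> C n \<Longrightarrow> y \<in> C n \<Longrightarrow> mid x y \<in> C n"
    and Q: "\<And>x. 0 \<le> Q x" and M: "\<And>n. \<exists>x\<in>C n. Q x \<le> M"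
  obtains x where "\<And>n. x n \<in> C n"
    "\<And>\<epsilon>. \<epsilon> > 0 \<Longrightarrow> \<exists>N. \<forall>i\<ge>N. \<forall>j\<ge>N. 2 * Q (x i) + 2 * Q (x j) - 4 * Q (mid (x i) (x j)) < \<epsilon>"
proof -
  define \<alpha> where "\<alpha> n = Inf (Q ` C n)" for n
  have bdd: "bdd_below (Q ` C n)" for n by (rule bdd_belowI[of _ 0]) (use Q in auto)
  have ne: "Q ` C n \<noteq> {}" for n using M by blast
  have low: "\<alpha> n \<le> Q x" if "x \<in> C n" for n x unfolding \<alpha>_def using that bdd by (intro cInf_lower) auto
  have le: "\<alpha> n \<le> M" for n using M[of n] low by (meson order_trans)
  have inc: "incseq \<alpha>"
  proof (rule incseq_SucI)
    fix n show "\<alpha> n \<le> \<alpha> (Suc n)"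
      unfolding \<alpha>_def using dec[of n "Suc n"] ne bdd by (intro cInf_superset_mono) auto
  qed
  obtain l where l: "\<alpha> \<longlonglongrightarrow> l" "\<And>n. \<alpha> n \<le> l"
    using incseq_convergent[OF inc, of M] le by blast
  have "\<exists>x\<in>C n. Q x < \<alpha> n + 1 / real (Suc n)" for n
    using cInf_lessD[OF ne, of n "\<alpha> n + 1 / real (Suc n)"] unfolding \<alpha>_def by auto
  then obtain x where x: "\<And>n. x n \<in> C n" "\<And>n. Q (x n) < \<alpha> n + 1 / real (Suc n)" by metis
  show thesis
  proof (rule that[OF x(1)])
    fix \<epsilon> :: real assume \<epsilon>: "\<epsilon> > 0"
    have "(\<lambda>n. 4 * (l - \<alpha> n) + 4 * (1 / real (Suc n))) \<longlonglongrightarrow> 4 * (l - l) + 4 * 0"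
      by (intro tendsto_intros l LIMSEQ_Suc[OF lim_1_over_n])
    then have "\<forall>\<^sub>F n in sequentially. 4 * (l - \<alpha> n) + 4 * (1 / real (Suc n)) < \<epsilon>"
      using \<epsilon> by (intro order_tendstoD(2)) auto
    then obtain N where N: "4 * (l - \<alpha> N) + 4 * (1 / real (Suc N)) < \<epsilon>" by (auto simp: eventually_sequentially)
    show "\<exists>N. \<forall>i\<ge>N. \<forall>j\<ge>N. 2 * Q (x i) + 2 * Q (x j) - 4 * Q (mid (x i) (x j)) < \<epsilon>"
    proof (intro exI[of _ N] allI impI)
      fix i j assume ij: "i \<ge> N" "j \<ge> N"
      have b: "Q (x k) < l + 1 / real (Suc N)" if "k \<ge> N" for k
      proof -
        have "1 / real (Suc k) \<le> 1 / real (Suc N)" using that by (intro divide_left_mono) auto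
        then show ?thesis using x(2)[of k] l(2)[of k] by linarith
      qed
      have "x i \<in> C N" "x j \<in> C N" using x(1) dec ij by blast+
      then have "\<alpha> N \<le> Q (mid (x i) (x j))" by (intro low mid)
      then show "2 * Q (x i) + 2 * Q (x j) - 4 * Q (mid (x i) (x j)) < \<epsilon>" using b[OF ij(1)] b[OF ij(2)] N by argo
    qed
  qed
qed

lemma sq_norm_parallelogram:
  fixes f g :: "'a \<Rightarrow> 'b::euclidean_space"
  assumes f: "sq_integrable M f" and g: "sq_integrable M g"
  shows "sq_norm M (\<lambda>x. f x - g x) = 2 * sq_norm M f + 2 * sq_norm M g - 4 * sq_norm M (\<lambda>x. (1 / 2) *\<^sub>R (f x + g x))"
proof -
  have "sq_norm M (\<lambda>x. f x - g x) = (LINT x|M. 2 * (norm (f x))\<^sup>2 + 2 * (norm (g x))\<^sup>2 - (norm (f x + g x))\<^sup>2)"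
    unfolding sq_norm_def
    by (intro Bochner_Integration.integral_cong) (auto simp: power2_norm_eq_inner inner_add inner_diff algebra_simps)
  also have "\<dots> = 2 * sq_norm M f + 2 * sq_norm M g - sq_norm M (\<lambda>x. f x + g x)"
    using f g sq_integrable_add[OF f g] by (simp add: sq_integrable_def sq_norm_def)
  finally show ?thesis unfolding sq_norm_scaleR by (simp add: power_divide)
qed

text \<open>Balls in \<open>L\<^sup>2\<close> are closed under midpoints; through this lemma bounds
  pass to hulls.\<close>

lemma sq_norm_midpoint_le:
  fixes f g :: "'a \<Rightarrow> 'b::euclidean_space"
  assumes f: "sq_integrable M f" "sq_norm M f \<le> L" and g: "sq_integrable M g" "sq_norm M g \<le> L"
  shows "sq_norm M (\<lambda>x. (1 / 2) *\<^sub>R (f x + g x)) \<le> L"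
  unfolding sq_norm_scaleR using sq_norm_add_le[OF f(1) g(1)] f(2) g(2) by (simp add: power_divide)

lemma sq_norm_tendsto_sum:
  fixes f :: "nat \<Rightarrow> nat \<Rightarrow> 'a \<Rightarrow> 'b::euclidean_space"
  assumes f: "\<And>n i. i < k \<Longrightarrow> sq_integrable M (f n i)" "\<And>i. i < k \<Longrightarrow> sq_integrable M (h i)"
    and lim: "\<And>i. i < k \<Longrightarrow> (\<lambda>n. sq_norm M (\<lambda>x. f n i x - h i x)) \<longlonglongrightarrow> 0"
  shows "(\<lambda>n. sq_norm M (\<lambda>x. (\<Sum>i<k. a i *\<^sub>R f n i x) - (\<Sum>i<k. a i *\<^sub>R h i x))) \<longlonglongrightarrow> 0"
  using assms
proof (induction k)
  case 0
  then show ?case by (simp add: sq_norm_def)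
next
  case (Suc k)
  let ?A = "\<lambda>n x. (\<Sum>i<k. a i *\<^sub>R f n i x) - (\<Sum>i<k. a i *\<^sub>R h i x)" and ?B = "\<lambda>n x. a k *\<^sub>R (f n k x - h k x)"
  have sA: "sq_integrable M (?A n)" for n
    using Suc.prems(1,2) by (intro sq_integrable_diff sq_integrable_sum sq_integrable_scaleR) auto
  have sB: "sq_integrable M (?B n)" for n
    using Suc.prems(1,2) by (intro sq_integrable_diff sq_integrable_scaleR) auto
  have "(\<lambda>n. sq_norm M (?A n)) \<longlonglongrightarrow> 0" using Suc.prems by (intro Suc.IH) auto
  moreover have "(\<lambda>n. sq_norm M (?B n)) \<longlonglongrightarrow> 0"
    unfolding sq_norm_scaleR using Suc.prems(3)[of k] tendsto_mult_right_zero by auto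
  ultimately have "(\<lambda>n. 2 * sq_norm M (?A n) + 2 * sq_norm M (?B n)) \<longlonglongrightarrow> 2 * 0 + 2 * 0" by (intro tendsto_intros)
  then have lim: "(\<lambda>n. 2 * sq_norm M (?A n) + 2 * sq_norm M (?B n)) \<longlonglongrightarrow> 0" by simp
  have eq: "(\<Sum>i<Suc k. a i *\<^sub>R f n i x) - (\<Sum>i<Suc k. a i *\<^sub>R h i x) = ?A n x + ?B n x" for n x
    by (simp add: algebra_simps)
  show ?case unfolding eq
    by (rule tendsto_sandwich[OF _ _ tendsto_const lim])
       (use sq_norm_add_le[OF sA sB] in \<open>auto intro!: always_eventually\<close>)
qed

text \<open>A \<open>k\<close>-tuple of functions together with their gradients; iterated midpoints replace convex
  combinations, which is all that the parallelogram identity needs.\<close>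

type_synonym tuple = "(nat \<Rightarrow> real^2 \<Rightarrow> real) \<times> (nat \<Rightarrow> real^2 \<Rightarrow> real^2)"

definition tuple_mid :: "tuple \<Rightarrow> tuple \<Rightarrow> tuple" where
  "tuple_mid p q = (\<lambda>i x. (1 / 2) * (fst p i x + fst q i x), \<lambda>i x. (1 / 2) *\<^sub>R (snd p i x + snd q i x))"

inductive_set tuple_hull :: "tuple set \<Rightarrow> tuple set" for S where
  base: "p \<in> S \<Longrightarrow> p \<in> tuple_hull S"
| mid: "p \<in> tuple_hull S \<Longrightarrow> q \<in> tuple_hull S \<Longrightarrow> tuple_mid p q \<in> tuple_hull S"

lemma tuple_hull_mono: "S \<subseteq> T \<Longrightarrow> tuple_hull S \<subseteq> tuple_hull T"
proof
  fix p assume "S \<subseteq> T" "p \<in> tuple_hull S"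
  from this(2,1) show "p \<in> tuple_hull T" by induction (auto intro: tuple_hull.intros)
qed

context gaussian_plane
begin

lemma tuple_hull_sobolev:
  assumes "p \<in> tuple_hull S" "\<And>s. s \<in> S \<Longrightarrow> sobolev (fst s i) (snd s i) \<and> quasi_continuous m (fst s i)"
  shows "sobolev (fst p i) (snd p i) \<and> quasi_continuous m (fst p i)"
  using assms(1)
proof induction
  case (mid p q)
  have s: "sobolev (\<lambda>x. (1 / 2) * (fst p i x + fst q i x)) (\<lambda>x. (1 / 2) *\<^sub>R (snd p i x + snd q i x))"
    by (rule sobolev_scale[OF sobolev_add]) (use mid in auto)
  have "quasi_continuous m (\<lambda>x. (1 / 2) * (fst p i x + fst q i x))"
    by (rule quasi_continuous_scale[OF quasi_continuous_add]) (use mid in auto)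
  with s show ?case unfolding tuple_mid_def fst_conv snd_conv by blast
qed (use assms in auto)

text \<open>Being close to \<open>v\<close> in square mean is a convex condition, so averaging a
  tail of a convergent sequence does not move its limit.\<close>

lemma tuple_hull_close:
  assumes p: "p \<in> tuple_hull S" and S: "\<And>s. s \<in> S \<Longrightarrow> sobolev (fst s i) (snd s i) \<and> quasi_continuous m (fst s i)"
    and v: "sq_integrable m v" and close: "\<And>s. s \<in> S \<Longrightarrow> sq_norm m (\<lambda>x. fst s i x - v x) \<le> \<epsilon>"
  shows "sq_norm m (\<lambda>x. fst p i x - v x) \<le> \<epsilon>"
  using p
proof induction
  case (mid p q)
  have sq: "sq_integrable m (\<lambda>x. fst p i x - v x)" "sq_integrable m (\<lambda>x. fst q i x - v x)"
    using tuple_hull_sobolev[OF mid(1) S] tuple_hull_sobolev[OF mid(2) S] v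
    by (auto intro!: sq_integrable_diff dest: sobolevD(2))
  have eq: "fst (tuple_mid p q) i x - v x = (1 / 2) *\<^sub>R ((fst p i x - v x) + (fst q i x - v x))" for x
    by (simp add: tuple_mid_def field_simps)
  show ?case unfolding eq by (rule sq_norm_midpoint_le[OF sq(1) mid(3) sq(2) mid(4)])
qed (use close in auto)

text \<open>The same midpoints are taken in all coordinates of a tuple, so every fixed linear
  combination of the gradients is averaged as a whole and keeps its bound. Averaging each coordinate
  on its own would destroy this.\<close>

lemma tuple_hull_gradient:
  assumes p: "p \<in> tuple_hull S" and S: "\<And>s i. s \<in> S \<Longrightarrow> i < k \<Longrightarrow> sobolev (fst s i) (snd s i) \<and> quasi_continuous m (fst s i)"
    and L: "\<And>s. s \<in> S \<Longrightarrow> sq_norm m (\<lambda>x. \<Sum>i<k. t i *\<^sub>R snd s i x) \<le> L"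
  shows "sq_norm m (\<lambda>x. \<Sum>i<k. t i *\<^sub>R snd p i x) \<le> L"
  using p
proof induction
  case (mid p q)
  have sq: "sq_integrable m (\<lambda>x. \<Sum>i<k. t i *\<^sub>R snd p i x)" if "p \<in> tuple_hull S" for p
    using tuple_hull_sobolev[OF that S]
    by (intro sq_integrable_sum sq_integrable_scaleR) (auto dest: sobolevD(3))
  have eq: "(\<Sum>i<k. t i *\<^sub>R snd (tuple_mid p q) i x) = (1 / 2) *\<^sub>R ((\<Sum>i<k. t i *\<^sub>R snd p i x) + (\<Sum>i<k. t i *\<^sub>R snd q i x))" for x
    by (simp add: tuple_mid_def scaleR_sum_right scaleR_add_right sum.distrib mult.commute)
  show ?case unfolding eq by (rule sq_norm_midpoint_le[OF sq[OF mid(1)] mid(3) sq[OF mid(2)] mid(4)])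
qed (use L in auto)

text \<open>One further thinning per coordinate; convergence obtained for earlier coordinates passes
  to subsequences.\<close>

lemma tuple_subsequence:
  fixes k :: nat
  assumes "\<And>n i. i < k \<Longrightarrow> sobolev (b n i) (g n i)" "\<And>n i. i < k \<Longrightarrow> sq_norm m (b n i) \<le> K" "\<And>n i. i < k \<Longrightarrow> sq_norm m (g n i) \<le> K"
  shows "\<exists>r. strict_mono (r::nat\<Rightarrow>nat) \<and> (\<forall>i<k. \<exists>v. sq_integrable m v \<and> (\<lambda>n. sq_norm m (\<lambda>x. b (r n) i x - v x)) \<longlonglongrightarrow> 0 \<and>
     (AE x in m. (\<lambda>n. b (r n) i x) \<longlonglongrightarrow> v x))"
  using assms
proof (induction k)
  case 0
  show ?case by (intro exI[of _ id] conjI) (simp_all add: strict_mono_def)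
next
  case (Suc k)
  have "\<exists>r. strict_mono (r::nat\<Rightarrow>nat) \<and> (\<forall>i<k. \<exists>v. sq_integrable m v \<and> (\<lambda>n. sq_norm m (\<lambda>x. b (r n) i x - v x)) \<longlonglongrightarrow> 0 \<and>
     (AE x in m. (\<lambda>n. b (r n) i x) \<longlonglongrightarrow> v x))" by (rule Suc.IH) (use Suc.prems in auto)
  then obtain r where r: "strict_mono (r::nat\<Rightarrow>nat)" and rv: "\<And>i. i < k \<Longrightarrow> \<exists>v. sq_integrable m v \<and> (\<lambda>n. sq_norm m (\<lambda>x. b (r n) i x - v x)) \<longlonglongrightarrow> 0 \<and>
     (AE x in m. (\<lambda>n. b (r n) i x) \<longlonglongrightarrow> v x)" by blast
  have s: "sobolev (b (r n) k) (g (r n) k)" "sq_norm m (b (r n) k) \<le> K" "sq_norm m (g (r n) k) \<le> K" for n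
    using Suc.prems by auto
  obtain r1 v where r1: "strict_mono (r1::nat\<Rightarrow>nat)" "sq_integrable m v" "(\<lambda>n. sq_norm m (\<lambda>x. b (r (r1 n)) k x - v x)) \<longlonglongrightarrow> 0"
    by (rule rellich[of "\<lambda>n. b (r n) k" "\<lambda>n. g (r n) k" K]) (use s in auto)
  obtain r2 where r2: "strict_mono (r2::nat\<Rightarrow>nat)" "AE x in m. (\<lambda>n. b (r (r1 (r2 n))) k x) \<longlonglongrightarrow> v x"
    by (rule sq_norm_tendsto_AE_subseq[of m "\<lambda>n. b (r (r1 n)) k" v]) (use sobolevD(2)[OF s(1)] r1 in auto)
  have m12: "strict_mono (r1 \<circ> r2)" using r1(1) r2(1) by (rule strict_mono_o)
  show ?case
  proof (intro exI[of _ "r \<circ> (r1 \<circ> r2)"] conjI allI impI)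
    show "strict_mono (r \<circ> (r1 \<circ> r2))" using r m12 by (rule strict_mono_o)
    fix i assume "i < Suc k"
    then consider "i < k" | "i = k" by linarith
    then show "\<exists>v. sq_integrable m v \<and> (\<lambda>n. sq_norm m (\<lambda>x. b ((r \<circ> (r1 \<circ> r2)) n) i x - v x)) \<longlonglongrightarrow> 0 \<and>
     (AE x in m. (\<lambda>n. b ((r \<circ> (r1 \<circ> r2)) n) i x) \<longlonglongrightarrow> v x)"
    proof cases
      case 1
      from rv[OF this] obtain w where w: "sq_integrable m w" "(\<lambda>n. sq_norm m (\<lambda>x. b (r n) i x - w x)) \<longlonglongrightarrow> 0"
        "AE x in m. (\<lambda>n. b (r n) i x) \<longlonglongrightarrow> w x" by blast
      have "AE x in m. (\<lambda>n. b ((r \<circ> (r1 \<circ> r2)) n) i x) \<longlonglongrightarrow> w x"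
        using w(3) by eventually_elim (use LIMSEQ_subseq_LIMSEQ[OF _ m12] in \<open>auto simp: o_def\<close>)
      then show ?thesis using w(1) LIMSEQ_subseq_LIMSEQ[OF w(2) m12] by (auto simp: o_def)
    next
      case 2
      then show ?thesis using r1(2) r2(2) LIMSEQ_subseq_LIMSEQ[OF r1(3) r2(1)] by (auto simp: o_def)
    qed
  qed
qed

text \<open>The last conclusion is lower semicontinuity of the Dirichlet form on all linear
  combinations at once. It is phrased as a transfer of upper bounds from tails, because
  \<open>G\<close> is a strong limit of averages of the gradients and not of the gradients
  themselves.\<close>

theorem quasi_continuous_compactness:
  fixes k :: nat
  assumes b: "\<And>n i. i < k \<Longrightarrow> sobolev (b n i) (g n i)" "\<And>n i. i < k \<Longrightarrow> quasi_continuous m (b n i)"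
    and K: "\<And>n i. i < k \<Longrightarrow> sq_norm m (b n i) \<le> K" "\<And>n i. i < k \<Longrightarrow> sq_norm m (g n i) \<le> K"
  obtains r B G where "strict_mono (r::nat\<Rightarrow>nat)"
    "\<forall>i<k. sobolev (B i) (G i) \<and> quasi_continuous m (B i) \<and> (\<lambda>n. sq_norm m (\<lambda>x. b (r n) i x - B i x)) \<longlonglongrightarrow> 0 \<and>
      (AE x in m. (\<lambda>n. b (r n) i x) \<longlonglongrightarrow> B i x)"
    "\<forall>t L N. (\<forall>n\<ge>N. sq_norm m (\<lambda>x. \<Sum>i<k. t i *\<^sub>R g (r n) i x) \<le> L) \<longrightarrow> sq_norm m (\<lambda>x. \<Sum>i<k. t i *\<^sub>R G i x) \<le> L"
proof -
  define lim where "lim r i v \<longleftrightarrow> sq_integrable m v \<and> (\<lambda>n. sq_norm m (\<lambda>x. b (r n) i x - v x)) \<longlonglongrightarrow> 0 \<and>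
     (AE x in m. (\<lambda>n. b (r n) i x) \<longlonglongrightarrow> v x)" for r :: "nat \<Rightarrow> nat" and i v
  have "\<exists>r. strict_mono (r::nat\<Rightarrow>nat) \<and> (\<forall>i<k. \<exists>v. lim r i v)"
    unfolding lim_def by (rule tuple_subsequence[of k b g K]) (use b(1) K in auto)
  then obtain r where r: "strict_mono (r::nat\<Rightarrow>nat)" and ex: "\<forall>i<k. \<exists>v. lim r i v" by blast
  from ex obtain v where "\<And>i. i < k \<Longrightarrow> lim r i (v i)" by metis
  then have v: "\<And>i. i < k \<Longrightarrow> sq_integrable m (v i)" "\<And>i. i < k \<Longrightarrow> (\<lambda>n. sq_norm m (\<lambda>x. b (r n) i x - v i x)) \<longlonglongrightarrow> 0"
    "\<And>i. i < k \<Longrightarrow> AE x in m. (\<lambda>n. b (r n) i x) \<longlonglongrightarrow> v i x" unfolding lim_def by blast+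
  \<comment> \<open>Tails, so that each property valid from some index on is inherited by the hulls
    from that index on.\<close>
  define S where "S n = (\<lambda>j. (b (r j), g (r j))) ` {n..}" for n
  have SS: "\<And>s i. s \<in> S n \<Longrightarrow> i < k \<Longrightarrow> sobolev (fst s i) (snd s i) \<and> quasi_continuous m (fst s i)" for n
    unfolding S_def using b by auto
  have hs: "\<And>p i. p \<in> tuple_hull (S n) \<Longrightarrow> i < k \<Longrightarrow> sobolev (fst p i) (snd p i) \<and> quasi_continuous m (fst p i)" for n
    using tuple_hull_sobolev SS by blast
  have Sdec: "i \<le> j \<Longrightarrow> tuple_hull (S j) \<subseteq> tuple_hull (S i)" for i j
    by (rule tuple_hull_mono) (auto simp: S_def)
  \<comment> \<open>Only gradients enter \<open>Q\<close>: the functions themselves already converge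
    strongly.\<close>
  define Q where "Q p = (\<Sum>i<k. sq_norm m (snd p i))" for p :: tuple
  obtain x where x: "\<And>n. x n \<in> tuple_hull (S n)"
    and xc: "\<And>\<epsilon>. \<epsilon> > 0 \<Longrightarrow> \<exists>N. \<forall>i\<ge>N. \<forall>j\<ge>N. 2 * Q (x i) + 2 * Q (x j) - 4 * Q (tuple_mid (x i) (x j)) < \<epsilon>"
  proof (rule midpoint_cauchy_sequence[of "\<lambda>n. tuple_hull (S n)" tuple_mid Q "real k * K"])
    show "\<exists>p\<in>tuple_hull (S n). Q p \<le> real k * K" for n
    proof
      show "(b (r n), g (r n)) \<in> tuple_hull (S n)" by (rule tuple_hull.base) (simp add: S_def)
      have "Q (b (r n), g (r n)) \<le> (\<Sum>i<k. K)" unfolding Q_def by (rule sum_mono) (use K in auto)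
      then show "Q (b (r n), g (r n)) \<le> real k * K" by simp
    qed
  qed (auto simp: Q_def intro: Sdec[THEN subsetD] tuple_hull.mid sum_nonneg)
  have sx: "sobolev (fst (x n) i) (snd (x n) i)" "quasi_continuous m (fst (x n) i)" if "i < k" for n i
    using hs[OF x that] by auto
  define glim where "glim i G \<longleftrightarrow> sq_integrable m G \<and> (\<lambda>n. sq_norm m (\<lambda>y. snd (x n) i y - G y)) \<longlonglongrightarrow> 0" for i G
  have "\<exists>G. glim i G" if i: "i < k" for i
  proof -
    have "\<exists>N. \<forall>p\<ge>N. \<forall>q\<ge>N. sq_norm m (\<lambda>y. snd (x p) i y - snd (x q) i y) < \<epsilon>" if e: "\<epsilon> > 0" for \<epsilon>
    proof -
      obtain N where N: "\<forall>p\<ge>N. \<forall>q\<ge>N. 2 * Q (x p) + 2 * Q (x q) - 4 * Q (tuple_mid (x p) (x q)) < \<epsilon>" using xc[OF e] by blast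
      have "sq_norm m (\<lambda>y. snd (x p) i y - snd (x q) i y) \<le> 2 * Q (x p) + 2 * Q (x q) - 4 * Q (tuple_mid (x p) (x q))" for p q
      proof -
        have "sq_norm m (\<lambda>y. snd (x p) i y - snd (x q) i y) \<le> (\<Sum>i<k. sq_norm m (\<lambda>y. snd (x p) i y - snd (x q) i y))"
          using i by (intro member_le_sum) auto
        also have "\<dots> = (\<Sum>i<k. 2 * sq_norm m (snd (x p) i) + 2 * sq_norm m (snd (x q) i) - 4 * sq_norm m (snd (tuple_mid (x p) (x q)) i))"
          unfolding tuple_mid_def snd_conv
          by (intro sum.cong refl sq_norm_parallelogram) (use sobolevD(3)[OF sx(1)] in auto)
        also have "\<dots> = 2 * Q (x p) + 2 * Q (x q) - 4 * Q (tuple_mid (x p) (x q))"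
          unfolding Q_def by (simp add: sum.distrib sum_subtractf sum_distrib_left)
        finally show ?thesis .
      qed
      with N show ?thesis by (meson le_less_trans)
    qed
    note cauchy = this
    obtain G where "sq_integrable m G" "(\<lambda>n. sq_norm m (\<lambda>y. snd (x n) i y - G y)) \<longlonglongrightarrow> 0"
      by (rule sq_integrable_complete[of m "\<lambda>n. snd (x n) i", OF sobolevD(3)[OF sx(1)[OF i]] cauchy])
    then show ?thesis unfolding glim_def by blast
  qed
  then obtain G where "\<And>i. i < k \<Longrightarrow> glim i (G i)" by metis
  then have G: "\<And>i. i < k \<Longrightarrow> sq_integrable m (G i)" "\<And>i. i < k \<Longrightarrow> (\<lambda>n. sq_norm m (\<lambda>y. snd (x n) i y - G i y)) \<longlonglongrightarrow> 0"
    unfolding glim_def by blast+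
  \<comment> \<open>The averaged functions keep the limit \<open>v i\<close>, since they lie in
    hulls of ever later tails.\<close>
  have U: "(\<lambda>n. sq_norm m (\<lambda>y. fst (x n) i y - v i y)) \<longlonglongrightarrow> 0" if i: "i < k" for i
  proof (rule LIMSEQ_I)
    fix \<epsilon> :: real assume "\<epsilon> > 0"
    then have "\<epsilon> / 2 > 0" by simp
    from order_tendstoD(2)[OF v(2)[OF i] this] obtain N where N: "\<And>n. n \<ge> N \<Longrightarrow> sq_norm m (\<lambda>x. b (r n) i x - v i x) < \<epsilon> / 2"
      by (auto simp: eventually_sequentially)
    have "sq_norm m (\<lambda>y. fst (x n) i y - v i y) \<le> \<epsilon> / 2" if "n \<ge> N" for n
    proof (rule tuple_hull_close[OF _ SS[OF _ i] v(1)[OF i]])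
      show "x n \<in> tuple_hull (S N)" using x Sdec[OF that] by blast
      show "sq_norm m (\<lambda>x. fst s i x - v i x) \<le> \<epsilon> / 2" if "s \<in> S N" for s using that N by (auto simp: S_def less_imp_le)
    qed
    note half = this
    show "\<exists>no. \<forall>n\<ge>no. norm (sq_norm m (\<lambda>y. fst (x n) i y - v i y) - 0) < \<epsilon>"
    proof (intro exI[of _ N] allI impI)
      fix n assume "N \<le> n"
      from half[OF this] \<open>\<epsilon> > 0\<close> show "norm (sq_norm m (\<lambda>y. fst (x n) i y - v i y) - 0) < \<epsilon>" by simp
    qed
  qed
  \<comment> \<open>The limit \<open>v i\<close> is only a class modulo null sets; strong
    convergence of the averages with their gradients provides a quasi-continuous
    representative.\<close>
  define rep where "rep i B \<longleftrightarrow> quasi_continuous m B \<and> sobolev B (G i) \<and> (AE x in m. B x = v i x)" for i B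
  have "\<exists>B. rep i B" if i: "i < k" for i
  proof -
    have "sobolev (v i) (G i)" by (rule sobolev_limit[OF sx(1)[OF i] v(1)[OF i] G(1)[OF i] U[OF i] G(2)[OF i]])
    from this obtain B where "quasi_continuous m B" "sobolev B (G i)" "AE x in m. B x = v i x"
      by (rule quasi_continuous_limit[OF sx(2)[OF i] sx(1)[OF i] _ U[OF i] G(2)[OF i]])
    then show ?thesis unfolding rep_def by blast
  qed
  then obtain B where "\<And>i. i < k \<Longrightarrow> rep i (B i)" by metis
  then have B: "\<And>i. i < k \<Longrightarrow> quasi_continuous m (B i)" "\<And>i. i < k \<Longrightarrow> sobolev (B i) (G i)" "\<And>i. i < k \<Longrightarrow> AE x in m. B i x = v i x"
    unfolding rep_def by blast+
  show thesis
  proof (rule that[OF r])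
    have "sobolev (B i) (G i) \<and> quasi_continuous m (B i) \<and> (\<lambda>n. sq_norm m (\<lambda>x. b (r n) i x - B i x)) \<longlonglongrightarrow> 0 \<and>
      (AE x in m. (\<lambda>n. b (r n) i x) \<longlonglongrightarrow> B i x)" if i: "i < k" for i
    proof (intro conjI B(1)[OF i] B(2)[OF i])
    have "sq_norm m (\<lambda>x. b (r n) i x - B i x) = sq_norm m (\<lambda>x. b (r n) i x - v i x)" for n
    proof (rule sq_norm_cong_AE)
      show "AE x in m. b (r n) i x - B i x = b (r n) i x - v i x" using B(3)[OF i] by eventually_elim simp
      show "(\<lambda>x. b (r n) i x - B i x) \<in> borel_measurable m" "(\<lambda>x. b (r n) i x - v i x) \<in> borel_measurable m"
        using sobolevD(2)[OF b(1)[OF i]] sobolevD(2)[OF B(2)[OF i]] v(1)[OF i]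
        by (auto intro!: borel_measurable_diff dest: sq_integrable_measurable)
    qed
    with v(2)[OF i] show "(\<lambda>n. sq_norm m (\<lambda>x. b (r n) i x - B i x)) \<longlonglongrightarrow> 0" by simp
    show "AE x in m. (\<lambda>n. b (r n) i x) \<longlonglongrightarrow> B i x" using v(3)[OF i] B(3)[OF i] by eventually_elim simp
    qed
    then show "\<forall>i<k. sobolev (B i) (G i) \<and> quasi_continuous m (B i) \<and> (\<lambda>n. sq_norm m (\<lambda>x. b (r n) i x - B i x)) \<longlonglongrightarrow> 0 \<and>
      (AE x in m. (\<lambda>n. b (r n) i x) \<longlonglongrightarrow> B i x)" by blast
  next
    show "\<forall>t L N. (\<forall>n\<ge>N. sq_norm m (\<lambda>x. \<Sum>i<k. t i *\<^sub>R g (r n) i x) \<le> L) \<longrightarrow> sq_norm m (\<lambda>x. \<Sum>i<k. t i *\<^sub>R G i x) \<le> L"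
    proof (intro allI impI)
    fix t L N assume L: "\<forall>n\<ge>N. sq_norm m (\<lambda>x. \<Sum>i<k. t i *\<^sub>R g (r n) i x) \<le> L"
    show "sq_norm m (\<lambda>x. \<Sum>i<k. t i *\<^sub>R G i x) \<le> L"
    proof (rule sq_norm_limit_le)
      show "sq_integrable m (\<lambda>y. \<Sum>i<k. t i *\<^sub>R snd (x n) i y)" for n
        using sobolevD(3)[OF sx(1)] by (intro sq_integrable_sum sq_integrable_scaleR) auto
      show "sq_integrable m (\<lambda>x. \<Sum>i<k. t i *\<^sub>R G i x)" using G(1) by (intro sq_integrable_sum sq_integrable_scaleR) auto
      show "(\<lambda>n. sq_norm m (\<lambda>y. (\<Sum>i<k. t i *\<^sub>R snd (x n) i y) - (\<Sum>i<k. t i *\<^sub>R G i y))) \<longlonglongrightarrow> 0"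
        using sobolevD(3)[OF sx(1)] G by (intro sq_norm_tendsto_sum) auto
      \<comment> \<open>The bound on the tail from \<open>N\<close> on holds on its hull, which
        contains \<open>x n\<close> for \<open>n \<ge> N\<close>.\<close>
      show "sq_norm m (\<lambda>y. \<Sum>i<k. t i *\<^sub>R snd (x n) i y) \<le> L" if "N \<le> n" for n
      proof (rule tuple_hull_gradient[OF _ SS])
        show "x n \<in> tuple_hull (S N)" using x Sdec[OF that] by blast
        show "sq_norm m (\<lambda>x. \<Sum>i<k. t i *\<^sub>R snd s i x) \<le> L" if "s \<in> S N" for s using that L by (auto simp: S_def)
      qed
    qed
    qed
  qed
qed

end

subsection \<open>Orthonormal systems\<close>

lemma sq_integrable_mult:
  fixes f g :: "'a \<Rightarrow> real"
  assumes "sq_integrable M f" "sq_integrable M g" shows "integrable M (\<lambda>x. f x * g x)"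
  using sq_integrable_inner[OF assms] by simp

lemma sq_norm_real: "sq_norm M f = (LINT x|M. f x * (f x :: real))"
  by (simp add: sq_norm_def power2_eq_square)

lemma sq_norm_zero_AE:
  fixes f :: "'a \<Rightarrow> 'b::euclidean_space"
  assumes "sq_integrable M f" "sq_norm M f \<le> 0" shows "AE x in M. f x = 0"
proof -
  have "(LINT x|M. (norm (f x))\<^sup>2) = 0" using assms(2) sq_norm_nonneg[of M f] unfolding sq_norm_def by linarith
  then have "AE x in M. (norm (f x))\<^sup>2 = 0"
    using integral_nonneg_eq_0_iff_AE[OF sq_integrableD[OF assms(1)]] by simp
  then show ?thesis by eventually_elim simp
qed

text \<open>The weight \<open>\<tau>\<close> is left free, to be tuned to convergence rates and to
  the Poincare constant.\<close>

lemma young_integral: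
  fixes f w :: "'a \<Rightarrow> real"
  assumes f: "sq_integrable M f" and w: "sq_integrable M w" and \<tau>: "\<tau> > 0"
  shows "\<bar>LINT x|M. f x * w x\<bar> \<le> \<tau> / 2 * sq_norm M f + 1 / (2 * \<tau>) * sq_norm M w"
proof -
  have "\<bar>LINT x|M. f x * w x\<bar> \<le> (LINT x|M. \<bar>f x * w x\<bar>)" by (rule integral_abs_bound)
  also have "\<dots> \<le> (LINT x|M. \<tau> / 2 * (norm (f x))\<^sup>2 + 1 / (2 * \<tau>) * (norm (w x))\<^sup>2)"
  proof (rule integral_mono)
    show "integrable M (\<lambda>x. \<bar>f x * w x\<bar>)" using sq_integrable_mult[OF f w] by (rule integrable_abs)
    show "integrable M (\<lambda>x. \<tau> / 2 * (norm (f x))\<^sup>2 + 1 / (2 * \<tau>) * (norm (w x))\<^sup>2)"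
      using sq_integrableD[OF f] sq_integrableD[OF w] by auto
    fix x
    have "2 * (\<tau> * \<bar>f x\<bar>) * \<bar>w x\<bar> \<le> (\<tau> * \<bar>f x\<bar>)\<^sup>2 + \<bar>w x\<bar>\<^sup>2" by (rule sum_squares_bound)
    then show "\<bar>f x * w x\<bar> \<le> \<tau> / 2 * (norm (f x))\<^sup>2 + 1 / (2 * \<tau>) * (norm (w x))\<^sup>2"
      using \<tau> by (simp add: abs_mult field_simps power2_eq_square)
  qed
  also have "\<dots> = \<tau> / 2 * sq_norm M f + 1 / (2 * \<tau>) * sq_norm M w"
    using sq_integrableD[OF f] sq_integrableD[OF w] by (simp add: sq_norm_def)
  finally show ?thesis .
qed

lemma sq_norm_tendsto_mult:
  fixes f :: "'a \<Rightarrow> real"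
  assumes f: "sq_integrable M f" and u: "\<And>n. sq_integrable M (u n)" "sq_integrable M v"
    and lim: "(\<lambda>n. sq_norm M (\<lambda>x. u n x - v x)) \<longlonglongrightarrow> 0"
  shows "(\<lambda>n. LINT x|M. f x * u n x) \<longlonglongrightarrow> (LINT x|M. f x * v x)"
proof (rule LIMSEQ_I)
  fix \<epsilon> :: real assume \<epsilon>: "\<epsilon> > 0"
  \<comment> \<open>The added 1 covers the case \<open>sq_norm M f = 0\<close>.\<close>
  define \<tau> where "\<tau> = \<epsilon> / (sq_norm M f + 1)"
  have \<tau>: "\<tau> > 0" using \<epsilon> sq_norm_nonneg[of M f] by (auto simp: \<tau>_def intro!: divide_pos_pos add_nonneg_pos)
  have \<tau>f: "\<tau> / 2 * sq_norm M f \<le> \<epsilon> / 2"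
  proof -
    have "\<tau> * sq_norm M f \<le> \<tau> * (sq_norm M f + 1)" using \<tau> by simp
    also have "\<dots> = \<epsilon>" using sq_norm_nonneg[of M f] by (simp add: \<tau>_def add_nonneg_eq_0_iff)
    finally show ?thesis by simp
  qed
  have "\<epsilon> * \<tau> > 0" using \<epsilon> \<tau> by simp
  from order_tendstoD(2)[OF lim this] obtain N where N: "\<And>n. n \<ge> N \<Longrightarrow> sq_norm M (\<lambda>x. u n x - v x) < \<epsilon> * \<tau>"
    by (auto simp: eventually_sequentially)
  show "\<exists>no. \<forall>n\<ge>no. norm ((LINT x|M. f x * u n x) - (LINT x|M. f x * v x)) < \<epsilon>"
  proof (intro exI[of _ N] allI impI)
    fix n assume n: "n \<ge> N"
    have "norm ((LINT x|M. f x * u n x) - (LINT x|M. f x * v x)) = \<bar>LINT x|M. f x * (u n x - v x)\<bar>"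
      using sq_integrable_mult[OF f u(1)] sq_integrable_mult[OF f u(2)] by (simp add: right_diff_distrib)
    also have "\<dots> \<le> \<tau> / 2 * sq_norm M f + 1 / (2 * \<tau>) * sq_norm M (\<lambda>x. u n x - v x)"
      by (rule young_integral[OF f sq_integrable_diff[OF u] \<tau>])
    also have "\<dots> < \<epsilon> / 2 + 1 / (2 * \<tau>) * (\<epsilon> * \<tau>)"
      using \<tau>f N[OF n] \<tau> by (intro add_le_less_mono mult_strict_left_mono) auto
    also have "\<dots> = \<epsilon>" using \<tau> by simp
    finally show "norm ((LINT x|M. f x * u n x) - (LINT x|M. f x * v x)) < \<epsilon>" .
  qed
qed

definition orthonormal :: "'a measure \<Rightarrow> nat \<Rightarrow> (nat \<Rightarrow> 'a \<Rightarrow> real) \<Rightarrow> bool" where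
  "orthonormal M k e \<longleftrightarrow> (\<forall>i<k. sq_integrable M (e i)) \<and>
    (\<forall>i<k. \<forall>j<k. (LINT x|M. e i x * e j x) = (if i = j then 1 else 0))"

lemma orthonormal_coefficient:
  assumes e: "orthonormal M k e" and j: "j < k"
  shows "(LINT x|M. (\<Sum>i<k. a i * e i x) * e j x) = a j"
proof -
  have i: "integrable M (\<lambda>x. e i x * e j x)" if "i < k" for i
    using e j that by (auto simp: orthonormal_def intro: sq_integrable_mult)
  have "(LINT x|M. (\<Sum>i<k. a i * e i x) * e j x) = (LINT x|M. (\<Sum>i<k. a i * (e i x * e j x)))"
    by (simp add: sum_distrib_right mult.assoc)
  also have "\<dots> = (\<Sum>i<k. a i * (LINT x|M. e i x * e j x))"
    using i by (subst Bochner_Integration.integral_sum) auto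
  also have "\<dots> = (\<Sum>i<k. if i = j then a i else 0)" using e j by (intro sum.cong) (auto simp: orthonormal_def)
  also have "\<dots> = a j" using j by simp
  finally show ?thesis .
qed

lemma orthonormal_lincomb_sq_integrable:
  "orthonormal M k e \<Longrightarrow> sq_integrable M (\<lambda>x. \<Sum>i<k. a i * e i x)"
  using sq_integrable_sum[of "{..<k}" M "\<lambda>i x. a i *\<^sub>R e i x"]
  by (auto simp: orthonormal_def intro: sq_integrable_scaleR[where 'b=real, simplified])

lemma orthonormal_sq_norm:
  assumes e: "orthonormal M k e" shows "sq_norm M (\<lambda>x. \<Sum>i<k. a i * e i x) = (\<Sum>i<k. (a i)\<^sup>2)"
proof -
  let ?u = "\<lambda>x. \<Sum>i<k. a i * e i x"
  have u: "sq_integrable M ?u" by (rule orthonormal_lincomb_sq_integrable[OF e])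
  have i: "integrable M (\<lambda>x. ?u x * e j x)" if "j < k" for j
    using sq_integrable_mult[OF u] e that by (auto simp: orthonormal_def)
  have "sq_norm M ?u = (LINT x|M. (\<Sum>j<k. a j * (?u x * e j x)))"
    unfolding sq_norm_real by (intro Bochner_Integration.integral_cong refl) (simp add: sum_distrib_left mult_ac)
  also have "\<dots> = (\<Sum>j<k. a j * (LINT x|M. ?u x * e j x))" using i by (subst Bochner_Integration.integral_sum) auto
  also have "\<dots> = (\<Sum>j<k. (a j)\<^sup>2)" using orthonormal_coefficient[OF e] by (intro sum.cong) (auto simp: power2_eq_square)
  finally show ?thesis .
qed

text \<open>Explicit coefficients keep each orthonormal function an everywhere valid combination of
  the \<open>b j\<close>. It therefore inherits quasi-continuity and vanishing outside the domain,
  which modification on null sets could spoil.\<close>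

lemma gram_schmidt:
  fixes b :: "nat \<Rightarrow> 'a \<Rightarrow> real"
  assumes b: "\<And>i. i < k \<Longrightarrow> sq_integrable M (b i)"
    and indep: "\<And>a. (AE x in M. (\<Sum>i<k. a i * b i x) = 0) \<Longrightarrow> \<forall>i<k. a i = 0"
  shows "\<exists>c. orthonormal M k (\<lambda>i x. \<Sum>j<k. c i j * b j x)"
  using assms
proof (induction k)
  case 0
  then show ?case by (simp add: orthonormal_def)
next
  case (Suc k)
  have "\<exists>c. orthonormal M k (\<lambda>i x. \<Sum>j<k. c i j * b j x)"
  proof (rule Suc.IH)
    fix a :: "nat \<Rightarrow> real" assume "AE x in M. (\<Sum>i<k. a i * b i x) = 0"
    then have "AE x in M. (\<Sum>i<Suc k. (a(k := 0)) i * b i x) = 0" by eventually_elim simp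
    note zero = Suc.prems(2)[OF this]
    show "\<forall>i<k. a i = 0"
    proof (intro allI impI)
      fix i assume "i < k"
      then have "(a(k := 0)) i = 0" using zero by (meson less_SucI)
      with \<open>i < k\<close> show "a i = 0" by simp
    qed
  qed (use Suc.prems in auto)
  then obtain c where c: "orthonormal M k (\<lambda>i x. \<Sum>j<k. c i j * b j x)" by blast
  define e where "e i x = (\<Sum>j<k. c i j * b j x)" for i x
  have e: "orthonormal M k e" using c unfolding e_def[abs_def] .
  define p where "p i = (LINT x|M. b k x * e i x)" for i
  define w where "w x = b k x - (\<Sum>i<k. p i * e i x)" for x
  \<comment> \<open>Coefficients of the residual \<open>w\<close> in the original functions. The
    leading one is 1, so by independence \<open>w\<close> does not vanish almost everywhere and can
    be normalised.\<close>
  define d where "d j = (if j = k then 1 else - (\<Sum>i<k. p i * c i j))" for j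
  have wd: "w x = (\<Sum>j<Suc k. d j * b j x)" for x
  proof -
    have "(\<Sum>i<k. p i * e i x) = (\<Sum>j<k. (\<Sum>i<k. p i * c i j) * b j x)"
      unfolding e_def sum_distrib_left sum_distrib_right by (subst sum.swap) (simp add: mult.assoc)
    then show ?thesis by (simp add: w_def d_def sum_negf)
  qed
  have bk: "sq_integrable M (b k)" using Suc.prems by simp
  have sw: "sq_integrable M w"
    unfolding w_def by (intro sq_integrable_diff bk orthonormal_lincomb_sq_integrable[OF e])
  have orth: "(LINT x|M. w x * e j x) = 0" if j: "j < k" for j
  proof -
    have ej: "sq_integrable M (e j)" using e j by (simp add: orthonormal_def)
    have "(LINT x|M. w x * e j x) = (LINT x|M. b k x * e j x) - (LINT x|M. (\<Sum>i<k. p i * e i x) * e j x)"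
      using sq_integrable_mult[OF bk ej] sq_integrable_mult[OF orthonormal_lincomb_sq_integrable[OF e, of p] ej]
      by (simp add: w_def left_diff_distrib)
    also have "\<dots> = 0" unfolding orthonormal_coefficient[OF e j] by (simp add: p_def)
    finally show ?thesis .
  qed
  have pos: "sq_norm M w > 0"
  proof (rule ccontr)
    assume "\<not> sq_norm M w > 0"
    then have "AE x in M. w x = 0" by (intro sq_norm_zero_AE sw) simp
    then have "AE x in M. (\<Sum>j<Suc k. d j * b j x) = 0" by (simp only: wd)
    from Suc.prems(2)[OF this] have "d k = 0" by blast
    then show False by (simp add: d_def)
  qed
  define s where "s = 1 / sqrt (sq_norm M w)"
  have s2: "s * s * sq_norm M w = 1" using pos by (simp add: s_def)
  define c' where "c' i j = (if i = k then s * d j else if j = k then 0 else c i j)" for i j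
  let ?e = "\<lambda>i x. \<Sum>j<Suc k. c' i j * b j x"
  have e1: "?e i = e i" if "i < k" for i using that by (auto simp: c'_def e_def)
  have e2: "?e k = (\<lambda>x. s * w x)" unfolding wd sum_distrib_left by (intro ext sum.cong refl) (simp add: c'_def)
  have ssw: "sq_integrable M (\<lambda>x. s * w x)" using sq_integrable_scaleR[OF sw, of s] by simp
  have "orthonormal M (Suc k) ?e"
    unfolding orthonormal_def
  proof (intro conjI allI impI)
    fix i assume "i < Suc k"
    then consider "i < k" | "i = k" by linarith
    then show "sq_integrable M (?e i)"
    proof cases
      case 1
      then show ?thesis using e unfolding e1[OF 1] by (simp add: orthonormal_def)
    next
      case 2
      show ?thesis unfolding 2 e2 by (rule ssw)
    qed
  next
    fix i j assume ij: "i < Suc k" "j < Suc k"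
    then consider "i < k" "j < k" | "i = k" "j < k" | "i < k" "j = k" | "i = k" "j = k" by linarith
    then show "(LINT x|M. ?e i x * ?e j x) = (if i = j then 1 else 0)"
    proof cases
      case 1
      then show ?thesis using e unfolding fun_cong[OF e1[OF 1(1)]] fun_cong[OF e1[OF 1(2)]] by (simp add: orthonormal_def)
    next
      case 2
      then show ?thesis using orth[OF 2(2)] unfolding 2(1) fun_cong[OF e2] fun_cong[OF e1[OF 2(2)]] by (simp add: mult.assoc)
    next
      case 3
      then show ?thesis using orth[OF 3(1)] unfolding 3(2) fun_cong[OF e2] fun_cong[OF e1[OF 3(1)]] by (simp add: mult_ac)
    next
      case 4
      have "(LINT x|M. (s * w x) * (s * w x)) = s * s * sq_norm M w"
        unfolding sq_norm_real by (simp add: mult_ac flip: integral_mult_right_zero)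
      then show ?thesis using s2 unfolding 4 fun_cong[OF e2] by simp
    qed
  qed
  then show ?case by blast
qed

subsection \<open>Functions vanishing outside a set\<close>

context gaussian_plane
begin

lemma W12_0_iff: "u \<in> W12_0 m \<Omega> \<longleftrightarrow> (\<exists>g. sobolev u g) \<and> quasi_continuous m u \<and> capacity m ({x. u x \<noteq> 0} - \<Omega>) = 0"
  by (auto simp: W12_0_def W12_qc_def W12_iff)

lemma W12_0D:
  assumes "u \<in> W12_0 m \<Omega>"
  shows "sobolev u (weak_gradient u)" "quasi_continuous m u" "AE x in m. x \<notin> \<Omega> \<longrightarrow> u x = 0" "sq_integrable m u"
    "AE x in m. x \<notin> \<Omega> \<longrightarrow> weak_gradient u x = 0"
proof -
  from assms obtain g where "sobolev u g" by (auto simp: W12_0_iff)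
  then show s: "sobolev u (weak_gradient u)" by (rule sobolev_weak_gradient)
  show "quasi_continuous m u" using assms by (simp add: W12_0_iff)
  show v: "AE x in m. x \<notin> \<Omega> \<longrightarrow> u x = 0"
    using capacity_zero_AE[of "{x. u x \<noteq> 0} - \<Omega>"] assms by (auto simp: W12_0_iff elim: eventually_mono)
  show "sq_integrable m u" using s by (rule sobolevD(2))
  show "AE x in m. x \<notin> \<Omega> \<longrightarrow> weak_gradient u x = 0"
    using v sobolev_gradient_zero[OF s] by eventually_elim blast
qed

lemma W12_0_zero: "(\<lambda>x. 0) \<in> W12_0 m \<Omega>"
  using sobolev_const[of 0] quasi_continuous_const capacity_empty by (auto simp: W12_0_iff)

lemma W12_0_add:
  assumes "u \<in> W12_0 m \<Omega>" "v \<in> W12_0 m \<Omega>" shows "(\<lambda>x. u x + v x) \<in> W12_0 m \<Omega>"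
proof -
  have "capacity m (({x. u x \<noteq> 0} - \<Omega>) \<union> ({x. v x \<noteq> 0} - \<Omega>)) = 0"
    by (rule capacity_zero_Un) (use assms in \<open>simp_all add: W12_0_iff\<close>)
  then have "capacity m ({x. u x + v x \<noteq> 0} - \<Omega>) = 0" by (rule capacity_zero_mono[rotated]) auto
  moreover have "quasi_continuous m (\<lambda>x. u x + v x)"
    by (rule quasi_continuous_add) (use assms in \<open>simp_all add: W12_0_iff\<close>)
  moreover have "sobolev (\<lambda>x. u x + v x) (\<lambda>x. weak_gradient u x + weak_gradient v x)"
    by (rule sobolev_add[OF W12_0D(1)[OF assms(1)] W12_0D(1)[OF assms(2)]])
  ultimately show ?thesis by (auto simp: W12_0_iff)
qed

lemma W12_0_scale:
  assumes "u \<in> W12_0 m \<Omega>" shows "(\<lambda>x. c * u x) \<in> W12_0 m \<Omega>"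
proof -
  have "capacity m ({x. u x \<noteq> 0} - \<Omega>) = 0" using assms by (simp add: W12_0_iff)
  then have "capacity m ({x. c * u x \<noteq> 0} - \<Omega>) = 0" by (rule capacity_zero_mono[rotated]) auto
  then show ?thesis
    using quasi_continuous_scale[OF W12_0D(2)[OF assms], of c] sobolev_scale[OF W12_0D(1)[OF assms], of c] by (auto simp: W12_0_iff)
qed

lemma W12_0_lincomb: "(\<And>i. i < k \<Longrightarrow> b i \<in> W12_0 m \<Omega>) \<Longrightarrow> (\<lambda>x. \<Sum>i<(k::nat). t i * b i x) \<in> W12_0 m \<Omega>"
proof (induction k)
  case 0
  then show ?case using W12_0_zero by simp
next
  case (Suc k)
  have "(\<lambda>x. (\<Sum>i<k. t i * b i x) + t k * b k x) \<in> W12_0 m \<Omega>"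
    by (intro W12_0_add W12_0_scale Suc.IH) (use Suc.prems in auto)
  then show ?case by simp
qed

lemma set_integral_restrict:
  fixes f :: "real^2 \<Rightarrow> real"
  assumes "f \<in> borel_measurable borel" "\<Omega> \<in> sets borel" "AE x in m. x \<notin> \<Omega> \<longrightarrow> f x = 0"
  shows "(LINT x:\<Omega>|m. f x) = (LINT x|m. f x)"
  unfolding set_lebesgue_integral_def
proof (rule integral_cong_AE)
  note assms(1,2)[measurable]
  show "(\<lambda>x. indicator \<Omega> x *\<^sub>R f x) \<in> borel_measurable m" "f \<in> borel_measurable m" by measurable
  show "AE x in m. indicator \<Omega> x *\<^sub>R f x = f x" using assms(3) by eventually_elim (auto simp: indicator_def)
qed

text \<open>A function in \<open>W12_0\<close> vanishes almost everywhere off the domain, and so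
  does its gradient, being zero almost everywhere on the zero set. After this the domain matters
  only through membership in \<open>W12_0\<close>.\<close>

lemma W12_0_integrals:
  assumes u: "u \<in> W12_0 m \<Omega>" and \<Omega>: "\<Omega> \<in> sets borel"
  shows "(LINT x:\<Omega>|m. (u x)\<^sup>2) = sq_norm m u"
    "(LINT x:\<Omega>|m. (norm (weak_gradient u x))\<^sup>2) = sq_norm m (weak_gradient u)"
    "f \<in> L2 m \<Longrightarrow> (LINT x:\<Omega>|m. f x * u x) = (LINT x|m. f x * u x)"
proof -
  note D = W12_0D[OF u]
  note [measurable] = sobolev_measurable[OF D(1)]
  show "(LINT x:\<Omega>|m. (u x)\<^sup>2) = sq_norm m u"
    unfolding sq_norm_def by (subst set_integral_restrict[OF _ \<Omega>]) (use D(3) in \<open>auto elim: eventually_mono\<close>)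
  show "(LINT x:\<Omega>|m. (norm (weak_gradient u x))\<^sup>2) = sq_norm m (weak_gradient u)"
    unfolding sq_norm_def by (subst set_integral_restrict[OF _ \<Omega>]) (use D(5) in \<open>auto elim: eventually_mono\<close>)
  assume "f \<in> L2 m"
  then have [measurable]: "f \<in> borel_measurable borel" by (simp add: L2_def measurable_def)
  show "(LINT x:\<Omega>|m. f x * u x) = (LINT x|m. f x * u x)"
    by (subst set_integral_restrict[OF _ \<Omega>]) (use D(3) in \<open>auto elim: eventually_mono\<close>)
qed

text \<open>The sum of absolute values is itself a quasi-continuous Sobolev function and witnesses
  quasi-openness exactly, with empty exceptional set. Likewise each \<open>B i\<close> vanishes
  everywhere off the set, so membership in \<open>W12_0\<close> holds without exceptional
  points.\<close>

lemma tuple_domain: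
  fixes k :: nat
  assumes B: "\<And>i. i < k \<Longrightarrow> sobolev (B i) (G i)" "\<And>i. i < k \<Longrightarrow> quasi_continuous m (B i)"
  defines "\<Omega> \<equiv> {x. 0 < (\<Sum>i<k. \<bar>B i x\<bar>)}"
  shows "\<Omega> \<in> sets borel" "quasi_open m \<Omega>" "\<And>i. i < k \<Longrightarrow> B i \<in> W12_0 m \<Omega>" "\<Omega> = {x. \<exists>i<k. B i x \<noteq> 0}"
proof -
  have [measurable]: "B i \<in> borel_measurable borel" if "i < k" for i using sobolev_measurable[OF B(1)[OF that]] by simp
  show "\<Omega> \<in> sets borel" unfolding \<Omega>_def by measurable
  have s: "sobolev (\<lambda>x. \<Sum>i<k. \<bar>B i x\<bar>) (\<lambda>x. \<Sum>i<k. sgn (B i x) *\<^sub>R G i x)"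
    by (rule sobolev_sum) (use sobolev_abs(1)[OF B(1)] in auto)
  have q: "quasi_continuous m (\<lambda>x. \<Sum>i<k. \<bar>B i x\<bar>)"
    by (rule quasi_continuous_sum) (use quasi_continuous_abs[OF B(2)] in auto)
  have "(\<lambda>x. \<Sum>i<k. \<bar>B i x\<bar>) \<in> W12_qc m" unfolding W12_qc_def using s q by (auto simp: W12_iff)
  then show "quasi_open m \<Omega>"
    unfolding quasi_open_def \<Omega>_def using capacity_empty by (intro bexI) auto
  have pos: "0 < (\<Sum>i<k. \<bar>B i x\<bar>)" if "i < k" "B i x \<noteq> 0" for i x
    using that by (intro sum_pos2[of _ i]) auto
  show eq: "\<Omega> = {x. \<exists>i<k. B i x \<noteq> 0}"
  proof (intro set_eqI iffI)
    fix x assume "x \<in> \<Omega>"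
    then have "(\<Sum>i<k. \<bar>B i x\<bar>) \<noteq> 0" by (simp add: \<Omega>_def)
    then obtain i where "i \<in> {..<k}" "\<bar>B i x\<bar> \<noteq> 0" by (rule sum.not_neutral_contains_not_neutral)
    then show "x \<in> {x. \<exists>i<k. B i x \<noteq> 0}" by auto
  qed (use pos in \<open>auto simp: \<Omega>_def\<close>)
  show "B i \<in> W12_0 m \<Omega>" if "i < k" for i
  proof -
    have e0: "{x. B i x \<noteq> 0} - \<Omega> = {}" using that by (auto simp: eq)
    have "capacity m ({x. B i x \<noteq> 0} - \<Omega>) = 0" unfolding e0 by (rule capacity_empty)
    with B[OF that] show ?thesis unfolding W12_0_iff by blast
  qed
qed

text \<open>At almost every point of \<open>E\<close> some coordinate has a non-zero limit, so it is
  eventually non-zero and the point eventually lies in \<open>\<Omega> n\<close>: the indicator of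
  \<open>E\<close> is at most the lower limit of the indicators.\<close>

lemma limit_domain_measure:
  fixes k :: nat
  assumes lim: "\<And>i. i < k \<Longrightarrow> AE x in m. (\<lambda>n. b n i x) \<longlonglongrightarrow> B i x"
    and \<Omega>: "\<And>n. \<Omega> n \<in> admissible m c" "\<And>n i. i < k \<Longrightarrow> b n i \<in> W12_0 m (\<Omega> n)"
    and E: "E \<in> sets borel" "E = {x. \<exists>i<k. B i x \<noteq> 0}" and c: "0 \<le> c"
  shows "E \<in> admissible m c"
proof -
  have [measurable]: "\<Omega> n \<in> sets borel" "E \<in> sets borel" for n using \<Omega>(1) E(1) by (auto simp: admissible_def)
  have "AE x in m. \<forall>i\<in>{..<k}. (\<lambda>n. b n i x) \<longlonglongrightarrow> B i x" using lim by (intro AE_finite_allI) auto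
  moreover have "AE x in m. \<forall>n. \<forall>i\<in>{..<k}. x \<notin> \<Omega> n \<longrightarrow> b n i x = 0"
    unfolding AE_all_countable using W12_0D(3)[OF \<Omega>(2)] by (intro allI AE_finite_allI) auto
  ultimately have "AE x in m. indicator E x \<le> liminf (\<lambda>n. indicator (\<Omega> n) x :: ennreal)"
  proof eventually_elim
    case (elim x)
    show ?case
    proof (cases "x \<in> E")
      case True
      then obtain i where i: "i < k" "B i x \<noteq> 0" by (auto simp: E(2))
      with elim(1) have "(\<lambda>n. b n i x) \<longlonglongrightarrow> B i x" by simp
      from tendsto_imp_eventually_ne[OF this i(2)] have "\<forall>\<^sub>F n in sequentially. x \<in> \<Omega> n"
        by eventually_elim (use elim(2) i in auto)
      then have "\<forall>\<^sub>F n in sequentially. 1 \<le> (indicator (\<Omega> n) x :: ennreal)" by eventually_elim simp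
      then have "1 \<le> liminf (\<lambda>n. indicator (\<Omega> n) x :: ennreal)" by (rule Liminf_bounded)
      then show ?thesis using True by simp
    qed simp
  qed
  then have "(\<integral>\<^sup>+x. indicator E x \<partial>m) \<le> (\<integral>\<^sup>+x. liminf (\<lambda>n. indicator (\<Omega> n) x :: ennreal) \<partial>m)" by (rule nn_integral_mono_AE)
  also have "\<dots> \<le> liminf (\<lambda>n. \<integral>\<^sup>+x. indicator (\<Omega> n) x \<partial>m)" by (rule nn_integral_liminf) measurable
  also have "\<dots> \<le> liminf (\<lambda>n. ennreal c)"
    by (rule Liminf_mono, rule always_eventually)
       (use \<Omega>(1) in \<open>auto simp: admissible_def emeasure_eq_measure intro: ennreal_leI\<close>)
  also have "\<dots> = ennreal c" by (simp add: Liminf_const)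
  finally have "measure m E \<le> c" using c by (simp add: emeasure_eq_measure)
  then show ?thesis using E(1) by (simp add: admissible_def)
qed

subsection \<open>Energy\<close>

text \<open>The shift estimate on the whole plane makes \<open>u (x + v) = u x\<close> for almost
  every \<open>x\<close>, for each \<open>v\<close>. Exchanging the two variables yields one point
  \<open>x0\<close> with \<open>u (x0 + v) = u x0\<close> for almost every \<open>v\<close>.\<close>

lemma zero_gradient_constant:
  assumes u: "sobolev u g" and 0: "AE x in m. g x = 0"
  obtains \<kappa> where "AE x in m. u x = \<kappa>"
proof -
  note [measurable] = sobolev_measurable[OF u]
  have g0: "(\<integral>\<^sup>+x. indicator UNIV x * ennreal ((norm (g x))\<^sup>2) \<partial>lborel) = 0"
    using 0 by (subst nn_integral_0_iff_AE) (auto simp: AE_m_iff elim: eventually_mono)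
  have "(\<integral>\<^sup>+x. ennreal ((u (x + v) - u x)\<^sup>2) \<partial>lborel) = 0" for v
    using weak_gradient_shift_convex[OF sobolevD(1)[OF u] convex_UNIV, of v] g0 by simp
  then have "(\<integral>\<^sup>+v. \<integral>\<^sup>+x. ennreal ((u (x + v) - u x)\<^sup>2) \<partial>lborel \<partial>lborel) = 0" by simp
  also have "(\<integral>\<^sup>+v. \<integral>\<^sup>+x. ennreal ((u (x + v) - u x)\<^sup>2) \<partial>lborel \<partial>lborel) = (\<integral>\<^sup>+x. \<integral>\<^sup>+v. ennreal ((u (x + v) - u x)\<^sup>2) \<partial>lborel \<partial>lborel)"
    by (rule lborel_pair.Fubini') measurable
  finally have "AE x in lborel. (\<integral>\<^sup>+v. ennreal ((u (x + v) - u x)\<^sup>2) \<partial>lborel) = 0"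
    by (subst (asm) nn_integral_0_iff_AE) measurable
  moreover have "\<not> (AE x in lborel. False :: bool)" if "True" for x :: "real^2"
    using prob_space by (simp add: AE_iff_null null_sets_def)
  ultimately obtain x0 :: "real^2" where x0: "(\<integral>\<^sup>+v. ennreal ((u (x0 + v) - u x0)\<^sup>2) \<partial>lborel) = 0"
    by (metis (mono_tags, lifting) eventually_mono)
  then have "AE v in lborel. u (v + x0) = u x0"
    by (subst (asm) nn_integral_0_iff_AE) (auto simp: add.commute elim: eventually_mono)
  from AE_lborel_translate[OF this, of "- x0"] have "AE x in lborel. u x = u x0" by simp
  then show thesis by (intro that[of "u x0"]) (simp add: AE_m_iff)
qed

lemma quasi_continuous_compactness_single:
  assumes u: "\<And>n. sobolev (u n) (g n)" "\<And>n. quasi_continuous m (u n)"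
    and K: "\<And>n. sq_norm m (u n) \<le> K" "\<And>n. sq_norm m (g n) \<le> K'"
  obtains r B G where "strict_mono (r::nat\<Rightarrow>nat)" "sobolev B G" "quasi_continuous m B"
    "(\<lambda>n. sq_norm m (\<lambda>x. u (r n) x - B x)) \<longlonglongrightarrow> 0" "AE x in m. (\<lambda>n. u (r n) x) \<longlonglongrightarrow> B x"
    "\<forall>L N. (\<forall>n\<ge>N. sq_norm m (g (r n)) \<le> L) \<longrightarrow> sq_norm m G \<le> L"
proof (rule quasi_continuous_compactness[of "1::nat" "\<lambda>n i. u n" "\<lambda>n i. g n" "max K K'"])
  fix r B G
  assume r: "strict_mono (r::nat\<Rightarrow>nat)" and B: "\<forall>i<(1::nat). sobolev (B i) (G i) \<and> quasi_continuous m (B i) \<and>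
      (\<lambda>n. sq_norm m (\<lambda>x. u (r n) x - B i x)) \<longlonglongrightarrow> 0 \<and> (AE x in m. (\<lambda>n. u (r n) x) \<longlonglongrightarrow> B i x)"
    and G: "\<forall>t L N. (\<forall>n\<ge>N. sq_norm m (\<lambda>x. \<Sum>i<(1::nat). t i *\<^sub>R g (r n) x) \<le> L) \<longrightarrow> sq_norm m (\<lambda>x. \<Sum>i<(1::nat). t i *\<^sub>R G i x) \<le> L"
  have "\<forall>L N. (\<forall>n\<ge>N. sq_norm m (g (r n)) \<le> L) \<longrightarrow> sq_norm m (G 0) \<le> L"
    using G[THEN spec, of "\<lambda>_. 1"] by simp
  with r B show thesis by (intro that[of r "B 0" "G 0"]) simp_all
qed (use u K in \<open>auto simp: le_max_iff_disj\<close>)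

text \<open>Were there no constant, normalised functions on varying admissible sets with gradients
  tending to 0 would converge to a constant. Its set of non-zero values has measure at most
  \<open>c < 1\<close>, so the constant is 0, against the normalisation. The domains vary along the
  sequence, which makes \<open>P\<close> uniform in them.\<close>

lemma poincare_inequality:
  assumes c: "0 \<le> c" "c < 1"
  obtains P where "P > 0" "\<And>\<Omega> u. \<Omega> \<in> admissible m c \<Longrightarrow> u \<in> W12_0 m \<Omega> \<Longrightarrow> sq_norm m u \<le> P * sq_norm m (weak_gradient u)"
proof (rule ccontr)
  assume no: "\<not> thesis"
  have "\<exists>\<Omega> v. \<Omega> \<in> admissible m c \<and> v \<in> W12_0 m \<Omega> \<and> sq_norm m v = 1 \<and> sq_norm m (weak_gradient v) \<le> 1 / real (Suc n)" for n
  proof -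
    have "\<exists>\<Omega> u. \<Omega> \<in> admissible m c \<and> u \<in> W12_0 m \<Omega> \<and> sq_norm m u > real (Suc n) * sq_norm m (weak_gradient u)"
    proof (rule ccontr)
      assume "\<not> ?thesis"
      then show False using no that[of "real (Suc n)"] by (force simp: not_less)
    qed
    then obtain \<Omega> u where u: "\<Omega> \<in> admissible m c" "u \<in> W12_0 m \<Omega>" "sq_norm m u > real (Suc n) * sq_norm m (weak_gradient u)" by blast
    have pos: "sq_norm m u > 0" using u(3) by (intro le_less_trans[OF _ u(3)] mult_nonneg_nonneg) auto
    define s where "s = 1 / sqrt (sq_norm m u)"
    have s2: "s\<^sup>2 = 1 / sq_norm m u" using pos by (simp add: s_def power_divide)
    have v: "(\<lambda>x. s * u x) \<in> W12_0 m \<Omega>" using u(2) by (rule W12_0_scale)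
    have "sq_norm m (\<lambda>x. s * u x) = 1" using sq_norm_scaleR[of m s u] s2 pos by simp
    moreover have "sq_norm m (weak_gradient (\<lambda>x. s * u x)) = s\<^sup>2 * sq_norm m (weak_gradient u)"
      using sobolev_sq_norm_gradient[OF W12_0D(1)[OF v] sobolev_scale[OF W12_0D(1)[OF u(2)]]] sq_norm_scaleR[of m s "weak_gradient u"] by simp
    moreover have "s\<^sup>2 * sq_norm m (weak_gradient u) \<le> 1 / real (Suc n)"
      unfolding s2 using u(3) pos by (simp add: field_simps)
    ultimately show ?thesis using u(1) v by (intro exI[of _ \<Omega>] exI[of _ "\<lambda>x. s * u x"]) simp
  qed
  then obtain \<Omega> v where v: "\<And>n. \<Omega> n \<in> admissible m c" "\<And>n. v n \<in> W12_0 m (\<Omega> n)" "\<And>n. sq_norm m (v n) = 1"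
    "\<And>n. sq_norm m (weak_gradient (v n)) \<le> 1 / real (Suc n)" by metis
  have le1: "sq_norm m (weak_gradient (v n)) \<le> 1" for n
    using v(4)[of n] by (rule order_trans) simp
  obtain r B' G' where r: "strict_mono (r::nat\<Rightarrow>nat)" and S: "sobolev B' G'" "quasi_continuous m B'"
    "(\<lambda>n. sq_norm m (\<lambda>x. v (r n) x - B' x)) \<longlonglongrightarrow> 0" "AE x in m. (\<lambda>n. v (r n) x) \<longlonglongrightarrow> B' x"
    "\<forall>L N. (\<forall>n\<ge>N. sq_norm m (weak_gradient (v (r n))) \<le> L) \<longrightarrow> sq_norm m G' \<le> L"
    by (rule quasi_continuous_compactness_single[of v "\<lambda>n. weak_gradient (v n)", OF W12_0D(1)[OF v(2)] W12_0D(2)[OF v(2)] eq_refl[OF v(3)] le1])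
  \<comment> \<open>A constant family, to match the lemmas on tuples with
    \<open>k = 1\<close>.\<close>
  define B where "B = (\<lambda>i::nat. B')"
  define G where "G = (\<lambda>i::nat. G')"
  have BG: "\<And>i. i < (1::nat) \<Longrightarrow> sobolev (B i) (G i)" "\<And>i. i < (1::nat) \<Longrightarrow> quasi_continuous m (B i)"
    "\<And>i. i < (1::nat) \<Longrightarrow> (\<lambda>n. sq_norm m (\<lambda>x. v (r n) x - B i x)) \<longlonglongrightarrow> 0"
    "\<And>i. i < (1::nat) \<Longrightarrow> AE x in m. (\<lambda>n. v (r n) x) \<longlonglongrightarrow> B i x"
    "\<And>L N. (\<And>n. n \<ge> N \<Longrightarrow> sq_norm m (weak_gradient (v (r n))) \<le> L) \<Longrightarrow> sq_norm m (G 0) \<le> L"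
    using S unfolding B_def G_def by blast+
  have "sq_norm m (G 0) \<le> 1 / real (Suc N)" for N
  proof -
    have "sq_norm m (G 0) \<le> 1 / real (Suc N)"
    proof (rule BG(5))
      fix n assume "N \<le> n"
      then have "N \<le> r n" using seq_suble[OF r, of n] by simp
      then have "1 / real (Suc (r n)) \<le> 1 / real (Suc N)" by (intro divide_left_mono) auto
      then show "sq_norm m (weak_gradient (v (r n))) \<le> 1 / real (Suc N)"
        using v(4)[of "r n"] by simp
    qed
    then show ?thesis by simp
  qed
  then have "sq_norm m (G 0) \<le> 0" by (intro LIMSEQ_le_const[OF abs_regularisation_tendsto]) auto
  then have "AE x in m. G 0 x = 0" using sobolevD(3)[OF BG(1)] by (intro sq_norm_zero_AE) auto
  then obtain \<kappa> where \<kappa>: "AE x in m. B 0 x = \<kappa>" using zero_gradient_constant[OF BG(1)] by auto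
  have dom: "{x. 0 < (\<Sum>i<(1::nat). \<bar>B i x\<bar>)} \<in> sets borel" "quasi_open m {x. 0 < (\<Sum>i<(1::nat). \<bar>B i x\<bar>)}"
    "{x. 0 < (\<Sum>i<(1::nat). \<bar>B i x\<bar>)} = {x. \<exists>i<1. B i x \<noteq> 0}"
    by (rule tuple_domain[OF BG(1,2)]; assumption)+
  have adm: "{x. 0 < (\<Sum>i<(1::nat). \<bar>B i x\<bar>)} \<in> admissible m c"
    by (rule limit_domain_measure[where b="\<lambda>n i. v (r n)" and k="1::nat" and B=B and \<Omega>="\<lambda>n. \<Omega> (r n)",
          OF BG(4) v(1) v(2) dom(1) dom(3) c(1)])
  have eqset: "{x. B 0 x \<noteq> 0} = {x. 0 < (\<Sum>i<(1::nat). \<bar>B i x\<bar>)}" by simp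
  have meas: "measure m {x. B 0 x \<noteq> 0} \<le> c" "{x. B 0 x \<noteq> 0} \<in> sets borel"
    using adm unfolding eqset admissible_def by blast+
  \<comment> \<open>A non-zero constant would be non-zero almost everywhere, on a set of measure
    1.\<close>
  have "\<kappa> = 0"
  proof (rule ccontr)
    assume "\<kappa> \<noteq> 0"
    then have "AE x in m. x \<in> {x. B 0 x \<noteq> 0}" using \<kappa> by (auto elim: eventually_mono)
    then have "measure m {x. B 0 x \<noteq> 0} = 1" using meas(2) by (subst prob_eq_1) auto
    with meas(1) c(2) show False by simp
  qed
  have "sq_norm m (\<lambda>x. v (r n) x - B 0 x) = 1" for n
  proof -
    have "sq_norm m (\<lambda>x. v (r n) x - B 0 x) = sq_norm m (v (r n))"
      using \<kappa> \<open>\<kappa> = 0\<close> sobolev_measurable(1)[OF W12_0D(1)[OF v(2)[of "r n"]]] sobolev_measurable(1)[OF BG(1)[of 0]]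
      by (intro sq_norm_cong_AE) (auto elim: eventually_mono)
    then show ?thesis using v(3) by simp
  qed
  with BG(3)[of 0] show False by (simp add: LIMSEQ_const_iff)
qed

definition energy_functional :: "(real^2 \<Rightarrow> real) \<Rightarrow> (real^2 \<Rightarrow> real) \<Rightarrow> real" where
  "energy_functional f u = 1 / 2 * sq_norm m (weak_gradient u) - (LINT x|m. f x * u x)"

lemma energy_eq:
  assumes "\<Omega> \<in> sets borel" "f \<in> L2 m"
  shows "energy m f \<Omega> = (INF u\<in>W12_0 m \<Omega>. ereal (energy_functional f u))"
  unfolding energy_def energy_functional_def
  by (intro INF_cong refl) (simp add: W12_0_integrals(2)[OF _ assms(1)] W12_0_integrals(3)[OF _ assms])

lemma L2_sq_integrable: "f \<in> L2 m \<Longrightarrow> sq_integrable m f"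
  by (simp add: L2_def sq_integrable_def)

theorem energy_minimiser:
  assumes f: "f \<in> L2 m" and c: "0 \<le> c" "c \<le> 1"
  shows "\<exists>\<Omega>. is_solution m c (energy m f) \<Omega> \<and> quasi_open m \<Omega>"
proof (cases "c = 1")
  case True
  have "energy m f UNIV \<le> energy m f \<Omega>" if "\<Omega> \<in> sets borel" for \<Omega>
  proof -
    have "W12_0 m \<Omega> \<subseteq> W12_0 m UNIV" using capacity_empty by (auto simp: W12_0_iff)
    then show ?thesis using that by (simp add: energy_eq[OF _ f] INF_superset_mono)
  qed
  then have "is_solution m c (energy m f) UNIV"
    using True by (auto simp: is_solution_def admissible_def)
  moreover have "quasi_open m UNIV"
    unfolding quasi_open_def
  proof (rule bexI[of _ "\<lambda>x. 1"])
    show "(\<lambda>x. 1) \<in> W12_qc m" using sobolev_const[of 1] quasi_continuous_const by (auto simp: W12_qc_def W12_iff)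
  qed (use capacity_empty in simp)
  ultimately show ?thesis by blast
next
  case False
  with c have c1: "c < 1" by simp
  obtain P where P: "P > 0" "\<And>\<Omega> u. \<Omega> \<in> admissible m c \<Longrightarrow> u \<in> W12_0 m \<Omega> \<Longrightarrow> sq_norm m u \<le> P * sq_norm m (weak_gradient u)"
    using poincare_inequality[OF c(1) c1] by blast
  let ?J = "energy_functional f"
  define F where "F = sq_norm m f"
  have sf: "sq_integrable m f" using f by (rule L2_sq_integrable)
  \<comment> \<open>With weight \<open>2 * P\<close> in Young's inequality the linear term is at
    most \<open>P * F\<close> plus a quarter of the gradient norm. Half of the gradient norm is
    available in the energy, so a quarter remains.\<close>
  have coercive: "sq_norm m (weak_gradient u) \<le> 4 * (?J u + P * F)" if "\<Omega> \<in> admissible m c" "u \<in> W12_0 m \<Omega>" for \<Omega> u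
  proof -
    have "\<bar>LINT x|m. f x * u x\<bar> \<le> (2 * P) / 2 * sq_norm m f + 1 / (2 * (2 * P)) * sq_norm m u"
      by (rule young_integral[OF sf W12_0D(4)[OF that(2)]]) (use P in simp)
    moreover have "1 / (2 * (2 * P)) * sq_norm m u \<le> 1 / (2 * (2 * P)) * (P * sq_norm m (weak_gradient u))"
      using P(1) P(2)[OF that] by (intro mult_left_mono) auto
    moreover have "1 / (2 * (2 * P)) * (P * sq_norm m (weak_gradient u)) = sq_norm m (weak_gradient u) / 4" using P(1) by simp
    moreover have "(2 * P) / 2 * sq_norm m f = P * F" by (simp add: F_def)
    ultimately have "(LINT x|m. f x * u x) \<le> P * F + sq_norm m (weak_gradient u) / 4" by linarith
    then show ?thesis unfolding energy_functional_def by (simp add: field_simps)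
  qed
  define I where "I = {?J u | u \<Omega>. \<Omega> \<in> admissible m c \<and> u \<in> W12_0 m \<Omega>}"
  \<comment> \<open>The empty set with the zero function is always a competitor, so the infimum is
    over a non-empty set.\<close>
  have empty_adm: "{} \<in> admissible m c" using c by (simp add: admissible_def)
  have ne: "I \<noteq> {}" unfolding I_def using empty_adm W12_0_zero by blast
  have lb: "- (P * F) \<le> y" if y: "y \<in> I" for y
  proof -
    obtain u \<Omega> where u: "\<Omega> \<in> admissible m c" "u \<in> W12_0 m \<Omega>" "y = ?J u" using y by (auto simp: I_def)
    have "0 \<le> 4 * (?J u + P * F)" using coercive[OF u(1,2)] sq_norm_nonneg[of m "weak_gradient u"] by linarith
    then show ?thesis using u(3) by simp
  qed
  have bdd: "bdd_below I" using lb by (rule bdd_belowI)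
  define l where "l = Inf I"
  have "\<exists>\<Omega> u. \<Omega> \<in> admissible m c \<and> u \<in> W12_0 m \<Omega> \<and> ?J u < l + 1 / real (Suc n)" for n
    using cInf_lessD[OF ne, of "l + 1 / real (Suc n)"] by (auto simp: l_def I_def)
  then obtain \<Omega> u where u: "\<And>n. \<Omega> n \<in> admissible m c" "\<And>n. u n \<in> W12_0 m (\<Omega> n)" "\<And>n. ?J (u n) < l + 1 / real (Suc n)" by metis
  define K0 where "K0 = 4 * (l + 1 + P * F)"
  have bg: "sq_norm m (weak_gradient (u n)) \<le> K0" for n
  proof -
    have "1 / real (Suc n) \<le> 1" by simp
    with u(3)[of n] have "?J (u n) \<le> l + 1" by linarith
    then have "4 * (?J (u n) + P * F) \<le> K0" by (simp add: K0_def)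
    with coercive[OF u(1)[of n] u(2)[of n]] show ?thesis by (rule order_trans)
  qed
  have bu: "sq_norm m (u n) \<le> P * K0" for n
    using P(2)[OF u(1)[of n] u(2)[of n]] bg[of n] P(1) by (meson less_imp_le mult_left_mono order_trans)
  obtain r B' G' where r: "strict_mono (r::nat\<Rightarrow>nat)" and S: "sobolev B' G'" "quasi_continuous m B'"
    "(\<lambda>n. sq_norm m (\<lambda>x. u (r n) x - B' x)) \<longlonglongrightarrow> 0" "AE x in m. (\<lambda>n. u (r n) x) \<longlonglongrightarrow> B' x"
    "\<forall>L N. (\<forall>n\<ge>N. sq_norm m (weak_gradient (u (r n))) \<le> L) \<longrightarrow> sq_norm m G' \<le> L"
    by (rule quasi_continuous_compactness_single[of u "\<lambda>n. weak_gradient (u n)", OF W12_0D(1)[OF u(2)] W12_0D(2)[OF u(2)] bu bg])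
  define B where "B = (\<lambda>i::nat. B')"
  define G where "G = (\<lambda>i::nat. G')"
  have BG: "\<And>i. i < (1::nat) \<Longrightarrow> sobolev (B i) (G i)" "\<And>i. i < (1::nat) \<Longrightarrow> quasi_continuous m (B i)"
    "\<And>i. i < (1::nat) \<Longrightarrow> (\<lambda>n. sq_norm m (\<lambda>x. u (r n) x - B i x)) \<longlonglongrightarrow> 0"
    "\<And>i. i < (1::nat) \<Longrightarrow> AE x in m. (\<lambda>n. u (r n) x) \<longlonglongrightarrow> B i x"
    "\<And>L N. (\<And>n. n \<ge> N \<Longrightarrow> sq_norm m (weak_gradient (u (r n))) \<le> L) \<Longrightarrow> sq_norm m (G 0) \<le> L"
    using S unfolding B_def G_def by blast+
  have dom: "{x. 0 < (\<Sum>i<(1::nat). \<bar>B i x\<bar>)} \<in> sets borel" "quasi_open m {x. 0 < (\<Sum>i<(1::nat). \<bar>B i x\<bar>)}"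
    "{x. 0 < (\<Sum>i<(1::nat). \<bar>B i x\<bar>)} = {x. \<exists>i<1. B i x \<noteq> 0}"
    by (rule tuple_domain[OF BG(1,2)]; assumption)+
  define E where "E = {x. 0 < (\<Sum>i<(1::nat). \<bar>B i x\<bar>)}"
  have E: "E \<in> admissible m c" unfolding E_def
    by (rule limit_domain_measure[where b="\<lambda>n i. u (r n)" and k="1::nat" and B=B and \<Omega>="\<lambda>n. \<Omega> (r n)",
          OF BG(4) u(1) u(2) dom(1) dom(3) c(1)])
  have BE: "B 0 \<in> W12_0 m E" unfolding E_def by (rule tuple_domain(3)[OF BG(1,2)]) simp_all
  have flim: "(\<lambda>n. LINT x|m. f x * u (r n) x) \<longlonglongrightarrow> (LINT x|m. f x * B 0 x)"
    using sf W12_0D(4)[OF u(2)] sobolevD(2)[OF BG(1)] BG(3) by (intro sq_norm_tendsto_mult) auto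
  \<comment> \<open>The linear term converges by strong convergence in square mean, so near
    minimality becomes an upper bound on the gradients along a tail. Since bounds rather than limits
    pass to \<open>G 0\<close>, an \<open>\<epsilon>\<close> is spent.\<close>
  have "?J (B 0) \<le> l"
  proof (rule field_le_epsilon)
    fix \<epsilon> :: real assume \<epsilon>: "0 < \<epsilon>"
    have "(\<lambda>n. 1 / real (Suc n) + (LINT x|m. f x * u (r n) x)) \<longlonglongrightarrow> 0 + (LINT x|m. f x * B 0 x)"
      by (intro tendsto_add abs_regularisation_tendsto flim)
    then have "\<forall>\<^sub>F n in sequentially. 1 / real (Suc n) + (LINT x|m. f x * u (r n) x) < (LINT x|m. f x * B 0 x) + \<epsilon>"
      using \<epsilon> by (intro order_tendstoD(2)) auto
    then obtain N where N: "\<And>n. n \<ge> N \<Longrightarrow> 1 / real (Suc n) + (LINT x|m. f x * u (r n) x) < (LINT x|m. f x * B 0 x) + \<epsilon>"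
      by (auto simp: eventually_sequentially)
    have "sq_norm m (G 0) \<le> 2 * (l + (LINT x|m. f x * B 0 x) + \<epsilon>)"
    proof (rule BG(5))
      fix n assume n: "N \<le> n"
      have "1 / real (Suc (r n)) \<le> 1 / real (Suc n)" using seq_suble[OF r, of n] by (intro divide_left_mono) auto
      then show "sq_norm m (weak_gradient (u (r n))) \<le> 2 * (l + (LINT x|m. f x * B 0 x) + \<epsilon>)"
        using N[OF n] u(3)[of "r n"] unfolding energy_functional_def by argo
    qed
    moreover have "sq_norm m (weak_gradient (B 0)) = sq_norm m (G 0)"
      using sobolev_sq_norm_gradient[OF W12_0D(1)[OF BE] BG(1)] by simp
    ultimately show "?J (B 0) \<le> l + \<epsilon>" unfolding energy_functional_def by argo
  qed
  then have "energy m f E \<le> ereal l"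
    using E BE by (subst energy_eq[OF _ f]) (auto simp: admissible_def intro: INF_lower2)
  moreover have "ereal l \<le> energy m f \<Omega>'" if "\<Omega>' \<in> admissible m c" for \<Omega>'
  proof -
    have "l \<le> ?J w" if "w \<in> W12_0 m \<Omega>'" for w
      unfolding l_def using \<open>\<Omega>' \<in> admissible m c\<close> that by (intro cInf_lower bdd) (auto simp: I_def)
    then show ?thesis using that by (subst energy_eq[OF _ f]) (auto simp: admissible_def intro!: INF_greatest)
  qed
  ultimately have "is_solution m c (energy m f) E" using E unfolding is_solution_def by (meson order_trans)
  then show ?thesis using dom(2) unfolding E_def by blast
qed

subsection \<open>Eigenvalues\<close>

text \<open>A \<open>k\<close>-dimensional subspace, represented by an orthonormal basis: unlike
  linear independence, this property is closed under convergence in square mean.\<close>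

definition frame :: "nat \<Rightarrow> (real^2) set \<Rightarrow> (nat \<Rightarrow> real^2 \<Rightarrow> real) \<Rightarrow> bool" where
  "frame k \<Omega> e \<longleftrightarrow> orthonormal m k e \<and> (\<forall>i<k. e i \<in> W12_0 m \<Omega>)"

text \<open>For an orthonormal system the unit sphere of the span is the Euclidean unit sphere of
  coefficients, so this bounds the Rayleigh quotient on the span by \<open>L\<close>.\<close>

definition frame_level :: "nat \<Rightarrow> (nat \<Rightarrow> real^2 \<Rightarrow> real) \<Rightarrow> real \<Rightarrow> bool" where
  "frame_level k e L \<longleftrightarrow> (\<forall>t. (\<Sum>i<k. (t i)\<^sup>2) = 1 \<longrightarrow> sq_norm m (\<lambda>x. \<Sum>i<k. t i *\<^sub>R weak_gradient (e i) x) \<le> L)"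

lemma lincomb_gradient:
  assumes "\<And>i. i < k \<Longrightarrow> sobolev (e i) (g i)" "sobolev u h" "AE x in m. u x = (\<Sum>i<(k::nat). t i * e i x)"
  shows "sq_norm m h = sq_norm m (\<lambda>x. \<Sum>i<k. t i *\<^sub>R g i x)"
proof -
  have s: "sobolev (\<lambda>x. \<Sum>i<k. t i * e i x) (\<lambda>x. \<Sum>i<k. t i *\<^sub>R g i x)"
    by (rule sobolev_sum) (use assms(1) in \<open>auto intro: sobolev_scale\<close>)
  have "sobolev u (\<lambda>x. \<Sum>i<k. t i *\<^sub>R g i x)"
    by (rule sobolev_cong_AE[OF s sobolev_measurable(1)[OF assms(2)] sobolev_measurable(2)[OF s]])
       (use assms(3) in \<open>auto elim: eventually_mono\<close>)
  then show ?thesis by (rule sobolev_sq_norm_gradient[OF assms(2)])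
qed

lemma subspace_frame:
  assumes K: "subspace_of_dim m k (W12_0 m \<Omega>) K"
  obtains e where "frame k \<Omega> e" "\<forall>t. (\<lambda>x. \<Sum>i<k. t i * e i x) \<in> K"
proof -
  from K obtain b where b: "\<And>i. i < k \<Longrightarrow> b i \<in> W12_0 m \<Omega>"
    "\<And>a. (AE x in m. (\<Sum>i<k. a i * b i x) = 0) \<Longrightarrow> \<forall>i<k. a i = 0"
    "K = {u \<in> W12_0 m \<Omega>. \<exists>a. AE x in m. u x = (\<Sum>i<k. a i * b i x)}"
    unfolding subspace_of_dim_def by blast
  have "\<exists>c. orthonormal m k (\<lambda>i x. \<Sum>j<k. c i j * b j x)"
    by (rule gram_schmidt) (use W12_0D(4)[OF b(1)] b(2) in auto)
  then obtain c where c: "orthonormal m k (\<lambda>i x. \<Sum>j<k. c i j * b j x)" by blast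
  let ?e = "\<lambda>i x. \<Sum>j<k. c i j * b j x"
  have e: "?e i \<in> W12_0 m \<Omega>" for i by (rule W12_0_lincomb) (rule b(1))
  show thesis
  proof (rule that[of ?e])
    show "frame k \<Omega> ?e" unfolding frame_def using c e by blast
    show "\<forall>t. (\<lambda>x. \<Sum>i<k. t i * ?e i x) \<in> K"
    proof
      fix t :: "nat \<Rightarrow> real"
      have "(\<Sum>i<k. t i * ?e i x) = (\<Sum>j<k. (\<Sum>i<k. t i * c i j) * b j x)" for x
        unfolding sum_distrib_left sum_distrib_right by (subst sum.swap) (simp add: mult.assoc)
      then show "(\<lambda>x. \<Sum>i<k. t i * ?e i x) \<in> K"
        unfolding b(3) using W12_0_lincomb[of k ?e \<Omega> t, OF e] by auto
    qed
  qed
qed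

text \<open>One half of the translation of the inf-sup formula into an infimum over real levels of
  frames. A real bound \<open>z\<close> excludes subspaces with infinite supremum.\<close>

lemma subspace_level:
  assumes K: "subspace_of_dim m k (W12_0 m \<Omega>) K" and \<Omega>: "\<Omega> \<in> sets borel"
    and z: "(SUP u \<in> {u \<in> K. (LINT x:\<Omega>|m. (u x)\<^sup>2) = 1}. ereal (LINT x:\<Omega>|m. (norm (weak_gradient u x))\<^sup>2)) \<le> ereal z"
  obtains e where "frame k \<Omega> e" "frame_level k e z"
proof -
  obtain e where e: "frame k \<Omega> e" "\<forall>t. (\<lambda>x. \<Sum>i<k. t i * e i x) \<in> K" by (rule subspace_frame[OF K])
  have eW: "e i \<in> W12_0 m \<Omega>" if "i < k" for i using e(1) that by (simp add: frame_def)
  have "sq_norm m (\<lambda>x. \<Sum>i<k. t i *\<^sub>R weak_gradient (e i) x) \<le> z" if t: "(\<Sum>i<k. (t i)\<^sup>2) = 1" for t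
  proof -
    let ?u = "\<lambda>x. \<Sum>i<k. t i * e i x"
    have u: "?u \<in> W12_0 m \<Omega>" using eW by (rule W12_0_lincomb)
    have "sq_norm m ?u = 1" using orthonormal_sq_norm[of m k e t] e(1) t by (simp add: frame_def)
    then have "?u \<in> {u \<in> K. (LINT x:\<Omega>|m. (u x)\<^sup>2) = 1}"
      using e(2) W12_0_integrals(1)[OF u \<Omega>] by simp
    then have "ereal (LINT x:\<Omega>|m. (norm (weak_gradient ?u x))\<^sup>2) \<le> ereal z"
      by (rule order_trans[OF SUP_upper z])
    then have "sq_norm m (weak_gradient ?u) \<le> z" using W12_0_integrals(2)[OF u \<Omega>] by simp
    moreover have "sq_norm m (weak_gradient ?u) = sq_norm m (\<lambda>x. \<Sum>i<k. t i *\<^sub>R weak_gradient (e i) x)"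
      by (rule lincomb_gradient[OF W12_0D(1)[OF eW] W12_0D(1)[OF u]]) auto
    ultimately show ?thesis by simp
  qed
  then have "frame_level k e z" by (simp add: frame_level_def)
  with e(1) show thesis by (rule that)
qed

text \<open>The other half: the coefficient formula \<open>orthonormal_sq_norm\<close> gives both
  the independence of the frame modulo null sets and unit coefficients for every normalised element
  of its span.\<close>

lemma frame_eigenvalue_le:
  assumes e: "frame k \<Omega> e" and L: "frame_level k e L" and \<Omega>: "\<Omega> \<in> sets borel"
  shows "eigenvalue m k \<Omega> \<le> ereal L"
proof -
  have o: "orthonormal m k e" and eW: "\<And>i. i < k \<Longrightarrow> e i \<in> W12_0 m \<Omega>" using e by (auto simp: frame_def)
  define K where "K = {u \<in> W12_0 m \<Omega>. \<exists>a :: nat \<Rightarrow> real. AE x in m. u x = (\<Sum>i<k. a i * e i x)}"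
  have em: "e i \<in> borel_measurable borel" if "i < k" for i using sobolev_measurable(1)[OF W12_0D(1)[OF eW[OF that]]] .
  have lm: "(\<lambda>x. \<Sum>i<k. t i * e i x) \<in> borel_measurable m" for t using em by measurable
  have indep: "\<forall>j<k. t j = 0" if "AE x in m. (\<Sum>i<k. t i * e i x) = 0" for t :: "nat \<Rightarrow> real"
  proof -
    have "(\<Sum>i<k. (t i)\<^sup>2) = sq_norm m (\<lambda>x. \<Sum>i<k. t i * e i x)" by (rule orthonormal_sq_norm[OF o, symmetric])
    also have "\<dots> = sq_norm m (\<lambda>x. 0 :: real)" using that lm by (intro sq_norm_cong_AE) auto
    also have "\<dots> = 0" by (simp add: sq_norm_def)
    finally show ?thesis by (subst (asm) sum_nonneg_eq_0_iff) auto
  qed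
  have "subspace_of_dim m k (W12_0 m \<Omega>) K"
    unfolding subspace_of_dim_def using eW indep K_def by (intro exI[of _ e]) auto
  moreover have "(SUP u \<in> {u \<in> K. (LINT x:\<Omega>|m. (u x)\<^sup>2) = 1}. ereal (LINT x:\<Omega>|m. (norm (weak_gradient u x))\<^sup>2)) \<le> ereal L"
  proof (rule SUP_least)
    fix u assume "u \<in> {u \<in> K. (LINT x:\<Omega>|m. (u x)\<^sup>2) = 1}"
    then obtain t where u: "u \<in> W12_0 m \<Omega>" "(LINT x:\<Omega>|m. (u x)\<^sup>2) = 1" and t: "AE x in m. u x = (\<Sum>i<k. t i * e i x)"
      by (auto simp: K_def)
    have "(\<Sum>i<k. (t i)\<^sup>2) = sq_norm m (\<lambda>x. \<Sum>i<k. t i * e i x)" by (rule orthonormal_sq_norm[OF o, symmetric])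
    also have "\<dots> = sq_norm m u"
      using t lm sobolev_measurable(1)[OF W12_0D(1)[OF u(1)]] by (intro sq_norm_cong_AE) (auto elim: eventually_mono)
    also have "\<dots> = 1" using W12_0_integrals(1)[OF u(1) \<Omega>] u(2) by simp
    finally have "sq_norm m (\<lambda>x. \<Sum>i<k. t i *\<^sub>R weak_gradient (e i) x) \<le> L" using L by (simp add: frame_level_def)
    moreover have "sq_norm m (weak_gradient u) = sq_norm m (\<lambda>x. \<Sum>i<k. t i *\<^sub>R weak_gradient (e i) x)"
      by (rule lincomb_gradient[OF W12_0D(1)[OF eW] W12_0D(1)[OF u(1)] t])
    ultimately show "ereal (LINT x:\<Omega>|m. (norm (weak_gradient u x))\<^sup>2) \<le> ereal L"
      using W12_0_integrals(2)[OF u(1) \<Omega>] by simp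
  qed
  ultimately show ?thesis unfolding eigenvalue_def by (intro INF_lower2) auto
qed

theorem eigenvalue_minimiser:
  assumes k: "1 \<le> k" and c: "0 \<le> c"
  shows "\<exists>\<Omega>. is_solution m c (eigenvalue m k) \<Omega> \<and> quasi_open m \<Omega>"
proof -
  define I where "I = {L. \<exists>\<Omega> e. \<Omega> \<in> admissible m c \<and> frame k \<Omega> e \<and> frame_level k e L}"
  \<comment> \<open>The eigenvalue is an extended real, so it is compared with \<open>l\<close>
    through all real upper bounds of each supremum; an infinite supremum has none.\<close>
  have lower: "ereal l \<le> eigenvalue m k \<Omega>" if \<Omega>: "\<Omega> \<in> admissible m c" and l: "\<And>L. L \<in> I \<Longrightarrow> l \<le> L" for \<Omega> l
    unfolding eigenvalue_def
  proof (rule INF_greatest, rule ereal_le_real)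
    fix K z assume K: "K \<in> {K. subspace_of_dim m k (W12_0 m \<Omega>) K}"
      and z: "(SUP u \<in> {u \<in> K. (LINT x:\<Omega>|m. (u x)\<^sup>2) = 1}. ereal (LINT x:\<Omega>|m. (norm (weak_gradient u x))\<^sup>2)) \<le> ereal z"
    have "\<Omega> \<in> sets borel" using \<Omega> by (simp add: admissible_def)
    with K z obtain e where "frame k \<Omega> e" "frame_level k e z" using subspace_level by blast
    then have "z \<in> I" using \<Omega> by (auto simp: I_def)
    then show "ereal l \<le> ereal z" using l by simp
  qed
  show ?thesis
  proof (cases "I = {}")
    \<comment> \<open>No admissible set carries a frame with a finite level, as happens for
      \<open>c = 0\<close>, where only functions vanishing almost everywhere are available. All
      eigenvalues are then infinite and any admissible set is a minimiser.\<close>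
    case True
    have "eigenvalue m k \<Omega> = \<infinity>" if "\<Omega> \<in> admissible m c" for \<Omega>
      using lower[OF that] True by (intro ereal_top) auto
    moreover have "{} \<in> admissible m c" using c by (simp add: admissible_def)
    ultimately have "is_solution m c (eigenvalue m k) {}" by (simp add: is_solution_def)
    moreover have "quasi_open m {}"
      unfolding quasi_open_def
    proof (rule bexI[of _ "\<lambda>x. 0"])
      show "(\<lambda>x. 0) \<in> W12_qc m" using sobolev_const[of 0] quasi_continuous_const by (auto simp: W12_qc_def W12_iff)
    qed (use capacity_empty in simp)
    ultimately show ?thesis by blast
  next
    case False
    \<comment> \<open>Coordinate vectors as coefficients turn a level into a bound on each single
      gradient, as compactness requires.\<close>
    have unit: "sq_norm m (weak_gradient (e i)) \<le> L" if "frame_level k e L" "i < k" for e L i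
    proof -
      have "(\<Sum>j<k. ((\<lambda>j. if j = i then 1 else 0 :: real) j)\<^sup>2) = (\<Sum>j<k. if j = i then 1 else 0)"
        by (intro sum.cong) auto
      also have "\<dots> = 1" using that(2) by simp
      finally have "sq_norm m (\<lambda>x. \<Sum>j<k. (if j = i then 1 else 0) *\<^sub>R weak_gradient (e j) x) \<le> L"
        using that(1)[unfolded frame_level_def, rule_format, of "\<lambda>j. if j = i then 1 else 0"] by simp
      moreover have "(\<Sum>j<k. (if j = i then 1 else 0) *\<^sub>R weak_gradient (e j) x) = weak_gradient (e i) x" for x
      proof -
        have "(\<Sum>j<k. (if j = i then 1 else 0 :: real) *\<^sub>R weak_gradient (e j) x) = (\<Sum>j<k. if j = i then weak_gradient (e j) x else 0)"
          by (intro sum.cong) auto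
        then show ?thesis using that(2) by simp
      qed
      ultimately show ?thesis by simp
    qed
    have pos: "0 \<le> L" if L: "L \<in> I" for L
    proof -
      from L obtain e where "frame_level k e L" by (auto simp: I_def)
      from unit[OF this, of 0] k have "sq_norm m (weak_gradient (e 0)) \<le> L" by simp
      then show ?thesis using sq_norm_nonneg[of m "weak_gradient (e 0)"] by linarith
    qed
    have bdd: "bdd_below I" using pos by (rule bdd_belowI)
    define l where "l = Inf I"
    have "\<exists>\<Omega> e L. \<Omega> \<in> admissible m c \<and> frame k \<Omega> e \<and> frame_level k e L \<and> L < l + 1 / real (Suc n)" for n
      using cInf_lessD[OF False, of "l + 1 / real (Suc n)"] unfolding l_def I_def by auto
    then obtain \<Omega> e L where E: "\<And>n. \<Omega> n \<in> admissible m c" "\<And>n. frame k (\<Omega> n) (e n)" "\<And>n. frame_level k (e n) (L n)"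
      "\<And>n. L n < l + 1 / real (Suc n)" by metis
    have eW: "e n i \<in> W12_0 m (\<Omega> n)" if "i < k" for n i using E(2) that by (simp add: frame_def)
    have L1: "L n \<le> l + 1" for n
    proof -
      have "1 / real (Suc n) \<le> 1" by simp
      then show ?thesis using E(4)[of n] by linarith
    qed
    have l0: "0 \<le> l" unfolding l_def using False pos by (rule cInf_greatest)
    \<comment> \<open>The squared norms are 1, so \<open>l + 1\<close> bounds functions and
      gradients alike.\<close>
    have ne: "sq_norm m (e n i) \<le> l + 1" if "i < k" for n i
      using E(2)[of n] that l0 by (simp add: frame_def orthonormal_def sq_norm_real)
    have ng: "sq_norm m (weak_gradient (e n i)) \<le> l + 1" if "i < k" for n i
      using unit[OF E(3) that, of n] L1[of n] by linarith
    obtain r B G where r: "strict_mono (r::nat\<Rightarrow>nat)" and BG0: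
      "\<forall>i<k. sobolev (B i) (G i) \<and> quasi_continuous m (B i) \<and> (\<lambda>n. sq_norm m (\<lambda>x. e (r n) i x - B i x)) \<longlonglongrightarrow> 0 \<and>
        (AE x in m. (\<lambda>n. e (r n) i x) \<longlonglongrightarrow> B i x)"
      "\<forall>t L N. (\<forall>n\<ge>N. sq_norm m (\<lambda>x. \<Sum>i<k. t i *\<^sub>R weak_gradient (e (r n) i) x) \<le> L) \<longrightarrow> sq_norm m (\<lambda>x. \<Sum>i<k. t i *\<^sub>R G i x) \<le> L"
      by (rule quasi_continuous_compactness[of k e "\<lambda>n i. weak_gradient (e n i)" "l + 1",
            OF W12_0D(1)[OF eW] W12_0D(2)[OF eW] ne ng])
    have BG: "\<And>i. i < k \<Longrightarrow> sobolev (B i) (G i)" "\<And>i. i < k \<Longrightarrow> quasi_continuous m (B i)"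
      "\<And>i. i < k \<Longrightarrow> (\<lambda>n. sq_norm m (\<lambda>x. e (r n) i x - B i x)) \<longlonglongrightarrow> 0"
      "\<And>i. i < k \<Longrightarrow> AE x in m. (\<lambda>n. e (r n) i x) \<longlonglongrightarrow> B i x"
      "\<And>t L N. (\<And>n. n \<ge> N \<Longrightarrow> sq_norm m (\<lambda>x. \<Sum>i<k. t i *\<^sub>R weak_gradient (e (r n) i) x) \<le> L) \<Longrightarrow> sq_norm m (\<lambda>x. \<Sum>i<k. t i *\<^sub>R G i x) \<le> L"
      using BG0 by blast+
    have dom: "{x. 0 < (\<Sum>i<k. \<bar>B i x\<bar>)} \<in> sets borel" "quasi_open m {x. 0 < (\<Sum>i<k. \<bar>B i x\<bar>)}"
      "\<And>i. i < k \<Longrightarrow> B i \<in> W12_0 m {x. 0 < (\<Sum>i<k. \<bar>B i x\<bar>)}"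
      "{x. 0 < (\<Sum>i<k. \<bar>B i x\<bar>)} = {x. \<exists>i<k. B i x \<noteq> 0}"
      by (rule tuple_domain[OF BG(1,2)]; assumption)+
    define D where "D = {x. 0 < (\<Sum>i<k. \<bar>B i x\<bar>)}"
    have D: "D \<in> admissible m c" unfolding D_def
      by (rule limit_domain_measure[where b="\<lambda>n i. e (r n) i" and k=k and B=B and \<Omega>="\<lambda>n. \<Omega> (r n)",
            OF BG(4) E(1) eW dom(1) dom(4) c])
    have sB: "sq_integrable m (B i)" if "i < k" for i using sobolevD(2)[OF BG(1)[OF that]] .
    have se: "sq_integrable m (e n i)" if "i < k" for n i using W12_0D(4)[OF eW[OF that]] .
    have "orthonormal m k B"
      unfolding orthonormal_def
    proof (intro conjI allI impI sB)
      fix i j assume i: "i < k" and j: "j < k"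
      have l1: "(\<lambda>n. LINT x|m. B i x * e (r n) j x) \<longlonglongrightarrow> (LINT x|m. B i x * B j x)"
        by (rule sq_norm_tendsto_mult[OF sB[OF i] se[OF j] sB[OF j] BG(3)[OF j]])
      \<comment> \<open>Both factors of the product vary. One is frozen at its limit in
        \<open>l1\<close>; here the error of freezing it is shown to vanish.\<close>
      have l2: "(\<lambda>n. (LINT x|m. e (r n) i x * e (r n) j x) - (LINT x|m. B i x * e (r n) j x)) \<longlonglongrightarrow> 0"
      proof (rule LIMSEQ_I)
        fix \<epsilon> :: real assume \<epsilon>: "\<epsilon> > 0"
        \<comment> \<open>Balances Young's inequality: with a squared distance below
          \<open>\<epsilon> / \<tau>\<close> and a squared norm at most
          \<open>l + 1 = \<epsilon> * \<tau>\<close>, each half contributes at most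
          \<open>\<epsilon> / 2\<close>.\<close>
        define \<tau> where "\<tau> = (l + 1) / \<epsilon>"
        have \<tau>: "\<tau> > 0" using \<epsilon> l0 by (simp add: \<tau>_def)
        have l\<tau>: "l + 1 = \<epsilon> * \<tau>" using \<epsilon> by (simp add: \<tau>_def)
        have "\<epsilon> / \<tau> > 0" using \<epsilon> \<tau> by simp
        from order_tendstoD(2)[OF BG(3)[OF i] this] obtain N where N: "\<And>n. n \<ge> N \<Longrightarrow> sq_norm m (\<lambda>x. e (r n) i x - B i x) < \<epsilon> / \<tau>"
          by (auto simp: eventually_sequentially)
        show "\<exists>no. \<forall>n\<ge>no. norm ((LINT x|m. e (r n) i x * e (r n) j x) - (LINT x|m. B i x * e (r n) j x) - 0) < \<epsilon>"
        proof (intro exI[of _ N] allI impI)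
          fix n assume n: "N \<le> n"
          have "norm ((LINT x|m. e (r n) i x * e (r n) j x) - (LINT x|m. B i x * e (r n) j x) - 0) = \<bar>LINT x|m. (e (r n) i x - B i x) * e (r n) j x\<bar>"
            using sq_integrable_mult[OF se[OF i] se[OF j], of "r n" "r n"] sq_integrable_mult[OF sB[OF i] se[OF j], of "r n"]
            by (simp add: left_diff_distrib)
          also have "\<dots> \<le> \<tau> / 2 * sq_norm m (\<lambda>x. e (r n) i x - B i x) + 1 / (2 * \<tau>) * sq_norm m (e (r n) j)"
            by (rule young_integral[OF sq_integrable_diff[OF se[OF i] sB[OF i]] se[OF j] \<tau>])
          also have "\<dots> < \<tau> / 2 * (\<epsilon> / \<tau>) + 1 / (2 * \<tau>) * (l + 1)"
            using N[OF n] ne[OF j, of "r n"] \<tau> by (intro add_less_le_mono mult_strict_left_mono mult_left_mono) auto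
          also have "\<dots> = \<epsilon>" unfolding l\<tau> using \<tau> by (simp add: field_simps)
          finally show "norm ((LINT x|m. e (r n) i x * e (r n) j x) - (LINT x|m. B i x * e (r n) j x) - 0) < \<epsilon>" .
        qed
      qed
      have "(LINT x|m. e (r n) i x * e (r n) j x) = (if i = j then 1 else 0)" for n
        using E(2)[of "r n"] i j by (simp add: frame_def orthonormal_def)
      with tendsto_add[OF l2 l1] show "(LINT x|m. B i x * B j x) = (if i = j then 1 else 0)"
        by (simp add: LIMSEQ_const_iff)
    qed
    then have fB: "frame k D B" using dom(3) unfolding D_def frame_def by blast
    have "frame_level k B l"
      unfolding frame_level_def
    proof (intro allI impI)
      fix t :: "nat \<Rightarrow> real" assume t: "(\<Sum>i<k. (t i)\<^sup>2) = 1"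
      \<comment> \<open>Upper bounds pass to the limit only when they hold along a tail, so the
        level \<open>l\<close> is reached through all levels \<open>l + 1 / (N + 1)\<close>.\<close>
      have "sq_norm m (\<lambda>x. \<Sum>i<k. t i *\<^sub>R G i x) \<le> l + 1 / real (Suc N)" for N
      proof (rule BG(5))
        fix n assume "N \<le> n"
        then have "N \<le> r n" using seq_suble[OF r, of n] by simp
        then have "1 / real (Suc (r n)) \<le> 1 / real (Suc N)" by (intro divide_left_mono) auto
        moreover have "sq_norm m (\<lambda>x. \<Sum>i<k. t i *\<^sub>R weak_gradient (e (r n) i) x) \<le> L (r n)"
          using E(3)[of "r n"] t by (simp add: frame_level_def)
        ultimately show "sq_norm m (\<lambda>x. \<Sum>i<k. t i *\<^sub>R weak_gradient (e (r n) i) x) \<le> l + 1 / real (Suc N)"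
          using E(4)[of "r n"] by linarith
      qed
      moreover have "(\<lambda>N. l + 1 / real (Suc N)) \<longlonglongrightarrow> l + 0" by (intro tendsto_intros abs_regularisation_tendsto)
      ultimately have le: "sq_norm m (\<lambda>x. \<Sum>i<k. t i *\<^sub>R G i x) \<le> l" by (intro LIMSEQ_le_const[where X="\<lambda>N. l + 1 / real (Suc N)"]) auto
      have "(\<lambda>x. \<Sum>i<k. t i * B i x) \<in> W12_0 m D" using fB by (intro W12_0_lincomb) (simp add: frame_def)
      note s = W12_0D(1)[OF this]
      have bW: "sobolev (B i) (weak_gradient (B i))" if "i < k" for i using fB that by (auto simp: frame_def intro: W12_0D(1))
      \<comment> \<open>Two versions of one gradient are compared: \<open>G\<close> from
        compactness, and the choice made by \<open>weak_gradient\<close>.\<close>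
      have "sq_norm m (\<lambda>x. \<Sum>i<k. t i *\<^sub>R weak_gradient (B i) x) = sq_norm m (\<lambda>x. \<Sum>i<k. t i *\<^sub>R G i x)"
        using lincomb_gradient[of k B "\<lambda>i. weak_gradient (B i)", OF bW s, of t] lincomb_gradient[of k B G, OF BG(1) s, of t] by simp
      with le show "sq_norm m (\<lambda>x. \<Sum>i<k. t i *\<^sub>R weak_gradient (B i) x) \<le> l" by simp
    qed
    then have "eigenvalue m k D \<le> ereal l"
      using frame_eigenvalue_le[OF fB] D by (simp add: admissible_def)
    moreover have "ereal l \<le> eigenvalue m k \<Omega>'" if "\<Omega>' \<in> admissible m c" for \<Omega>'
      by (rule lower[OF that]) (simp add: l_def cInf_lower bdd)
    ultimately have "is_solution m c (eigenvalue m k) D" using D unfolding is_solution_def by (meson order_trans)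
    then show ?thesis using dom(2) unfolding D_def by blast
  qed
qed

end

subsection \<open>Non-degenerate Gaussian measures\<close>

lemma nn_integral_std_normal_density: "(\<integral>\<^sup>+t. ennreal (std_normal_density t) \<partial>lborel) = 1"
  using prob_space.emeasure_space_1[OF prob_space_normal_density[of 1 0]] by (simp add: emeasure_density)

text \<open>Independence of the coordinates, obtained from the product formula for Lebesgue
  integrals over \<open>Basis\<close> by reindexing to coordinates.\<close>

lemma std_gaussian_nn_integral:
  assumes [measurable]: "\<And>i. h i \<in> borel_measurable borel"
  shows "(\<integral>\<^sup>+z. (\<Prod>i\<in>UNIV. h i (z $ i)) \<partial>std_gaussian) = (\<Prod>i\<in>(UNIV::2 set). \<integral>\<^sup>+t. ennreal (std_normal_density t) * h i t \<partial>lborel)"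
proof -
  have B: "Basis = range (\<lambda>i::2. axis i (1::real))" by (auto simp: Basis_vec_def)
  have inj: "inj (\<lambda>i::2. axis i (1::real))" by (auto simp: inj_def axis_eq_axis)
  \<comment> \<open>Recovers the coordinate from its basis vector.\<close>
  define i where "i = (\<lambda>b::real^2. inv (\<lambda>i::2. axis i (1::real)) b)"
  have i: "i (axis j 1) = j" for j unfolding i_def by (simp add: inv_f_f[OF inj])
  have "(\<integral>\<^sup>+z. (\<Prod>i\<in>UNIV. h i (z $ i)) \<partial>std_gaussian)
      = (\<integral>\<^sup>+z. (\<Prod>b\<in>Basis. ennreal (std_normal_density (z \<bullet> b)) * h (i b) (z \<bullet> b)) \<partial>lborel)"
    unfolding std_gaussian_def
    by (subst nn_integral_density)
       (auto simp: B prod.reindex[OF inj] i prod.distrib prod_ennreal[symmetric] inner_axis intro!: nn_integral_cong)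
  also have "\<dots> = (\<Prod>b\<in>Basis. \<integral>\<^sup>+t. ennreal (std_normal_density t) * h (i b) t \<partial>lborel)"
    by (rule nn_integral_lborel_prod) auto
  finally show ?thesis by (simp add: B prod.reindex[OF inj] i)
qed

lemma sets_std_gaussian [simp, measurable_cong]: "sets std_gaussian = sets borel"
  by (simp add: std_gaussian_def)

lemma space_std_gaussian [simp]: "space std_gaussian = UNIV"
  by (simp add: std_gaussian_def)

lemma prob_space_std_gaussian: "prob_space std_gaussian"
proof
  have "(\<integral>\<^sup>+z. (\<Prod>i\<in>(UNIV::2 set). 1) \<partial>std_gaussian) = 1"
    using std_gaussian_nn_integral[of "\<lambda>i t. 1"] by (simp add: nn_integral_std_normal_density)
  then show "emeasure std_gaussian (space std_gaussian) = 1" by simp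
qed

text \<open>Each coordinate has a finite first absolute moment, the other coordinate integrating to
  1. This makes the mean vector a genuine integral.\<close>

lemma integrable_std_gaussian: "integrable std_gaussian (\<lambda>z. z)"
proof -
  have fin: "(\<integral>\<^sup>+z. ennreal \<bar>z $ j\<bar> \<partial>std_gaussian) < \<infinity>" for j :: 2
  proof -
    let ?h = "\<lambda>i t::real. if i = j then ennreal \<bar>t\<bar> else 1"
    have "(\<integral>\<^sup>+t. ennreal (std_normal_density t) * ?h i t \<partial>lborel) < \<infinity>" for i
    proof (cases "i = j")
      case True
      have "(\<integral>\<^sup>+t. ennreal (norm (std_normal_density t * \<bar>t\<bar>^1)) \<partial>lborel) < \<infinity>"
        using integrable_std_normal_moment_abs[of 1] unfolding integrable_iff_bounded by simp
      moreover have "(\<integral>\<^sup>+t. ennreal (std_normal_density t) * ?h i t \<partial>lborel) = (\<integral>\<^sup>+t. ennreal (norm (std_normal_density t * \<bar>t\<bar>^1)) \<partial>lborel)"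
        using True by (intro nn_integral_cong) (simp add: ennreal_mult abs_mult)
      ultimately show ?thesis by simp
    qed (simp add: nn_integral_std_normal_density)
    then have "(\<integral>\<^sup>+z. (\<Prod>i\<in>UNIV. ?h i (z $ i)) \<partial>std_gaussian) < \<infinity>"
      by (subst std_gaussian_nn_integral) (auto simp: less_top[symmetric] ennreal_prod_eq_top)
    moreover have "(\<Prod>i\<in>UNIV. ?h i (z $ i)) = ennreal \<bar>z $ j\<bar>" for z :: "real^2" by simp
    ultimately show ?thesis by simp
  qed
  have "(\<integral>\<^sup>+z. ennreal (norm z) \<partial>std_gaussian) \<le> (\<integral>\<^sup>+z. (\<Sum>j\<in>UNIV. ennreal \<bar>z $ j\<bar>) \<partial>std_gaussian)"
    by (intro nn_integral_mono) (simp add: sum_ennreal norm_le_l1_cart ennreal_leI)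
  also have "\<dots> = (\<Sum>j\<in>UNIV. \<integral>\<^sup>+z. ennreal \<bar>z $ j\<bar> \<partial>std_gaussian)" by (rule nn_integral_sum) simp
  also have "\<dots> < \<infinity>" using fin by simp
  finally show ?thesis by (simp add: integrable_iff_bounded)
qed

text \<open>The preimage of a box is the image under \<open>B\<close> of a translated box, of area
  \<open>1 / \<bar>det A\<bar>\<close> times that of the box. A measure giving boxes their area is
  Lebesgue measure; this identifies the push-forward multiplied by \<open>\<bar>det A\<bar>\<close>,
  and the factor is then divided out.\<close>

lemma lborel_distr_affine:
  fixes A B :: "real^2^2"
  assumes AB: "A ** B = mat 1" and BA: "B ** A = mat 1"
  shows "distr lborel borel (\<lambda>z. t + A *v z) = density lborel (\<lambda>_. ennreal (1 / \<bar>det A\<bar>))"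
proof -
  let ?T = "\<lambda>z. t + A *v z"
  have d: "det A * det B = 1" using AB det_mul[of A B] by simp
  have d0: "\<bar>det A\<bar> > 0" using d by auto
  have dB: "\<bar>det B\<bar> = 1 / \<bar>det A\<bar>" using d d0 by (simp add: field_simps abs_mult[symmetric])
  have [measurable]: "?T \<in> borel_measurable borel"
    by (intro borel_measurable_continuous_onI continuous_intros matrix_vector_mult_linear_continuous_on)
  have "lborel = density (distr lborel borel ?T) (\<lambda>_. ennreal \<bar>det A\<bar>)"
  proof (rule lborel_eqI)
    fix l u :: "real^2" assume lu: "\<And>b. b \<in> Basis \<Longrightarrow> l \<bullet> b \<le> u \<bullet> b"
    let ?S = "(\<lambda>x. x - t) ` box l u"
    have im: "?T -` box l u = (*v) B ` ?S"
    proof (intro set_eqI iffI)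
      fix z assume "z \<in> ?T -` box l u"
      then have "?T z \<in> box l u" by simp
      moreover have "z = B *v (?T z - t)" using BA by (simp add: matrix_vector_mul_assoc)
      ultimately show "z \<in> (*v) B ` ?S" by blast
    next
      fix z assume "z \<in> (*v) B ` ?S"
      then show "z \<in> ?T -` box l u" using AB by (auto simp: matrix_vector_mul_assoc)
    qed
    have S: "?S \<in> lmeasurable" "measure lebesgue ?S = measure lborel (box l u)"
      using measurable_translation_subtract[of "box l u" t] measure_translation_subtract[of t "box l u"] by auto
    have lin: "linear ((*v) B)" by simp
    have L: "(*v) B ` ?S \<in> lmeasurable" using measurable_linear_image[OF lin S(1)] .
    have M: "measure lebesgue ((*v) B ` ?S) = 1 / \<bar>det A\<bar> * measure lborel (box l u)"
      using measure_linear_image[OF lin S(1)] S(2) dB by simp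
    have sb: "?T -` box l u \<in> sets borel" using measurable_sets[of ?T borel borel "box l u"] by simp
    have "emeasure lborel (?T -` box l u) = emeasure lebesgue ((*v) B ` ?S)"
      using sb unfolding im by simp
    also have "\<dots> = ennreal (1 / \<bar>det A\<bar> * measure lborel (box l u))"
      using L M by (simp add: emeasure_eq_measure2)
    finally have e: "emeasure lborel (?T -` box l u) = ennreal (1 / \<bar>det A\<bar> * measure lborel (box l u))" .
    have "emeasure (density (distr lborel borel ?T) (\<lambda>_. ennreal \<bar>det A\<bar>)) (box l u) = ennreal \<bar>det A\<bar> * emeasure lborel (?T -` box l u)"
      by (simp add: emeasure_density nn_integral_cmult emeasure_distr)
    also have "\<dots> = ennreal (measure lborel (box l u))"
      unfolding e using d0 by (simp add: ennreal_mult[symmetric])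
    also have "\<dots> = ennreal (\<Prod>b\<in>Basis. (u - l) \<bullet> b)" using lu by (simp add: measure_lborel_box_eq)
    finally show "emeasure (density (distr lborel borel ?T) (\<lambda>_. ennreal \<bar>det A\<bar>)) (box l u) = (\<Prod>b\<in>Basis. (u - l) \<bullet> b)"
      using lu by simp
  qed simp
  then have "density lborel (\<lambda>_. ennreal (1 / \<bar>det A\<bar>))
      = density (density (distr lborel borel ?T) (\<lambda>_. ennreal \<bar>det A\<bar>)) (\<lambda>_. ennreal (1 / \<bar>det A\<bar>))"
    by simp
  also have "\<dots> = density (distr lborel borel ?T) (\<lambda>_. ennreal \<bar>det A\<bar> * ennreal (1 / \<bar>det A\<bar>))"
    by (rule density_density_eq) auto
  also have "ennreal \<bar>det A\<bar> * ennreal (1 / \<bar>det A\<bar>) = 1" using d0 by (simp add: ennreal_mult[symmetric])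
  finally show ?thesis by (simp add: density_1)
qed

text \<open>If \<open>A\<close> is singular, a non-zero \<open>w\<close> in the kernel of its
  transpose makes \<open>w \<bullet> x\<close> constant almost surely. The centred coordinates are
  then linearly dependent and the covariance determinant vanishes.\<close>

lemma gaussian_invertible:
  assumes m: "m = distr std_gaussian borel (\<lambda>z. t + A *v z)" and inv: "invertible (covariance_matrix m)"
  shows "invertible (A :: real^2^2)"
proof (rule ccontr)
  assume "\<not> invertible A"
  then have "\<not> invertible (transpose A)" by (simp add: invertible_det_nz)
  then obtain w where w: "w \<noteq> 0" "transpose A *v w = 0"
    using invertible_left_inverse matrix_left_invertible_ker by blast
  interpret prob_space std_gaussian by (rule prob_space_std_gaussian)
  have T [measurable]: "(\<lambda>z. t + A *v z) \<in> borel_measurable borel"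
    by (intro borel_measurable_continuous_onI continuous_intros matrix_vector_mult_linear_continuous_on)
  have sets_m [measurable_cong, simp]: "sets m = sets borel" by (simp add: m)
  \<comment> \<open>Needed to move \<open>w\<close> inside the integral: the Bochner mean of a
    non-integrable function would be 0 by convention.\<close>
  have int_m: "integrable m (\<lambda>x. x)"
    unfolding m
    by (subst integrable_distr_eq)
       (auto intro!: integrable_add integrable_bounded_linear[OF matrix_vector_mul_bounded_linear integrable_std_gaussian])
  have wx: "AE x in m. w \<bullet> x = w \<bullet> t"
  proof -
    have "w v* A = 0" using w(2) by simp
    then have "w \<bullet> (t + A *v z) = w \<bullet> t" for z
      using dot_lmul_matrix[of w A z] by (simp add: inner_add_right)
    then show ?thesis unfolding m by (subst AE_distr_iff) auto
  qed
  let ?\<mu> = "mean_vector m"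
  have pm: "prob_space m" unfolding m by (rule prob_space_distr) simp
  have "w \<bullet> ?\<mu> = (LINT x|m. w \<bullet> x)" unfolding mean_vector_def using int_m by simp
  also have "\<dots> = (LINT x|m. w \<bullet> t)" using wx by (intro integral_cong_AE) auto
  also have "\<dots> = w \<bullet> t" using prob_space.prob_space[OF pm] by simp
  finally have wy: "AE x in m. w \<bullet> (x - ?\<mu>) = 0" using wx by (auto simp: inner_diff_right)
  \<comment> \<open>A coordinate where \<open>w\<close> is non-zero is, after centring, a fixed
    multiple of the other one, so the covariance matrix has rank at most one.\<close>
  have key: "det (covariance_matrix m) = 0" if wi: "w $ i \<noteq> 0" and ij: "{i, j} = {1, 2}" "i \<noteq> j" for i j
  proof -
    define s where "s = - (w $ j / w $ i)"
    have "w \<bullet> y = w $ i * y $ i + w $ j * y $ j" for y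
      using ij by (auto simp: inner_vec_def sum_2 doubleton_eq_iff)
    with wy have xi: "AE x in m. x $ i - ?\<mu> $ i = s * (x $ j - ?\<mu> $ j)"
      using wi by (auto simp: s_def field_simps elim!: eventually_mono)
    let ?c = "\<lambda>i j. LINT x|m. (x $ i - ?\<mu> $ i) * (x $ j - ?\<mu> $ j)"
    have "?c i j = (LINT x|m. s * ((x $ j - ?\<mu> $ j) * (x $ j - ?\<mu> $ j)))"
      using xi by (intro integral_cong_AE) (auto elim!: eventually_mono)
    then have c1: "?c i j = s * ?c j j" by simp
    have "?c j i = (LINT x|m. s * ((x $ j - ?\<mu> $ j) * (x $ j - ?\<mu> $ j)))"
      using xi by (intro integral_cong_AE) (auto elim!: eventually_mono)
    then have c2: "?c j i = s * ?c j j" by simp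
    have "?c i i = (LINT x|m. s * s * ((x $ j - ?\<mu> $ j) * (x $ j - ?\<mu> $ j)))"
      using xi by (intro integral_cong_AE) (auto elim!: eventually_mono)
    then have c3: "?c i i = s * s * ?c j j" by simp
    have "det (covariance_matrix m) = ?c i i * ?c j j - ?c i j * ?c j i"
      using ij by (auto simp: det_2 covariance_matrix_def doubleton_eq_iff)
    then show ?thesis unfolding c1 c2 c3 by simp
  qed
  have "w $ 1 \<noteq> 0 \<or> w $ 2 \<noteq> 0" using w(1) by (auto simp: vec_eq_iff forall_2)
  then have "det (covariance_matrix m) = 0" using key[of 1 2] key[of 2 1] by auto
  with inv show False by (simp add: invertible_det_nz)
qed

lemma std_gaussian_density: "(\<Prod>i\<in>(UNIV :: 2 set). std_normal_density (z $ i)) = 1 / (2 * pi) * exp (- (z \<bullet> z) / 2)"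
  by (simp add: UNIV_2 normal_density_def inner_vec_def exp_add[symmetric] power2_eq_square add_divide_distrib[symmetric] real_sqrt_mult[symmetric])

text \<open>With \<open>B\<close> the inverse of \<open>A\<close>, the density is a constant times
  \<open>exp (- |B (x - t)|^2 / 2)\<close>, and its derivative in direction \<open>x - t\<close> is
  \<open>- |B (x - t)|^2 \<rho>\<close>, which an operator norm bound for \<open>A\<close> compares
  with \<open>|x - t|^2\<close>.\<close>

theorem gaussian_plane_nondegenerate:
  assumes "gaussian_measure m" "invertible (covariance_matrix m)"
  obtains \<rho> t lam where "gaussian_plane m \<rho> t lam"
proof -
  obtain t A where m: "m = distr std_gaussian borel (\<lambda>z. t + A *v z)" using assms(1) by (auto simp: gaussian_measure_def)
  have "invertible A" using gaussian_invertible[OF m assms(2)] .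
  then obtain B where AB: "A ** B = mat 1" and BA: "B ** A = mat 1" by (auto simp: invertible_def)
  have d: "det A * det B = 1" using AB det_mul[of A B] by simp
  then have d0: "\<bar>det A\<bar> > 0" by auto
  define K where "K = 1 / \<bar>det A\<bar> * (1 / (2 * pi))"
  have K: "K > 0" using d0 by (simp add: K_def)
  define \<rho> where "\<rho> = (\<lambda>x. K * exp (- ((B *v (x - t)) \<bullet> (B *v (x - t))) / 2))"
  have [measurable]: "(\<lambda>z. t + A *v z) \<in> borel_measurable borel"
    by (intro borel_measurable_continuous_onI continuous_intros matrix_vector_mult_linear_continuous_on)
  have cB: "continuous_on UNIV (\<lambda>x. B *v (x - t))"
    by (rule continuous_on_compose2[OF matrix_vector_mult_linear_continuous_on]) (auto intro!: continuous_intros)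
  have c\<rho>: "continuous_on UNIV \<rho>" unfolding \<rho>_def by (intro continuous_intros cB) auto
  have m\<rho>: "m = density lborel (\<lambda>x. ennreal (\<rho> x))"
  proof -
    define g where "g = (\<lambda>x. ennreal (1 / (2 * pi) * exp (- ((B *v (x - t)) \<bullet> (B *v (x - t))) / 2)))"
    have [measurable]: "g \<in> borel_measurable borel"
      unfolding g_def by (intro measurable_compose[OF _ measurable_ennreal] borel_measurable_continuous_onI continuous_intros cB) auto
    have "std_gaussian = density lborel (\<lambda>z. g (t + A *v z))"
      unfolding std_gaussian_def g_def by (simp add: std_gaussian_density matrix_vector_mul_assoc BA)
    then have "m = density (distr lborel borel (\<lambda>z. t + A *v z)) g"
      unfolding m by (subst density_distr) auto
    also have "\<dots> = density (density lborel (\<lambda>_. ennreal (1 / \<bar>det A\<bar>))) g" by (subst lborel_distr_affine[OF AB BA]) simp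
    also have "\<dots> = density lborel (\<lambda>x. ennreal (1 / \<bar>det A\<bar>) * g x)" by (rule density_density_eq) auto
    also have "(\<lambda>x. ennreal (1 / \<bar>det A\<bar>) * g x) = (\<lambda>x. ennreal (\<rho> x))"
      unfolding g_def \<rho>_def K_def by (subst ennreal_mult[symmetric]) (simp_all add: mult.assoc)
    finally show ?thesis .
  qed
  \<comment> \<open>The gradient of \<open>\<rho>\<close> by coordinates, written so that summing
    against a vector collapses by linearity of \<open>B\<close>.\<close>
  define D where "D = (\<lambda>i x. - ((B *v (x - t)) \<bullet> (B *v axis i 1)) * \<rho> x)"
  have D_sum: "(\<Sum>i\<in>UNIV. h $ i * D i x) = - ((B *v (x - t)) \<bullet> (B *v h)) * \<rho> x" for h x
  proof -
    have "B *v h = B *v (\<Sum>i\<in>UNIV. h $ i *\<^sub>R axis i 1)" using basis_expansion[of h] by (simp add: scalar_mult_eq_scaleR)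
    also have "\<dots> = (\<Sum>i\<in>UNIV. h $ i *\<^sub>R (B *v axis i 1))"
      by (simp add: linear_sum[OF matrix_vector_mul_linear] matrix_vector_mult_scaleR)
    finally show ?thesis by (simp add: D_def inner_sum_right sum_distrib_right sum_negf[symmetric] mult.assoc)
  qed
  have der: "(\<rho> has_derivative (\<lambda>h. \<Sum>i\<in>UNIV. h $ i * D i x)) (at x)" for x
  proof -
    define y where "y = (\<lambda>x. B *v (x - t))"
    have 1: "(y has_derivative (\<lambda>h. B *v h)) (at x)"
      unfolding y_def
      by (rule bounded_linear.has_derivative[OF matrix_vector_mul_bounded_linear]) (auto intro!: derivative_eq_intros)
    have 2: "((\<lambda>x. - (y x \<bullet> y x) / 2) has_derivative (\<lambda>h. - (y x \<bullet> (B *v h)))) (at x)"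
      by (rule derivative_eq_intros 1 refl | simp)+ (simp add: fun_eq_iff inner_commute)
    have "((\<lambda>x. K * exp (- (y x \<bullet> y x) / 2)) has_derivative (\<lambda>h. - (y x \<bullet> (B *v h)) * (K * exp (- (y x \<bullet> y x) / 2)))) (at x)"
      by (rule derivative_eq_intros 2 refl)+ (simp add: fun_eq_iff)
    then have "(\<rho> has_derivative (\<lambda>h. - ((B *v (x - t)) \<bullet> (B *v h)) * \<rho> x)) (at x)"
      by (simp only: \<rho>_def y_def)
    then show ?thesis by (simp only: D_sum)
  qed
  have cD: "continuous_on UNIV (D i)" for i unfolding D_def by (intro continuous_intros cB c\<rho>)
  note C1 = has_derivative_C1[of \<rho> D, OF der cD]
  \<comment> \<open>Since \<open>x - t\<close> is \<open>A\<close> applied to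
    \<open>B *v (x - t)\<close>, its norm is at most \<open>C\<close> times that of the latter;
    hence \<open>lam = 1 / C^2\<close>.\<close>
  obtain C where C: "C > 0" "\<And>y. norm (A *v y) \<le> norm y * C"
    using bounded_linear.pos_bounded[OF matrix_vector_mul_bounded_linear[of A]] by blast
  interpret s: prob_space std_gaussian by (rule prob_space_std_gaussian)
  have "prob_space m" unfolding m by (rule s.prob_space_distr) simp
  then have "gaussian_plane m \<rho> t (1 / C\<^sup>2)"
  proof (intro gaussian_plane.intro weighted_plane.intro weighted_plane_axioms.intro gaussian_plane_axioms.intro)
    fix x
    have "norm (x - t) \<le> norm (B *v (x - t)) * C"
      using C(2)[of "B *v (x - t)"] by (simp add: matrix_vector_mul_assoc AB)
    then have "(norm (x - t))\<^sup>2 \<le> (norm (B *v (x - t)) * C)\<^sup>2" by (rule power_mono) simp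
    then have "1 / C\<^sup>2 * (norm (x - t))\<^sup>2 \<le> (norm (B *v (x - t)))\<^sup>2"
      using C(1) by (simp add: power_mult_distrib field_simps)
    moreover have "0 \<le> \<rho> x" using K by (simp add: \<rho>_def)
    ultimately have "1 / C\<^sup>2 * (norm (x - t))\<^sup>2 * \<rho> x \<le> (norm (B *v (x - t)))\<^sup>2 * \<rho> x" by (rule mult_right_mono)
    then show "(\<Sum>i\<in>UNIV. (x - t) $ i * partial_deriv i \<rho> x) \<le> - (1 / C\<^sup>2) * (norm (x - t))\<^sup>2 * \<rho> x"
      unfolding C1(2) D_sum by (simp add: power2_norm_eq_inner)
  qed (use m\<rho> c\<rho> K C1 C(1) in \<open>auto simp: \<rho>_def\<close>)
  then show thesis by (rule that)
qed

theorem theorem2p9: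
  fixes m :: "(real^2) measure" and k :: nat and f :: "real^2 \<Rightarrow> real" and c :: real
  assumes "gaussian_measure m" and "invertible (covariance_matrix m)"
    and "1 \<le> k" and "f \<in> L2 m" and "0 \<le> c" and "c \<le> 1"
  shows "(\<exists>\<Omega>. is_solution m c (eigenvalue m k) \<Omega> \<and> quasi_open m \<Omega>) \<and>
         (\<exists>\<Omega>. is_solution m c (energy m f) \<Omega> \<and> quasi_open m \<Omega>)"
proof -
  obtain \<rho> t lam where "gaussian_plane m \<rho> t lam" using assms(1,2) by (rule gaussian_plane_nondegenerate)
  then interpret gaussian_plane m \<rho> t lam .
  show ?thesis using eigenvalue_minimiser[OF assms(3,5)] energy_minimiser[OF assms(4-6)] by blast
qed

end
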